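(* Let $\mathcal{C}$ be a category of partitions and let $t$ be a non-zero complex number. Then the mapping $V\mapsto\mathcal{L}_p(V)$ induces a bijection between the collection of all isomorphism classes of irreducible complex representations of all finite groups $S(p)$ for $[p]\in\mathcal{P}/{\sim}$ (one representative $p$ per class), i.e. $\bigsqcup_{[p]\in\mathcal{P}/\sim}\mathrm{Irr}(S(p))$, and the set of isomorphism classes of (non-zero) indecomposable objects in $\underline{\mathrm{Rep}}(\mathcal{C},t)$.
   Context: For $k,l\in\mathbb{N}_0$ let $P(k,l)$ be the set of set partitions of $\{1,\dots,k,1',\dots,l'\}$ ($k$ upper points, $l$ lower points). Operations: the tensor product $p\otimes q$ is horizontal concatenation; the involution $p^*\in P(l,k)$ swaps upper and lower points; for $p\in P(k,l)$, $q\in P(l,m)$, stack $p$ above $q$, identifying the lower points of $p$ with the upper points of $q$; $q\cdot p\in P(k,m)$ is the induced partition of the outer points by connected components, and $\ell(q,p)$ is the number of connected components containing only middle points. A category of partitions $\mathcal{C}$ is a collection of subsets $\mathcal{C}(k,l)\subseteq P(k,l)$ containing $\{\{1,2\}\}\in P(2,0)$ and $\{\{1,1'\}\}\in P(1,1)$ and closed under $\otimes$, $*$ and $\cdot$. For $t\in\mathbb{C}$, $\underline{\mathrm{Rep}}_0(\mathcal{C},t)$ is the $\mathbb{C}$-linear category with objects $[k]$, $k\in\mathbb{N}_0$, $\mathrm{Hom}([k],[l])=\mathbb{C}\,\mathcal{C}(k,l)$, and composition extending $qp:=t^{\ell(q,p)}\,q\cdot p$; $\underline{\mathrm{Rep}}(\mathcal{C},t)$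 is its Karoubi envelope (idempotent completion of the additive completion). For an idempotent $e\in\mathrm{End}([k])$, $([k],e)$ denotes its image. Projective partitions: a through-block is a block containing both upper and lower points; $t(p)$ is the number of through-blocks of $p$. A partition $p\in P(k,k)$ is projective if $p=p_0^*\cdot p_0$ for some $p_0\in P(k,t(p))$. $\mathrm{Proj}_{\mathcal{C}}(k)$ is the set of projective partitions in $\mathcal{C}(k,k)$. Two elements $p,q\in\mathrm{Proj}_{\mathcal{C}}(k)$ are equivalent, $p\sim q$, if there is $r\in\mathcal{C}(k,k)$ with $r\cdot r^*=p$ and $r^*\cdot r=q$. Let $$\mathcal{P}:=\{p\in\mathrm{Proj}_{\mathcal{C}}(k): k\in\mathbb{N}_0,\ p\ne b^*\cdot q\cdot b\text{ for all }0\le l<k,\ b\in\mathcal{C}(k,l),\ q\in\mathrm{Proj}_{\mathcal{C}}(l)\};$$ $\sim$ restricts to $\mathcal{P}$. Groups: for $p\in\mathrm{Proj}_{\mathcal{C}}(k)$ with $T=t(p)$, fix $p_0\in P(k,T)$ with $p=p_0^*\cdot p_0$, regard $\sigma\in S_T$ as the partition $\{\{i,\sigma(i)'\}:1\le i\le T\}\in P(T,T)$, put $p_\sigma:=p_0^*\cdot\sigma\cdot p_0$, and $S(p):=\{\sigma\in S_T: p_\sigma\in\mathcal{C}(k,k)\}$, a subgroup of $S_T$ (independent of $p_0$ up to conjugation). $\mathrm{Irr}(G)$ is the set of isomorphism classes of irreducible complex representations of $G$. Objects $\mathcal{L}_p(V)$ ($t\neq0$): put $E=\mathrm{End}([k])$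 and let $I_p\subseteq pEp$ be the ideal of those elements that are linear combinations of partitions with fewer than $t(p)$ through-blocks. The map $\sigma\mapsto t^{-\ell(p,p)}p_\sigma$ induces an algebra isomorphism $\mathbb{C}S(p)\cong pEp/I_p$. For $V\in\mathrm{Irr}(S(p))$ let $e'\in\mathbb{C}S(p)$ be an idempotent with $\mathbb{C}S(p)e'\cong V$, let $e\in pEp/I_p$ be its image, and let $\mathcal{L}_p(e)\in pEp\subseteq E$ be a primitive idempotent lifting $e$ (it exists and is unique up to conjugation). Then $\mathcal{L}_p(V)$ is the isomorphism class of $([k],\mathcal{L}_p(e))$. *)

theory Defs
  imports
    "HOL-Library.Disjoint_Sets"
    "HOL-Library.Poly_Mapping"
    "HOL-Algebra.Sym_Groups"
    "Jordan_Normal_Form.Matrix"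
begin

section \<open>Set partitions of upper and lower points\<close>

text \<open>The upper points \<open>1, \<dots>, k\<close> are \<open>Inl 1, \<dots>, Inl k\<close>, the lower points
  \<open>1', \<dots>, l'\<close> are \<open>Inr 1, \<dots>, Inr l\<close>. A partition determines the two numbers of points,
  so no type or index keeps track of them.\<close>

type_synonym two_part = "(nat + nat) set set"

definition parts :: "nat \<Rightarrow> nat \<Rightarrow> two_part set" where
  "parts k l = {p. partition_on ({1..k} <+> {1..l}) p}"

definition tensor :: "nat \<Rightarrow> nat \<Rightarrow> two_part \<Rightarrow> two_part \<Rightarrow> two_part" where
  "tensor k l p q = p \<union> (\<lambda>B. map_sum ((+) k) ((+) l) ` B) ` q"

definition involution :: "two_part \<Rightarrow> two_part" where
  "involution p = (\<lambda>B. case_sum Inr Inl ` B) ` p"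

datatype stack_point = Upp nat | Mid nat | Low nat

definition stack :: "two_part \<Rightarrow> two_part \<Rightarrow> stack_point set set" where
  "stack q p = (\<lambda>B. case_sum Upp Mid ` B) ` p \<union> (\<lambda>B. case_sum Mid Low ` B) ` q"

definition stack_components :: "two_part \<Rightarrow> two_part \<Rightarrow> stack_point set set" where
  "stack_components q p = \<Union>(stack q p) // (\<Union>B\<in>stack q p. B \<times> B)\<^sup>+"

text \<open>As in the notation \<open>q \<cdot> p\<close>, the partition \<open>p\<close> on the right is the one on top.\<close>

definition pcomp :: "two_part \<Rightarrow> two_part \<Rightarrow> two_part" (infixl "\<bullet>\<^sub>p" 70) where
  "q \<bullet>\<^sub>p p = (\<lambda>K. case_sum Upp Low -` K) ` stack_components q p - {{}}"

definition ploops :: "two_part \<Rightarrow> two_part \<Rightarrow> nat" where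
  "ploops q p = card {K \<in> stack_components q p. K \<subseteq> range Mid}"

definition through_blocks :: "two_part \<Rightarrow> nat" where
  "through_blocks p = card {B \<in> p. B \<inter> range Inl \<noteq> {} \<and> B \<inter> range Inr \<noteq> {}}"

locale partition_category =
  fixes C :: "nat \<Rightarrow> nat \<Rightarrow> two_part set"
  assumes C_subset: "C k l \<subseteq> parts k l"
    and C_pair: "{{Inl 1, Inl 2}} \<in> C 2 0"
    and C_identity: "{{Inl 1, Inr 1}} \<in> C 1 1"
    and C_tensor: "p \<in> C k l \<Longrightarrow> q \<in> C k' l' \<Longrightarrow> tensor k l p q \<in> C (k + k') (l + l')"
    and C_involution: "p \<in> C k l \<Longrightarrow> involution p \<in> C l k"
    and C_comp: "p \<in> C k l \<Longrightarrow> q \<in> C l m \<Longrightarrow> q \<bullet>\<^sub>p p \<in> C k m"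


section \<open>Projective partitions\<close>

definition proj_by :: "nat \<Rightarrow> two_part \<Rightarrow> two_part \<Rightarrow> bool" where
  "proj_by k p p\<^sub>0 \<longleftrightarrow> p\<^sub>0 \<in> parts k (through_blocks p) \<and> p = involution p\<^sub>0 \<bullet>\<^sub>p p\<^sub>0"

definition Proj :: "(nat \<Rightarrow> nat \<Rightarrow> two_part set) \<Rightarrow> nat \<Rightarrow> two_part set" where
  "Proj C k = {p \<in> C k k. \<exists>p\<^sub>0. proj_by k p p\<^sub>0}"

definition PP :: "(nat \<Rightarrow> nat \<Rightarrow> two_part set) \<Rightarrow> (nat \<times> two_part) set" where
  "PP C = {(k, p). p \<in> Proj C k \<and>
     (\<forall>l<k. \<forall>b\<in>C k l. \<forall>q\<in>Proj C l. p \<noteq> involution b \<bullet>\<^sub>p q \<bullet>\<^sub>p b)}"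

definition PP_equiv ::
  "(nat \<Rightarrow> nat \<Rightarrow> two_part set) \<Rightarrow> ((nat \<times> two_part) \<times> (nat \<times> two_part)) set" where
  "PP_equiv C = {((k, p), (k', q)). (k, p) \<in> PP C \<and> (k', q) \<in> PP C \<and> k = k' \<and>
     (\<exists>r\<in>C k k. r \<bullet>\<^sub>p involution r = p \<and> involution r \<bullet>\<^sub>p r = q)}"

definition perm_part :: "nat \<Rightarrow> (nat \<Rightarrow> nat) \<Rightarrow> two_part" where
  "perm_part T \<sigma> = {{Inl i, Inr (\<sigma> i)} |i. i \<in> {1..T}}"

definition p_perm :: "two_part \<Rightarrow> two_part \<Rightarrow> (nat \<Rightarrow> nat) \<Rightarrow> two_part" where
  "p_perm p p\<^sub>0 \<sigma> = involution p\<^sub>0 \<bullet>\<^sub>p perm_part (through_blocks p) \<sigma> \<bullet>\<^sub>p p\<^sub>0"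

definition S_group ::
  "(nat \<Rightarrow> nat \<Rightarrow> two_part set) \<Rightarrow> nat \<Rightarrow> two_part \<Rightarrow> two_part \<Rightarrow> (nat \<Rightarrow> nat) monoid" where
  "S_group C k p p\<^sub>0 = (sym_group (through_blocks p))
     \<lparr>carrier := {\<sigma> \<in> carrier (sym_group (through_blocks p)). p_perm p p\<^sub>0 \<sigma> \<in> C k k}\<rparr>"


section \<open>Irreducible complex representations of a finite group\<close>

text \<open>A representation on \<open>\<complex>\<^sup>n\<close> is a pair \<open>(n, \<rho>)\<close>. The values of \<open>\<rho>\<close> outside the carrier are
  irrelevant, and isomorphism ignores them.\<close>

definition matrix_rep :: "('g, 'b) monoid_scheme \<Rightarrow> nat \<times> ('g \<Rightarrow> complex mat) \<Rightarrow> bool" where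
  "matrix_rep G = (\<lambda>(n, \<rho>). (\<forall>x\<in>carrier G. \<rho> x \<in> carrier_mat n n) \<and>
     \<rho> \<one>\<^bsub>G\<^esub> = 1\<^sub>m n \<and>
     (\<forall>x\<in>carrier G. \<forall>y\<in>carrier G. \<rho> (x \<otimes>\<^bsub>G\<^esub> y) = \<rho> x * \<rho> y))"

definition invariant_subspace ::
  "('g, 'b) monoid_scheme \<Rightarrow> nat \<times> ('g \<Rightarrow> complex mat) \<Rightarrow> complex vec set \<Rightarrow> bool" where
  "invariant_subspace G = (\<lambda>(n, \<rho>) W. W \<subseteq> carrier_vec n \<and> 0\<^sub>v n \<in> W \<and>
     (\<forall>v\<in>W. \<forall>w\<in>W. v + w \<in> W) \<and> (\<forall>c. \<forall>v\<in>W. c \<cdot>\<^sub>v v \<in> W) \<and>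
     (\<forall>x\<in>carrier G. \<forall>v\<in>W. \<rho> x *\<^sub>v v \<in> W))"

definition irreducible_rep :: "('g, 'b) monoid_scheme \<Rightarrow> nat \<times> ('g \<Rightarrow> complex mat) \<Rightarrow> bool" where
  "irreducible_rep G = (\<lambda>(n, \<rho>). matrix_rep G (n, \<rho>) \<and> n \<noteq> 0 \<and>
     (\<forall>W. invariant_subspace G (n, \<rho>) W \<longrightarrow> W = {0\<^sub>v n} \<or> W = carrier_vec n))"

definition rep_iso ::
  "('g, 'b) monoid_scheme
    \<Rightarrow> ((nat \<times> ('g \<Rightarrow> complex mat)) \<times> (nat \<times> ('g \<Rightarrow> complex mat))) set" where
  "rep_iso G = {((n, \<rho>), (m, \<tau>)). matrix_rep G (n, \<rho>) \<and> matrix_rep G (m, \<tau>) \<and> n = m \<and>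
     (\<exists>A\<in>carrier_mat n n. invertible_mat A \<and> (\<forall>x\<in>carrier G. A * \<rho> x = \<tau> x * A))}"

definition Irr :: "('g, 'b) monoid_scheme \<Rightarrow> (nat \<times> ('g \<Rightarrow> complex mat)) set set" where
  "Irr G = {V. irreducible_rep G V} // rep_iso G"

definition group_algebra :: "('g, 'b) monoid_scheme \<Rightarrow> ('g \<Rightarrow>\<^sub>0 complex) set" where
  "group_algebra G = {a. Poly_Mapping.keys a \<subseteq> carrier G}"

definition ga_mult ::
  "('g, 'b) monoid_scheme \<Rightarrow> ('g \<Rightarrow>\<^sub>0 complex) \<Rightarrow> ('g \<Rightarrow>\<^sub>0 complex) \<Rightarrow> ('g \<Rightarrow>\<^sub>0 complex)" where
  "ga_mult G a b = (\<Sum>x\<in>Poly_Mapping.keys a. \<Sum>y\<in>Poly_Mapping.keys b.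
     Poly_Mapping.single (x \<otimes>\<^bsub>G\<^esub> y) (Poly_Mapping.lookup a x * Poly_Mapping.lookup b y))"

definition left_ideal :: "('g, 'b) monoid_scheme \<Rightarrow> ('g \<Rightarrow>\<^sub>0 complex) \<Rightarrow> ('g \<Rightarrow>\<^sub>0 complex) set" where
  "left_ideal G e = {ga_mult G a e |a. a \<in> group_algebra G}"

text \<open>The representation \<open>(n, \<rho>)\<close> is isomorphic to the left module generated by \<open>e\<close>. Compatibility
  with the elements \<open>c \<cdot> x\<close> of the group algebra, for a scalar \<open>c\<close> and a group element \<open>x\<close>,
  comprises both homogeneity (\<open>x = 1\<close>) and equivariance (\<open>c = 1\<close>).\<close>

definition affords ::
  "('g, 'b) monoid_scheme \<Rightarrow> ('g \<Rightarrow>\<^sub>0 complex) \<Rightarrow> nat \<times> ('g \<Rightarrow> complex mat) \<Rightarrow> bool" where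
  "affords G e = (\<lambda>(n, \<rho>). \<exists>\<phi>. bij_betw \<phi> (left_ideal G e) (carrier_vec n) \<and>
     (\<forall>a\<in>left_ideal G e. \<forall>b\<in>left_ideal G e. \<phi> (a + b) = \<phi> a + \<phi> b) \<and>
     (\<forall>c. \<forall>x\<in>carrier G. \<forall>a\<in>left_ideal G e.
        \<phi> (ga_mult G (Poly_Mapping.single x c) a) = c \<cdot>\<^sub>v (\<rho> x *\<^sub>v \<phi> a)))"


section \<open>The interpolating partition category\<close>

text \<open>Morphisms of the skeletal category are formal linear combinations of partitions.\<close>

type_synonym mor = "two_part \<Rightarrow>\<^sub>0 complex"

definition hom0 :: "(nat \<Rightarrow> nat \<Rightarrow> two_part set) \<Rightarrow> nat \<Rightarrow> nat \<Rightarrow> mor set" where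
  "hom0 C k l = {f. Poly_Mapping.keys f \<subseteq> C k l}"

definition comp0 :: "complex \<Rightarrow> mor \<Rightarrow> mor \<Rightarrow> mor" where
  "comp0 t g f = (\<Sum>q\<in>Poly_Mapping.keys g. \<Sum>p\<in>Poly_Mapping.keys f.
     Poly_Mapping.single (q \<bullet>\<^sub>p p) (Poly_Mapping.lookup g q * Poly_Mapping.lookup f p * t ^ ploops q p))"

text \<open>Additive completion: the list \<open>[k\<^sub>1, \<dots>, k\<^sub>n]\<close> stands for the formal direct sum
  \<open>[k\<^sub>1] \<oplus> \<dots> \<oplus> [k\<^sub>n]\<close>.\<close>

definition hom_add :: "(nat \<Rightarrow> nat \<Rightarrow> two_part set) \<Rightarrow> nat list \<Rightarrow> nat list \<Rightarrow> mor mat set" where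
  "hom_add C ks ls = {M \<in> carrier_mat (length ls) (length ks).
     \<forall>i<length ls. \<forall>j<length ks. M $$ (i, j) \<in> hom0 C (ks ! j) (ls ! i)}"

definition comp_add :: "complex \<Rightarrow> mor mat \<Rightarrow> mor mat \<Rightarrow> mor mat" where
  "comp_add t N M = mat (dim_row N) (dim_col M)
     (\<lambda>(i, j). \<Sum>h<dim_row M. comp0 t (N $$ (i, h)) (M $$ (h, j)))"

text \<open>Idempotent completion: the identity of the object \<open>(ks, e)\<close> is \<open>e\<close>.\<close>

type_synonym obj = "nat list \<times> mor mat"

definition Rep_obj :: "(nat \<Rightarrow> nat \<Rightarrow> two_part set) \<Rightarrow> complex \<Rightarrow> obj set" where
  "Rep_obj C t = {(ks, e). e \<in> hom_add C ks ks \<and> comp_add t e e = e}"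

definition Rep_hom :: "(nat \<Rightarrow> nat \<Rightarrow> two_part set) \<Rightarrow> complex \<Rightarrow> obj \<Rightarrow> obj \<Rightarrow> mor mat set" where
  "Rep_hom C t = (\<lambda>(ks, e) (ls, f).
     {M \<in> hom_add C ks ls. comp_add t M e = M \<and> comp_add t f M = M})"

definition Rep_iso :: "(nat \<Rightarrow> nat \<Rightarrow> two_part set) \<Rightarrow> complex \<Rightarrow> (obj \<times> obj) set" where
  "Rep_iso C t = {(X, Y). X \<in> Rep_obj C t \<and> Y \<in> Rep_obj C t \<and>
     (\<exists>M\<in>Rep_hom C t X Y. \<exists>N\<in>Rep_hom C t Y X.
        comp_add t N M = snd X \<and> comp_add t M N = snd Y)}"

definition Rep_zero :: obj where
  "Rep_zero = ([], 0\<^sub>m 0 0)"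

definition Rep_sum :: "obj \<Rightarrow> obj \<Rightarrow> obj" where
  "Rep_sum = (\<lambda>(ks, e) (ls, f). (ks @ ls, four_block_mat e
     (0\<^sub>m (length ks) (length ls)) (0\<^sub>m (length ls) (length ks)) f))"

definition indecomposable :: "(nat \<Rightarrow> nat \<Rightarrow> two_part set) \<Rightarrow> complex \<Rightarrow> obj \<Rightarrow> bool" where
  "indecomposable C t X \<longleftrightarrow> X \<in> Rep_obj C t \<and> (X, Rep_zero) \<notin> Rep_iso C t \<and>
     (\<forall>Y\<in>Rep_obj C t. \<forall>Z\<in>Rep_obj C t. (X, Rep_sum Y Z) \<in> Rep_iso C t \<longrightarrow>
        (Y, Rep_zero) \<in> Rep_iso C t \<or> (Z, Rep_zero) \<in> Rep_iso C t)"

definition Indec :: "(nat \<Rightarrow> nat \<Rightarrow> two_part set) \<Rightarrow> complex \<Rightarrow> obj set set" where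
  "Indec C t = {X. indecomposable C t X} // Rep_iso C t"

definition image_obj :: "nat \<Rightarrow> mor \<Rightarrow> obj" where
  "image_obj k e = ([k], mat 1 1 (\<lambda>_. e))"


section \<open>The objects attached to irreducible representations\<close>

definition primitive_idempotent ::
  "(nat \<Rightarrow> nat \<Rightarrow> two_part set) \<Rightarrow> complex \<Rightarrow> nat \<Rightarrow> mor \<Rightarrow> bool" where
  "primitive_idempotent C t k e \<longleftrightarrow> e \<in> hom0 C k k \<and> comp0 t e e = e \<and> e \<noteq> 0 \<and>
     (\<forall>f\<in>hom0 C k k. \<forall>g\<in>hom0 C k k. comp0 t f f = f \<longrightarrow> comp0 t g g = g \<longrightarrow>
        comp0 t f g = 0 \<longrightarrow> comp0 t g f = 0 \<longrightarrow> e = f + g \<longrightarrow> f = 0 \<or> g = 0)"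

definition corner :: "(nat \<Rightarrow> nat \<Rightarrow> two_part set) \<Rightarrow> complex \<Rightarrow> nat \<Rightarrow> two_part \<Rightarrow> mor set" where
  "corner C t k p = {comp0 t (comp0 t (Poly_Mapping.single p 1) f) (Poly_Mapping.single p 1) |f.
     f \<in> hom0 C k k}"

definition corner_ideal ::
  "(nat \<Rightarrow> nat \<Rightarrow> two_part set) \<Rightarrow> complex \<Rightarrow> nat \<Rightarrow> two_part \<Rightarrow> mor set" where
  "corner_ideal C t k p = {f \<in> corner C t k p.
     \<forall>q\<in>Poly_Mapping.keys f. through_blocks q < through_blocks p}"

text \<open>A representative in the corner \<open>pEp\<close> of the image of \<open>a \<in> \<complex>S(p)\<close> in \<open>pEp / I\<^sub>p\<close>.\<close>

definition ga_image :: "complex \<Rightarrow> two_part \<Rightarrow> two_part \<Rightarrow> ((nat \<Rightarrow> nat) \<Rightarrow>\<^sub>0 complex) \<Rightarrow> mor" where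
  "ga_image t p p\<^sub>0 a = (\<Sum>\<sigma>\<in>Poly_Mapping.keys a.
     Poly_Mapping.single (p_perm p p\<^sub>0 \<sigma>) (Poly_Mapping.lookup a \<sigma> / t ^ ploops p p))"

definition is_lift ::
  "(nat \<Rightarrow> nat \<Rightarrow> two_part set) \<Rightarrow> complex \<Rightarrow> nat \<Rightarrow> two_part \<Rightarrow> two_part
    \<Rightarrow> nat \<times> ((nat \<Rightarrow> nat) \<Rightarrow> complex mat) \<Rightarrow> mor \<Rightarrow> bool" where
  "is_lift C t k p p\<^sub>0 \<rho> e \<longleftrightarrow>
     primitive_idempotent C t k e \<and> e \<in> corner C t k p \<and>
     (\<exists>e'\<in>group_algebra (S_group C k p p\<^sub>0).
        ga_mult (S_group C k p p\<^sub>0) e' e' = e' \<and>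
        affords (S_group C k p p\<^sub>0) e' \<rho> \<and>
        e - ga_image t p p\<^sub>0 e' \<in> corner_ideal C t k p)"

text \<open>The union of the isomorphism classes \<open>[([k], e)]\<close> over all admissible choices (of a matrix form
  of \<open>V\<close>, of \<open>e'\<close> and of the lift \<open>e\<close>). It is a single isomorphism class exactly if such choices
  exist and they all lead to isomorphic objects.\<close>

definition L_obj ::
  "(nat \<Rightarrow> nat \<Rightarrow> two_part set) \<Rightarrow> complex \<Rightarrow> nat \<Rightarrow> two_part \<Rightarrow> two_part
    \<Rightarrow> (nat \<times> ((nat \<Rightarrow> nat) \<Rightarrow> complex mat)) set \<Rightarrow> obj set" where
  "L_obj C t k p p\<^sub>0 V = (\<Union>\<rho>\<in>V. \<Union>e\<in>{e. is_lift C t k p p\<^sub>0 \<rho> e}. Rep_iso C t `` {image_obj k e})"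

end

theory Submission
  imports Defs
begin

text \<open>A set partition is handled through its equivalence relation, so that composition is generation of
  an equivalence relation on the stacked points and restriction to the outer ones. Morphisms between
  formal direct sums embed into one algebra spanned by partitions with a row and a column label; objects
  become idempotents of this algebra, isomorphism becomes equivalence of idempotents.

  The identity of an object is a sum of morphisms \<open>\<alpha>\<^sub>i\<beta>\<^sub>i\<close> factoring through objects \<open>[k]\<close>, and each
  partition \<open>r\<close> is absorbed by the projective partition \<open>r\<^sup>*r\<close>. By Fitting's lemma an indecomposable
  object is therefore the image of a primitive idempotent \<open>f \<in> pEp\<close> for some projective \<open>p \<in> \<C>(k, k)\<close>.
  Choosing first \<open>t(p)\<close> and then \<open>k\<close> minimal forces \<open>f \<notin> I\<^sub>p\<close> and \<open>p \<in> \<P>\<close>. The primitive idempotents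
  of \<open>pEp\<close> outside \<open>I\<^sub>p\<close> are the lifts of the primitive idempotents of \<open>pEp / I\<^sub>p \<cong> \<complex>S(p)\<close>, which
  correspond to the irreducible representations by Maschke's theorem. Conversely, an isomorphism
  between two such images involves a partition \<open>r\<close> of full rank with \<open>pr = r = rq\<close>; then \<open>r r\<^sup>* = p\<close> and
  \<open>r\<^sup>* r = q\<close>, and minimality of the numbers of points makes them equal, that is \<open>p \<sim> q\<close>.\<close>

section \<open>Composition of partitions through relations\<close>

text \<open>Two facts about rank carry the argument. Composition never increases the number of
  through-blocks, and \<open>r r\<^sup>* r = r\<close> for every partition. So a partition of full
  rank between two projective ones is a partial isometry linking them, and a partition of full rank
  in the corner of \<open>p\<close> is a permutation of the through-blocks of \<open>p\<close>.

  The descent on the rank works because the summand found for an idempotent belongs to a partition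
  \<open>r\<close> in its own support, and \<open>r\<^sup>* r\<close> has the rank of
  \<open>r\<close>. An idempotent inside the ideal of lower rank would therefore give a projective
  partition with fewer through-blocks.

  The condition t \<noteq> 0 enters because \<open>p\<close> squares to itself only up to the factor
  \<open>t ^ ploops p p\<close>, which has to be divided out to obtain an idempotent of the algebra.

  Associativity of the weighted composition requires that both bracketings of a triple product
  produce the same number of loops. The closed components of a single triple stack are counted in
  two ways; the count uses finitely many points, which is why algebra identities are confined to a
  subspace of finite partitions.\<close>

definition block_rel :: "'a set set \<Rightarrow> 'a rel" where
  "block_rel p = (\<Union>B\<in>p. B \<times> B)"

lemma sym_block_rel: "sym (block_rel p)"
  by (auto simp: block_rel_def sym_def)

lemma Domain_block_rel [simp]: "Domain (block_rel p) = \<Union>p"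
  by (auto simp: block_rel_def)

lemma block_rel_image: "block_rel ((`) f ` p) = map_prod f f ` block_rel p"
  by (fastforce simp: block_rel_def)

lemma block_rel_Un: "block_rel (p \<union> q) = block_rel p \<union> block_rel q"
  by (auto simp: block_rel_def)

lemma block_rel_remove_empty: "block_rel (p - {{}}) = block_rel p"
  by (auto simp: block_rel_def)

text \<open>A partition of its own union. The ground set is left open because the point set of a
  composite is read off afterwards, from the domain of \<open>block_rel\<close>.\<close>

definition is_part :: "'a set set \<Rightarrow> bool" where
  "is_part p \<longleftrightarrow> disjoint p \<and> {} \<notin> p"

lemma is_part_parts: "p \<in> parts k l \<Longrightarrow> is_part p"
  by (auto simp: parts_def partition_on_def is_part_def)

lemma parts_iff: "p \<in> parts k l \<longleftrightarrow> is_part p \<and> \<Union>p = {1..k} <+> {1..l}"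
  by (auto simp: parts_def partition_on_def is_part_def)

lemma trans_block_rel: "is_part p \<Longrightarrow> trans (block_rel p)"
  unfolding trans_def block_rel_def is_part_def disjoint_def by blast

lemma block_eqI:
  "is_part p \<Longrightarrow> B \<in> p \<Longrightarrow> x \<in> B \<Longrightarrow> B = block_rel p `` {x}"
  unfolding block_rel_def is_part_def disjoint_def by blast

text \<open>With empty blocks excluded the relation determines the partition, point set included,
  since its domain is the union of the blocks. Equality of partitions thus becomes equality of
  relations.\<close>

lemma is_part_eq_quotient:
  assumes "is_part p"
  shows "p = Domain (block_rel p) // block_rel p"
proof
  show "p \<subseteq> Domain (block_rel p) // block_rel p"
  proof
    fix B assume "B \<in> p"
    then obtain x where "x \<in> B" using assms by (metis is_part_def equals0I)
    with \<open>B \<in> p\<close> show "B \<in> Domain (block_rel p) // block_rel p"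
      by (metis Domain_block_rel UnionI assms block_eqI quotientI)
  qed
  show "Domain (block_rel p) // block_rel p \<subseteq> p"
  proof
    fix B assume "B \<in> Domain (block_rel p) // block_rel p"
    then obtain x where x: "x \<in> \<Union>p" "B = block_rel p `` {x}" by (auto elim!: quotientE)
    then obtain B' where "B' \<in> p" "x \<in> B'" by auto
    with block_eqI[OF assms] x show "B \<in> p" by metis
  qed
qed

lemma is_part_eqI: "is_part p \<Longrightarrow> is_part q \<Longrightarrow> block_rel p = block_rel q \<Longrightarrow> p = q"
  using is_part_eq_quotient by metis

lemma is_part_quotient:
  assumes "sym E" "trans E"
  shows "is_part (Domain E // E)"
  unfolding is_part_def disjoint_def
proof (intro conjI ballI impI)
  fix A B assume A: "A \<in> Domain E // E" "B \<in> Domain E // E" "A \<noteq> B"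
  then obtain x y where "A = E `` {x}" "B = E `` {y}" by (auto elim!: quotientE)
  with A assms show "A \<inter> B = {}" unfolding sym_def trans_def by blast
next
  show "{} \<notin> Domain E // E" using assms by (auto elim!: quotientE)
qed

lemma block_rel_quotient:
  assumes "sym E" "trans E"
  shows "block_rel (Domain E // E) = E"
proof
  show "block_rel (Domain E // E) \<subseteq> E"
  proof
    fix z assume "z \<in> block_rel (Domain E // E)"
    then obtain u x y where "z = (x, y)" "(u, x) \<in> E" "(u, y) \<in> E"
      by (auto simp: block_rel_def elim!: quotientE)
    then show "z \<in> E" using symD[OF assms(1)] transD[OF assms(2)] by blast
  qed
  show "E \<subseteq> block_rel (Domain E // E)"
  proof
    fix z assume "z \<in> E"
    then obtain x y where z: "z = (x, y)" "(x, y) \<in> E" by (cases z) auto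
    then have "(x, x) \<in> E" using assms unfolding sym_def trans_def by blast
    with z show "z \<in> block_rel (Domain E // E)"
      unfolding block_rel_def by (auto intro!: bexI[of _ "E `` {x}"] quotientI)
  qed
qed

text \<open>Injectivity is what joins two steps in the image: the shared endpoint has only one
  preimage, so the lifted path does not jump.\<close>

lemma trancl_map_prod:
  assumes "inj f"
  shows "(map_prod f f ` r)\<^sup>+ = map_prod f f ` r\<^sup>+"
proof
  show "(map_prod f f ` r)\<^sup>+ \<subseteq> map_prod f f ` r\<^sup>+"
  proof
    fix z assume "z \<in> (map_prod f f ` r)\<^sup>+"
    then obtain x y where z: "z = (x, y)" "(x, y) \<in> (map_prod f f ` r)\<^sup>+" by (cases z) auto
    from z(2) have "\<exists>a b. x = f a \<and> y = f b \<and> (a, b) \<in> r\<^sup>+"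
    proof induction
      case (base y) then show ?case by auto
    next
      case (step y z)
      then obtain a b c d where "x = f a" "y = f b" "(a, b) \<in> r\<^sup>+" "y = f c" "z = f d" "(c, d) \<in> r"
        by auto
      moreover from this assms have "b = c" by (simp add: inj_eq)
      ultimately show ?case by (blast intro: trancl_into_trancl)
    qed
    with z(1) show "z \<in> map_prod f f ` r\<^sup>+" by force
  qed
  show "map_prod f f ` r\<^sup>+ \<subseteq> (map_prod f f ` r)\<^sup>+"
  proof clarsimp
    fix a b assume "(a, b) \<in> r\<^sup>+"
    then show "(f a, f b) \<in> (map_prod f f ` r)\<^sup>+"
      by induction (force intro: trancl_into_trancl)+
  qed
qed

text \<open>The closure is not reflexive, so that points outside the stack stay unrelated and the
  domain is exactly the set of stacked points.\<close>

definition stack_rel :: "two_part \<Rightarrow> two_part \<Rightarrow> stack_point rel" where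
  "stack_rel q p = (block_rel (stack q p))\<^sup>+"

lemma stack_components_eq: "stack_components q p = Domain (stack_rel q p) // stack_rel q p"
  by (simp add: stack_components_def stack_rel_def flip: block_rel_def)

lemma sym_stack_rel: "sym (stack_rel q p)"
  unfolding stack_rel_def by (intro sym_trancl sym_block_rel)

lemma trans_stack_rel: "trans (stack_rel q p)"
  unfolding stack_rel_def by (rule trans_trancl)

text \<open>The discarded empty set stems from components made of middle points. An empty block
  contributes no pair, so the relation does not see the removal.\<close>

lemma block_rel_pcomp:
  "block_rel (q \<bullet>\<^sub>p p)
    = {(x, y). (case_sum Upp Low x, case_sum Upp Low y) \<in> stack_rel q p}" (is "_ = ?E")
proof -
  let ?f = "case_sum Upp Low"
  have "block_rel (q \<bullet>\<^sub>p p) = {(x, y). (?f x, ?f y) \<in> block_rel (stack_components q p)}"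
    unfolding pcomp_def block_rel_remove_empty by (auto simp: block_rel_def)
  then show ?thesis
    by (simp add: stack_components_eq block_rel_quotient sym_stack_rel trans_stack_rel)
qed

lemma is_part_pcomp: "is_part (q \<bullet>\<^sub>p p)"
proof -
  have "is_part (stack_components q p)"
    by (simp add: stack_components_eq is_part_quotient sym_stack_rel trans_stack_rel)
  then have "A \<inter> B = {}" if "A \<in> stack_components q p" "B \<in> stack_components q p" "A \<noteq> B" for A B
    using that by (simp add: is_part_def disjoint_def)
  then show ?thesis
    unfolding pcomp_def is_part_def disjoint_def by (fastforce simp flip: vimage_Int)
qed

text \<open>Points of a stack of several partitions: a level and an index within the level.\<close>

definition at_levels :: "nat \<Rightarrow> nat \<Rightarrow> nat + nat \<Rightarrow> nat \<times> nat" where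
  "at_levels i j = case_sum (Pair i) (Pair j)"

lemma at_levels_simps [simp]: "at_levels i j (Inl a) = (i, a)" "at_levels i j (Inr a) = (j, a)"
  by (simp_all add: at_levels_def)

definition level_rel :: "nat \<Rightarrow> nat \<Rightarrow> two_part \<Rightarrow> (nat \<times> nat) rel" where
  "level_rel i j p = map_prod (at_levels i j) (at_levels i j) ` block_rel p"

lemma sym_level_rel: "sym (level_rel i j p)"
  using sym_block_rel[of p] unfolding level_rel_def sym_def by fastforce

fun point_of :: "nat \<Rightarrow> nat \<Rightarrow> nat \<Rightarrow> stack_point \<Rightarrow> nat \<times> nat" where
  "point_of i j k (Upp a) = (i, a)"
| "point_of i j k (Mid a) = (j, a)"
| "point_of i j k (Low a) = (k, a)"

lemma inj_point_of: "distinct [i, j, k] \<Longrightarrow> inj (point_of i j k)"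
  by (rule injI, rename_tac x y, case_tac x; case_tac y) auto

text \<open>Replaces the three constructors by arbitrary distinct levels. This freedom embeds a
  twofold stack in a threefold one and lets a stack be read upside down.\<close>

lemma map_stack_rel:
  assumes "distinct [i, j, k]"
  shows "map_prod (point_of i j k) (point_of i j k) ` stack_rel q p
    = (level_rel i j p \<union> level_rel j k q)\<^sup>+"
proof -
  have "map_prod (point_of i j k) (point_of i j k) ` block_rel (stack q p)
    = level_rel i j p \<union> level_rel j k q"
  proof -
    have "point_of i j k \<circ> case_sum Upp Mid = at_levels i j"
      "point_of i j k \<circ> case_sum Mid Low = at_levels j k"
      by (auto simp: fun_eq_iff at_levels_def split: sum.splits)
    then show ?thesis
      unfolding stack_def block_rel_Un block_rel_image level_rel_def image_Un
      by (simp only: image_comp map_prod.comp)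
  qed
  then show ?thesis
    by (simp add: stack_rel_def inj_point_of[OF assms] flip: trancl_map_prod)
qed

lemma inj_map_prod_mem: "inj f \<Longrightarrow> (f x, f y) \<in> map_prod f f ` r \<longleftrightarrow> (x, y) \<in> r"
  by (auto simp: inj_eq)

lemma in_block_rel_pcomp:
  assumes "distinct [i, j, k]"
  shows "(x, y) \<in> block_rel (q \<bullet>\<^sub>p p)
    \<longleftrightarrow> (at_levels i k x, at_levels i k y) \<in> (level_rel i j p \<union> level_rel j k q)\<^sup>+"
proof -
  have *: "at_levels i k z = point_of i j k (case_sum Upp Low z)" for z
    by (cases z) auto
  show ?thesis
    unfolding block_rel_pcomp map_stack_rel[OF assms, symmetric] *
    using inj_map_prod_mem[OF inj_point_of[OF assms]] by simp
qed

lemma quotient_map_prod: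
  assumes "inj f"
  shows "Domain (map_prod f f ` E) // (map_prod f f ` E) = (`) f ` (Domain E // E)"
proof -
  have 1: "(map_prod f f ` E) `` {f x} = f ` (E `` {x})" for x
    using assms by (force dest: injD)
  have 2: "Domain (map_prod f f ` E) = f ` Domain E" by force
  show ?thesis
    unfolding 2 quotient_def by (auto simp: 1)
qed

lemma ploops_eq:
  fixes p q :: two_part
  assumes "distinct [i, j, k]"
  defines "E \<equiv> (level_rel i j p \<union> level_rel j k q)\<^sup>+"
  shows "ploops q p = card {K \<in> Domain E // E. K \<subseteq> {j} \<times> UNIV}"
proof -
  let ?f = "point_of i j k"
  have inj: "inj ?f" by (rule inj_point_of[OF assms(1)])
  have sub: "?f ` K \<subseteq> {j} \<times> UNIV \<longleftrightarrow> K \<subseteq> range Mid" for K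
  proof -
    have "?f x \<in> {j} \<times> UNIV \<longleftrightarrow> x \<in> range Mid" for x
      using assms(1) by (cases x) auto
    then have "(\<forall>x\<in>K. ?f x \<in> {j} \<times> UNIV) \<longleftrightarrow> (\<forall>x\<in>K. x \<in> range Mid)"
      by (intro ball_cong refl)
    then show ?thesis by (simp only: subset_eq ball_simps)
  qed
  have "Domain E // E = (`) ?f ` stack_components q p"
    unfolding E_def map_stack_rel[OF assms(1), symmetric] stack_components_eq
    by (rule quotient_map_prod[OF inj])
  then have "{K \<in> Domain E // E. K \<subseteq> {j} \<times> UNIV}
    = (`) ?f ` {K \<in> stack_components q p. K \<subseteq> range Mid}"
    using sub by auto
  moreover have "inj_on ((`) ?f) X" for X
    by (rule inj_onI) (simp add: inj_image_eq_iff[OF inj])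
  ultimately show ?thesis
    unfolding ploops_def by (simp only: card_image)
qed

text \<open>Gluing a relation onto a partial equivalence relation only sees the latter on the common
  points.\<close>

locale glue =
  fixes U W :: "'a rel" and A :: "'a set"
  assumes sym_U: "sym U" and trans_U: "trans U" and sym_W: "sym W"
    and common: "Domain U \<inter> Domain W \<subseteq> A"
begin

definition "V = (U \<union> W)\<^sup>+"
definition "V' = ((U \<inter> A \<times> A) \<union> W)\<^sup>+"
text \<open>The points that survive when \<open>U\<close> is cut down to \<open>A\<close>. The
  relation \<open>V'\<close> lives on them, and it is there that \<open>V\<close> and
  \<open>V'\<close> are compared.\<close>

definition "A' = A \<union> Domain W"

lemma sym_V: "sym V"
  unfolding V_def by (rule sym_trancl) (use sym_U sym_W in \<open>auto simp: sym_def\<close>)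

lemma sym_V': "sym V'"
  unfolding V'_def by (rule sym_trancl) (use sym_U sym_W in \<open>auto simp: sym_def\<close>)

lemma trans_V: "trans V" and trans_V': "trans V'"
  unfolding V_def V'_def by (rule trans_trancl)+

lemma V'_subset: "V' \<subseteq> V"
  unfolding V_def V'_def by (rule trancl_mono_subset) auto

lemma U_subset: "U \<subseteq> V" and W_subset': "W \<subseteq> V'"
  unfolding V_def V'_def by auto

lemma Domain_V: "Domain V = Domain U \<union> Domain W"
  unfolding V_def by auto

lemma Domain_V'_subset: "Domain V' \<subseteq> A'"
  unfolding V'_def A'_def by auto

lemma UA_subset': "x \<in> A \<Longrightarrow> y \<in> A \<Longrightarrow> (x, y) \<in> U \<Longrightarrow> (x, y) \<in> V'"
  unfolding V'_def by auto

text \<open>Invariant for an induction along a path: either it has reached a surviving point that is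
  already reachable in \<open>V'\<close>, or it is inside an excursion through \<open>U\<close> that
  left from a point \<open>a\<close> of \<open>A\<close>. Transitivity of \<open>U\<close> condenses
  the excursion to one step.\<close>

lemma glue_step:
  assumes "(x, y) \<in> V" "x \<in> A'"
  shows "(y \<in> A' \<and> (x, y) \<in> V') \<or> (\<exists>a\<in>A. (a, y) \<in> U \<and> (a = x \<or> (x, a) \<in> V'))"
  using assms(1) unfolding V_def
proof (induction rule: trancl_induct)
  case (base y)
  show ?case
  proof (cases "(x, y) \<in> W")
    case True
    then have "y \<in> Domain W" using sym_W by (auto dest: symD)
    with True W_subset' show ?thesis by (auto simp: A'_def)
  next
    case False
    with base have "(x, y) \<in> U" by auto
    moreover from this assms(2) common have "x \<in> A" by (auto simp: A'_def)
    ultimately show ?thesis by auto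
  qed
next
  case (step y z)
  show ?case
  proof (cases "(y, z) \<in> W")
    case True
    then have z: "z \<in> A'" "(y, z) \<in> V'"
      using sym_W W_subset' by (auto simp: A'_def dest: symD)
    from step.IH show ?thesis
    proof
      assume "y \<in> A' \<and> (x, y) \<in> V'"
      with z trans_V' show ?thesis by (blast dest: transD)
    next
      assume "\<exists>a\<in>A. (a, y) \<in> U \<and> (a = x \<or> (x, a) \<in> V')"
      then obtain a where a: "a \<in> A" "(a, y) \<in> U" "a = x \<or> (x, a) \<in> V'" by auto
      have "y \<in> A" using a(2) True common sym_U by (auto dest: symD)
      with a z trans_V' UA_subset'[of a y] show ?thesis by (blast dest: transD)
    qed
  next
    case False
    with step have yz: "(y, z) \<in> U" by auto
    from step.IH show ?thesis
    proof
      assume y: "y \<in> A' \<and> (x, y) \<in> V'"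
      with yz common have "y \<in> A" by (auto simp: A'_def)
      with y yz show ?thesis by auto
    next
      assume "\<exists>a\<in>A. (a, y) \<in> U \<and> (a = x \<or> (x, a) \<in> V')"
      with yz trans_U show ?thesis by (blast dest: transD)
    qed
  qed
qed

text \<open>An excursion that ends at a surviving point ends in \<open>A\<close>, because a point of
  \<open>U\<close> outside \<open>A\<close> is not in the domain of \<open>W\<close>. Hence it is a
  single step of the restricted relation.\<close>

lemma glue_restrict:
  assumes "(x, y) \<in> V" "x \<in> A'" "y \<in> A'"
  shows "(x, y) \<in> V'"
proof -
  have False if "a \<in> A" "(a, y) \<in> U" "y \<notin> A" for a
  proof -
    have "y \<in> Domain U" using that sym_U by (auto dest: symD)
    with that assms(3) common show False by (auto simp: A'_def)
  qed
  with glue_step[OF assms(1,2)] UA_subset' trans_V' show ?thesis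
    by (blast dest: transD)
qed

text \<open>A component that avoids \<open>A'\<close> never touches \<open>W\<close>, so it is
  closed up by \<open>U\<close> alone.\<close>

lemma component_disjoint_iff:
  assumes "K \<inter> A' = {}"
  shows "K \<in> Domain V // V \<longleftrightarrow> K \<in> Domain U // U"
proof -
  have *: "V `` {x} = U `` {x}" if "x \<in> Domain U" "U `` {x} \<inter> A = {}" for x
  proof -
    have "(x, y) \<in> U" if "(x, y) \<in> V" for y
      using that unfolding V_def
    proof (induction rule: trancl_induct)
      case (base y)
      have "x \<notin> Domain W"
        using \<open>x \<in> Domain U\<close> \<open>U `` {x} \<inter> A = {}\<close> common sym_U trans_U
        by (blast dest: symD transD)
      with base show ?case by auto
    next
      case (step y z)
      have "y \<notin> Domain W"
        using step.IH \<open>U `` {x} \<inter> A = {}\<close> common sym_U by (blast dest: symD)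
      with step show ?case using trans_U by (blast dest: transD)
    qed
    with U_subset show ?thesis by auto
  qed
  show ?thesis
  proof
    assume "K \<in> Domain V // V"
    then obtain x where x: "x \<in> Domain V" "K = V `` {x}" by (auto elim!: quotientE)
    then have "x \<in> K" using sym_V trans_V by (blast dest: symD transD)
    with assms have "x \<notin> Domain W" by (auto simp: A'_def)
    with x Domain_V have "x \<in> Domain U" by auto
    moreover have "U `` {x} \<inter> A = {}" using assms x U_subset by (auto simp: A'_def)
    ultimately show "K \<in> Domain U // U" using * x by (simp add: quotientI)
  next
    assume "K \<in> Domain U // U"
    then obtain x where x: "x \<in> Domain U" "K = U `` {x}" by (auto elim!: quotientE)
    then have "U `` {x} \<inter> A = {}" using assms by (auto simp: A'_def)
    with * x Domain_V show "K \<in> Domain V // V" by (metis UnI1 quotientI)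
  qed
qed

lemma restrict_component:
  assumes "x \<in> A'" "x \<in> Domain V"
  shows "V `` {x} \<inter> A' = V' `` {x}"
  using assms glue_restrict V'_subset Domain_V'_subset sym_V' by (blast dest: symD)

lemma component_eq: "K \<in> Domain V // V \<Longrightarrow> x \<in> K \<Longrightarrow> K = V `` {x} \<and> x \<in> Domain V"
  using sym_V trans_V by (auto elim!: quotientE dest: symD transD)

lemma mem_V: "x \<in> Domain V \<Longrightarrow> (x, x) \<in> V"
  using sym_V trans_V by (blast dest: symD transD)

lemma mem_V': "x \<in> Domain V' \<Longrightarrow> (x, x) \<in> V'"
  using sym_V' trans_V' by (blast dest: symD transD)

text \<open>Cutting a component of \<open>V\<close> down to \<open>A'\<close> and saturating a
  component of \<open>V'\<close> under \<open>V\<close> are mutually inverse.\<close>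

lemma component_bij:
  "bij_betw (\<lambda>K. K \<inter> A') {K \<in> Domain V // V. K \<inter> A' \<noteq> {}} (Domain V' // V')"
proof (rule bij_betw_byWitness[where f' = "\<lambda>K'. V `` K'"])
  have 1: "K \<inter> A' \<in> Domain V' // V' \<and> V `` (K \<inter> A') = K"
    if "K \<in> Domain V // V" "K \<inter> A' \<noteq> {}" for K
  proof -
    from that obtain x where x: "x \<in> K" "x \<in> A'" by auto
    have K: "K = V `` {x}" "x \<in> Domain V" using component_eq[OF that(1) x(1)] by auto
    have "(x, x) \<in> V'" using glue_restrict mem_V K x by blast
    then have "x \<in> Domain V'" by auto
    moreover have "K \<inter> A' = V' `` {x}" using restrict_component K x by blast
    moreover have "V `` (V' `` {x}) = V `` {x}"
      using \<open>(x, x) \<in> V'\<close> V'_subset trans_V by (blast dest: transD)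
    ultimately show ?thesis using K by (metis quotientI)
  qed
  have 2: "V `` K' \<in> Domain V // V \<and> V `` K' \<inter> A' = K'" if "K' \<in> Domain V' // V'" for K'
  proof -
    from that obtain x where x: "x \<in> Domain V'" "K' = V' `` {x}" by (auto elim!: quotientE)
    have "V `` K' = V `` {x}"
      using x mem_V'[OF x(1)] V'_subset trans_V by (blast dest: transD)
    moreover have "x \<in> Domain V" "x \<in> A'" using x V'_subset Domain_V'_subset by auto
    ultimately show ?thesis using restrict_component x by (metis quotientI)
  qed
  show "\<forall>K\<in>{K \<in> Domain V // V. K \<inter> A' \<noteq> {}}. V `` (K \<inter> A') = K" using 1 by auto
  show "\<forall>K'\<in>Domain V' // V'. V `` K' \<inter> A' = K'" using 2 by auto
  show "(\<lambda>K. K \<inter> A') ` {K \<in> Domain V // V. K \<inter> A' \<noteq> {}} \<subseteq> Domain V' // V'" using 1 by auto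
  have "K' \<noteq> {}" if "K' \<in> Domain V' // V'" for K'
    using that mem_V' by (auto elim!: quotientE)
  then show "(\<lambda>K'. V `` K') ` (Domain V' // V') \<subseteq> {K \<in> Domain V // V. K \<inter> A' \<noteq> {}}"
    using 2 by (auto 0 3)
qed

text \<open>In the application \<open>M\<close> consists of the middle levels. A component inside
  \<open>M\<close> either misses \<open>A'\<close>, and was a loop of the first composition already,
  or meets it, and becomes a loop only after \<open>W\<close> is glued on.\<close>

lemma card_components:
  assumes fin: "finite (Domain V)" and M: "Domain U - A \<subseteq> M"
  shows "card {K \<in> Domain V // V. K \<subseteq> M}
    = card {K \<in> Domain U // U. K \<subseteq> M - A'} + card {K \<in> Domain V' // V'. K \<subseteq> M}"
proof -
  let ?X = "{K \<in> Domain V // V. K \<subseteq> M \<and> K \<inter> A' = {}}"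
  let ?Y = "{K \<in> Domain V // V. K \<subseteq> M \<and> K \<inter> A' \<noteq> {}}"
  have "finite (Domain V // V)"
  proof (rule finite_subset)
    have "V `` {x} \<subseteq> Domain V" for x using sym_V by (auto dest: symD)
    then show "Domain V // V \<subseteq> Pow (Domain V)" by (auto elim!: quotientE)
  qed (use fin in simp)
  then have finXY: "finite ?X" "finite ?Y" by auto
  have "{K \<in> Domain V // V. K \<subseteq> M} = ?X \<union> ?Y" by auto
  then have "card {K \<in> Domain V // V. K \<subseteq> M} = card ?X + card ?Y"
    using finXY by (simp add: card_Un_disjoint disjoint_iff)
  moreover have "?X = {K \<in> Domain U // U. K \<subseteq> M - A'}"
    using component_disjoint_iff by auto
  moreover have "card ?Y = card {K \<in> Domain V' // V'. K \<subseteq> M}"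
  proof (rule bij_betw_same_card)
    \<comment> \<open>Points of \<open>K\<close> outside \<open>A'\<close> lie in
      \<open>Domain U - A\<close>, hence in \<open>M\<close> by assumption, so only the trace on
      \<open>A'\<close> has to be tested.\<close>
    have sub: "K \<subseteq> M \<longleftrightarrow> K \<inter> A' \<subseteq> M" if "K \<in> Domain V // V" for K
    proof -
      have "K \<subseteq> Domain V" using that sym_V by (auto elim!: quotientE dest: symD)
      then show ?thesis using Domain_V M unfolding A'_def by blast
    qed
    have "inj_on (\<lambda>K. K \<inter> A') ?Y"
      using component_bij by (auto simp: bij_betw_def elim: inj_on_subset)
    moreover have "(\<lambda>K. K \<inter> A') ` ?Y = {K \<in> Domain V' // V'. K \<subseteq> M}"
    proof
      show "(\<lambda>K. K \<inter> A') ` ?Y \<subseteq> {K \<in> Domain V' // V'. K \<subseteq> M}"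
        using bij_betw_imp_surj_on[OF component_bij] by blast
      show "{K \<in> Domain V' // V'. K \<subseteq> M} \<subseteq> (\<lambda>K. K \<inter> A') ` ?Y"
      proof
        fix K' assume K': "K' \<in> {K \<in> Domain V' // V'. K \<subseteq> M}"
        then have "K' \<in> (\<lambda>K. K \<inter> A') ` {K \<in> Domain V // V. K \<inter> A' \<noteq> {}}"
          by (simp only: bij_betw_imp_surj_on[OF component_bij] mem_Collect_eq)
        then obtain K where K: "K \<in> Domain V // V" "K \<inter> A' \<noteq> {}" "K' = K \<inter> A'"
          by (elim imageE) blast
        from K' have "K' \<subseteq> M" by simp
        with K sub[OF K(1)] have "K \<in> ?Y" by simp
        then show "K' \<in> (\<lambda>K. K \<inter> A') ` ?Y" using K(3) by (rule rev_image_eqI)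
      qed
    qed
    ultimately show "bij_betw (\<lambda>K. K \<inter> A') ?Y {K \<in> Domain V' // V'. K \<subseteq> M}"
      by (simp only: bij_betw_def)
  qed
  ultimately show ?thesis by simp
qed

end


section \<open>Triple stacks: associativity, the involution and the loop cocycle\<close>

lemma trancl_Un_trancl: "(X\<^sup>+ \<union> W)\<^sup>+ = (X \<union> W)\<^sup>+"
proof
  have "X\<^sup>+ \<subseteq> (X \<union> W)\<^sup>+" by (rule trancl_mono_subset) auto
  then have "X\<^sup>+ \<union> W \<subseteq> (X \<union> W)\<^sup>+" by auto
  then show "(X\<^sup>+ \<union> W)\<^sup>+ \<subseteq> (X \<union> W)\<^sup>+"
    using trancl_mono_subset[of "X\<^sup>+ \<union> W" "(X \<union> W)\<^sup>+"] by (simp only: trancl_id[OF trans_trancl])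
  show "(X \<union> W)\<^sup>+ \<subseteq> (X\<^sup>+ \<union> W)\<^sup>+"
    by (rule trancl_mono_subset) auto
qed

lemma Domain_level_rel: "Domain (level_rel i j p) = at_levels i j ` \<Union>p"
  by (auto simp: level_rel_def block_rel_def) force

lemma Domain_level_rel_subset: "Domain (level_rel i j p) \<subseteq> {i, j} \<times> UNIV"
  unfolding Domain_level_rel by (auto simp: at_levels_def split: sum.splits)

lemma Restr_level_rel:
  assumes "distinct [i, j, k]"
  shows "Restr ((level_rel i j p \<union> level_rel j k q)\<^sup>+) ({i, k} \<times> UNIV) = level_rel i k (q \<bullet>\<^sub>p p)"
    (is "Restr ?E _ = _")
proof -
  have range: "\<exists>x. z = at_levels i k x" if "z \<in> {i, k} \<times> UNIV" for z
    using that by (metis SigmaE at_levels_simps insertE singletonD)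
  have in_range: "at_levels i k x \<in> {i, k} \<times> UNIV" for x
    by (cases x) auto
  have "(u, v) \<in> Restr ?E ({i, k} \<times> UNIV) \<longleftrightarrow> (u, v) \<in> level_rel i k (q \<bullet>\<^sub>p p)" for u v
  proof
    assume "(u, v) \<in> Restr ?E ({i, k} \<times> UNIV)"
    then obtain x y where "u = at_levels i k x" "v = at_levels i k y" "(u, v) \<in> ?E"
      using range by blast
    then have "(x, y) \<in> block_rel (q \<bullet>\<^sub>p p)" using in_block_rel_pcomp[OF assms] by simp
    then show "(u, v) \<in> level_rel i k (q \<bullet>\<^sub>p p)"
      using \<open>u = _\<close> \<open>v = _\<close> unfolding level_rel_def by force
  next
    assume "(u, v) \<in> level_rel i k (q \<bullet>\<^sub>p p)"
    then obtain x y where "u = at_levels i k x" "v = at_levels i k y" "(x, y) \<in> block_rel (q \<bullet>\<^sub>p p)"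
      unfolding level_rel_def by auto
    then show "(u, v) \<in> Restr ?E ({i, k} \<times> UNIV)"
      using in_block_rel_pcomp[OF assms, of x y] in_range by simp
  qed
  then show ?thesis by (auto simp only: set_eq_iff split_paired_all)
qed

text \<open>A reference object without brackets: both bracketings of a threefold product are
  compared with it rather than with each other.\<close>

definition triple_rel :: "two_part \<Rightarrow> two_part \<Rightarrow> two_part \<Rightarrow> (nat \<times> nat) rel" where
  "triple_rel r q p = (level_rel 0 1 p \<union> level_rel 1 2 q \<union> level_rel 2 3 r)\<^sup>+"

lemma glue_levels:
  assumes "distinct [i, j, k, l]"
  shows "glue ((level_rel i j p \<union> level_rel j k q)\<^sup>+) (level_rel k l r) ({i, k} \<times> UNIV)"
proof
  show "sym ((level_rel i j p \<union> level_rel j k q)\<^sup>+)"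
    by (intro sym_trancl sym_Un sym_level_rel)
  have "Domain ((level_rel i j p \<union> level_rel j k q)\<^sup>+) \<subseteq> {i, j, k} \<times> UNIV"
    using Domain_level_rel_subset[of i j p] Domain_level_rel_subset[of j k q] by (simp add: Domain_Un_eq) blast
  moreover have "Domain (level_rel k l r) \<subseteq> {k, l} \<times> UNIV"
    by (rule Domain_level_rel_subset)
  ultimately have "Domain ((level_rel i j p \<union> level_rel j k q)\<^sup>+) \<inter> Domain (level_rel k l r)
    \<subseteq> ({i, j, k} \<times> UNIV) \<inter> ({k, l} \<times> UNIV)" by (rule Int_mono)
  also have "\<dots> \<subseteq> {i, k} \<times> UNIV" using assms by auto
  finally show "Domain ((level_rel i j p \<union> level_rel j k q)\<^sup>+) \<inter> Domain (level_rel k l r)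
    \<subseteq> {i, k} \<times> UNIV" .
qed (auto simp: sym_level_rel)

text \<open>The levels are variables so that one statement serves 0, 1, 2, 3 as well as 3, 2, 1, 0.
  The second reading, after passing to involutions, handles the other bracketing.\<close>

lemma level_rel_glue:
  assumes "distinct [i, j, k, l]"
    and T: "T = (level_rel i j p \<union> level_rel j k q \<union> level_rel k l r)\<^sup>+"
    and T': "T' = (level_rel i k s \<union> level_rel k l r)\<^sup>+"
    and s: "level_rel i k s = Restr ((level_rel i j p \<union> level_rel j k q)\<^sup>+) ({i, k} \<times> UNIV)"
  shows "(at_levels i l x, at_levels i l y) \<in> T' \<longleftrightarrow> (at_levels i l x, at_levels i l y) \<in> T"
    and "\<lbrakk>finite (\<Union>p); finite (\<Union>q); finite (\<Union>r)\<rbrakk> \<Longrightarrow>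
      card {K \<in> Domain T // T. K \<subseteq> {j, k} \<times> UNIV}
      = card {K \<in> Domain ((level_rel i j p \<union> level_rel j k q)\<^sup>+) // (level_rel i j p \<union> level_rel j k q)\<^sup>+.
          K \<subseteq> {j} \<times> UNIV}
        + card {K \<in> Domain T' // T'. K \<subseteq> {k} \<times> UNIV}"
proof -
  interpret glue "(level_rel i j p \<union> level_rel j k q)\<^sup>+" "level_rel k l r" "{i, k} \<times> UNIV"
    by (rule glue_levels) fact
  have V: "V = T" unfolding V_def T by (rule trancl_Un_trancl)
  have V': "V' = T'" unfolding V'_def T' s ..
  have DU: "Domain ((level_rel i j p \<union> level_rel j k q)\<^sup>+) \<subseteq> {i, j, k} \<times> UNIV"
    using Domain_level_rel_subset[of i j p] Domain_level_rel_subset[of j k q] by (simp add: Domain_Un_eq) blast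
  have "at_levels i l z \<in> A'" if "at_levels i l z \<in> Domain V" for z
    using that DU assms(1) unfolding Domain_V A'_def by (cases z) auto
  moreover have "u \<in> Domain V \<and> v \<in> Domain V" if "(u, v) \<in> V" for u v
    using that sym_V by (auto dest: symD)
  ultimately show "(at_levels i l x, at_levels i l y) \<in> T' \<longleftrightarrow> (at_levels i l x, at_levels i l y) \<in> T"
    using glue_restrict V'_subset unfolding V V' by blast
  assume fin: "finite (\<Union>p)" "finite (\<Union>q)" "finite (\<Union>r)"
  have "finite (Domain V)"
    unfolding Domain_V trancl_domain Domain_Un_eq Domain_level_rel using fin by blast
  moreover have "Domain ((level_rel i j p \<union> level_rel j k q)\<^sup>+) - {i, k} \<times> UNIV \<subseteq> {j, k} \<times> UNIV"
    using DU by blast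
  moreover have "{j, k} \<times> UNIV - A' = {j} \<times> UNIV"
    using Domain_level_rel_subset[of k l r] assms(1) unfolding A'_def by auto
  moreover have "K \<subseteq> {j, k} \<times> UNIV \<longleftrightarrow> K \<subseteq> {k} \<times> UNIV" if "K \<in> Domain V' // V'" for K
  proof -
    have "K \<subseteq> Domain V'" using that sym_V' by (auto elim!: quotientE dest: symD)
    also have "\<dots> \<subseteq> {i, k, l} \<times> UNIV"
      using Domain_V'_subset Domain_level_rel_subset[of k l r] unfolding A'_def by blast
    finally show ?thesis using assms(1) by auto
  qed
  then have "{K \<in> Domain V' // V'. K \<subseteq> {j, k} \<times> UNIV} = {K \<in> Domain V' // V'. K \<subseteq> {k} \<times> UNIV}"
    by blast
  ultimately show "card {K \<in> Domain T // T. K \<subseteq> {j, k} \<times> UNIV}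
      = card {K \<in> Domain ((level_rel i j p \<union> level_rel j k q)\<^sup>+) // (level_rel i j p \<union> level_rel j k q)\<^sup>+.
          K \<subseteq> {j} \<times> UNIV}
        + card {K \<in> Domain T' // T'. K \<subseteq> {k} \<times> UNIV}"
    using card_components[of "{j, k} \<times> UNIV"] unfolding V V' by simp
qed

definition flip :: "nat + nat \<Rightarrow> nat + nat" where
  "flip = case_sum Inr Inl"

lemma flip_simps [simp]: "flip (Inl a) = Inr a" "flip (Inr a) = Inl a" "flip (flip x) = x"
  by (simp_all add: flip_def split: sum.splits)

lemma involution_eq: "involution p = (`) flip ` p"
  by (simp add: involution_def flip_def)

lemma inj_flip: "inj flip"
  by (metis flip_simps(3) injI)

lemma block_rel_involution: "(x, y) \<in> block_rel (involution p) \<longleftrightarrow> (flip x, flip y) \<in> block_rel p"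
  unfolding involution_eq block_rel_image
  using inj_map_prod_mem[OF inj_flip, of "flip x" "flip y" "block_rel p"] by simp

lemma involution_involution [simp]: "involution (involution p) = p"
  unfolding involution_eq by (simp add: image_image)

lemma Union_involution: "\<Union>(involution p) = flip ` \<Union>p"
  unfolding involution_eq by auto

lemma is_part_involution: "is_part p \<Longrightarrow> is_part (involution p)"
  unfolding is_part_def involution_eq disjoint_def using inj_flip
  by (auto simp flip: image_Int)

lemma at_levels_flip [simp]: "at_levels i j (flip x) = at_levels j i x"
  by (cases x) auto

lemma level_rel_involution: "level_rel i j (involution p) = level_rel j i p"
  unfolding level_rel_def involution_eq block_rel_image image_image
  by (rule image_cong) auto

lemma involution_pcomp: "involution (q \<bullet>\<^sub>p p) = involution p \<bullet>\<^sub>p involution q"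
proof (rule is_part_eqI)
  have "(x, y) \<in> block_rel (involution (q \<bullet>\<^sub>p p)) \<longleftrightarrow> (x, y) \<in> block_rel (involution p \<bullet>\<^sub>p involution q)" for x y
    using in_block_rel_pcomp[of 0 1 2 "flip x" "flip y" q p]
      in_block_rel_pcomp[of 2 1 0 x y "involution p" "involution q"]
    by (simp add: block_rel_involution level_rel_involution Un_commute)
  then show "block_rel (involution (q \<bullet>\<^sub>p p)) = block_rel (involution p \<bullet>\<^sub>p involution q)"
    by auto
qed (simp_all add: is_part_involution is_part_pcomp)

lemma in_block_rel_triple:
  "(x, y) \<in> block_rel (r \<bullet>\<^sub>p (q \<bullet>\<^sub>p p)) \<longleftrightarrow> (at_levels 0 3 x, at_levels 0 3 y) \<in> triple_rel r q p"
  "(x, y) \<in> block_rel (r \<bullet>\<^sub>p q \<bullet>\<^sub>p p) \<longleftrightarrow> (at_levels 0 3 x, at_levels 0 3 y) \<in> triple_rel r q p"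
proof -
  show "(x, y) \<in> block_rel (r \<bullet>\<^sub>p (q \<bullet>\<^sub>p p)) \<longleftrightarrow> (at_levels 0 3 x, at_levels 0 3 y) \<in> triple_rel r q p"
    unfolding in_block_rel_pcomp[of 0 2 3 x y r, simplified]
    by (rule level_rel_glue(1)[of 0 1 2 3 _ p q r _ "q \<bullet>\<^sub>p p"])
      (simp_all add: triple_rel_def Restr_level_rel)
  \<comment> \<open>The stack is turned upside down: in the levels 3, 2, 1, 0 the product glued
    first is the involution of \<open>r \<bullet>\<^sub>p q\<close>, and flipping the outer points
    undoes the reversal.\<close>
  show "(x, y) \<in> block_rel (r \<bullet>\<^sub>p q \<bullet>\<^sub>p p) \<longleftrightarrow> (at_levels 0 3 x, at_levels 0 3 y) \<in> triple_rel r q p"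
    using in_block_rel_pcomp[of 0 1 3 x y "r \<bullet>\<^sub>p q" p] Restr_level_rel[of 1 2 3 q r]
      level_rel_glue(1)[of 3 2 1 0 "triple_rel r q p" "involution r" "involution q" "involution p"
        "(level_rel 0 1 p \<union> level_rel 1 3 (r \<bullet>\<^sub>p q))\<^sup>+" "involution (r \<bullet>\<^sub>p q)" "flip x" "flip y"]
    by (simp add: triple_rel_def level_rel_involution Un_ac insert_commute)
qed

lemma pcomp_assoc: "r \<bullet>\<^sub>p q \<bullet>\<^sub>p p = r \<bullet>\<^sub>p (q \<bullet>\<^sub>p p)"
  by (rule is_part_eqI) (auto simp: is_part_pcomp in_block_rel_triple)

text \<open>Each side counts the components of the triple stack that stay in the levels 1 and 2,
  sorted by the stage at which they close. This is the cocycle identity behind associativity of the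
  composition weighted by powers of t.\<close>

lemma ploops_cocycle:
  assumes fin: "finite (\<Union>p)" "finite (\<Union>q)" "finite (\<Union>r)"
  shows "ploops r (q \<bullet>\<^sub>p p) + ploops q p = ploops (r \<bullet>\<^sub>p q) p + ploops r q"
proof -
  have d: "distinct [0, 1, 2::nat]" "distinct [0, 2, 3::nat]" "distinct [0, 1, 3::nat]"
    "distinct [1, 2, 3::nat]" "distinct [0, 1, 2, 3::nat]" "distinct [3, 2, 1, 0::nat]"
    "distinct [3, 2, 1::nat]" "distinct [3, 1, 0::nat]"
    by simp_all
  have "card {K \<in> Domain (triple_rel r q p) // triple_rel r q p. K \<subseteq> {1, 2} \<times> UNIV}
      = ploops q p + ploops r (q \<bullet>\<^sub>p p)"
    unfolding ploops_eq[OF d(1), where p = p and q = q] ploops_eq[OF d(2), where p = "q \<bullet>\<^sub>p p" and q = r]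
    by (rule level_rel_glue(2)[OF d(5) triple_rel_def refl Restr_level_rel[OF d(1), symmetric] fin])
  moreover have "card {K \<in> Domain (triple_rel r q p) // triple_rel r q p. K \<subseteq> {2, 1} \<times> UNIV}
      = ploops r q + ploops (r \<bullet>\<^sub>p q) p"
  proof -
    have T: "triple_rel r q p = (level_rel 3 2 (involution r) \<union> level_rel 2 1 (involution q) \<union>
        level_rel 1 0 (involution p))\<^sup>+"
      by (simp only: triple_rel_def level_rel_involution Un_ac)
    have loops_flip: "ploops q' p' = card {K \<in> Domain ((level_rel k j (involution q') \<union> level_rel j i (involution p'))\<^sup>+)
        // (level_rel k j (involution q') \<union> level_rel j i (involution p'))\<^sup>+. K \<subseteq> {j} \<times> UNIV}"
      if "distinct [i, j, k]" for i j k q' p'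
      by (simp only: ploops_eq[OF that] level_rel_involution Un_commute)
    show ?thesis
      unfolding loops_flip[OF d(4), where p' = q and q' = r] loops_flip[OF d(3), where p' = p and q' = "r \<bullet>\<^sub>p q"]
      by (rule level_rel_glue(2)[OF d(6) T refl])
        (use fin Restr_level_rel[OF d(7), of "involution r" "involution q"]
          in \<open>simp_all only: involution_pcomp Union_involution finite_imageI\<close>)
  qed
  ultimately show ?thesis by (simp add: insert_commute)
qed

subsection \<open>Blocks of composites\<close>

lemma Union_pcomp: "\<Union>(q \<bullet>\<^sub>p p) = {Inl a |a. Inl a \<in> \<Union>p} \<union> {Inr c |c. Inr c \<in> \<Union>q}"
proof -
  have "x \<in> Domain (block_rel (q \<bullet>\<^sub>p p)) \<longleftrightarrow> at_levels 0 2 x \<in> Domain ((level_rel 0 1 p \<union> level_rel 1 2 q)\<^sup>+)" for x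
  proof
    assume "x \<in> Domain (block_rel (q \<bullet>\<^sub>p p))"
    then obtain y where "(x, y) \<in> block_rel (q \<bullet>\<^sub>p p)" by blast
    then have "(at_levels 0 2 x, at_levels 0 2 y) \<in> (level_rel 0 1 p \<union> level_rel 1 2 q)\<^sup>+"
      using in_block_rel_pcomp[of 0 1 2 x y q p] by simp
    then show "at_levels 0 2 x \<in> Domain ((level_rel 0 1 p \<union> level_rel 1 2 q)\<^sup>+)"
      by (rule DomainI)
  next
    assume "at_levels 0 2 x \<in> Domain ((level_rel 0 1 p \<union> level_rel 1 2 q)\<^sup>+)"
    moreover have "sym ((level_rel 0 1 p \<union> level_rel 1 2 q)\<^sup>+)"
      by (intro sym_trancl sym_Un sym_level_rel)
    ultimately have "(at_levels 0 2 x, at_levels 0 2 x) \<in> (level_rel 0 1 p \<union> level_rel 1 2 q)\<^sup>+"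
      by (meson DomainE symD trancl_trans)
    then have "(x, x) \<in> block_rel (q \<bullet>\<^sub>p p)"
      using in_block_rel_pcomp[of 0 1 2 x x q p] by simp
    then show "x \<in> Domain (block_rel (q \<bullet>\<^sub>p p))" by (rule DomainI)
  qed
  then have 1: "x \<in> \<Union>(q \<bullet>\<^sub>p p) \<longleftrightarrow> at_levels 0 2 x \<in> at_levels 0 1 ` \<Union>p \<union> at_levels 1 2 ` \<Union>q" for x
    by (simp only: Domain_block_rel trancl_domain Domain_Un_eq Domain_level_rel)
  have 2: "at_levels 0 2 x \<in> at_levels 0 1 ` X \<union> at_levels 1 2 ` Y
      \<longleftrightarrow> x \<in> {Inl a |a. Inl a \<in> X} \<union> {Inr c |c. Inr c \<in> Y}" for x X Y
  proof (cases x)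
    case (Inl a)
    have "(0::nat, a) = at_levels 0 1 z \<longleftrightarrow> z = Inl a" for z by (cases z) auto
    moreover have "(0::nat, a) \<noteq> at_levels 1 2 z" for z by (cases z) auto
    ultimately show ?thesis using Inl by (auto simp: image_iff)
  next
    case (Inr a)
    have "(2::nat, a) = at_levels 1 2 z \<longleftrightarrow> z = Inr a" for z by (cases z) auto
    moreover have "(2::nat, a) \<noteq> at_levels 0 1 z" for z by (cases z) auto
    ultimately show ?thesis using Inr by (auto simp: image_iff)
  qed
  show ?thesis by (rule Set.set_eqI) (rule trans[OF 1 2])
qed

lemma pcomp_parts: "p \<in> parts k l \<Longrightarrow> q \<in> parts l m \<Longrightarrow> q \<bullet>\<^sub>p p \<in> parts k m"
  unfolding parts_iff by (auto simp: is_part_pcomp Union_pcomp)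

lemma finite_pcomp: "finite (\<Union>p) \<Longrightarrow> finite (\<Union>q) \<Longrightarrow> finite (\<Union>(q \<bullet>\<^sub>p p))"
  unfolding Union_pcomp
  by (rule finite_subset[of _ "\<Union>p \<union> \<Union>q"]) auto

lemma finite_parts: "p \<in> parts k l \<Longrightarrow> finite (\<Union>p)"
  by (simp add: parts_iff)

lemma flip_Plus: "flip ` (A <+> B) = B <+> A"
  by (auto simp: Plus_def image_Un image_image)

lemma involution_parts: "p \<in> parts k l \<Longrightarrow> involution p \<in> parts l k"
  by (simp add: parts_iff is_part_involution Union_involution flip_Plus)

lemma block_rel_refl: "x \<in> \<Union>p \<Longrightarrow> (x, x) \<in> block_rel p"
  by (auto simp: block_rel_def)

lemma block_rel_sym: "(x, y) \<in> block_rel p \<Longrightarrow> (y, x) \<in> block_rel p"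
  by (auto simp: block_rel_def)

lemma block_rel_trans: "is_part p \<Longrightarrow> (x, y) \<in> block_rel p \<Longrightarrow> (y, z) \<in> block_rel p \<Longrightarrow> (x, z) \<in> block_rel p"
  using trans_block_rel by (blast dest: transD)

lemma block_rel_Union: "(x, y) \<in> block_rel p \<Longrightarrow> x \<in> \<Union>p \<and> y \<in> \<Union>p"
  by (auto simp: block_rel_def)

text \<open>The means for upper bounds on a composite: labels on the three levels that are
  compatible with the blocks of both factors are compatible with the blocks of the composite. An
  induction along paths is thereby replaced by the choice of a labelling.\<close>

lemma pcomp_label:
  assumes xy: "(x, y) \<in> block_rel (q \<bullet>\<^sub>p p)" and R: "trans R"
    and p: "\<And>u v. (u, v) \<in> block_rel p \<Longrightarrow> (case_sum f0 f1 u, case_sum f0 f1 v) \<in> R"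
    and q: "\<And>u v. (u, v) \<in> block_rel q \<Longrightarrow> (case_sum f1 f2 u, case_sum f1 f2 v) \<in> R"
  shows "(case_sum f0 f2 x, case_sum f0 f2 y) \<in> R"
proof -
  define f where "f = (\<lambda>(i, a). if i = 0 then f0 a else if i = (1::nat) then f1 a else f2 a)"
  have f: "f (at_levels 0 1 u) = case_sum f0 f1 u" "f (at_levels 1 2 u) = case_sum f1 f2 u"
    "f (at_levels 0 2 u) = case_sum f0 f2 u" for u
    by (cases u; simp add: f_def)+
  have edge: "(f u, f v) \<in> R" if "(u, v) \<in> level_rel 0 1 p \<union> level_rel 1 2 q" for u v
    using that p q unfolding level_rel_def by (auto simp: f[simplified])
  have "(f u, f v) \<in> R" if "(u, v) \<in> (level_rel 0 1 p \<union> level_rel 1 2 q)\<^sup>+" for u v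
    using that
  proof (induction rule: trancl_induct)
    case (base v)
    then show ?case by (rule edge)
  next
    case (step v w)
    then show ?case using edge[OF step.hyps(2)] transD[OF R] by blast
  qed
  moreover have "(at_levels 0 2 x, at_levels 0 2 y) \<in> (level_rel 0 1 p \<union> level_rel 1 2 q)\<^sup>+"
    using xy in_block_rel_pcomp[of 0 1 2 x y q p] by simp
  ultimately show ?thesis using f(3) by metis
qed

lemma pcomp_label_eq:
  assumes "(x, y) \<in> block_rel (q \<bullet>\<^sub>p p)"
    and "\<And>u v. (u, v) \<in> block_rel p \<Longrightarrow> case_sum f0 f1 u = case_sum f0 f1 v"
    and "\<And>u v. (u, v) \<in> block_rel q \<Longrightarrow> case_sum f1 f2 u = case_sum f1 f2 v"
  shows "case_sum f0 f2 x = case_sum f0 f2 y"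
  using pcomp_label[of x y q p Id f0 f1 f2] assms by (simp add: trans_Id)

lemma pcomp_upper: "(Inl a, Inl b) \<in> block_rel p \<Longrightarrow> (Inl a, Inl b) \<in> block_rel (q \<bullet>\<^sub>p p)"
    and pcomp_lower: "(Inr a, Inr b) \<in> block_rel q \<Longrightarrow> (Inr a, Inr b) \<in> block_rel (q \<bullet>\<^sub>p p)"
    and pcomp_through: "(Inl a, Inr m) \<in> block_rel p \<Longrightarrow> (Inl m, Inr c) \<in> block_rel q
      \<Longrightarrow> (Inl a, Inr c) \<in> block_rel (q \<bullet>\<^sub>p p)"
proof -
  let ?E = "(level_rel 0 1 p \<union> level_rel 1 2 q)\<^sup>+"
  have d: "distinct [0, 1, 2::nat]" by simp
  have p: "(at_levels 0 1 x, at_levels 0 1 y) \<in> ?E" if "(x, y) \<in> block_rel p" for x y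
    using that unfolding level_rel_def by (intro r_into_trancl) force
  have q: "(at_levels 1 2 x, at_levels 1 2 y) \<in> ?E" if "(x, y) \<in> block_rel q" for x y
    using that unfolding level_rel_def by (intro r_into_trancl) force
  show "(Inl a, Inl b) \<in> block_rel (q \<bullet>\<^sub>p p)" if "(Inl a, Inl b) \<in> block_rel p"
    using p[OF that] unfolding in_block_rel_pcomp[OF d] by simp
  show "(Inr a, Inr b) \<in> block_rel (q \<bullet>\<^sub>p p)" if "(Inr a, Inr b) \<in> block_rel q"
    using q[OF that] unfolding in_block_rel_pcomp[OF d] by simp
  show "(Inl a, Inr c) \<in> block_rel (q \<bullet>\<^sub>p p)"
    if "(Inl a, Inr m) \<in> block_rel p" "(Inl m, Inr c) \<in> block_rel q"
    using trancl_trans[of "(0, a)" "(1, m)" ?E] p[OF that(1)] q[OF that(2)]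
    unfolding in_block_rel_pcomp[OF d] by (auto intro: trancl_trans)
qed

lemma pcomp_through_upper:
  assumes "is_part p" "(Inl a, Inr c) \<in> block_rel (q \<bullet>\<^sub>p p)"
  obtains m where "(Inl a, Inr m) \<in> block_rel p"
proof (rule ccontr)
  assume no: "\<not> thesis"
  \<comment> \<open>Indicator of the block of \<open>Inl a\<close> on the top level, extended by
    False to the other two. If that block has no middle point, the labelling is constant on blocks,
    although it separates \<open>a\<close> from \<open>c\<close>.\<close>
  define f where "f = (\<lambda>x. (Inl a, Inl x) \<in> block_rel p)"
  have "case_sum f (\<lambda>_. False) (Inl a :: nat + nat) = case_sum f (\<lambda>_. False) (Inr c :: nat + nat)"
  proof (rule pcomp_label_eq[OF assms(2), of f "\<lambda>_. False" "\<lambda>_. False"])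
    fix u v assume uv: "(u, v) \<in> block_rel p"
    have "(Inl a, u) \<in> block_rel p \<longleftrightarrow> (Inl a, v) \<in> block_rel p"
      using uv block_rel_sym[OF uv] block_rel_trans[OF assms(1)] by blast
    moreover have "(Inl a, Inr m) \<notin> block_rel p" for m using no that by blast
    ultimately show "case_sum f (\<lambda>_. False) u = case_sum f (\<lambda>_. False) v"
      by (cases u; cases v) (simp_all add: f_def)
  qed (auto split: sum.splits)
  moreover have "(Inl a, Inl a) \<in> block_rel p"
    using block_rel_Union[OF assms(2)] by (auto simp: Union_pcomp block_rel_def)
  ultimately show False by (simp add: f_def)
qed

subsection \<open>Through-blocks\<close>

definition through_set :: "two_part \<Rightarrow> two_part" where
  "through_set p = {B \<in> p. B \<inter> range Inl \<noteq> {} \<and> B \<inter> range Inr \<noteq> {}}"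

lemma through_blocks_eq: "through_blocks p = card (through_set p)"
  by (simp add: through_blocks_def through_set_def)

lemma finite_part: "finite (\<Union>p) \<Longrightarrow> finite p"
  by (rule finite_UnionD)

lemma finite_through_set: "finite (\<Union>p) \<Longrightarrow> finite (through_set p)"
  unfolding through_set_def by (rule finite_subset[OF _ finite_part]) auto

text \<open>A through-block of the composite has an upper point, and the block of \<open>p\<close>
  at this point must reach the middle. Blocks of \<open>p\<close> stay together in the composite, so
  distinct through-blocks select distinct blocks of \<open>p\<close>.\<close>

lemma through_blocks_pcomp_le:
  assumes "is_part p" "finite (\<Union>p)"
  shows "through_blocks (q \<bullet>\<^sub>p p) \<le> through_blocks p"
proof -
  have "\<exists>a D. B \<in> q \<bullet>\<^sub>p p \<and> Inl a \<in> B \<and> Inl a \<in> D \<and> D \<in> through_set p"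
    if B: "B \<in> through_set (q \<bullet>\<^sub>p p)" for B
  proof -
    from B obtain a c where "Inl a \<in> B" "Inr c \<in> B" "B \<in> q \<bullet>\<^sub>p p" by (auto simp: through_set_def)
    then have "(Inl a, Inr c) \<in> block_rel (q \<bullet>\<^sub>p p)" by (auto simp: block_rel_def)
    then obtain m where "(Inl a, Inr m) \<in> block_rel p" by (rule pcomp_through_upper[OF assms(1)])
    then obtain D where "D \<in> p" "Inl a \<in> D" "Inr m \<in> D" by (auto simp: block_rel_def)
    then have "D \<in> through_set p" unfolding through_set_def by blast
    then show ?thesis using \<open>Inl a \<in> B\<close> \<open>B \<in> q \<bullet>\<^sub>p p\<close> \<open>Inl a \<in> D\<close> by blast
  qed
  then obtain f g where fg: "\<And>B. B \<in> through_set (q \<bullet>\<^sub>p p) \<Longrightarrow>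
      B \<in> q \<bullet>\<^sub>p p \<and> Inl (f B) \<in> B \<and> Inl (f B) \<in> g B \<and> g B \<in> through_set p"
    by metis
  have "inj_on g (through_set (q \<bullet>\<^sub>p p))"
  proof (rule inj_onI)
    fix B B' assume B: "B \<in> through_set (q \<bullet>\<^sub>p p)" "B' \<in> through_set (q \<bullet>\<^sub>p p)" "g B = g B'"
    then have "(Inl (f B), Inl (f B')) \<in> block_rel p"
      using fg[OF B(1)] fg[OF B(2)] by (auto simp: block_rel_def through_set_def)
    then have "(Inl (f B), Inl (f B')) \<in> block_rel (q \<bullet>\<^sub>p p)" by (rule pcomp_upper)
    then show "B = B'"
      using block_eqI[OF is_part_pcomp] fg[OF B(1)] fg[OF B(2)] by (metis Image_singleton_iff)
  qed
  moreover have "g ` through_set (q \<bullet>\<^sub>p p) \<subseteq> through_set p" using fg by auto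
  ultimately show ?thesis
    unfolding through_blocks_eq using finite_through_set[OF assms(2)] by (metis card_inj_on_le)
qed

lemma through_set_involution: "through_set (involution p) = (`) flip ` through_set p"
proof -
  have "through_set (involution p)
      = (`) flip ` {B \<in> p. flip ` B \<inter> range Inl \<noteq> {} \<and> flip ` B \<inter> range Inr \<noteq> {}}"
    unfolding through_set_def involution_eq by blast
  moreover have "flip ` B \<inter> range Inl \<noteq> {} \<longleftrightarrow> B \<inter> range Inr \<noteq> {}" for B
    by (auto simp: flip_def image_iff split: sum.splits)
  moreover have "flip ` B \<inter> range Inr \<noteq> {} \<longleftrightarrow> B \<inter> range Inl \<noteq> {}" for B
    by (auto simp: flip_def image_iff split: sum.splits)
  ultimately show ?thesis unfolding through_set_def by (simp only: conj_commute)
qed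

lemma through_blocks_involution: "through_blocks (involution p) = through_blocks p"
  unfolding through_blocks_eq through_set_involution
  by (rule card_image) (meson inj_flip inj_image_eq_iff inj_onI)

lemma through_blocks_pcomp_le':
  assumes "is_part q" "finite (\<Union>q)"
  shows "through_blocks (q \<bullet>\<^sub>p p) \<le> through_blocks q"
  using through_blocks_pcomp_le[of "involution q" "involution p"] assms
  by (simp add: is_part_involution Union_involution through_blocks_involution flip: involution_pcomp)

lemma Plus_mem_iff [simp]: "Inl a \<in> A <+> B \<longleftrightarrow> a \<in> A" "Inr b \<in> A <+> B \<longleftrightarrow> b \<in> B"
  by auto

lemma Union_iff_block_rel: "x \<in> \<Union>p \<longleftrightarrow> (x, x) \<in> block_rel p"
  by (auto simp: block_rel_def)

lemma pcomp_mid: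
  assumes "(Inr m, Inr m') \<in> block_rel p" "(Inl m, Inr c) \<in> block_rel q" "(Inl m', Inr c') \<in> block_rel q"
  shows "(Inr c, Inr c') \<in> block_rel (q \<bullet>\<^sub>p p)"
proof -
  let ?E = "(level_rel 0 1 p \<union> level_rel 1 2 q)\<^sup>+"
  have d: "distinct [0, 1, 2::nat]" by simp
  have "(at_levels 0 1 (Inr m), at_levels 0 1 (Inr m')) \<in> ?E"
    using assms(1) unfolding level_rel_def by (intro r_into_trancl) force
  moreover have "(at_levels 1 2 (Inr c), at_levels 1 2 (Inl m)) \<in> ?E"
    using block_rel_sym[OF assms(2)] unfolding level_rel_def by (intro r_into_trancl) force
  moreover have "(at_levels 1 2 (Inl m'), at_levels 1 2 (Inr c')) \<in> ?E"
    using assms(3) unfolding level_rel_def by (intro r_into_trancl) force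
  ultimately show ?thesis
    unfolding in_block_rel_pcomp[OF d] at_levels_simps by (blast intro: trancl_trans)
qed

lemma block_rel_eqI:
  fixes p q :: two_part
  assumes "is_part p" "is_part q"
    and "\<And>a b. (Inl a, Inl b) \<in> block_rel p \<longleftrightarrow> (Inl a, Inl b) \<in> block_rel q"
    and "\<And>a b. (Inl a, Inr b) \<in> block_rel p \<longleftrightarrow> (Inl a, Inr b) \<in> block_rel q"
    and "\<And>a b. (Inr a, Inr b) \<in> block_rel p \<longleftrightarrow> (Inr a, Inr b) \<in> block_rel q"
  shows "p = q"
proof (rule is_part_eqI[OF assms(1,2)])
  have "(x, y) \<in> block_rel p \<longleftrightarrow> (x, y) \<in> block_rel q" for x y
    using assms(3-5) block_rel_sym[of x y] block_rel_sym[of y x]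
    by (cases x; cases y) (simp; metis block_rel_sym)+
  then show "block_rel p = block_rel q" by auto
qed

text \<open>Folding the stack along its middle maps it onto \<open>r\<close>, which bounds the
  composite from above; a block meets its mirror image exactly when it reaches the middle. So the
  composite depends only on the upper half of \<open>r\<close> and on which of its blocks are
  through-blocks.\<close>

lemma block_rel_involution_pcomp:
  assumes r: "is_part r"
  shows "(Inl a, Inl b) \<in> block_rel (involution r \<bullet>\<^sub>p r) \<longleftrightarrow> (Inl a, Inl b) \<in> block_rel r"
    and "(Inr a, Inr b) \<in> block_rel (involution r \<bullet>\<^sub>p r) \<longleftrightarrow> (Inl a, Inl b) \<in> block_rel r"
    and "(Inl a, Inr b) \<in> block_rel (involution r \<bullet>\<^sub>p r)
      \<longleftrightarrow> (Inl a, Inl b) \<in> block_rel r \<and> (\<exists>m. (Inl a, Inr m) \<in> block_rel r)"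
proof -
  have lab: "(case_sum Inl Inl x, case_sum Inl Inl y) \<in> block_rel r"
    if "(x, y) \<in> block_rel (involution r \<bullet>\<^sub>p r)" for x y
  proof (rule pcomp_label[OF that trans_block_rel[OF r], of Inl Inr Inl])
    fix u v
    have [simp]: "case_sum Inl Inr w = w" for w :: "nat + nat" by (cases w) auto
    have [simp]: "case_sum Inr Inl w = flip w" for w :: "nat + nat" by (simp add: flip_def)
    show "(u, v) \<in> block_rel r \<Longrightarrow> (case_sum Inl Inr u, case_sum Inl Inr v) \<in> block_rel r"
      by simp
    show "(u, v) \<in> block_rel (involution r) \<Longrightarrow> (case_sum Inr Inl u, case_sum Inr Inl v) \<in> block_rel r"
      by (simp add: block_rel_involution)
  qed
  show "(Inl a, Inl b) \<in> block_rel (involution r \<bullet>\<^sub>p r) \<longleftrightarrow> (Inl a, Inl b) \<in> block_rel r"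
    using lab[of "Inl a" "Inl b"] pcomp_upper[of a b r] by auto
  show "(Inr a, Inr b) \<in> block_rel (involution r \<bullet>\<^sub>p r) \<longleftrightarrow> (Inl a, Inl b) \<in> block_rel r"
    using lab[of "Inr a" "Inr b"] pcomp_lower[of a b "involution r" r]
    by (auto simp: block_rel_involution)
  show "(Inl a, Inr b) \<in> block_rel (involution r \<bullet>\<^sub>p r)
      \<longleftrightarrow> (Inl a, Inl b) \<in> block_rel r \<and> (\<exists>m. (Inl a, Inr m) \<in> block_rel r)"
  proof
    assume l: "(Inl a, Inr b) \<in> block_rel (involution r \<bullet>\<^sub>p r)"
    obtain m where "(Inl a, Inr m) \<in> block_rel r" by (rule pcomp_through_upper[OF r l])
    with lab[OF l] show "(Inl a, Inl b) \<in> block_rel r \<and> (\<exists>m. (Inl a, Inr m) \<in> block_rel r)"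
      by auto
  next
    assume "(Inl a, Inl b) \<in> block_rel r \<and> (\<exists>m. (Inl a, Inr m) \<in> block_rel r)"
    then obtain m where ab: "(Inl a, Inl b) \<in> block_rel r" and m: "(Inl a, Inr m) \<in> block_rel r" by auto
    then have "(Inr m, Inl b) \<in> block_rel r" using r block_rel_sym block_rel_trans by metis
    then have "(Inl m, Inr b) \<in> block_rel (involution r)" by (simp add: block_rel_involution)
    with m show "(Inl a, Inr b) \<in> block_rel (involution r \<bullet>\<^sub>p r)" by (rule pcomp_through)
  qed
qed

text \<open>Again the stack folds onto \<open>r\<close>. The identity makes every partition a
  partial isometry with initial projection \<open>involution r \<bullet>\<^sub>p r\<close>.\<close>

lemma pcomp_involution_pcomp:
  assumes r: "is_part r"
  shows "r \<bullet>\<^sub>p (involution r \<bullet>\<^sub>p r) = r"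
proof (rule block_rel_eqI)
  let ?s = "involution r \<bullet>\<^sub>p r"
  have lab: "(case_sum Inl Inr x, case_sum Inl Inr y) \<in> block_rel r"
    if "(x, y) \<in> block_rel (r \<bullet>\<^sub>p ?s)" for x y
  proof (rule pcomp_label[OF that trans_block_rel[OF r], of Inl Inl Inr])
    fix u v :: "nat + nat"
    have [simp]: "case_sum Inl Inr w = w" for w :: "nat + nat" by (cases w) auto
    show "(u, v) \<in> block_rel r \<Longrightarrow> (case_sum Inl Inr u, case_sum Inl Inr v) \<in> block_rel r"
      by simp
    assume uv: "(u, v) \<in> block_rel ?s"
    show "(case_sum Inl Inl u, case_sum Inl Inl v) \<in> block_rel r"
      using uv block_rel_sym[OF uv]
      by (cases u; cases v) (auto simp: block_rel_involution_pcomp[OF r] dest: block_rel_sym)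
  qed
  fix a b
  show "(Inl a, Inl b) \<in> block_rel (r \<bullet>\<^sub>p ?s) \<longleftrightarrow> (Inl a, Inl b) \<in> block_rel r"
    using lab[of "Inl a" "Inl b"] pcomp_upper[of a b ?s r] block_rel_involution_pcomp[OF r] by auto
  show "(Inr a, Inr b) \<in> block_rel (r \<bullet>\<^sub>p ?s) \<longleftrightarrow> (Inr a, Inr b) \<in> block_rel r"
    using lab[of "Inr a" "Inr b"] pcomp_lower[of a b r ?s] by auto
  have "(Inl a, Inr b) \<in> block_rel (r \<bullet>\<^sub>p ?s)" if ab: "(Inl a, Inr b) \<in> block_rel r"
  proof (rule pcomp_through)
    have "(Inl a, Inl a) \<in> block_rel r" using block_rel_Union[OF ab] by (auto intro: block_rel_refl)
    then show "(Inl a, Inr a) \<in> block_rel ?s"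
      using ab block_rel_involution_pcomp(3)[OF r] by auto
  qed (rule ab)
  then show "(Inl a, Inr b) \<in> block_rel (r \<bullet>\<^sub>p ?s) \<longleftrightarrow> (Inl a, Inr b) \<in> block_rel r"
    using lab[of "Inl a" "Inr b"] by auto
qed (simp_all add: is_part_pcomp r)

text \<open>Both inequalities are monotonicity of the rank, the second one because \<open>r\<close>
  is itself a composite with \<open>involution r \<bullet>\<^sub>p r\<close>.\<close>

lemma through_blocks_involution_pcomp:
  assumes "is_part r" "finite (\<Union>r)"
  shows "through_blocks (involution r \<bullet>\<^sub>p r) = through_blocks r"
proof (rule antisym)
  show "through_blocks (involution r \<bullet>\<^sub>p r) \<le> through_blocks r"
    by (rule through_blocks_pcomp_le) fact+
  have "through_blocks (r \<bullet>\<^sub>p (involution r \<bullet>\<^sub>p r)) \<le> through_blocks (involution r \<bullet>\<^sub>p r)"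
    using assms by (intro through_blocks_pcomp_le) (simp_all add: is_part_pcomp finite_pcomp Union_involution)
  then show "through_blocks r \<le> through_blocks (involution r \<bullet>\<^sub>p r)"
    by (simp add: pcomp_involution_pcomp assms)
qed

text \<open>Pigeonhole: every through-block uses up one of only \<open>T\<close> lower points, and
  there are at least \<open>T\<close> through-blocks.\<close>

lemma lower_points_separated:
  assumes p: "p \<in> parts k T" and le: "T \<le> through_blocks p"
  shows "i \<in> {1..T} \<Longrightarrow> \<exists>a. (Inl a, Inr i) \<in> block_rel p"
    and "(Inr i, Inr j) \<in> block_rel p \<Longrightarrow> i = j"
proof -
  have ip: "is_part p" and U: "\<Union>p = {1..k} <+> {1..T}" using p by (auto simp: parts_iff)
  let ?g = "\<lambda>i. block_rel p `` {Inr i}"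
  have sub: "through_set p \<subseteq> ?g ` {1..T}"
  proof
    fix B assume B: "B \<in> through_set p"
    then obtain i where i: "Inr i \<in> B" "B \<in> p" by (auto simp: through_set_def)
    then have "Inr i \<in> \<Union>p" by blast
    then have "i \<in> {1..T}" unfolding U by auto
    then show "B \<in> ?g ` {1..T}" using block_eqI[OF ip i(2,1)] by blast
  qed
  have c1: "card (?g ` {1..T}) \<le> T" using card_image_le[of "{1..T}" ?g] by simp
  have c2: "card (through_set p) \<le> card (?g ` {1..T})" by (rule card_mono[OF _ sub]) simp
  have eq: "through_set p = ?g ` {1..T}"
    using c1 c2 le sub unfolding through_blocks_eq by (intro card_subset_eq) auto
  have "card (?g ` {1..T}) = card {1..T}" using c1 c2 le unfolding through_blocks_eq by simp
  then have inj: "inj_on ?g {1..T}" by (rule eq_card_imp_inj_on[rotated]) simp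
  show "\<exists>a. (Inl a, Inr i) \<in> block_rel p" if "i \<in> {1..T}"
  proof -
    have "?g i \<in> through_set p" using that eq by blast
    then obtain a where "Inl a \<in> ?g i" by (auto simp: through_set_def)
    then show ?thesis using block_rel_sym by (metis Image_singleton_iff)
  qed
  show "i = j" if ij: "(Inr i, Inr j) \<in> block_rel p"
  proof (rule inj_onD[OF inj])
    show "i \<in> {1..T}" "j \<in> {1..T}" using block_rel_Union[OF ij] unfolding U by auto
    show "?g i = ?g j"
      using block_rel_trans[OF ip] ij block_rel_sym[OF ij] by blast
  qed
qed

subsection \<open>Permutation partitions\<close>

lemma perm_part_eq_image: "perm_part T \<sigma> = (\<lambda>i. {Inl i, Inr (\<sigma> i)}) ` {1..T}"
  by (auto simp: perm_part_def)

lemma block_rel_perm_part: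
  "(Inl a, Inl b) \<in> block_rel (perm_part T \<sigma>) \<longleftrightarrow> a = b \<and> a \<in> {1..T}"
  "(Inl a, Inr b) \<in> block_rel (perm_part T \<sigma>) \<longleftrightarrow> b = \<sigma> a \<and> a \<in> {1..T}"
  by (auto simp: block_rel_def perm_part_def)

lemma block_rel_perm_part_lower:
  "\<sigma> permutes {1..T} \<Longrightarrow> (Inr a, Inr b) \<in> block_rel (perm_part T \<sigma>) \<longleftrightarrow> a = b \<and> a \<in> {1..T}"
proof -
  assume "\<sigma> permutes {1..T}"
  then have "a \<in> {1..T} \<longleftrightarrow> (\<exists>i\<in>{1..T}. a = \<sigma> i)" by (metis image_iff permutes_image)
  moreover have "(Inr a, Inr b) \<in> block_rel (perm_part T \<sigma>) \<longleftrightarrow> (\<exists>i\<in>{1..T}. a = \<sigma> i \<and> b = \<sigma> i)"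
    by (auto simp: block_rel_def perm_part_eq_image)
  ultimately show ?thesis by blast
qed

lemma perm_part_parts:
  assumes "\<sigma> permutes {1..T}"
  shows "perm_part T \<sigma> \<in> parts T T"
  unfolding parts_iff
proof
  show "is_part (perm_part T \<sigma>)"
    unfolding is_part_def disjoint_def perm_part_eq_image
    using permutes_inj[OF assms] by (auto dest: injD)
  have "x \<in> \<Union>(perm_part T \<sigma>) \<longleftrightarrow> x \<in> {1..T} <+> {1..T}" for x
  proof (cases x)
    case (Inl a)
    then show ?thesis
      by (simp only: Inl Union_iff_block_rel block_rel_perm_part Plus_mem_iff simp_thms)
  next
    case (Inr b)
    then show ?thesis
      by (simp only: Inr Union_iff_block_rel block_rel_perm_part_lower[OF assms] Plus_mem_iff simp_thms)
  qed
  then show "\<Union>(perm_part T \<sigma>) = {1..T} <+> {1..T}" by (rule Set.set_eqI)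
qed

lemma perm_part_inject:
  assumes "\<sigma> permutes {1..T}" "\<tau> permutes {1..T}" "perm_part T \<sigma> = perm_part T \<tau>"
  shows "\<sigma> = \<tau>"
proof
  fix a show "\<sigma> a = \<tau> a"
  proof (cases "a \<in> {1..T}")
    case True
    then show ?thesis using block_rel_perm_part(2)[of a "\<sigma> a" T] assms(3) by metis
  next
    case False
    then show ?thesis using assms by (simp add: permutes_not_in)
  qed
qed

lemma pcomp_perm_part:
  assumes s: "\<sigma> permutes {1..T}" and t: "\<tau> permutes {1..T}"
  shows "perm_part T \<sigma> \<bullet>\<^sub>p perm_part T \<tau> = perm_part T (\<sigma> \<circ> \<tau>)"
proof (rule block_rel_eqI)
  have st: "(\<sigma> \<circ> \<tau>) permutes {1..T}" by (rule permutes_compose[OF t s])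
  note P = perm_part_parts[OF s] perm_part_parts[OF t] perm_part_parts[OF st]
  show "is_part (perm_part T (\<sigma> \<circ> \<tau>))" using P(3) by (simp add: parts_iff)
  \<comment> \<open>The labelling sends each point to the upper end of its strand: a middle point
    back along \<tau>, a lower point back along \<sigma> and then \<tau>.\<close>
  have lab: "case_sum id (inv_into UNIV \<tau> \<circ> inv_into UNIV \<sigma>) x = case_sum id (inv_into UNIV \<tau> \<circ> inv_into UNIV \<sigma>) y"
    if "(x, y) \<in> block_rel (perm_part T \<sigma> \<bullet>\<^sub>p perm_part T \<tau>)" for x y
  proof (rule pcomp_label_eq[OF that, of id "inv_into UNIV \<tau>" "inv_into UNIV \<tau> \<circ> inv_into UNIV \<sigma>"])
    fix u v
    show "(u, v) \<in> block_rel (perm_part T \<tau>) \<Longrightarrow> case_sum id (inv_into UNIV \<tau>) u = case_sum id (inv_into UNIV \<tau>) v"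
      by (auto simp: block_rel_def perm_part_def permutes_inverses[OF t])
    show "(u, v) \<in> block_rel (perm_part T \<sigma>)
        \<Longrightarrow> case_sum (inv_into UNIV \<tau>) (inv_into UNIV \<tau> \<circ> inv_into UNIV \<sigma>) u = case_sum (inv_into UNIV \<tau>) (inv_into UNIV \<tau> \<circ> inv_into UNIV \<sigma>) v"
      by (auto simp: block_rel_def perm_part_def permutes_inverses[OF s])
  qed
  have U: "\<Union>(perm_part T \<sigma> \<bullet>\<^sub>p perm_part T \<tau>) = {1..T} <+> {1..T}"
    using pcomp_parts[OF P(2,1)] by (simp add: parts_iff)
  fix a b
  show "(Inl a, Inl b) \<in> block_rel (perm_part T \<sigma> \<bullet>\<^sub>p perm_part T \<tau>)
      \<longleftrightarrow> (Inl a, Inl b) \<in> block_rel (perm_part T (\<sigma> \<circ> \<tau>))"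
    using lab[of "Inl a" "Inl b"] block_rel_Union[of "Inl a" "Inl b" "perm_part T \<sigma> \<bullet>\<^sub>p perm_part T \<tau>"]
      block_rel_refl[of "Inl a" "perm_part T \<sigma> \<bullet>\<^sub>p perm_part T \<tau>"]
    unfolding U block_rel_perm_part by auto
  show "(Inr a, Inr b) \<in> block_rel (perm_part T \<sigma> \<bullet>\<^sub>p perm_part T \<tau>)
      \<longleftrightarrow> (Inr a, Inr b) \<in> block_rel (perm_part T (\<sigma> \<circ> \<tau>))"
  proof -
    have "inv_into UNIV \<tau> (inv_into UNIV \<sigma> a) = inv_into UNIV \<tau> (inv_into UNIV \<sigma> b) \<Longrightarrow> a = b"
      using permutes_inverses[OF s] permutes_inverses[OF t] by metis
    then show ?thesis
      using lab[of "Inr a" "Inr b"] block_rel_Union[of "Inr a" "Inr b" "perm_part T \<sigma> \<bullet>\<^sub>p perm_part T \<tau>"]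
        block_rel_refl[of "Inr a" "perm_part T \<sigma> \<bullet>\<^sub>p perm_part T \<tau>"]
      unfolding U block_rel_perm_part_lower[OF st] by auto
  qed
  show "(Inl a, Inr b) \<in> block_rel (perm_part T \<sigma> \<bullet>\<^sub>p perm_part T \<tau>)
      \<longleftrightarrow> (Inl a, Inr b) \<in> block_rel (perm_part T (\<sigma> \<circ> \<tau>))"
  proof
    assume l: "(Inl a, Inr b) \<in> block_rel (perm_part T \<sigma> \<bullet>\<^sub>p perm_part T \<tau>)"
    from lab[OF l] have "b = \<sigma> (\<tau> a)"
      using permutes_inverses[OF s] permutes_inverses[OF t] by (metis comp_apply id_apply old.sum.simps(5,6))
    with block_rel_Union[OF l] show "(Inl a, Inr b) \<in> block_rel (perm_part T (\<sigma> \<circ> \<tau>))"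
      unfolding U block_rel_perm_part by auto
  next
    assume "(Inl a, Inr b) \<in> block_rel (perm_part T (\<sigma> \<circ> \<tau>))"
    then have "b = \<sigma> (\<tau> a)" "a \<in> {1..T}" "\<tau> a \<in> {1..T}"
      using permutes_in_image[OF t] by (auto simp: block_rel_perm_part)
    then show "(Inl a, Inr b) \<in> block_rel (perm_part T \<sigma> \<bullet>\<^sub>p perm_part T \<tau>)"
      by (intro pcomp_through[of a "\<tau> a"]) (auto simp: block_rel_perm_part)
  qed
qed (simp add: is_part_pcomp)

text \<open>The pigeonhole lemma, applied to \<open>s\<close> and to its involution, leaves exactly
  one upper and one lower point in every block.\<close>

lemma perm_partE:
  assumes s: "s \<in> parts T T" and le: "T \<le> through_blocks s"
  obtains \<sigma> where "\<sigma> permutes {1..T}" "s = perm_part T \<sigma>"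
proof -
  have ip: "is_part s" and U: "\<Union>s = {1..T} <+> {1..T}" using s by (auto simp: parts_iff)
  note low = lower_points_separated[OF s le]
  have le': "T \<le> through_blocks (involution s)" using le by (simp add: through_blocks_involution)
  have up1: "\<exists>b. (Inl i, Inr b) \<in> block_rel s" if "i \<in> {1..T}" for i
    using lower_points_separated(1)[OF involution_parts[OF s] le' that]
    by (auto simp: block_rel_involution intro: block_rel_sym)
  have up2: "i = j" if "(Inl i, Inl j) \<in> block_rel s" for i j
    using lower_points_separated(2)[OF involution_parts[OF s] le', of i j] that
    by (simp add: block_rel_involution)
  \<comment> \<open>The identity off \<open>{1..T}\<close>, as \<open>permutes\<close>
    demands.\<close>
  define \<sigma> where "\<sigma> = (\<lambda>i. if i \<in> {1..T} then SOME b. (Inl i, Inr b) \<in> block_rel s else i)"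
  have sig: "(Inl i, Inr (\<sigma> i)) \<in> block_rel s" if "i \<in> {1..T}" for i
    using someI_ex[OF up1[OF that]] that by (simp add: \<sigma>_def)
  have "inj_on \<sigma> {1..T}"
  proof (rule inj_onI)
    fix i j assume "i \<in> {1..T}" "j \<in> {1..T}" "\<sigma> i = \<sigma> j"
    then have "(Inl i, Inl j) \<in> block_rel s"
      using sig[of i] sig[of j] block_rel_trans[OF ip] block_rel_sym by metis
    then show "i = j" by (rule up2)
  qed
  moreover have "\<sigma> ` {1..T} \<subseteq> {1..T}"
    using sig block_rel_Union[of _ _ s] unfolding U by fastforce
  ultimately have "bij_betw \<sigma> {1..T} {1..T}"
    by (simp add: bij_betw_def endo_inj_surj)
  then have perm: "\<sigma> permutes {1..T}"
    by (rule bij_imp_permutes) (auto simp: \<sigma>_def)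
  have "s = perm_part T \<sigma>"
  proof (rule block_rel_eqI[OF ip])
    show "is_part (perm_part T \<sigma>)" using perm_part_parts[OF perm] by (simp add: parts_iff)
    fix a b
    show "(Inl a, Inl b) \<in> block_rel s \<longleftrightarrow> (Inl a, Inl b) \<in> block_rel (perm_part T \<sigma>)"
      unfolding block_rel_perm_part
      using up2[of a b] block_rel_Union[of "Inl a" "Inl b" s] block_rel_refl[of "Inl a" s] unfolding U by auto
    show "(Inr a, Inr b) \<in> block_rel s \<longleftrightarrow> (Inr a, Inr b) \<in> block_rel (perm_part T \<sigma>)"
      unfolding block_rel_perm_part_lower[OF perm]
      using low(2)[of a b] block_rel_Union[of "Inr a" "Inr b" s] block_rel_refl[of "Inr a" s] unfolding U by auto
    show "(Inl a, Inr b) \<in> block_rel s \<longleftrightarrow> (Inl a, Inr b) \<in> block_rel (perm_part T \<sigma>)"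
      unfolding block_rel_perm_part
    proof
      assume ab: "(Inl a, Inr b) \<in> block_rel s"
      then have a: "a \<in> {1..T}" using block_rel_Union[OF ab] unfolding U by auto
      have "(Inr b, Inr (\<sigma> a)) \<in> block_rel s"
        using block_rel_trans[OF ip] block_rel_sym[OF ab] sig[OF a] by metis
      then show "b = \<sigma> a \<and> a \<in> {1..T}" using low(2) a by simp
    qed (use sig in auto)
  qed
  with perm show thesis by (rule that)
qed

lemma perm_part_id_pcomp:
  assumes p: "p \<in> parts k l"
  shows "perm_part l id \<bullet>\<^sub>p p = p"
proof (rule block_rel_eqI)
  show ip: "is_part p" using p by (simp add: parts_iff)
  have U: "\<Union>p = {1..k} <+> {1..l}" using p by (simp add: parts_iff)
  have [simp]: "case_sum Inl Inr w = w" for w :: "nat + nat" by (cases w) auto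
  have lab: "(x, y) \<in> block_rel p" if "(x, y) \<in> block_rel (perm_part l id \<bullet>\<^sub>p p)" for x y
  proof -
    have "(case_sum Inl Inr x, case_sum Inl Inr y) \<in> block_rel p"
    proof (rule pcomp_label[OF that trans_block_rel[OF ip], of Inl Inr Inr])
      fix u v :: "nat + nat"
      show "(u, v) \<in> block_rel p \<Longrightarrow> (case_sum Inl Inr u, case_sum Inl Inr v) \<in> block_rel p"
        by simp
      assume "(u, v) \<in> block_rel (perm_part l id)"
      then obtain i where "i \<in> {1..l}" "u \<in> {Inl i, Inr i}" "v \<in> {Inl i, Inr i}"
        by (auto simp: block_rel_def perm_part_def)
      moreover from this have "(Inr i, Inr i) \<in> block_rel p"
        by (intro block_rel_refl) (simp add: U)
      ultimately show "(case_sum Inr Inr u, case_sum Inr Inr v) \<in> block_rel p" by auto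
    qed
    then show ?thesis by simp
  qed
  have id: "(Inl i, Inr i) \<in> block_rel (perm_part l id)" if "Inr i \<in> \<Union>p" for i
    using that unfolding U by (auto simp: block_rel_perm_part)
  fix a b
  show "(Inl a, Inl b) \<in> block_rel (perm_part l id \<bullet>\<^sub>p p) \<longleftrightarrow> (Inl a, Inl b) \<in> block_rel p"
    using lab pcomp_upper by blast
  show "(Inl a, Inr b) \<in> block_rel (perm_part l id \<bullet>\<^sub>p p) \<longleftrightarrow> (Inl a, Inr b) \<in> block_rel p"
    using lab pcomp_through id block_rel_Union by metis
  show "(Inr a, Inr b) \<in> block_rel (perm_part l id \<bullet>\<^sub>p p) \<longleftrightarrow> (Inr a, Inr b) \<in> block_rel p"
    using lab pcomp_mid id block_rel_Union by metis
qed (simp add: is_part_pcomp)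

lemma involution_perm_part_id: "involution (perm_part l id) = perm_part l id"
proof -
  show ?thesis by (simp add: involution_eq perm_part_eq_image image_image insert_commute)
qed

lemma pcomp_perm_part_id:
  assumes p: "p \<in> parts k l"
  shows "p \<bullet>\<^sub>p perm_part k id = p"
proof -
  have "involution (p \<bullet>\<^sub>p perm_part k id) = involution p"
    by (simp add: involution_pcomp involution_perm_part_id perm_part_id_pcomp[OF involution_parts[OF p]])
  then show ?thesis by (metis involution_involution)
qed

subsection \<open>Loops\<close>

lemma ploops_involution: "ploops q p = ploops (involution p) (involution q)"
proof -
  have d: "distinct [0, 1, 2::nat]" "distinct [2, 1, 0::nat]" by simp_all
  show ?thesis
    unfolding ploops_eq[OF d(1), where p = p and q = q]
      ploops_eq[OF d(2), where p = "involution q" and q = "involution p"] level_rel_involution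
    by (simp only: Un_commute)
qed

text \<open>A closed component would contain a middle point; every middle point is an upper point of
  \<open>q\<close>, and those are all tied to the bottom level.\<close>

lemma ploops_eq_0:
  assumes q: "\<And>m. Inl m \<in> \<Union>q \<Longrightarrow> \<exists>c. (Inl m, Inr c) \<in> block_rel q"
    and p: "\<And>m. Inr m \<in> \<Union>p \<Longrightarrow> Inl m \<in> \<Union>q"
  shows "ploops q p = 0"
proof -
  let ?E = "(level_rel 0 1 p \<union> level_rel 1 2 q)\<^sup>+"
  have d: "distinct [0, 1, 2::nat]" by simp
  have False if K: "K \<in> Domain ?E // ?E" "K \<subseteq> {1} \<times> UNIV" for K
  proof -
    have symE: "sym ?E" by (intro sym_trancl sym_Un sym_level_rel)
    from K obtain x where x: "x \<in> Domain ?E" "K = ?E `` {x}" by (auto elim!: quotientE)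
    then have "x \<in> K" using symE by (blast dest: symD intro: trancl_trans)
    with K(2) obtain m where m: "x = (1, m)" by auto
    have "x \<in> at_levels 0 1 ` \<Union>p \<union> at_levels 1 2 ` \<Union>q"
      using x(1) by (simp only: trancl_domain Domain_Un_eq Domain_level_rel)
    then obtain z where "(z \<in> \<Union>p \<and> at_levels 0 1 z = (1, m)) \<or> (z \<in> \<Union>q \<and> at_levels 1 2 z = (1, m))"
      unfolding m by (metis Un_iff imageE)
    then have "Inr m \<in> \<Union>p \<or> Inl m \<in> \<Union>q" by (cases z) auto
    with p q obtain c where "(Inl m, Inr c) \<in> block_rel q" by metis
    then have "(at_levels 1 2 (Inl m), at_levels 1 2 (Inr c)) \<in> level_rel 1 2 q"
      unfolding level_rel_def by force
    then have "((1, m), (2, c)) \<in> ?E" by auto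
    then have "(2, c) \<in> K" using x(2) m by simp
    with K(2) show False by auto
  qed
  then have "{K \<in> Domain ?E // ?E. K \<subseteq> {1} \<times> UNIV} = {}" by (simp only: empty_iff Collect_empty_eq) blast
  then show ?thesis unfolding ploops_eq[OF d, where p = p and q = q] by (simp only: card.empty)
qed

lemma ploops_perm_part:
  assumes "\<sigma> permutes {1..l}" "p \<in> parts k l"
  shows "ploops (perm_part l \<sigma>) p = 0"
proof (rule ploops_eq_0)
  have U: "\<Union>(perm_part l \<sigma>) = {1..l} <+> {1..l}" "\<Union>p = {1..k} <+> {1..l}"
    using perm_part_parts[OF assms(1)] assms(2) by (simp_all add: parts_iff)
  show "\<exists>c. (Inl m, Inr c) \<in> block_rel (perm_part l \<sigma>)" if "Inl m \<in> \<Union>(perm_part l \<sigma>)" for m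
    using that unfolding U by (simp add: block_rel_perm_part)
  show "Inl m \<in> \<Union>(perm_part l \<sigma>)" if "Inr m \<in> \<Union>p" for m
    using that unfolding U by simp
qed

lemma ploops_id_left: "p \<in> parts k l \<Longrightarrow> ploops (perm_part l id) p = 0"
  by (rule ploops_perm_part[OF permutes_id])

lemma ploops_id_right: "p \<in> parts k l \<Longrightarrow> ploops p (perm_part k id) = 0"
  unfolding ploops_involution[of p] involution_perm_part_id
  by (rule ploops_id_left[OF involution_parts])

subsection \<open>Projective partitions\<close>

text \<open>The lower half of \<open>r\<close> is replaced by one point per through-block. The
  product with the involution sees only the upper half and which blocks are through-blocks, so it
  does not change.\<close>

lemma proj_by_exists:
  assumes r: "r \<in> parts k l"
  shows "\<exists>r\<^sub>0. proj_by k (involution r \<bullet>\<^sub>p r) r\<^sub>0"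
proof -
  let ?T = "through_blocks r"
  have ir: "is_part r" and U: "\<Union>r = {1..k} <+> {1..l}" using r by (auto simp: parts_iff)
  have fin: "finite (\<Union>r)" using r by (rule finite_parts)
  obtain f where f: "bij_betw f {1..?T} (through_set r)"
    using ex_bij_betw_nat_finite_1[OF finite_through_set[OF fin]] unfolding through_blocks_eq by blast
  \<comment> \<open>A block keeps its upper points and receives its number under \<open>f\<close>,
    if it has one, as its only lower point. Blocks without upper points are dropped in
    \<open>r\<^sub>0\<close>.\<close>
  define g where "g B = (B \<inter> range Inl) \<union> Inr ` {i \<in> {1..?T}. f i = B}" for B
  define r\<^sub>0 where "r\<^sub>0 = g ` {B \<in> r. B \<inter> range Inl \<noteq> {}}"
  have fr: "f i \<in> r" "f i \<inter> range Inl \<noteq> {}" if "i \<in> {1..?T}" for i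
    using bij_betwE[OF f] that by (auto simp: through_set_def)
  have g_inter: "B = B'" if "x \<in> g B" "x \<in> g B'" "B \<in> r" "B' \<in> r" for x B B'
    using that ir unfolding g_def is_part_def disjoint_def by auto
  have "is_part r\<^sub>0"
    unfolding is_part_def disjoint_def
  proof (intro conjI ballI impI)
    fix D D' assume D: "D \<in> r\<^sub>0" "D' \<in> r\<^sub>0" "D \<noteq> D'"
    then obtain B B' where "D = g B" "D' = g B'" "B \<in> r" "B' \<in> r" by (auto simp: r\<^sub>0_def)
    with D(3) g_inter show "D \<inter> D' = {}" by blast
  qed (auto simp: r\<^sub>0_def g_def)
  have up: "(Inl a, Inl b) \<in> block_rel r\<^sub>0 \<longleftrightarrow> (Inl a, Inl b) \<in> block_rel r" for a b
    unfolding block_rel_def r\<^sub>0_def g_def by auto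
  have thr: "(Inl a, Inr i) \<in> block_rel r\<^sub>0 \<longleftrightarrow> i \<in> {1..?T} \<and> Inl a \<in> f i" for a i
    using fr[of i] unfolding block_rel_def r\<^sub>0_def g_def by auto
  have "r\<^sub>0 \<in> parts k ?T"
    unfolding parts_iff
  proof
    show "\<Union>r\<^sub>0 = {1..k} <+> {1..?T}"
    proof (rule Set.set_eqI)
      fix x show "x \<in> \<Union>r\<^sub>0 \<longleftrightarrow> x \<in> {1..k} <+> {1..?T}"
      proof (cases x)
        case (Inl a)
        have "Inl a \<in> \<Union>r \<longleftrightarrow> a \<in> {1..k}" unfolding U by simp
        then show ?thesis by (simp only: Inl Union_iff_block_rel up Plus_mem_iff)
      next
        case (Inr i)
        have "Inr i \<in> \<Union>r\<^sub>0 \<longleftrightarrow> i \<in> {1..?T}"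
          using fr[of i] unfolding r\<^sub>0_def g_def by auto
        then show ?thesis by (simp only: Inr Plus_mem_iff)
      qed
    qed
  qed fact
  moreover have "through_blocks (involution r \<bullet>\<^sub>p r) = ?T"
    by (rule through_blocks_involution_pcomp[OF ir fin])
  moreover have "involution r \<bullet>\<^sub>p r = involution r\<^sub>0 \<bullet>\<^sub>p r\<^sub>0"
  proof -
    have thr': "(\<exists>m. (Inl a, Inr m) \<in> block_rel r) \<longleftrightarrow> (\<exists>i. (Inl a, Inr i) \<in> block_rel r\<^sub>0)" for a
    proof
      assume "\<exists>m. (Inl a, Inr m) \<in> block_rel r"
      then obtain m B where B: "B \<in> r" "Inl a \<in> B" "Inr m \<in> B" by (auto simp: block_rel_def)
      then have "B \<in> through_set r" unfolding through_set_def by blast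
      then have "B \<in> f ` {1..?T}" by (simp only: bij_betw_imp_surj_on[OF f])
      then obtain i where "i \<in> {1..?T}" "f i = B" by blast
      with B show "\<exists>i. (Inl a, Inr i) \<in> block_rel r\<^sub>0" unfolding thr by blast
    next
      assume "\<exists>i. (Inl a, Inr i) \<in> block_rel r\<^sub>0"
      then obtain i where i: "i \<in> {1..?T}" "Inl a \<in> f i" unfolding thr by blast
      then have "f i \<in> through_set r" using bij_betwE[OF f] by blast
      then show "\<exists>m. (Inl a, Inr m) \<in> block_rel r"
        using i unfolding through_set_def block_rel_def by blast
    qed
    show ?thesis
      by (rule block_rel_eqI)
        (simp_all add: is_part_pcomp block_rel_involution_pcomp ir \<open>is_part r\<^sub>0\<close> up thr')
  qed
  ultimately show ?thesis unfolding proj_by_def by auto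
qed

locale projective =
  fixes k :: nat and p p\<^sub>0 :: two_part
  assumes proj_by: "proj_by k p p\<^sub>0"
begin

abbreviation "T \<equiv> through_blocks p"
abbreviation "pp \<equiv> p_perm p p\<^sub>0"

lemma p\<^sub>0_parts: "p\<^sub>0 \<in> parts k T" and p_eq: "p = involution p\<^sub>0 \<bullet>\<^sub>p p\<^sub>0"
  using proj_by unfolding proj_by_def by auto

lemma is_part_p\<^sub>0: "is_part p\<^sub>0"
  using p\<^sub>0_parts by (rule is_part_parts)

lemma p_parts: "p \<in> parts k k"
  by (subst p_eq) (rule pcomp_parts[OF p\<^sub>0_parts involution_parts[OF p\<^sub>0_parts]])

lemma T_le: "T \<le> through_blocks p\<^sub>0"
proof -
  have "T = through_blocks (involution p\<^sub>0 \<bullet>\<^sub>p p\<^sub>0)" by (subst (1) p_eq) (rule refl)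
  also have "\<dots> \<le> through_blocks p\<^sub>0"
    by (rule through_blocks_pcomp_le[OF is_part_p\<^sub>0 finite_parts[OF p\<^sub>0_parts]])
  finally show ?thesis .
qed

lemma p\<^sub>0_lower: "i \<in> {1..T} \<Longrightarrow> \<exists>a. (Inl a, Inr i) \<in> block_rel p\<^sub>0"
  "(Inr i, Inr j) \<in> block_rel p\<^sub>0 \<Longrightarrow> i = j"
  using lower_points_separated[OF p\<^sub>0_parts T_le] by blast+

text \<open>Each lower point of \<open>p\<^sub>0\<close> lies in a through-block of its own. Hence
  \<open>p\<close> splits over \<open>T\<close> points, and what \<open>p\<close> absorbs on both
  sides can be compressed to \<open>T\<close> upper and \<open>T\<close> lower points.\<close>

lemma p\<^sub>0_involution: "p\<^sub>0 \<bullet>\<^sub>p involution p\<^sub>0 = perm_part T id"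
proof -
  have "involution (involution p\<^sub>0) \<bullet>\<^sub>p involution p\<^sub>0 = perm_part T id"
  proof (rule block_rel_eqI)
    have U: "\<Union>p\<^sub>0 = {1..k} <+> {1..T}" using p\<^sub>0_parts by (simp add: parts_iff)
    have low: "(Inr a, Inr b) \<in> block_rel p\<^sub>0 \<longleftrightarrow> a = b \<and> a \<in> {1..T}" for a b
    proof
      assume ab: "(Inr a, Inr b) \<in> block_rel p\<^sub>0"
      have "a \<in> {1..T}" using block_rel_Union[OF ab] unfolding U Plus_mem_iff by simp
      with p\<^sub>0_lower(2)[OF ab] show "a = b \<and> a \<in> {1..T}" by simp
    next
      assume "a = b \<and> a \<in> {1..T}"
      moreover from this have "Inr a \<in> \<Union>p\<^sub>0" unfolding U Plus_mem_iff by simp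
      ultimately show "(Inr a, Inr b) \<in> block_rel p\<^sub>0" by (simp only: Union_iff_block_rel)
    qed
    have thr: "\<exists>m. (Inr a, Inl m) \<in> block_rel p\<^sub>0" if "a \<in> {1..T}" for a
      using p\<^sub>0_lower(1)[OF that] by (blast intro: block_rel_sym)
    note i = is_part_involution[OF is_part_p\<^sub>0]
    fix a b
    show "(Inl a, Inl b) \<in> block_rel (involution (involution p\<^sub>0) \<bullet>\<^sub>p involution p\<^sub>0)
        \<longleftrightarrow> (Inl a, Inl b) \<in> block_rel (perm_part T id)"
      unfolding block_rel_involution_pcomp[OF i] block_rel_involution flip_simps low block_rel_perm_part by simp
    show "(Inr a, Inr b) \<in> block_rel (involution (involution p\<^sub>0) \<bullet>\<^sub>p involution p\<^sub>0)
        \<longleftrightarrow> (Inr a, Inr b) \<in> block_rel (perm_part T id)"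
      unfolding block_rel_involution_pcomp[OF i] block_rel_involution flip_simps low
        block_rel_perm_part_lower[OF permutes_id] ..
    show "(Inl a, Inr b) \<in> block_rel (involution (involution p\<^sub>0) \<bullet>\<^sub>p involution p\<^sub>0)
        \<longleftrightarrow> (Inl a, Inr b) \<in> block_rel (perm_part T id)"
      unfolding block_rel_involution_pcomp[OF i] block_rel_involution flip_simps low block_rel_perm_part
      using thr[of a] by auto
  qed (simp_all add: is_part_pcomp is_part_parts[OF perm_part_parts[OF permutes_id]])
  then show ?thesis by simp
qed

lemma pp_eq: "pp \<sigma> = involution p\<^sub>0 \<bullet>\<^sub>p (perm_part T \<sigma> \<bullet>\<^sub>p p\<^sub>0)"
  by (simp add: p_perm_def pcomp_assoc)

lemma pp_id: "pp id = p"
  unfolding pp_eq by (subst perm_part_id_pcomp[OF p\<^sub>0_parts]) (rule p_eq[symmetric])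

lemma perm_p\<^sub>0_parts: "\<sigma> permutes {1..T} \<Longrightarrow> perm_part T \<sigma> \<bullet>\<^sub>p p\<^sub>0 \<in> parts k T"
  by (rule pcomp_parts[OF p\<^sub>0_parts perm_part_parts])

lemma pp_parts: "\<sigma> permutes {1..T} \<Longrightarrow> pp \<sigma> \<in> parts k k"
  unfolding pp_eq by (rule pcomp_parts[OF perm_p\<^sub>0_parts involution_parts[OF p\<^sub>0_parts]])

lemma p\<^sub>0_cancel: "x \<in> parts m T \<Longrightarrow> p\<^sub>0 \<bullet>\<^sub>p (involution p\<^sub>0 \<bullet>\<^sub>p x) = x"
  using p\<^sub>0_involution perm_part_id_pcomp by (simp flip: pcomp_assoc)

lemma pp_comp:
  assumes "\<sigma> permutes {1..T}" "\<tau> permutes {1..T}"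
  shows "pp \<sigma> \<bullet>\<^sub>p pp \<tau> = pp (\<sigma> \<circ> \<tau>)"
proof -
  have "pp \<sigma> \<bullet>\<^sub>p pp \<tau> = involution p\<^sub>0 \<bullet>\<^sub>p (perm_part T \<sigma> \<bullet>\<^sub>p (p\<^sub>0 \<bullet>\<^sub>p (involution p\<^sub>0 \<bullet>\<^sub>p (perm_part T \<tau> \<bullet>\<^sub>p p\<^sub>0))))"
    unfolding pp_eq by (simp add: pcomp_assoc)
  also have "\<dots> = pp (\<sigma> \<circ> \<tau>)"
    unfolding p\<^sub>0_cancel[OF perm_p\<^sub>0_parts[OF assms(2)]] pp_eq pcomp_perm_part[OF assms, symmetric] pcomp_assoc ..
  finally show ?thesis .
qed

lemma pp_inject:
  assumes "\<sigma> permutes {1..T}" "\<tau> permutes {1..T}" "pp \<sigma> = pp \<tau>"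
  shows "\<sigma> = \<tau>"
proof (rule perm_part_inject[OF assms(1,2)])
  have "perm_part T \<rho> = p\<^sub>0 \<bullet>\<^sub>p (pp \<rho> \<bullet>\<^sub>p involution p\<^sub>0)" if "\<rho> permutes {1..T}" for \<rho>
  proof -
    have "p\<^sub>0 \<bullet>\<^sub>p (pp \<rho> \<bullet>\<^sub>p involution p\<^sub>0) = p\<^sub>0 \<bullet>\<^sub>p (involution p\<^sub>0 \<bullet>\<^sub>p (perm_part T \<rho> \<bullet>\<^sub>p (p\<^sub>0 \<bullet>\<^sub>p involution p\<^sub>0)))"
      unfolding pp_eq by (simp add: pcomp_assoc)
    also have "\<dots> = perm_part T \<rho>"
      unfolding p\<^sub>0_involution pcomp_perm_part_id[OF perm_part_parts[OF that]]
      by (rule p\<^sub>0_cancel[OF perm_part_parts[OF that]])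
    finally show ?thesis ..
  qed
  with assms show "perm_part T \<sigma> = perm_part T \<tau>" by metis
qed

lemma p_idem: "p \<bullet>\<^sub>p p = p"
  using pp_comp[OF permutes_id permutes_id] by (simp add: pp_id)

lemma involution_p: "involution p = p"
  by (subst p_eq, subst involution_pcomp) (simp flip: p_eq)

lemma p_absorb_pp: "\<sigma> permutes {1..T} \<Longrightarrow> p \<bullet>\<^sub>p pp \<sigma> = pp \<sigma>" "\<sigma> permutes {1..T} \<Longrightarrow> pp \<sigma> \<bullet>\<^sub>p p = pp \<sigma>"
  using pp_comp[of id \<sigma>] pp_comp[of \<sigma> id] by (simp_all add: pp_id permutes_id)

text \<open>Multiplying by the partition of the inverse permutation gives back \<open>p\<close>, so
  no through-block can have been lost.\<close>

lemma pp_through: "\<sigma> permutes {1..T} \<Longrightarrow> through_blocks (pp \<sigma>) = T"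
proof -
  have le: "through_blocks (pp \<sigma>) \<le> T" "pp \<sigma> \<in> parts k k" if s: "\<sigma> permutes {1..T}" for \<sigma>
  proof -
    have "through_blocks (p \<bullet>\<^sub>p pp \<sigma>) \<le> T"
      by (rule through_blocks_pcomp_le'[OF is_part_parts[OF p_parts] finite_parts[OF p_parts]])
    then show "through_blocks (pp \<sigma>) \<le> T" by (simp only: p_absorb_pp(1)[OF s])
  qed (rule pp_parts[OF s])
  assume s: "\<sigma> permutes {1..T}"
  have "pp (inv_into UNIV \<sigma>) \<bullet>\<^sub>p pp \<sigma> = p"
    using pp_comp[OF permutes_inv[OF s] s] permutes_inv_o(2)[OF s] pp_id by simp
  then have "T \<le> through_blocks (pp \<sigma>)"
    using through_blocks_pcomp_le[OF is_part_parts[OF le(2)[OF s]] finite_parts[OF le(2)[OF s]],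
        of "pp (inv_into UNIV \<sigma>)"] by simp
  with le(1)[OF s] show ?thesis by simp
qed

text \<open>Compression by \<open>p\<^sub>0\<close> loses nothing on elements absorbed by
  \<open>p\<close>. The compressed partition still has \<open>T\<close> through-blocks, now on
  \<open>T\<close> upper and \<open>T\<close> lower points, and is a permutation.\<close>

lemma pp_E:
  assumes r: "r \<in> parts k k" "p \<bullet>\<^sub>p r = r" "r \<bullet>\<^sub>p p = r" and le: "T \<le> through_blocks r"
  obtains \<sigma> where "\<sigma> permutes {1..T}" "r = pp \<sigma>"
proof -
  let ?s = "p\<^sub>0 \<bullet>\<^sub>p (r \<bullet>\<^sub>p involution p\<^sub>0)"
  note q = involution_parts[OF p\<^sub>0_parts]
  have 1: "r \<bullet>\<^sub>p involution p\<^sub>0 \<in> parts T k" by (rule pcomp_parts[OF q r(1)])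
  have s: "?s \<in> parts T T" by (rule pcomp_parts[OF 1 p\<^sub>0_parts])
  have "r = p \<bullet>\<^sub>p (r \<bullet>\<^sub>p p)" using r by simp
  also have "\<dots> = involution p\<^sub>0 \<bullet>\<^sub>p (?s \<bullet>\<^sub>p p\<^sub>0)"
    by (subst (1 2) p_eq) (simp add: pcomp_assoc)
  finally have r_eq: "r = involution p\<^sub>0 \<bullet>\<^sub>p (?s \<bullet>\<^sub>p p\<^sub>0)" .
  have sp: "?s \<bullet>\<^sub>p p\<^sub>0 \<in> parts k T" by (rule pcomp_parts[OF p\<^sub>0_parts s])
  have "through_blocks r \<le> through_blocks (?s \<bullet>\<^sub>p p\<^sub>0)"
    using through_blocks_pcomp_le[OF is_part_parts[OF sp] finite_parts[OF sp]] r_eq by metis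
  also have "\<dots> \<le> through_blocks ?s"
    by (rule through_blocks_pcomp_le'[OF is_part_parts[OF s] finite_parts[OF s]])
  finally have "T \<le> through_blocks ?s" using le by simp
  then obtain \<sigma> where \<sigma>: "\<sigma> permutes {1..T}" "?s = perm_part T \<sigma>" by (rule perm_partE[OF s])
  have "r = pp \<sigma>" using r_eq unfolding pp_eq \<sigma>(2) .
  with \<sigma>(1) show thesis by (rule that)
qed

text \<open>At full rank \<open>r\<close> is a permutation partition, and the identity is the only
  idempotent permutation.\<close>

lemma eq_p:
  assumes "r \<in> parts k k" "p \<bullet>\<^sub>p r = r" "r \<bullet>\<^sub>p p = r" "r \<bullet>\<^sub>p r = r" "T \<le> through_blocks r"
  shows "r = p"
proof -
  obtain \<sigma> where s: "\<sigma> permutes {1..T}" "r = pp \<sigma>" by (rule pp_E[OF assms(1-3,5)])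
  then have "pp (\<sigma> \<circ> \<sigma>) = pp \<sigma>" using assms(4) pp_comp[OF s(1) s(1)] by simp
  then have "\<sigma> \<circ> \<sigma> = \<sigma>" using pp_inject s(1) permutes_compose by metis
  then have "\<sigma> = id"
    using permutes_inj[OF s(1)] by (metis comp_apply eq_id_iff injD)
  then show ?thesis using s pp_id by simp
qed

lemma ploops_involution_p\<^sub>0: "x \<in> parts m T \<Longrightarrow> ploops (involution p\<^sub>0) x = 0"
proof (rule ploops_eq_0)
  fix i assume x: "x \<in> parts m T"
  have U: "\<Union>(involution p\<^sub>0) = {1..T} <+> {1..k}"
    using involution_parts[OF p\<^sub>0_parts] by (simp add: parts_iff)
  show "\<exists>c. (Inl i, Inr c) \<in> block_rel (involution p\<^sub>0)" if "Inl i \<in> \<Union>(involution p\<^sub>0)"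
  proof -
    have "i \<in> {1..T}" using that unfolding U Plus_mem_iff .
    then obtain a where "(Inl a, Inr i) \<in> block_rel p\<^sub>0" using p\<^sub>0_lower(1) by blast
    then have "(flip (Inl i), flip (Inr a)) \<in> block_rel p\<^sub>0" using block_rel_sym by simp
    then show ?thesis by (auto simp only: block_rel_involution)
  qed
  have V: "\<Union>x = {1..m} <+> {1..T}" using x by (simp add: parts_iff)
  show "Inl i \<in> \<Union>(involution p\<^sub>0)" if "Inr i \<in> \<Union>x"
    using that unfolding U V Plus_mem_iff .
qed

text \<open>Peeling off the outer involution of \<open>p\<^sub>0\<close> and then the permutations
  creates no loops. What remains are the loops of \<open>p\<^sub>0\<close> against its involution,
  whatever the permutations are, so one normalising factor serves all of
  \<open>S(p)\<close>.\<close>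

lemma ploops_pp:
  assumes s: "\<sigma> permutes {1..T}" and t: "\<tau> permutes {1..T}"
  shows "ploops (pp \<sigma>) (pp \<tau>) = ploops p p"
proof -
  have "ploops (pp \<sigma>) (pp \<tau>) = ploops p\<^sub>0 (involution p\<^sub>0)"
    if s: "\<sigma> permutes {1..T}" and t: "\<tau> permutes {1..T}" for \<sigma> \<tau>
  proof -
    let ?a = "involution p\<^sub>0" let ?A = "perm_part T \<sigma> \<bullet>\<^sub>p p\<^sub>0" let ?B = "perm_part T \<tau> \<bullet>\<^sub>p p\<^sub>0"
    note P = finite_parts[OF p\<^sub>0_parts] finite_parts[OF involution_parts[OF p\<^sub>0_parts]]
      finite_parts[OF perm_p\<^sub>0_parts[OF s]] finite_parts[OF perm_p\<^sub>0_parts[OF t]]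
      finite_parts[OF pp_parts[OF t]] finite_parts[OF perm_part_parts[OF s]]
    have "ploops (pp \<sigma>) (pp \<tau>) = ploops ?A (pp \<tau>)"
      using ploops_cocycle[OF P(5,3,2)]
        ploops_involution_p\<^sub>0[OF pcomp_parts[OF pp_parts[OF t] perm_p\<^sub>0_parts[OF s]]]
        ploops_involution_p\<^sub>0[OF perm_p\<^sub>0_parts[OF s]] by (simp flip: pp_eq)
    also have "\<dots> = ploops p\<^sub>0 (pp \<tau>)"
      using ploops_cocycle[OF P(5,1,6)] ploops_perm_part[OF s p\<^sub>0_parts]
        ploops_perm_part[OF s pcomp_parts[OF pp_parts[OF t] p\<^sub>0_parts]] by simp
    also have "\<dots> = ploops p\<^sub>0 ?a"
      using ploops_cocycle[OF P(4,2,1)] ploops_involution_p\<^sub>0[OF perm_p\<^sub>0_parts[OF t]]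
        ploops_id_left[OF perm_p\<^sub>0_parts[OF t]] by (simp add: p\<^sub>0_involution flip: pp_eq)
    finally show ?thesis .
  qed
  from this[OF s t] this[OF permutes_id permutes_id] show ?thesis by (simp add: pp_id)
qed

text \<open>In the cocycle identity for \<open>p\<close>, \<open>p\<close> and \<open>r\<close> the
  absorption laws make all terms but one equal to \<open>ploops p r\<close>; cancelling leaves
  \<open>ploops p p\<close>. Dividing by a single power of t therefore makes \<open>p\<close> act as
  an identity on everything it absorbs.\<close>

lemma ploops_absorb_left: "r \<in> parts l k \<Longrightarrow> p \<bullet>\<^sub>p r = r \<Longrightarrow> ploops p r = ploops p p"
  using ploops_cocycle[of r p p] finite_parts[of r] finite_parts[OF p_parts] by (simp add: p_idem)

lemma ploops_absorb_right: "r \<in> parts k l \<Longrightarrow> r \<bullet>\<^sub>p p = r \<Longrightarrow> ploops r p = ploops p p"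
  using ploops_cocycle[of p p r] finite_parts[of r] finite_parts[OF p_parts] by (simp add: p_idem)

text \<open>A morphism into \<open>p\<close> of maximal rank exhibits \<open>p\<close> as the projection onto its image.\<close>

lemma pcomp_involution_eq_p:
  assumes u: "u \<in> parts l k" "p \<bullet>\<^sub>p u = u" and le: "T \<le> through_blocks u"
  shows "u \<bullet>\<^sub>p involution u = p"
proof (rule eq_p)
  note iu = is_part_parts[OF u(1)] and v = involution_parts[OF u(1)]
  show x: "u \<bullet>\<^sub>p involution u \<in> parts k k" by (rule pcomp_parts[OF v u(1)])
  show "p \<bullet>\<^sub>p (u \<bullet>\<^sub>p involution u) = u \<bullet>\<^sub>p involution u"
    using u(2) by (simp flip: pcomp_assoc)
  have "involution u \<bullet>\<^sub>p p = involution u"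
    using u(2) involution_pcomp[of p u] by (simp add: involution_p)
  then show "u \<bullet>\<^sub>p involution u \<bullet>\<^sub>p p = u \<bullet>\<^sub>p involution u"
    by (simp add: pcomp_assoc)
  have uuu: "u \<bullet>\<^sub>p (involution u \<bullet>\<^sub>p u) = u" by (rule pcomp_involution_pcomp[OF iu])
  show "u \<bullet>\<^sub>p involution u \<bullet>\<^sub>p (u \<bullet>\<^sub>p involution u) = u \<bullet>\<^sub>p involution u"
    using uuu by (metis pcomp_assoc)
  have "through_blocks (u \<bullet>\<^sub>p involution u \<bullet>\<^sub>p u) \<le> through_blocks (u \<bullet>\<^sub>p involution u)"
    by (rule through_blocks_pcomp_le'[OF is_part_parts[OF x] finite_parts[OF x]])
  with le show "T \<le> through_blocks (u \<bullet>\<^sub>p involution u)" by (simp add: uuu pcomp_assoc)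
qed

end

subsection \<open>Categories of partitions\<close>

context partition_category
begin

lemma C_parts: "p \<in> C k l \<Longrightarrow> p \<in> parts k l"
  using C_subset by blast

lemma finite_C: "finite (C k l)"
proof (rule finite_subset[OF C_subset])
  show "finite (parts k l)" unfolding parts_def by (rule finitely_many_partition_on) simp
qed

lemma id_part_in_C: "perm_part k id \<in> C k k"
proof (induction k)
  case 0
  \<comment> \<open>The pair closed up with its involution is a partition of no points, and the
    empty partition is the only one.\<close>
  have "{{Inl 1, Inl 2}} \<bullet>\<^sub>p involution {{Inl 1, Inl 2}} \<in> C 0 0"
    by (rule C_comp[OF C_involution[OF C_pair] C_pair])
  moreover have "p = {}" if "p \<in> C 0 0" for p
    using C_parts[OF that] by (simp add: parts_def Plus_def partition_on_empty)
  ultimately have "{} \<in> C 0 0" by metis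
  then show ?case by (simp add: perm_part_eq_image)
next
  case (Suc k)
  have "{1..Suc k} = insert (Suc k) {1..k}" by auto
  then have "tensor k k (perm_part k id) {{Inl 1, Inr 1}} = perm_part (Suc k) id"
    by (simp add: tensor_def perm_part_eq_image)
  then show ?case using C_tensor[OF Suc.IH C_identity] by (simp only: Suc_eq_plus1)
qed

lemma Proj_involution_pcomp:
  assumes "r \<in> C k l"
  shows "involution r \<bullet>\<^sub>p r \<in> Proj C k"
  using proj_by_exists[OF C_parts[OF assms]] C_comp[OF assms C_involution[OF assms]]
  unfolding Proj_def by auto

lemma Proj_projective: "p \<in> Proj C k \<Longrightarrow> \<exists>p\<^sub>0. projective k p p\<^sub>0"
  by (auto simp: Proj_def projective_def)

lemma Proj_C: "p \<in> Proj C k \<Longrightarrow> p \<in> C k k"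
  by (auto simp: Proj_def)

end

section \<open>Finite-dimensional algebras\<close>

text \<open>The multiplication is bilinear everywhere but associative only on the subspace \<open>U\<close>: the
  composition of formal combinations of partitions is associative on finite partitions only.\<close>

locale lin_alg = vector_space scale
  for scale :: "complex \<Rightarrow> 'm::ab_group_add \<Rightarrow> 'm" +
  fixes U :: "'m set" and mult :: "'m \<Rightarrow> 'm \<Rightarrow> 'm" (infixl "\<star>" 70)
  assumes subspace_U: "subspace U"
    and mult_closed [simp, intro]: "x \<in> U \<Longrightarrow> y \<in> U \<Longrightarrow> x \<star> y \<in> U"
    and mult_assoc: "x \<in> U \<Longrightarrow> y \<in> U \<Longrightarrow> z \<in> U \<Longrightarrow> x \<star> y \<star> z = x \<star> (y \<star> z)"
    and mult_add_left: "(x + y) \<star> z = x \<star> z + y \<star> z"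
    and mult_add_right: "x \<star> (y + z) = x \<star> y + x \<star> z"
    and mult_scale_left: "scale c x \<star> y = scale c (x \<star> y)"
    and mult_scale_right: "x \<star> scale c y = scale c (x \<star> y)"
begin

lemma mult_zero_left [simp]: "0 \<star> x = 0" and mult_zero_right [simp]: "x \<star> 0 = 0"
  using mult_add_left[of 0 0 x] mult_add_right[of x 0 0] by simp_all

lemma mult_diff_left: "(x - y) \<star> z = x \<star> z - y \<star> z"
  using mult_add_left[of "x - y" y z] by (simp add: algebra_simps)

lemma mult_diff_right: "x \<star> (y - z) = x \<star> y - x \<star> z"
  using mult_add_right[of x "y - z" z] by (simp add: algebra_simps)

lemma mult_sum_left: "sum f S \<star> x = (\<Sum>i\<in>S. f i \<star> x)"
  by (induction S rule: infinite_finite_induct) (simp_all add: mult_add_left)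

lemma mult_sum_right: "x \<star> sum f S = (\<Sum>i\<in>S. x \<star> f i)"
  by (induction S rule: infinite_finite_induct) (simp_all add: mult_add_right)

lemmas bilin = mult_add_left mult_add_right mult_diff_left mult_diff_right
  mult_scale_left mult_scale_right

text \<open>The unit is a parameter because corners share the product while each has its own
  idempotent as unit.\<close>

definition fd_alg :: "'m set \<Rightarrow> 'm \<Rightarrow> bool" where
  "fd_alg A u \<longleftrightarrow> subspace A \<and> A \<subseteq> U \<and> u \<in> A \<and> (\<forall>a\<in>A. \<forall>b\<in>A. a \<star> b \<in> A) \<and>
     (\<forall>a\<in>A. u \<star> a = a \<and> a \<star> u = a) \<and> (\<exists>B. finite B \<and> A \<subseteq> span B)"

text \<open>\<open>I\<close> may be larger than \<open>A\<close>, so that an ideal of an algebra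
  counts at once as an ideal of each of its corners.\<close>

definition ideal_in :: "'m set \<Rightarrow> 'm set \<Rightarrow> bool" where
  "ideal_in A I \<longleftrightarrow> subspace I \<and> (\<forall>a\<in>A. \<forall>i\<in>I. a \<star> i \<in> I \<and> i \<star> a \<in> I)"

definition corner_alg :: "'m set \<Rightarrow> 'm \<Rightarrow> 'm set" where
  "corner_alg A e = {x \<in> A. e \<star> x = x \<and> x \<star> e = x}"

lemma fd_alg_corner:
  assumes A: "fd_alg A u" and e: "e \<in> A" "e \<star> e = e"
  shows "fd_alg (corner_alg A e) e"
proof -
  from A have s: "subspace A" "A \<subseteq> U" by (auto simp: fd_alg_def)
  have "subspace (corner_alg A e)"
    unfolding corner_alg_def using s(1)
    by (intro subspaceI) (auto simp: subspace_0 subspace_add subspace_scale bilin)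
  moreover have "a \<star> b \<in> corner_alg A e" if "a \<in> corner_alg A e" "b \<in> corner_alg A e" for a b
  proof -
    have 1: "a \<in> U" "b \<in> U" "e \<in> U" "a \<star> b \<in> A"
      using that e s A by (auto simp: corner_alg_def fd_alg_def)
    then have "e \<star> (a \<star> b) = a \<star> b" "a \<star> b \<star> e = a \<star> b"
      using that mult_assoc[of e a b] mult_assoc[of a b e] by (simp_all add: corner_alg_def)
    with 1 show ?thesis by (simp add: corner_alg_def)
  qed
  ultimately show ?thesis
    using A e unfolding fd_alg_def by (auto simp: corner_alg_def)
qed

context
  fixes A u
  assumes A: "fd_alg A u"
begin

lemma A_sub: "subspace A" and A_U: "x \<in> A \<Longrightarrow> x \<in> U" and u_in: "u \<in> A"
  and A_mult: "a \<in> A \<Longrightarrow> b \<in> A \<Longrightarrow> a \<star> b \<in> A"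
  and u_left: "a \<in> A \<Longrightarrow> u \<star> a = a" and u_right: "a \<in> A \<Longrightarrow> a \<star> u = a"
  using A by (auto simp: fd_alg_def)

lemma A_assoc: "a \<in> A \<Longrightarrow> b \<in> A \<Longrightarrow> c \<in> A \<Longrightarrow> a \<star> b \<star> c = a \<star> (b \<star> c)"
  by (rule mult_assoc) (auto intro: A_U)

text \<open>The powers of an element of a finite-dimensional algebra are linearly dependent; the lowest one
  in a relation is a multiple of the next.\<close>

lemma power_eq:
  fixes pw :: "nat \<Rightarrow> 'm"
  assumes z: "z \<in> A" and pw: "\<And>n. pw n \<in> A" "\<And>n. pw (Suc n) = z \<star> pw n"
    "\<And>n. pw n \<star> z = z \<star> pw n" "pw 0 = u"
  obtains n y where "y \<in> A" "y \<star> z = z \<star> y" "pw n = pw (Suc n) \<star> y"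
proof -
  obtain B where B: "finite B" "A \<subseteq> span B" using A by (auto simp: fd_alg_def)
  define M where "M = card B"
  have "\<exists>n\<le>M. pw n \<in> span (pw ` {n<..M})"
  proof (rule ccontr)
    assume no: "\<not> ?thesis"
    \<comment> \<open>The powers are added from the highest downwards, each lying outside the span
      of those above it. All \<open>Suc M\<close> of them would be independent in a space spanned by
      \<open>M\<close> vectors.\<close>
    have "independent (pw ` {Suc M - j..M}) \<and> card (pw ` {Suc M - j..M}) = j" if "j \<le> Suc M" for j
      using that
    proof (induction j)
      case 0
      then show ?case by (simp add: independent_empty)
    next
      case (Suc j)
      let ?n = "Suc M - Suc j"
      have eq: "{?n..M} = insert ?n {?n<..M}" "{?n<..M} = {Suc M - j..M}" using Suc.prems by auto
      have "pw ?n \<notin> span (pw ` {?n<..M})" using no by auto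
      moreover from this have "pw ?n \<notin> pw ` {?n<..M}" using span_base by blast
      ultimately show ?case
        using Suc unfolding eq(1) image_insert eq(2)
        by (intro conjI independent_insertI) (auto simp: card_insert_if)
    qed
    from this[of "Suc M"] have *: "independent (pw ` {0..M})" "card (pw ` {0..M}) = Suc M" by auto
    have "pw ` {0..M} \<subseteq> span B" using pw(1) B(2) by auto
    then have "Suc M \<le> card B" using independent_span_bound[OF B(1) *(1)] *(2) by simp
    then show False by (simp add: M_def)
  qed
  then obtain n where n: "pw n \<in> span (pw ` {n<..M})" by blast
  \<comment> \<open>Multipliers are taken from the commutant of \<open>z\<close>, so that the
    cofactor read off from the relation commutes with \<open>z\<close>.\<close>
  define Y where "Y = {y \<in> A. y \<star> z = z \<star> y}"
  have subY: "subspace Y"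
    unfolding Y_def using A_sub by (intro subspaceI) (auto simp: subspace_0 subspace_add subspace_scale bilin)
  have "subspace ((\<star>) (pw (Suc n)) ` Y)"
  proof (rule subspaceI)
    show "0 \<in> (\<star>) (pw (Suc n)) ` Y"
      using subspace_0[OF subY] by (metis image_eqI mult_zero_right)
    show "x + y \<in> (\<star>) (pw (Suc n)) ` Y" if "x \<in> (\<star>) (pw (Suc n)) ` Y" "y \<in> (\<star>) (pw (Suc n)) ` Y" for x y
      using that subspace_add[OF subY] by (auto simp flip: mult_add_right)
    show "scale c x \<in> (\<star>) (pw (Suc n)) ` Y" if "x \<in> (\<star>) (pw (Suc n)) ` Y" for c x
      using that subspace_scale[OF subY] by (auto simp flip: mult_scale_right)
  qed
  moreover have "pw ` {n<..M} \<subseteq> (\<star>) (pw (Suc n)) ` Y"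
  proof clarify
    fix i assume i: "i \<in> {n<..M}"
    have "pw (m + d) = pw m \<star> pw d" for m d
      by (induction m) (simp_all add: pw(2,4) u_left pw(1) A_assoc z)
    from this[of "Suc n" "i - Suc n"] i have "pw i = pw (Suc n) \<star> pw (i - Suc n)" by simp
    then show "pw i \<in> (\<star>) (pw (Suc n)) ` Y" using pw(1,3) by (auto simp: Y_def)
  qed
  ultimately have "pw n \<in> (\<star>) (pw (Suc n)) ` Y" using n span_minimal by blast
  then show thesis using that by (auto simp: Y_def)
qed

text \<open>The powers of \<open>z\<close> stabilise: some power x satisfies x = x x v with v
  commuting with \<open>z\<close>, and f = x v is the idempotent of the part on which
  \<open>z\<close> is invertible. If f = 0, then \<open>z\<close> is nilpotent and the geometric
  series inverts \<open>u - z\<close>. If \<open>z\<close> is idempotent modulo an ideal, its powers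
  all agree with \<open>z\<close> there, and f lifts it.\<close>

lemma fitting:
  assumes z: "z \<in> A"
  obtains f w where "f \<in> A" "w \<in> A" "f \<star> f = f" "f = z \<star> w" "f = w \<star> z"
    "f = 0 \<Longrightarrow> \<exists>g\<in>A. (u - z) \<star> g = u \<and> g \<star> (u - z) = u"
    "\<And>I. ideal_in A I \<Longrightarrow> z \<star> z - z \<in> I \<Longrightarrow> f - z \<in> I"
proof -
  define pw where "pw n = ((\<star>) z ^^ n) u" for n
  have pw_Suc: "pw (Suc n) = z \<star> pw n" and pw0: "pw 0 = u" for n by (simp_all add: pw_def)
  have pwA: "pw n \<in> A" for n by (induction n) (auto simp: pw0 pw_Suc u_in A_mult z)
  have pwz: "pw n \<star> z = z \<star> pw n" for n
    by (induction n) (simp_all add: pw0 pw_Suc u_left u_right z A_assoc pwA)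
  have pw_add: "pw (m + d) = pw m \<star> pw d" for m d
    by (induction m) (simp_all add: pw_Suc pw0 u_left pwA A_assoc z)
  obtain n y where y: "y \<in> A" "y \<star> z = z \<star> y" "pw n = pw (Suc n) \<star> y"
    by (rule power_eq[OF z pwA pw_Suc pwz pw0])
  have comm: "y' \<star> pw m = pw m \<star> y'" if "y' \<in> A" "y' \<star> z = z \<star> y'" for y' m
  proof (induction m)
    case 0
    then show ?case using that by (simp add: pw0 u_left u_right)
  next
    case (Suc m)
    have "y' \<star> (z \<star> pw m) = z \<star> (y' \<star> pw m)"
      using that z pwA by (metis A_assoc)
    then show ?case using Suc that z pwA by (simp add: pw_Suc A_assoc)
  qed
  let ?m = "Suc n"
  have m1: "pw ?m = pw (Suc ?m) \<star> y"
    using y(3) y(1) z pwA by (metis A_assoc pw_Suc)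
  \<comment> \<open>Iterating the relation between consecutive powers buys any number of further
    factors \<open>z\<close> at the price of a commuting cofactor; \<open>j = ?m\<close> then
    produces the square.\<close>
  have ex: "\<exists>v\<in>A. v \<star> z = z \<star> v \<and> pw ?m = pw (?m + j) \<star> v" for j
  proof (induction j)
    case 0
    then show ?case using u_in z pwA by (auto intro!: bexI[of _ u] simp: u_left u_right)
  next
    case (Suc j)
    then obtain v where v: "v \<in> A" "v \<star> z = z \<star> v" "pw ?m = pw (?m + j) \<star> v" by auto
    have "pw (?m + j) = pw j \<star> pw ?m" using pw_add[of j ?m] by (simp add: add.commute)
    also have "\<dots> = pw j \<star> pw (Suc ?m) \<star> y" using m1 pwA y(1) by (simp add: A_assoc)
    also have "\<dots> = pw (?m + Suc j) \<star> y" using pw_add[of j "Suc ?m"] by (simp add: add.commute)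
    finally have "pw ?m = pw (?m + Suc j) \<star> (y \<star> v)" using v pwA y by (simp add: A_assoc)
    moreover have "y \<star> v \<star> z = z \<star> (y \<star> v)" using v y z by (metis A_assoc)
    ultimately show ?case using v y A_mult by blast
  qed
  from ex[of ?m] obtain v where v: "v \<in> A" "v \<star> z = z \<star> v" "pw ?m = pw (?m + ?m) \<star> v" by auto
  define x where "x = pw ?m"
  have xA: "x \<in> A" and xv: "v \<star> x = x \<star> v"
    unfolding x_def by (rule pwA, rule comm[OF v(1,2)])
  have xx: "x \<star> x \<star> v = x" using v(3) pw_add[of ?m ?m] by (simp add: x_def)
  have xzn: "x = z \<star> pw n" by (simp add: x_def pw_Suc)
  define f where "f = x \<star> v"
  define w where "w = pw n \<star> v"
  have fA: "f \<in> A" "w \<in> A" using xA v pwA by (auto simp: f_def w_def A_mult)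
  have ff: "f \<star> f = f"
  proof -
    have "f \<star> f = x \<star> (v \<star> x) \<star> v" using xA v by (simp add: f_def A_assoc A_mult)
    also have "\<dots> = x \<star> x \<star> v \<star> v" unfolding xv using xA v by (simp add: A_assoc A_mult)
    finally show ?thesis by (simp add: xx f_def)
  qed
  have fz: "f = z \<star> w" using pwA v z by (simp add: f_def w_def xzn A_assoc)
  have "f = w \<star> z"
    using pwA v z pwz[of n] by (simp add: f_def w_def xzn A_assoc) (metis A_assoc)
  moreover have "\<exists>g\<in>A. (u - z) \<star> g = u \<and> g \<star> (u - z) = u" if f0: "f = 0"
  proof -
    have "x = x \<star> f" using xx xA v by (simp add: f_def A_assoc)
    then have x0: "pw ?m = 0" using f0 x_def by simp
    \<comment> \<open>Partial sums of the geometric series, with \<open>pw j\<close> as the error;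
      the error vanishes at \<open>j = ?m\<close>.\<close>
    have "\<exists>g\<in>A. (u - z) \<star> g = u - pw j \<and> g \<star> (u - z) = u - pw j" for j
    proof (induction j)
      case 0
      then show ?case using subspace_0[OF A_sub] by (auto simp: pw0 intro!: bexI[of _ 0])
    next
      case (Suc j)
      then obtain g where g: "g \<in> A" "(u - z) \<star> g = u - pw j" "g \<star> (u - z) = u - pw j" by auto
      have "(u - z) \<star> (g + pw j) = u - pw (Suc j)"
        using g pwA by (simp add: bilin u_left pw_Suc)
      moreover have "(g + pw j) \<star> (u - z) = u - pw (Suc j)"
        unfolding mult_add_left g(3) using pwA by (simp add: bilin u_right pw_Suc pwz)
      moreover have "g + pw j \<in> A" using g pwA A_sub by (auto intro: subspace_add)
      ultimately show ?case by blast
    qed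
    from this[of ?m] x0 show ?thesis by simp
  qed
  moreover have "f - z \<in> I" if I: "ideal_in A I" and zI: "z \<star> z - z \<in> I" for I
  proof -
    have Is: "subspace I" and Il: "\<And>a i. a \<in> A \<Longrightarrow> i \<in> I \<Longrightarrow> a \<star> i \<in> I"
      and Ir: "\<And>a i. a \<in> A \<Longrightarrow> i \<in> I \<Longrightarrow> i \<star> a \<in> I" using I by (auto simp: ideal_in_def)
    have pwI: "pw (Suc j) - z \<in> I" for j
    proof (induction j)
      case 0
      then show ?case using subspace_0[OF Is] z by (simp add: pw_Suc pw0 u_right)
    next
      case (Suc j)
      have "z \<star> (pw (Suc j) - z) + (z \<star> z - z) \<in> I" by (intro subspace_add[OF Is] Il z Suc zI)
      then show ?case by (simp add: pw_Suc bilin)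
    qed
    \<comment> \<open>Modulo \<open>I\<close> both x and its square are z. Hence z = x = x x v = z v
      = x v = f there.\<close>
    have 1: "x - z \<in> I" "pw (?m + ?m) - z \<in> I" using pwI by (simp_all add: x_def)
    have 2: "x - z \<star> v \<in> I"
      using Ir[OF v(1) 1(2)] v(3) by (simp add: x_def bilin)
    have 3: "f - z \<star> v \<in> I" using Ir[OF v(1) 1(1)] by (simp add: f_def bilin)
    have "(f - z \<star> v) - (x - z \<star> v) + (x - z) \<in> I"
      by (intro subspace_add[OF Is] subspace_diff[OF Is] 1 2 3)
    then show ?thesis by (simp add: algebra_simps)
  qed
  ultimately show thesis using that fA ff fz by blast
qed

end

section \<open>Primitive idempotents modulo an ideal\<close>

definition prim :: "'m set \<Rightarrow> 'm \<Rightarrow> bool" where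
  "prim A e \<longleftrightarrow> e \<in> A \<and> e \<star> e = e \<and> e \<noteq> 0 \<and>
     (\<forall>f\<in>A. f \<star> f = f \<longrightarrow> e \<star> f = f \<longrightarrow> f \<star> e = f \<longrightarrow> f = 0 \<or> f = e)"

text \<open>The corner of a primitive idempotent is local: the Fitting idempotent of
  \<open>z\<close> is 0 or \<open>e\<close>, and if it were 0, then \<open>e - z\<close>, an element
  of \<open>I\<close>, would be invertible and force \<open>e\<close> into \<open>I\<close>.\<close>

lemma prim_invertible:
  assumes A: "fd_alg A u" and e: "prim A e" and I: "ideal_in A I" "e \<notin> I"
    and z: "z \<in> A" "e \<star> z = z" "z \<star> e = z" "z - e \<in> I"
  obtains w where "w \<in> A" "e \<star> w = w" "w \<star> e = w" "z \<star> w = e"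
proof -
  have eA: "e \<in> A" "e \<star> e = e" using e by (auto simp: prim_def)
  note B = fd_alg_corner[OF A eA]
  obtain f w where f: "f \<in> corner_alg A e" "w \<in> corner_alg A e" "f \<star> f = f" "f = z \<star> w"
    "f = 0 \<Longrightarrow> \<exists>g\<in>corner_alg A e. (e - z) \<star> g = e \<and> g \<star> (e - z) = e"
    by (rule fitting[OF B, of z]) (use z in \<open>auto simp: corner_alg_def\<close>)
  have "f \<noteq> 0"
  proof
    assume "f = 0"
    then obtain g where g: "g \<in> A" "(e - z) \<star> g = e" using f by (auto simp: corner_alg_def)
    have "(z - e) \<star> g \<in> I" using I g z by (auto simp: ideal_in_def)
    moreover have "(z - e) \<star> g = - e" using g by (simp add: bilin minus_equation_iff[of _ e] eq_diff_eq)
        (metis add_diff_cancel_left' diff_add_cancel minus_diff_eq)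
    ultimately have "- (- e) \<in> I" using I subspace_neg unfolding ideal_in_def by metis
    with I show False by simp
  qed
  with e f have "f = e" by (auto simp: prim_def corner_alg_def)
  with f show thesis by (intro that[of w]) (auto simp: corner_alg_def)
qed

text \<open>The vector \<open>e - g\<close> lies in \<open>e A\<close>, but not in
  \<open>g A\<close>, since left multiplication by \<open>g\<close> fixes \<open>g A\<close> and
  kills \<open>e - g\<close>. Serves as the measure for the descent in
  \<open>prim_lift\<close>.\<close>

lemma dim_less:
  assumes A: "fd_alg A u" and e: "e \<in> A" "e \<star> e = e" and g: "g \<in> A" "g \<star> g = g" "e \<star> g = g" "g \<star> e = g" "g \<noteq> e"
  shows "dim ((\<star>) g ` A) < dim ((\<star>) e ` A)"
proof -
  note AU = A_U[OF A]
  obtain B where B: "finite B" "A \<subseteq> span B" using A by (auto simp: fd_alg_def)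
  obtain B1 where B1: "B1 \<subseteq> (\<star>) g ` A" "independent B1" "(\<star>) g ` A \<subseteq> span B1" "card B1 = dim ((\<star>) g ` A)"
    using basis_exists by blast
  obtain B2 where B2: "B2 \<subseteq> (\<star>) e ` A" "independent B2" "(\<star>) e ` A \<subseteq> span B2" "card B2 = dim ((\<star>) e ` A)"
    using basis_exists by blast
  have eA: "(\<star>) e ` A \<subseteq> A" and gA: "(\<star>) g ` A \<subseteq> A" using A_mult[OF A] e g by auto
  have finB2: "finite B2" using independent_span_bound[OF B(1) B2(2)] B2(1) eA B(2) by blast
  have finB1: "finite B1" using independent_span_bound[OF B(1) B1(2)] B1(1) gA B(2) by blast
  have "e - g \<notin> span B1"
  proof
    assume "e - g \<in> span B1"
    moreover have "span B1 \<subseteq> {x \<in> A. g \<star> x = x}"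
    proof (rule span_minimal)
      show "B1 \<subseteq> {x \<in> A. g \<star> x = x}"
        using B1(1) gA g(1,2) A_assoc[OF A, of g g] by (auto simp flip: A_assoc[OF A])
      show "subspace {x \<in> A. g \<star> x = x}"
        using A_sub[OF A] by (intro subspaceI) (auto simp: subspace_0 subspace_add subspace_scale bilin)
    qed
    ultimately have "g \<star> (e - g) = e - g" by auto
    with g show False by (simp add: bilin)
  qed
  then have "independent (insert (e - g) B1)" "card (insert (e - g) B1) = Suc (card B1)"
    using independent_insertI[OF _ B1(2)] finB1 span_base[of "e - g" B1] by (simp_all add: card_insert_if) blast
  moreover have "insert (e - g) B1 \<subseteq> span B2"
  proof -
    have "e - g \<in> (\<star>) e ` A"
      using e g A_sub[OF A] by (intro image_eqI[of _ _ "e - g"]) (auto simp: bilin subspace_diff)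
    moreover have "(\<star>) g ` A \<subseteq> (\<star>) e ` A"
    proof
      fix x assume "x \<in> (\<star>) g ` A"
      then obtain a where "a \<in> A" "x = g \<star> a" by auto
      then have "x = e \<star> (g \<star> a)" "g \<star> a \<in> A"
        using g e A_assoc[OF A, of e g a] A_mult[OF A] by simp_all
      then show "x \<in> (\<star>) e ` A" by blast
    qed
    ultimately show ?thesis using B1(1) B2(3) by blast
  qed
  ultimately have "Suc (card B1) \<le> card B2" using independent_span_bound[OF finB2] by metis
  then show ?thesis using B1 B2 by simp
qed

text \<open>Among the idempotents \<open>f\<close> below \<open>e\<close> and congruent to it, take
  one with \<open>f A\<close> of least dimension. An idempotent \<open>g\<close> below
  \<open>f\<close> is in \<open>I\<close> or congruent to \<open>e\<close>; accordingly
  \<open>f - g\<close> or \<open>g\<close> competes with \<open>f\<close>, and minimality forces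
  \<open>g = 0\<close> or \<open>g = f\<close>.\<close>

lemma prim_lift:
  assumes A: "fd_alg A u" and I: "ideal_in A I"
    and e: "e \<in> A" "e \<star> e = e" "e \<notin> I"
    and mod: "\<And>g. g \<in> A \<Longrightarrow> g \<star> g = g \<Longrightarrow> e \<star> g = g \<Longrightarrow> g \<star> e = g \<Longrightarrow> g \<in> I \<or> e - g \<in> I"
  obtains f where "prim A f" "f - e \<in> I"
proof -
  note AU = A_U[OF A]
  define Q where "Q f \<longleftrightarrow> f \<in> A \<and> f \<star> f = f \<and> e \<star> f = f \<and> f \<star> e = f \<and> e - f \<in> I" for f
  have Is: "subspace I" using I by (simp add: ideal_in_def)
  have "Q e" using e subspace_0[OF Is] by (simp add: Q_def)
  define f where "f = arg_min (\<lambda>f. dim ((\<star>) f ` A)) Q"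
  have f: "Q f" "\<And>g. Q g \<Longrightarrow> dim ((\<star>) f ` A) \<le> dim ((\<star>) g ` A)"
    unfolding f_def by (rule arg_min_natI[of Q, OF \<open>Q e\<close>], rule arg_min_nat_le)
  have fI: "e - f \<in> I" using f(1) by (simp add: Q_def)
  have "prim A f"
    unfolding prim_def
  proof (intro conjI ballI impI)
    show "f \<in> A" "f \<star> f = f" using f(1) by (auto simp: Q_def)
    show "f \<noteq> 0" using fI e by auto
    fix g assume g: "g \<in> A" "g \<star> g = g" "f \<star> g = g" "g \<star> f = g"
    have fA: "f \<in> A" "f \<star> f = f" "e \<star> f = f" "f \<star> e = f" using f(1) by (auto simp: Q_def)
    have eg: "e \<star> g = g" "g \<star> e = g"
      using g fA e A_assoc[OF A, of e f g] A_assoc[OF A, of g f e] by simp_all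
    have "g \<in> I \<or> e - g \<in> I" by (rule mod) (use g eg in auto)
    then show "g = 0 \<or> g = f"
    proof
      assume gI: "g \<in> I"
      have "(f - g) \<star> (f - g) = f - g" using g fA by (simp add: bilin)
      moreover have "e - (f - g) \<in> I" using subspace_add[OF Is fI gI] by (simp add: algebra_simps)
      ultimately have "Q (f - g)"
        using g fA eg subspace_diff[OF A_sub[OF A]] by (auto simp: Q_def bilin)
      from f(2)[OF this] have "f - g = f"
        using dim_less[OF A fA(1,2), of "f - g"] g fA \<open>Q (f - g)\<close> by (force simp: Q_def bilin)
      then show ?thesis by simp
    next
      assume "e - g \<in> I"
      then have "Q g" using g eg by (simp add: Q_def)
      from f(2)[OF this] show ?thesis
        using dim_less[OF A fA(1,2), of g] g by force
    qed
  qed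
  moreover have "f - e \<in> I" using subspace_neg[OF Is fI] by simp
  ultimately show thesis by (rule that)
qed

text \<open>If the identity \<open>e\<close> of an indecomposable object is a sum of endomorphisms \<open>\<alpha>\<^sub>i\<beta>\<^sub>i\<close> that factor
  through other objects, then it is an image of an idempotent of one of these: otherwise every
  \<open>1 - \<alpha>\<^sub>i\<beta>\<^sub>iv\<close> is invertible, with inverse \<open>1 + \<alpha>\<^sub>iq\<beta>\<^sub>iv\<close> where \<open>q\<close> inverts \<open>1 - \<beta>\<^sub>iv\<alpha>\<^sub>i\<close>, and the summands
  can be removed one by one.\<close>

lemma factor_through_summand:
  fixes \<alpha> \<beta> :: "'i \<Rightarrow> 'm" and A :: "'i \<Rightarrow> 'm set" and u :: "'i \<Rightarrow> 'm"
  assumes H: "subspace H" "H \<subseteq> U" "\<And>x y. x \<in> H \<Longrightarrow> y \<in> H \<Longrightarrow> x \<star> y \<in> H"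
    and e: "e \<in> H" "e \<star> e = e" "e \<noteq> 0"
    and triv: "\<And>g. g \<in> H \<Longrightarrow> g \<star> g = g \<Longrightarrow> e \<star> g = g \<Longrightarrow> g \<star> e = g \<Longrightarrow> g = 0 \<or> g = e"
    and F: "finite F"
    and A: "\<And>i. i \<in> F \<Longrightarrow> fd_alg (A i) (u i)"
    and U\<alpha>\<beta>: "\<And>i. i \<in> F \<Longrightarrow> \<alpha> i \<in> U" "\<And>i. i \<in> F \<Longrightarrow> \<beta> i \<in> U"
    and e\<alpha>: "\<And>i. i \<in> F \<Longrightarrow> e \<star> \<alpha> i = \<alpha> i" and \<beta>e: "\<And>i. i \<in> F \<Longrightarrow> \<beta> i \<star> e = \<beta> i"
    and \<alpha>u: "\<And>i. i \<in> F \<Longrightarrow> \<alpha> i \<star> u i = \<alpha> i" and u\<beta>: "\<And>i. i \<in> F \<Longrightarrow> u i \<star> \<beta> i = \<beta> i"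
    and \<beta>\<alpha>: "\<And>i v. i \<in> F \<Longrightarrow> v \<in> H \<Longrightarrow> \<beta> i \<star> v \<star> \<alpha> i \<in> A i"
    and \<alpha>\<beta>: "\<And>i a. i \<in> F \<Longrightarrow> a \<in> A i \<Longrightarrow> \<alpha> i \<star> a \<star> \<beta> i \<in> H"
    and sum: "e = (\<Sum>i\<in>F. \<alpha> i \<star> \<beta> i)"
  obtains i f w v where "i \<in> F" "f \<in> A i" "w \<in> A i" "v \<in> H" "f \<star> f = f"
    "f = \<beta> i \<star> v \<star> \<alpha> i \<star> w" "f = w \<star> (\<beta> i \<star> v \<star> \<alpha> i)" "v \<star> e = v" "e = \<alpha> i \<star> w \<star> f \<star> \<beta> i \<star> v"
proof -
  \<comment> \<open>Generalised for the induction: once summands have been removed, the rest no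
    longer sums to \<open>e\<close>, but it still has a right inverse \<open>v\<close>.\<close>
  have "\<exists>i\<in>F. \<exists>f\<in>A i. \<exists>w\<in>A i. \<exists>v\<in>H. f \<star> f = f \<and> f = \<beta> i \<star> v \<star> \<alpha> i \<star> w \<and> f = w \<star> (\<beta> i \<star> v \<star> \<alpha> i)
      \<and> v \<star> e = v \<and> e = \<alpha> i \<star> w \<star> f \<star> \<beta> i \<star> v"
    if "v \<in> H" "v \<star> e = v" "(\<Sum>i\<in>F. \<alpha> i \<star> \<beta> i) \<star> v = e" for v
    using F that A U\<alpha>\<beta> e\<alpha> \<beta>e \<alpha>u u\<beta> \<beta>\<alpha> \<alpha>\<beta>
  proof (induction F arbitrary: v rule: finite_induct)
    case empty
    then show ?case using e by simp
  next
    case (insert i F)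
    note vH = insert.prems(1) and ve = insert.prems(2)
    have Ai: "fd_alg (A i) (u i)" and a: "\<alpha> i \<in> U" and b: "\<beta> i \<in> U" and ea: "e \<star> \<alpha> i = \<alpha> i"
      and be: "\<beta> i \<star> e = \<beta> i" and au: "\<alpha> i \<star> u i = \<alpha> i" and ub: "u i \<star> \<beta> i = \<beta> i"
      and ba: "\<And>v. v \<in> H \<Longrightarrow> \<beta> i \<star> v \<star> \<alpha> i \<in> A i" and ab: "\<And>a. a \<in> A i \<Longrightarrow> \<alpha> i \<star> a \<star> \<beta> i \<in> H"
      using insert.prems(4-) by auto
    have vU: "v \<in> U" and eU: "e \<in> U" using vH e H by auto
    have AU: "x \<in> A i \<Longrightarrow> x \<in> U" for x using Ai by (auto simp: fd_alg_def)
    let ?z = "\<beta> i \<star> v \<star> \<alpha> i"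
    obtain f w where f: "f \<in> A i" "w \<in> A i" "f \<star> f = f" "f = ?z \<star> w" "f = w \<star> ?z"
      "f = 0 \<Longrightarrow> \<exists>g\<in>A i. (u i - ?z) \<star> g = u i \<and> g \<star> (u i - ?z) = u i"
      by (rule fitting[OF Ai ba[OF vH]]) blast
    have wU: "w \<in> U" and fU: "f \<in> U" using f AU by auto
    let ?g = "\<alpha> i \<star> w \<star> f \<star> \<beta> i \<star> v"
    have g_eq: "?g = \<alpha> i \<star> (w \<star> f) \<star> \<beta> i \<star> v" using a wU fU by (simp add: mult_assoc)
    have gH: "?g \<in> H" unfolding g_eq using ab A_mult[OF Ai] f vH H(3) by blast
    have fff: "f \<star> (\<beta> i \<star> (v \<star> (\<alpha> i \<star> (w \<star> f)))) = f"
    proof -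
      have "f \<star> (\<beta> i \<star> (v \<star> (\<alpha> i \<star> (w \<star> f)))) = f \<star> (?z \<star> w \<star> f)"
        using a b vU wU fU by (simp add: mult_assoc)
      then show ?thesis using f by simp
    qed
    have gg: "?g \<star> ?g = ?g"
    proof -
      have "?g \<star> ?g = \<alpha> i \<star> (w \<star> (f \<star> (\<beta> i \<star> (v \<star> (\<alpha> i \<star> (w \<star> f)))))) \<star> \<beta> i \<star> v"
        using a b vU wU fU by (simp add: mult_assoc)
      then show ?thesis unfolding fff using a b vU wU fU by (simp add: mult_assoc)
    qed
    have eg: "e \<star> ?g = ?g" using a b vU wU fU eU ea by (simp flip: mult_assoc)
    have ge: "?g \<star> e = ?g" using a b vU wU fU eU ve by (simp add: mult_assoc)
    from triv[OF gH gg eg ge] show ?case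
    proof
      assume "?g = e"
      show ?thesis
        by (rule bexI[of _ i], rule bexI[of _ f], rule bexI[of _ w], rule bexI[of _ v])
          (intro conjI f(3-5) ve \<open>?g = e\<close>[symmetric], use f(1,2) vH in simp_all)
    next
      assume g0: "?g = 0"
      have "f = ?z \<star> w \<star> f \<star> (?z \<star> w)" using f by simp
      also have "\<dots> = \<beta> i \<star> v \<star> ?g \<star> \<alpha> i \<star> w" using a b vU wU fU by (simp add: mult_assoc)
      finally have "f = 0" using g0 by simp
      then obtain q where q: "q \<in> A i" "(u i - ?z) \<star> q = u i" using f by blast
      have qU: "q \<in> U" using q AU by auto
      have uU: "u i \<in> U" using Ai by (auto simp: fd_alg_def)
      \<comment> \<open>Correcting \<open>v\<close> by \<open>?y\<close> compensates for the removed
        summand, so that \<open>v \<star> ?y\<close> is a right inverse of the remaining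
        sum.\<close>
      let ?y = "e + \<alpha> i \<star> q \<star> \<beta> i \<star> v"
      have yH: "?y \<in> H" using ab[OF q(1)] vH H e by (auto intro: subspace_add)
      have s: "(\<Sum>j\<in>F. \<alpha> j \<star> \<beta> j) \<star> v = e - \<alpha> i \<star> \<beta> i \<star> v"
        using insert.prems(3) insert.hyps by (simp add: bilin eq_diff_eq add.commute)
      have uq: "u i \<star> q = q" using u_left[OF Ai q(1)] .
      have zq: "\<alpha> i \<star> (?z \<star> q) \<star> (\<beta> i \<star> v) = \<alpha> i \<star> q \<star> (\<beta> i \<star> v) - \<alpha> i \<star> (\<beta> i \<star> v)"
      proof -
        have "?z \<star> q = q - u i" using q(2) uq by (simp add: bilin algebra_simps)
        then show ?thesis using au by (simp add: bilin)
      qed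
      have "(\<Sum>j\<in>F. \<alpha> j \<star> \<beta> j) \<star> (v \<star> ?y) = (e - \<alpha> i \<star> \<beta> i \<star> v) \<star> ?y"
      proof -
        have "(\<Sum>j\<in>F. \<alpha> j \<star> \<beta> j) \<in> U" using insert.prems by (intro subspace_sum[OF subspace_U]) auto
        moreover have "?y \<in> U" using yH H by auto
        ultimately show ?thesis using vU s by (simp flip: mult_assoc)
      qed
      also have "\<dots> = e + \<alpha> i \<star> q \<star> (\<beta> i \<star> v) - \<alpha> i \<star> (\<beta> i \<star> v) - \<alpha> i \<star> (?z \<star> q) \<star> (\<beta> i \<star> v)"
      proof -
        have "e \<star> (\<alpha> i \<star> q \<star> \<beta> i \<star> v) = \<alpha> i \<star> q \<star> (\<beta> i \<star> v)"
          using ea a b vU qU eU by (simp add: mult_assoc) (simp flip: mult_assoc)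
        moreover have "\<alpha> i \<star> \<beta> i \<star> v \<star> e = \<alpha> i \<star> (\<beta> i \<star> v)"
          using ve a b vU eU by (simp add: mult_assoc)
        moreover have "\<alpha> i \<star> \<beta> i \<star> v \<star> (\<alpha> i \<star> q \<star> \<beta> i \<star> v) = \<alpha> i \<star> (?z \<star> q) \<star> (\<beta> i \<star> v)"
          using a b vU qU by (simp add: mult_assoc)
        ultimately show ?thesis using e by (simp add: bilin algebra_simps)
      qed
      also have "\<dots> = e" unfolding zq by simp
      finally have 1: "(\<Sum>j\<in>F. \<alpha> j \<star> \<beta> j) \<star> (v \<star> ?y) = e" .
      have 2: "v \<star> ?y \<in> H" using vH yH H(3) by blast
      have ye: "?y \<star> e = ?y" using e ve a b vU qU eU by (simp add: bilin mult_assoc)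
      have "?y \<in> U" using yH H by auto
      then have 3: "v \<star> ?y \<star> e = v \<star> ?y" using vU eU ye by (simp add: mult_assoc)
      have "\<exists>i\<in>F. \<exists>f\<in>A i. \<exists>w\<in>A i. \<exists>v\<in>H. f \<star> f = f \<and> f = \<beta> i \<star> v \<star> \<alpha> i \<star> w \<and> f = w \<star> (\<beta> i \<star> v \<star> \<alpha> i)
        \<and> v \<star> e = v \<and> e = \<alpha> i \<star> w \<star> f \<star> \<beta> i \<star> v"
        by (rule insert.IH[OF 2 3 1]) (use insert.prems in auto)
      then show ?thesis by blast
    qed
  qed
  moreover have "(\<Sum>i\<in>F. \<alpha> i \<star> \<beta> i) \<star> e = e" unfolding sum[symmetric] by (rule e(2))
  ultimately obtain i f w v where "i \<in> F" "f \<in> A i" "w \<in> A i" "v \<in> H" "f \<star> f = f"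
    "f = \<beta> i \<star> v \<star> \<alpha> i \<star> w" "f = w \<star> (\<beta> i \<star> v \<star> \<alpha> i)" "v \<star> e = v" "e = \<alpha> i \<star> w \<star> f \<star> \<beta> i \<star> v"
    using e(1,2) by blast
  then show thesis by (rule that)
qed

end

section \<open>Twisted semigroup algebras\<close>

abbreviation lk :: "('a \<Rightarrow>\<^sub>0 'b::zero) \<Rightarrow> 'a \<Rightarrow> 'b" where "lk \<equiv> Poly_Mapping.lookup"
abbreviation kys :: "('a \<Rightarrow>\<^sub>0 'b::zero) \<Rightarrow> 'a set" where "kys \<equiv> Poly_Mapping.keys"
abbreviation sg :: "'a \<Rightarrow> 'b \<Rightarrow> 'a \<Rightarrow>\<^sub>0 'b::zero" where "sg \<equiv> Poly_Mapping.single"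

definition pscale :: "complex \<Rightarrow> ('a \<Rightarrow>\<^sub>0 complex) \<Rightarrow> ('a \<Rightarrow>\<^sub>0 complex)" where
  "pscale c f = Poly_Mapping.map ((*) c) f"

lemma lookup_pscale [simp]: "lk (pscale c f) x = c * lk f x"
  by (simp add: pscale_def Poly_Mapping.map.rep_eq when_def)

lemma pscale_single [simp]: "pscale c (sg x a) = sg x (c * a)"
  by (rule poly_mapping_eqI) (simp add: lookup_single when_def)

interpretation pm: vector_space pscale
  by unfold_locales (rule poly_mapping_eqI, simp add: lookup_add algebra_simps)+

definition supp_in :: "'a set \<Rightarrow> ('a \<Rightarrow>\<^sub>0 complex) set" where
  "supp_in S = {f. kys f \<subseteq> S}"

lemma supp_in_iff: "f \<in> supp_in S \<longleftrightarrow> (\<forall>x. x \<notin> S \<longrightarrow> lk f x = 0)"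
  by (auto simp: supp_in_def in_keys_iff)

lemma single_supp_in: "x \<in> S \<Longrightarrow> sg x a \<in> supp_in S"
  by (auto simp: supp_in_iff lookup_single when_def)

lemma supp_in_mono: "S \<subseteq> S' \<Longrightarrow> supp_in S \<subseteq> supp_in S'"
  by (auto simp: supp_in_def)

lemma subspace_supp_in: "pm.subspace (supp_in S)"
  by (rule pm.subspaceI) (auto simp: supp_in_iff lookup_add)

lemma sum_singles:
  assumes "finite X" "kys f \<subseteq> X"
  shows "(\<Sum>x\<in>X. sg x (lk f x)) = f"
proof (rule poly_mapping_eqI)
  fix y
  have "(\<Sum>x\<in>X. lk (sg x (lk f x)) y) = (\<Sum>x\<in>X. if x = y then lk f x else 0)"
    by (rule sum.cong) (auto simp: lookup_single when_def)
  also have "\<dots> = lk f y" using assms by (auto simp: in_keys_iff)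
  finally show "lk (\<Sum>x\<in>X. sg x (lk f x)) y = lk f y" by (simp add: lookup_sum)
qed

lemma supp_in_span: "supp_in S \<subseteq> pm.span ((\<lambda>x. sg x 1) ` S)"
proof
  fix f assume f: "f \<in> supp_in S"
  have "f = (\<Sum>x\<in>kys f. pscale (lk f x) (sg x 1))" by (simp add: sum_singles)
  also have "\<dots> \<in> pm.span ((\<lambda>x. sg x 1) ` S)"
    using f by (intro pm.span_sum pm.span_scale pm.span_base) (auto simp: supp_in_def)
  finally show "f \<in> pm.span ((\<lambda>x. sg x 1) ` S)" .
qed

text \<open>One product for three algebras: the weight is a power of t for partitions, the same or
  zero for labelled partitions, and constantly 1 for group algebras.\<close>

definition twisted_mult ::
  "('a \<Rightarrow> 'a \<Rightarrow> 'a) \<Rightarrow> ('a \<Rightarrow> 'a \<Rightarrow> complex) \<Rightarrow> ('a \<Rightarrow>\<^sub>0 complex) \<Rightarrow> ('a \<Rightarrow>\<^sub>0 complex) \<Rightarrow> ('a \<Rightarrow>\<^sub>0 complex)"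
  where "twisted_mult m w f g = (\<Sum>x\<in>kys f. \<Sum>y\<in>kys g. sg (m x y) (lk f x * lk g y * w x y))"

text \<open>Supports may shrink under addition by cancellation. Summing over a common finite
  superset makes bilinearity a termwise matter.\<close>

lemma twisted_mult_superset:
  assumes "finite X" "finite Y" "kys f \<subseteq> X" "kys g \<subseteq> Y"
  shows "twisted_mult m w f g = (\<Sum>x\<in>X. \<Sum>y\<in>Y. sg (m x y) (lk f x * lk g y * w x y))"
proof -
  have "twisted_mult m w f g = (\<Sum>x\<in>kys f. \<Sum>y\<in>Y. sg (m x y) (lk f x * lk g y * w x y))"
    unfolding twisted_mult_def using assms
    by (intro sum.cong refl sum.mono_neutral_left) (auto simp: in_keys_iff)
  also have "\<dots> = (\<Sum>x\<in>X. \<Sum>y\<in>Y. sg (m x y) (lk f x * lk g y * w x y))"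
    using assms by (intro sum.mono_neutral_left) (auto simp: in_keys_iff)
  finally show ?thesis .
qed

lemma twisted_mult_single:
  "twisted_mult m w (sg x a) (sg y b) = sg (m x y) (a * b * w x y)"
  by (subst twisted_mult_superset[of "{x}" "{y}"]) auto

lemma twisted_mult_add_left:
  "twisted_mult m w (f + f') g = twisted_mult m w f g + twisted_mult m w f' g"
proof -
  have "kys (f + f') \<subseteq> kys f \<union> kys f'" by (rule Poly_Mapping.keys_add)
  then show ?thesis
    by (subst (1 2 3) twisted_mult_superset[of "kys f \<union> kys f'" "kys g"])
      (auto simp: lookup_add algebra_simps single_add sum.distrib)
qed

lemma twisted_mult_add_right:
  "twisted_mult m w f (g + g') = twisted_mult m w f g + twisted_mult m w f g'"
proof -
  have "kys (g + g') \<subseteq> kys g \<union> kys g'" by (rule Poly_Mapping.keys_add)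
  then show ?thesis
    by (subst (1 2 3) twisted_mult_superset[of "kys f" "kys g \<union> kys g'"])
      (auto simp: lookup_add algebra_simps single_add sum.distrib)
qed

lemma keys_pscale: "kys (pscale c f) \<subseteq> kys f"
  by (auto simp: in_keys_iff)

lemma twisted_mult_scale_left:
  "twisted_mult m w (pscale c f) g = pscale c (twisted_mult m w f g)"
  by (subst (1 2) twisted_mult_superset[of "kys f" "kys g"])
    (use keys_pscale[of c f] in \<open>auto simp: pm.scale_sum_right mult.assoc intro!: sum.cong\<close>)

lemma twisted_mult_scale_right:
  "twisted_mult m w f (pscale c g) = pscale c (twisted_mult m w f g)"
  by (subst (1 2) twisted_mult_superset[of "kys f" "kys g"])
    (use keys_pscale[of c g] in \<open>auto simp: pm.scale_sum_right mult.left_commute mult.assoc intro!: sum.cong\<close>)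

lemma twisted_mult_zero [simp]: "twisted_mult m w 0 g = 0" "twisted_mult m w f 0 = 0"
  by (simp_all add: twisted_mult_def)

lemma twisted_mult_sum_left:
  "twisted_mult m w (sum f S) g = (\<Sum>i\<in>S. twisted_mult m w (f i) g)"
  by (induction S rule: infinite_finite_induct) (simp_all add: twisted_mult_add_left)

lemma twisted_mult_sum_right:
  "twisted_mult m w f (sum g S) = (\<Sum>i\<in>S. twisted_mult m w f (g i))"
  by (induction S rule: infinite_finite_induct) (simp_all add: twisted_mult_add_right)

lemma twisted_mult_id_right:
  assumes "\<And>z a. z \<in> kys x \<Longrightarrow> twisted_mult m w (sg z a) y = sg z a"
  shows "twisted_mult m w x y = x"
proof -
  have "twisted_mult m w x y = twisted_mult m w (\<Sum>z\<in>kys x. sg z (lk x z)) y"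
    by (simp only: sum_singles finite_keys order_refl)
  also have "\<dots> = (\<Sum>z\<in>kys x. sg z (lk x z))" by (simp add: twisted_mult_sum_left assms)
  also have "\<dots> = x" by (simp add: sum_singles)
  finally show ?thesis .
qed

lemma twisted_mult_id_left:
  assumes "\<And>z a. z \<in> kys x \<Longrightarrow> twisted_mult m w y (sg z a) = sg z a"
  shows "twisted_mult m w y x = x"
proof -
  have "twisted_mult m w y x = twisted_mult m w y (\<Sum>z\<in>kys x. sg z (lk x z))"
    by (simp only: sum_singles finite_keys order_refl)
  also have "\<dots> = (\<Sum>z\<in>kys x. sg z (lk x z))" by (simp add: twisted_mult_sum_right assms)
  also have "\<dots> = x" by (simp add: sum_singles)
  finally show ?thesis .
qed

lemma keys_twisted_mult: "kys (twisted_mult m w f g) \<subseteq> (\<lambda>(x, y). m x y) ` (kys f \<times> kys g)"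
proof -
  have "twisted_mult m w f g \<in> supp_in ((\<lambda>(x, y). m x y) ` (kys f \<times> kys g))"
    unfolding twisted_mult_def
    by (intro pm.subspace_sum subspace_supp_in single_supp_in) auto
  then show ?thesis by (simp add: supp_in_def)
qed

lemma twisted_mult_supp_in:
  assumes "f \<in> supp_in X" "g \<in> supp_in Y" "\<And>x y. x \<in> X \<Longrightarrow> y \<in> Y \<Longrightarrow> m x y \<in> Z"
  shows "twisted_mult m w f g \<in> supp_in Z"
  using keys_twisted_mult[of m w f g] assms by (fastforce simp: supp_in_def)

text \<open>The laws are asked on \<open>S\<close> only, because the loop cocycle is at hand for
  partitions of finitely many points.\<close>

locale twisted_semigroup =
  fixes m :: "'a \<Rightarrow> 'a \<Rightarrow> 'a" and w :: "'a \<Rightarrow> 'a \<Rightarrow> complex" and S :: "'a set"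
  assumes m_closed: "x \<in> S \<Longrightarrow> y \<in> S \<Longrightarrow> m x y \<in> S"
    and m_assoc: "x \<in> S \<Longrightarrow> y \<in> S \<Longrightarrow> z \<in> S \<Longrightarrow> m (m x y) z = m x (m y z)"
    and cocycle: "x \<in> S \<Longrightarrow> y \<in> S \<Longrightarrow> z \<in> S \<Longrightarrow> w (m x y) z * w x y = w x (m y z) * w y z"
begin

sublocale lin_alg pscale "supp_in S" "twisted_mult m w"
proof unfold_locales
  fix f g h :: "'a \<Rightarrow>\<^sub>0 complex"
  assume fgh: "f \<in> supp_in S" "g \<in> supp_in S" "h \<in> supp_in S"
  have f: "f = (\<Sum>x\<in>kys f. sg x (lk f x))" and g: "g = (\<Sum>x\<in>kys g. sg x (lk g x))"
    and h: "h = (\<Sum>x\<in>kys h. sg x (lk h x))" by (simp_all add: sum_singles)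
  have "twisted_mult m w (twisted_mult m w f g) h
    = (\<Sum>z\<in>kys h. \<Sum>y\<in>kys g. \<Sum>x\<in>kys f. sg (m (m x y) z) (lk f x * lk g y * lk h z * (w (m x y) z * w x y)))"
    by (subst f, subst g, subst h)
      (simp add: twisted_mult_sum_left twisted_mult_sum_right twisted_mult_single mult_ac)
  also have "\<dots> = (\<Sum>z\<in>kys h. \<Sum>y\<in>kys g. \<Sum>x\<in>kys f. sg (m x (m y z)) (lk f x * lk g y * lk h z * (w x (m y z) * w y z)))"
    using fgh by (intro sum.cong refl) (simp add: supp_in_def subset_iff m_assoc cocycle)
  also have "\<dots> = twisted_mult m w f (twisted_mult m w g h)"
    by (subst (3) f, subst (3) g, subst (3) h)
      (simp add: twisted_mult_sum_left twisted_mult_sum_right twisted_mult_single mult_ac)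
  finally show "twisted_mult m w (twisted_mult m w f g) h = twisted_mult m w f (twisted_mult m w g h)" .
qed (auto intro: subspace_supp_in twisted_mult_supp_in m_closed
    simp: twisted_mult_add_left twisted_mult_add_right twisted_mult_scale_left twisted_mult_scale_right)

end

section \<open>The partition algebra and its labelled version\<close>

definition fin_part :: "two_part set" where
  "fin_part = {p. finite (\<Union>p)}"

lemma comp0_eq: "comp0 t = twisted_mult (\<bullet>\<^sub>p) (\<lambda>q p. t ^ ploops q p)"
  by (intro ext) (simp add: comp0_def twisted_mult_def)

interpretation part_sg: twisted_semigroup "(\<bullet>\<^sub>p)" "\<lambda>q p. t ^ ploops q p" fin_part for t
proof unfold_locales
  fix x y z assume "x \<in> fin_part" "y \<in> fin_part" "z \<in> fin_part"
  then have "ploops x (y \<bullet>\<^sub>p z) + ploops y z = ploops (x \<bullet>\<^sub>p y) z + ploops x y"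
    by (intro ploops_cocycle) (auto simp: fin_part_def)
  then show "t ^ ploops (x \<bullet>\<^sub>p y) z * t ^ ploops x y = t ^ ploops x (y \<bullet>\<^sub>p z) * t ^ ploops y z"
    by (simp flip: power_add)
qed (auto simp: fin_part_def finite_pcomp pcomp_assoc)

interpretation part_alg: lin_alg pscale "supp_in fin_part" "comp0 t" for t
  unfolding comp0_eq by unfold_locales

lemma comp0_single: "comp0 t (sg q a) (sg p b) = sg (q \<bullet>\<^sub>p p) (a * b * t ^ ploops q p)"
  by (simp add: comp0_eq twisted_mult_single)

text \<open>The basis element \<open>(i, j, p)\<close> is the matrix unit \<open>E\<^sub>i\<^sub>j\<close> with entry \<open>p\<close>.\<close>

type_synonym lpart = "nat \<times> nat \<times> two_part"

definition lcomp :: "lpart \<Rightarrow> lpart \<Rightarrow> lpart" where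
  "lcomp = (\<lambda>(i, j, q) (j', l, p). (i, l, q \<bullet>\<^sub>p p))"

text \<open>Matrix units with mismatched inner labels multiply to zero. Putting this into the weight
  keeps \<open>lcomp\<close> total, and the cocycle identity survives because both of its sides
  vanish together.\<close>

definition lweight :: "complex \<Rightarrow> lpart \<Rightarrow> lpart \<Rightarrow> complex" where
  "lweight t = (\<lambda>(i, j, q) (j', l, p). if j = j' then t ^ ploops q p else 0)"

definition fin_lpart :: "lpart set" where
  "fin_lpart = UNIV \<times> UNIV \<times> fin_part"

abbreviation lmult :: "complex \<Rightarrow> (lpart \<Rightarrow>\<^sub>0 complex) \<Rightarrow> (lpart \<Rightarrow>\<^sub>0 complex) \<Rightarrow> (lpart \<Rightarrow>\<^sub>0 complex)" where
  "lmult t \<equiv> twisted_mult lcomp (lweight t)"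

interpretation labelled: twisted_semigroup lcomp "lweight t" fin_lpart for t
proof unfold_locales
  fix x y z :: lpart assume xyz: "x \<in> fin_lpart" "y \<in> fin_lpart" "z \<in> fin_lpart"
  show "lcomp x y \<in> fin_lpart"
    using xyz by (auto simp: fin_lpart_def lcomp_def fin_part_def finite_pcomp)
  show "lcomp (lcomp x y) z = lcomp x (lcomp y z)"
    by (cases x; cases y; cases z) (simp add: lcomp_def pcomp_assoc)
  show "lweight t (lcomp x y) z * lweight t x y = lweight t x (lcomp y z) * lweight t y z"
    using xyz part_sg.cocycle[of "snd (snd x)" "snd (snd y)" "snd (snd z)" t]
    by (cases x; cases y; cases z) (auto simp: lcomp_def lweight_def fin_lpart_def)
qed

definition lab :: "nat \<Rightarrow> nat \<Rightarrow> mor \<Rightarrow> (lpart \<Rightarrow>\<^sub>0 complex)" where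
  "lab i j f = (\<Sum>p\<in>kys f. sg (i, j, p) (lk f p))"

lemma lookup_lab: "lk (lab i j f) (i', j', p) = (if i = i' \<and> j = j' then lk f p else 0)"
proof -
  have "lk (lab i j f) (i', j', p) = (\<Sum>q\<in>kys f. if q = p then (if i = i' \<and> j = j' then lk f q else 0) else 0)"
    unfolding lab_def lookup_sum by (intro sum.cong refl) (auto simp: lookup_single when_def)
  then show ?thesis by (auto simp: in_keys_iff)
qed

lemma lab_add: "lab i j (f + g) = lab i j f + lab i j g"
  by (rule poly_mapping_eqI) (auto simp: lookup_lab lookup_add split: prod.splits)

lemma lab_zero [simp]: "lab i j 0 = 0"
  by (simp add: lab_def)

lemma lab_single [simp]: "lab i j (sg p a) = sg (i, j, p) a"
  by (rule poly_mapping_eqI) (auto simp: lookup_lab lookup_single when_def split: prod.splits if_splits)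

lemma lab_sum: "lab i j (sum f S) = (\<Sum>s\<in>S. lab i j (f s))"
  by (induction S rule: infinite_finite_induct) (simp_all add: lab_add)

lemma lab_inject: "lab i j f = lab i j g \<longleftrightarrow> f = g"
  by (metis lookup_lab poly_mapping_eqI)

lemma lmult_lab: "lmult t (lab i j f) (lab j' l g) = (if j = j' then lab i l (comp0 t f g) else 0)"
proof -
  have "lmult t (lab i j f) (lab j' l g) = (\<Sum>p\<in>kys g. \<Sum>q\<in>kys f. sg (i, l, q \<bullet>\<^sub>p p)
      (lk f q * lk g p * (if j = j' then t ^ ploops q p else 0)))"
    unfolding lab_def by (simp add: twisted_mult_sum_left twisted_mult_sum_right twisted_mult_single
      lcomp_def lweight_def)
  also have "\<dots> = (if j = j' then lab i l (comp0 t f g) else 0)"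
    by (subst sum.swap) (simp add: comp0_def lab_sum)
  finally show ?thesis .
qed

text \<open>The size of the matrix is forgotten; the carrier supplies it again when a matrix has to
  be recovered.\<close>

definition toL :: "mor mat \<Rightarrow> (lpart \<Rightarrow>\<^sub>0 complex)" where
  "toL M = (\<Sum>i<dim_row M. \<Sum>j<dim_col M. lab i j (M $$ (i, j)))"

lemma lookup_toL: "lk (toL M) (i, j, p) = (if i < dim_row M \<and> j < dim_col M then lk (M $$ (i, j)) p else 0)"
proof -
  have "lk (toL M) (i, j, p) = (\<Sum>i'<dim_row M. if i' = i then (\<Sum>j'<dim_col M. if j' = j then lk (M $$ (i', j')) p else 0) else 0)"
    unfolding toL_def lookup_sum by (intro sum.cong refl) (auto simp: lookup_lab intro!: sum.cong)
  then show ?thesis by auto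
qed

lemma toL_comp_add:
  assumes "dim_col N = dim_row M"
  shows "toL (comp_add t N M) = lmult t (toL N) (toL M)"
proof -
  have "lmult t (toL N) (toL M) = (\<Sum>h<dim_row M. \<Sum>j<dim_col M. \<Sum>i<dim_row N.
      lab i j (comp0 t (N $$ (i, h)) (M $$ (h, j))))"
    unfolding toL_def by (simp add: twisted_mult_sum_left twisted_mult_sum_right lmult_lab assms)
  also have "\<dots> = (\<Sum>h<dim_row M. \<Sum>i<dim_row N. \<Sum>j<dim_col M. lab i j (comp0 t (N $$ (i, h)) (M $$ (h, j))))"
    by (intro sum.cong refl sum.swap)
  also have "\<dots> = (\<Sum>i<dim_row N. \<Sum>h<dim_row M. \<Sum>j<dim_col M. lab i j (comp0 t (N $$ (i, h)) (M $$ (h, j))))"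
    by (rule sum.swap)
  also have "\<dots> = (\<Sum>i<dim_row N. \<Sum>j<dim_col M. \<Sum>h<dim_row M. lab i j (comp0 t (N $$ (i, h)) (M $$ (h, j))))"
    by (intro sum.cong refl sum.swap)
  also have "\<dots> = toL (comp_add t N M)"
    by (simp add: toL_def comp_add_def lab_sum)
  finally show ?thesis ..
qed

definition LH :: "(nat \<Rightarrow> nat \<Rightarrow> two_part set) \<Rightarrow> nat list \<Rightarrow> nat list \<Rightarrow> (lpart \<Rightarrow>\<^sub>0 complex) set" where
  "LH C ks ls = supp_in {(i, j, p). i < length ls \<and> j < length ks \<and> p \<in> C (ks ! j) (ls ! i)}"

definition fromL :: "nat \<Rightarrow> nat \<Rightarrow> (lpart \<Rightarrow>\<^sub>0 complex) \<Rightarrow> mor mat" where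
  "fromL r c x = mat r c (\<lambda>(i, j). Poly_Mapping.map_key (\<lambda>p. (i, j, p)) x)"

lemma fromL_carrier [simp]: "fromL r c x \<in> carrier_mat r c"
  by (simp add: fromL_def)

lemma dim_fromL [simp]: "dim_row (fromL r c x) = r" "dim_col (fromL r c x) = c"
  by (simp_all add: fromL_def)

lemma lookup_fromL: "i < r \<Longrightarrow> j < c \<Longrightarrow> lk (fromL r c x $$ (i, j)) p = lk x (i, j, p)"
  by (simp add: fromL_def map_key.rep_eq inj_def)

lemma hom0_iff: "f \<in> hom0 C k l \<longleftrightarrow> (\<forall>p. p \<notin> C k l \<longrightarrow> lk f p = 0)"
  by (auto simp: hom0_def in_keys_iff)

lemma hom0_supp_in: "hom0 C k l = supp_in (C k l)"
  by (simp add: hom0_def supp_in_def)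

lemma toL_LH: "M \<in> hom_add C ks ls \<Longrightarrow> toL M \<in> LH C ks ls"
  unfolding LH_def supp_in_iff hom_add_def by (auto simp: lookup_toL hom0_iff)

lemma fromL_hom_add: "x \<in> LH C ks ls \<Longrightarrow> fromL (length ls) (length ks) x \<in> hom_add C ks ls"
  unfolding LH_def supp_in_iff hom_add_def by (auto simp: lookup_fromL hom0_iff)

lemma toL_fromL: "x \<in> LH C ks ls \<Longrightarrow> toL (fromL (length ls) (length ks) x) = x"
  unfolding LH_def supp_in_iff
  by (rule poly_mapping_eqI) (auto simp: lookup_toL lookup_fromL split: prod.splits)

lemma toL_inject:
  assumes "M \<in> carrier_mat r c" "N \<in> carrier_mat r c" "toL M = toL N"
  shows "M = N"
proof (rule eq_matI)
  fix i j assume ij: "i < dim_row N" "j < dim_col N"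
  show "M $$ (i, j) = N $$ (i, j)"
  proof (rule poly_mapping_eqI)
    fix p
    have "lk (toL M) (i, j, p) = lk (toL N) (i, j, p)" using assms by simp
    then show "lk (M $$ (i, j)) p = lk (N $$ (i, j)) p"
      using assms(1,2) ij by (simp add: lookup_toL)
  qed
qed (use assms in auto)

lemma hom_add_carrier: "M \<in> hom_add C ks ls \<Longrightarrow> M \<in> carrier_mat (length ls) (length ks)"
  by (simp add: hom_add_def)

section \<open>The category of representations through the labelled algebra\<close>

locale rep_category = partition_category +
  fixes t :: complex
  assumes t_nonzero: "t \<noteq> 0"
begin

abbreviation lcomp_t :: "(lpart \<Rightarrow>\<^sub>0 complex) \<Rightarrow> (lpart \<Rightarrow>\<^sub>0 complex) \<Rightarrow> (lpart \<Rightarrow>\<^sub>0 complex)" (infixl "\<star>" 70) where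
  "x \<star> y \<equiv> lmult t x y"

abbreviation pcomp_t :: "mor \<Rightarrow> mor \<Rightarrow> mor" (infixl "\<diamondop>" 70) where
  "x \<diamondop> y \<equiv> comp0 t x y"

lemma C_fin_part: "C k l \<subseteq> fin_part"
proof
  fix p assume "p \<in> C k l"
  then show "p \<in> fin_part" using finite_parts[OF C_parts] by (simp add: fin_part_def)
qed

lemma LH_U: "x \<in> LH C ks ls \<Longrightarrow> x \<in> supp_in fin_lpart"
  unfolding LH_def using C_fin_part by (fastforce simp: supp_in_def fin_lpart_def)

lemma hom0_U: "f \<in> hom0 C k l \<Longrightarrow> f \<in> supp_in fin_part"
  unfolding hom0_supp_in using supp_in_mono[OF C_fin_part] by blast

lemma LH_mult: "x \<in> LH C ks ls \<Longrightarrow> y \<in> LH C ls ms \<Longrightarrow> y \<star> x \<in> LH C ks ms"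
proof -
  assume x: "x \<in> LH C ks ls" and y: "y \<in> LH C ls ms"
  let ?S = "\<lambda>ks ls. {(i, j, p). i < length ls \<and> j < length ks \<and> p \<in> C (ks ! j) (ls ! i)}"
  have "lk (y \<star> x) z = 0" if z: "z \<notin> ?S ks ms" for z
  proof -
    \<comment> \<open>If the inner labels differ, \<open>lcomp a b\<close> may leave the support,
      but then its weight is zero; if they agree, closure of \<open>C\<close> under composition
      applies.\<close>
    have "lk (sg (lcomp a b) (lk y a * lk x b * lweight t a b)) z = 0"
      if a: "a \<in> kys y" and b: "b \<in> kys x" for a b
    proof -
      obtain i j q where a': "a = (i, j, q)" by (cases a)
      obtain j' l p where b': "b = (j', l, p)" by (cases b)
      have "i < length ms" "j < length ls" "q \<in> C (ls ! j) (ms ! i)"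
        "j' < length ls" "l < length ks" "p \<in> C (ks ! l) (ls ! j')"
        using a b x y a' b' by (auto simp: LH_def supp_in_def)
      then have "j = j' \<Longrightarrow> lcomp a b \<in> ?S ks ms"
        using C_comp by (auto simp: a' b' lcomp_def)
      with z show ?thesis by (auto simp: a' b' lweight_def lookup_single when_def)
    qed
    then show ?thesis by (simp add: twisted_mult_def lookup_sum)
  qed
  then show ?thesis unfolding LH_def supp_in_iff by blast
qed

lemma hom0_mult: "f \<in> hom0 C k l \<Longrightarrow> g \<in> hom0 C l m \<Longrightarrow> g \<diamondop> f \<in> hom0 C k m"
  unfolding hom0_supp_in comp0_eq by (rule twisted_mult_supp_in) (auto intro: C_comp)

lemma subspace_LH: "pm.subspace (LH C ks ls)"
  unfolding LH_def by (rule subspace_supp_in)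

lemma subspace_hom0: "pm.subspace (hom0 C k l)"
  unfolding hom0_supp_in by (rule subspace_supp_in)

definition lid :: "nat list \<Rightarrow> (lpart \<Rightarrow>\<^sub>0 complex)" where
  "lid ks = (\<Sum>a<length ks. sg (a, a, perm_part (ks ! a) id) 1)"

definition pid :: "nat \<Rightarrow> mor" where
  "pid k = sg (perm_part k id) 1"

lemma pid_hom0: "pid k \<in> hom0 C k k"
  unfolding pid_def hom0_supp_in by (intro single_supp_in id_part_in_C)

lemma lid_right: "x \<in> LH C ks ls \<Longrightarrow> x \<star> lid ks = x"
proof (rule twisted_mult_id_right)
  assume x: "x \<in> LH C ks ls"
  fix z a assume "z \<in> kys x"
  then obtain i j p where z: "z = (i, j, p)" "i < length ls" "j < length ks" "p \<in> C (ks ! j) (ls ! i)"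
    using x by (auto simp: LH_def supp_in_def)
  have p: "p \<bullet>\<^sub>p perm_part (ks ! j) id = p" "ploops p (perm_part (ks ! j) id) = 0"
    using C_parts[OF z(4)] by (simp_all add: pcomp_perm_part_id ploops_id_right)
  have "sg z a \<star> lid ks = (\<Sum>b<length ks. if b = j then sg z a else 0)"
    unfolding lid_def twisted_mult_sum_right twisted_mult_single
    by (intro sum.cong refl) (auto simp: z lcomp_def lweight_def p)
  then show "sg z a \<star> lid ks = sg z a" using z by simp
qed

lemma lid_left: "x \<in> LH C ks ls \<Longrightarrow> lid ls \<star> x = x"
proof (rule twisted_mult_id_left)
  assume x: "x \<in> LH C ks ls"
  fix z a assume "z \<in> kys x"
  then obtain i j p where z: "z = (i, j, p)" "i < length ls" "j < length ks" "p \<in> C (ks ! j) (ls ! i)"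
    using x by (auto simp: LH_def supp_in_def)
  have p: "perm_part (ls ! i) id \<bullet>\<^sub>p p = p" "ploops (perm_part (ls ! i) id) p = 0"
    using C_parts[OF z(4)] by (simp_all add: perm_part_id_pcomp ploops_id_left)
  have "lid ls \<star> sg z a = (\<Sum>b<length ls. if b = i then sg z a else 0)"
    unfolding lid_def twisted_mult_sum_left twisted_mult_single
    by (intro sum.cong refl) (auto simp: z lcomp_def lweight_def p)
  then show "lid ls \<star> sg z a = sg z a" using z by simp
qed

lemma lid_LH: "lid ks \<in> LH C ks ks"
  unfolding lid_def LH_def
  by (intro pm.subspace_sum subspace_supp_in single_supp_in) (auto intro: id_part_in_C)

lemma fd_alg_LH: "labelled.fd_alg t (LH C ks ks) (lid ks)"
  unfolding labelled.fd_alg_def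
proof (intro conjI ballI)
  let ?S = "{(i, j, p). i < length ks \<and> j < length ks \<and> p \<in> C (ks ! j) (ks ! i)}"
  have "finite ({..<length ks} \<times> {..<length ks} \<times> (\<Union>i<length ks. \<Union>j<length ks. C (ks ! j) (ks ! i)))"
    using finite_C by auto
  then have "finite ?S" by (rule rev_finite_subset) auto
  then show "\<exists>B. finite B \<and> LH C ks ks \<subseteq> pm.span B"
    unfolding LH_def by (intro exI[of _ "(\<lambda>x. sg x 1) ` ?S"]) (simp add: supp_in_span)
qed (auto simp: subspace_LH lid_LH lid_left lid_right intro: LH_mult LH_U)

lemma pid_right: "f \<in> hom0 C k l \<Longrightarrow> f \<diamondop> pid k = f"
  unfolding comp0_eq
proof (rule twisted_mult_id_right)
  fix p a assume "f \<in> hom0 C k l" "p \<in> kys f"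
  then have "p \<in> parts k l" using C_parts by (auto simp: hom0_def)
  then show "twisted_mult (\<bullet>\<^sub>p) (\<lambda>q p. t ^ ploops q p) (sg p a) (pid k) = sg p a"
    by (simp add: pid_def twisted_mult_single pcomp_perm_part_id ploops_id_right)
qed

lemma pid_left: "f \<in> hom0 C k l \<Longrightarrow> pid l \<diamondop> f = f"
  unfolding comp0_eq
proof (rule twisted_mult_id_left)
  fix p a assume "f \<in> hom0 C k l" "p \<in> kys f"
  then have "p \<in> parts k l" using C_parts by (auto simp: hom0_def)
  then show "twisted_mult (\<bullet>\<^sub>p) (\<lambda>q p. t ^ ploops q p) (pid l) (sg p a) = sg p a"
    by (simp add: pid_def twisted_mult_single perm_part_id_pcomp ploops_id_left)
qed

lemma fd_alg_hom0: "part_alg.fd_alg t (hom0 C k k) (pid k)"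
  unfolding part_alg.fd_alg_def
proof (intro conjI ballI)
  show "\<exists>B. finite B \<and> hom0 C k k \<subseteq> pm.span B"
    unfolding hom0_supp_in
    by (rule exI[of _ "(\<lambda>x. sg x 1) ` C k k"]) (simp add: finite_C supp_in_span)
qed (auto simp: subspace_hom0 pid_hom0 pid_left pid_right intro: hom0_mult hom0_U)

section \<open>Isomorphism as Murray-von Neumann equivalence of idempotents\<close>

definition lequiv :: "nat list \<Rightarrow> (lpart \<Rightarrow>\<^sub>0 complex) \<Rightarrow> nat list \<Rightarrow> (lpart \<Rightarrow>\<^sub>0 complex) \<Rightarrow> bool" where
  "lequiv ks e ls f \<longleftrightarrow> (\<exists>a\<in>LH C ks ls. \<exists>b\<in>LH C ls ks.
     a \<star> e = a \<and> f \<star> a = a \<and> b \<star> f = b \<and> e \<star> b = b \<and> b \<star> a = e \<and> a \<star> b = f)"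

lemma comp_add_carrier: "N \<in> carrier_mat r n \<Longrightarrow> M \<in> carrier_mat n c \<Longrightarrow> comp_add t N M \<in> carrier_mat r c"
  by (simp add: comp_add_def)

lemma comp_add_eq_iff:
  assumes "N \<in> carrier_mat r n" "M \<in> carrier_mat n c" "L \<in> carrier_mat r c"
  shows "comp_add t N M = L \<longleftrightarrow> toL N \<star> toL M = toL L"
proof -
  have "toL (comp_add t N M) = toL N \<star> toL M" using assms by (intro toL_comp_add) simp
  then show ?thesis using toL_inject[OF comp_add_carrier[OF assms(1,2)] assms(3)] by metis
qed

lemma Rep_obj_iff: "(ks, e) \<in> Rep_obj C t \<longleftrightarrow> e \<in> hom_add C ks ks \<and> toL e \<star> toL e = toL e"
  using comp_add_eq_iff[OF hom_add_carrier[of e C ks ks] hom_add_carrier[of e C ks ks] hom_add_carrier[of e C ks ks]]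
  by (auto simp: Rep_obj_def)

lemma Rep_iso_iff:
  "((ks, e), (ls, f)) \<in> Rep_iso C t \<longleftrightarrow>
     (ks, e) \<in> Rep_obj C t \<and> (ls, f) \<in> Rep_obj C t \<and> lequiv ks (toL e) ls (toL f)"
proof -
  have main: "(\<exists>M\<in>Rep_hom C t (ks, e) (ls, f). \<exists>N\<in>Rep_hom C t (ls, f) (ks, e).
      comp_add t N M = e \<and> comp_add t M N = f) \<longleftrightarrow> lequiv ks (toL e) ls (toL f)"
    if e: "e \<in> hom_add C ks ks" and f: "f \<in> hom_add C ls ls"
  proof -
    note ce = hom_add_carrier[OF e] and cf = hom_add_carrier[OF f]
    have iff: "M \<in> Rep_hom C t (ks, e) (ls, f) \<longleftrightarrow> M \<in> hom_add C ks ls \<and> toL M \<star> toL e = toL M \<and> toL f \<star> toL M = toL M" for M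
      using comp_add_eq_iff[OF hom_add_carrier[of M C ks ls] ce hom_add_carrier[of M C ks ls]]
        comp_add_eq_iff[OF cf hom_add_carrier[of M C ks ls] hom_add_carrier[of M C ks ls]]
      by (auto simp: Rep_hom_def)
    have iff': "N \<in> Rep_hom C t (ls, f) (ks, e) \<longleftrightarrow> N \<in> hom_add C ls ks \<and> toL N \<star> toL f = toL N \<and> toL e \<star> toL N = toL N" for N
      using comp_add_eq_iff[OF hom_add_carrier[of N C ls ks] cf hom_add_carrier[of N C ls ks]]
        comp_add_eq_iff[OF ce hom_add_carrier[of N C ls ks] hom_add_carrier[of N C ls ks]]
      by (auto simp: Rep_hom_def)
    have iff'': "comp_add t N M = e \<longleftrightarrow> toL N \<star> toL M = toL e" "comp_add t M N = f \<longleftrightarrow> toL M \<star> toL N = toL f"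
      if "M \<in> hom_add C ks ls" "N \<in> hom_add C ls ks" for M N
      using comp_add_eq_iff[OF hom_add_carrier[OF that(2)] hom_add_carrier[OF that(1)] ce]
        comp_add_eq_iff[OF hom_add_carrier[OF that(1)] hom_add_carrier[OF that(2)] cf] by auto
    show ?thesis
    proof
      assume "\<exists>M\<in>Rep_hom C t (ks, e) (ls, f). \<exists>N\<in>Rep_hom C t (ls, f) (ks, e).
        comp_add t N M = e \<and> comp_add t M N = f"
      then obtain M N where MN: "M \<in> Rep_hom C t (ks, e) (ls, f)" "N \<in> Rep_hom C t (ls, f) (ks, e)"
        "comp_add t N M = e" "comp_add t M N = f" by blast
      then show "lequiv ks (toL e) ls (toL f)"
        unfolding lequiv_def iff iff' using iff''[of M N] toL_LH
        by (intro bexI[of _ "toL M"] bexI[of _ "toL N"]) simp_all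
    next
      assume "lequiv ks (toL e) ls (toL f)"
      then obtain a b where ab: "a \<in> LH C ks ls" "b \<in> LH C ls ks"
        "a \<star> toL e = a" "toL f \<star> a = a" "b \<star> toL f = b" "toL e \<star> b = b" "b \<star> a = toL e" "a \<star> b = toL f"
        unfolding lequiv_def by blast
      define M where "M = fromL (length ls) (length ks) a"
      define N where "N = fromL (length ks) (length ls) b"
      have MN: "M \<in> hom_add C ks ls" "N \<in> hom_add C ls ks" "toL M = a" "toL N = b"
        using ab fromL_hom_add toL_fromL by (auto simp: M_def N_def)
      then show "\<exists>M\<in>Rep_hom C t (ks, e) (ls, f). \<exists>N\<in>Rep_hom C t (ls, f) (ks, e).
        comp_add t N M = e \<and> comp_add t M N = f"
        using ab iff'' by (intro bexI[of _ M] bexI[of _ N]) (auto simp: iff iff')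
    qed
  qed
  show ?thesis
  proof (cases "(ks, e) \<in> Rep_obj C t \<and> (ls, f) \<in> Rep_obj C t")
    case True
    then have "e \<in> hom_add C ks ks" "f \<in> hom_add C ls ls" by (simp_all add: Rep_obj_iff)
    from main[OF this] True show ?thesis by (simp only: Rep_iso_def mem_Collect_eq prod.case snd_conv)
  next
    case False
    then show ?thesis by (auto simp only: Rep_iso_def mem_Collect_eq prod.case)
  qed
qed

lemma Rep_objD: "(ks, e) \<in> Rep_obj C t \<Longrightarrow> toL e \<in> LH C ks ks"
  by (simp add: Rep_obj_iff toL_LH)

lemma lequiv_refl: "e \<in> LH C ks ks \<Longrightarrow> e \<star> e = e \<Longrightarrow> lequiv ks e ks e"
  unfolding lequiv_def by blast

lemma lequiv_sym: "lequiv ks e ls f \<Longrightarrow> lequiv ls f ks e"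
  unfolding lequiv_def by blast

text \<open>The two absorption laws at \<open>f\<close> come from those at \<open>e\<close> by
  writing \<open>f\<close> as \<open>a \<star> b\<close> and \<open>e\<close> as
  \<open>b \<star> a\<close>.\<close>

lemma lequivI:
  assumes "a \<in> LH C ks ls" "b \<in> LH C ls ks" "e \<in> LH C ks ks" "f \<in> LH C ls ls" "e \<star> e = e" "f \<star> f = f"
    "b \<star> a = e" "a \<star> b = f" "a \<star> e = a" "e \<star> b = b"
  shows "lequiv ks e ls f"
proof -
  have U: "a \<in> supp_in fin_lpart" "b \<in> supp_in fin_lpart" using assms LH_U by blast+
  have "f \<star> a = a" using assms labelled.mult_assoc[OF U U(1), of t] by simp
  moreover have "b \<star> f = b" using assms labelled.mult_assoc[OF U(2) U, of t] by simp
  ultimately show ?thesis using assms unfolding lequiv_def by blast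
qed

lemma lequiv_trans:
  assumes "lequiv ks e ls f" "lequiv ls f ms g"
  shows "lequiv ks e ms g"
proof -
  obtain a b where ab: "a \<in> LH C ks ls" "b \<in> LH C ls ks" "a \<star> e = a" "f \<star> a = a" "b \<star> f = b" "e \<star> b = b"
    "b \<star> a = e" "a \<star> b = f" using assms(1) unfolding lequiv_def by blast
  obtain c d where cd: "c \<in> LH C ls ms" "d \<in> LH C ms ls" "c \<star> f = c" "g \<star> c = c" "d \<star> g = d" "f \<star> d = d"
    "d \<star> c = f" "c \<star> d = g" using assms(2) unfolding lequiv_def by blast
  note A = labelled.mult_assoc[of _ _ _ t]
  have U: "a \<in> supp_in fin_lpart" "b \<in> supp_in fin_lpart" "c \<in> supp_in fin_lpart" "d \<in> supp_in fin_lpart"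
    using ab cd LH_U by blast+
  have eU: "e \<in> supp_in fin_lpart" "f \<in> supp_in fin_lpart" "g \<in> supp_in fin_lpart"
    using U ab(7,8) cd(8) by (metis labelled.mult_closed)+
  have "b \<star> d \<star> (c \<star> a) = b \<star> (d \<star> c \<star> a)" using U by (simp add: A)
  then have 1: "b \<star> d \<star> (c \<star> a) = e" using ab cd by simp
  have "c \<star> a \<star> (b \<star> d) = c \<star> (a \<star> b \<star> d)" using U by (simp add: A)
  then have 2: "c \<star> a \<star> (b \<star> d) = g" using ab cd by simp
  show ?thesis
    unfolding lequiv_def
  proof (rule bexI[of _ "c \<star> a"], rule bexI[of _ "b \<star> d"], intro conjI)
    show "c \<star> a \<star> e = c \<star> a" "b \<star> d \<star> g = b \<star> d" using U eU ab cd by (simp_all add: A)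
    show "g \<star> (c \<star> a) = c \<star> a" "e \<star> (b \<star> d) = b \<star> d" using U eU ab cd by (simp_all flip: A)
    show "c \<star> a \<in> LH C ks ms" "b \<star> d \<in> LH C ms ks" using ab cd LH_mult by blast+
  qed (rule 1 2)+
qed

lemma Rep_iso_sym: "(X, Y) \<in> Rep_iso C t \<Longrightarrow> (Y, X) \<in> Rep_iso C t"
  by (cases X; cases Y) (auto simp: Rep_iso_iff intro: lequiv_sym)

lemma Rep_iso_trans: "(X, Y) \<in> Rep_iso C t \<Longrightarrow> (Y, Z) \<in> Rep_iso C t \<Longrightarrow> (X, Z) \<in> Rep_iso C t"
  by (cases X; cases Y; cases Z) (auto simp: Rep_iso_iff intro: lequiv_trans)

lemma Rep_iso_refl: "X \<in> Rep_obj C t \<Longrightarrow> (X, X) \<in> Rep_iso C t"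
  by (cases X) (auto simp: Rep_iso_iff Rep_obj_iff intro!: lequiv_refl toL_LH)

section \<open>The zero object, direct sums and splitting of idempotents\<close>

lemma LH_Nil [simp]: "LH C [] ls = {0}" "LH C ks [] = {0}"
  by (auto simp: LH_def supp_in_iff intro!: poly_mapping_eqI)

lemma toL_zero_mat [simp]: "toL (0\<^sub>m r c) = 0"
  by (simp add: toL_def)

lemma Rep_zero_iff: "((ks, e), Rep_zero) \<in> Rep_iso C t \<longleftrightarrow> (ks, e) \<in> Rep_obj C t \<and> toL e = 0"
proof -
  have "0\<^sub>m 0 0 \<in> hom_add C [] []" by (simp add: hom_add_def)
  then show ?thesis unfolding Rep_zero_def Rep_iso_iff lequiv_def by (auto simp: Rep_obj_iff)
qed

text \<open>The summand \<open>[l\<^sub>1] \<oplus> \<dots> \<oplus> [l\<^sub>m]\<close> of a direct sum occupies the indices from \<open>n\<close> on.\<close>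

definition shift_in :: "nat \<Rightarrow> nat list \<Rightarrow> (lpart \<Rightarrow>\<^sub>0 complex)" where
  "shift_in n ls = (\<Sum>a<length ls. sg (n + a, a, perm_part (ls ! a) id) 1)"

definition shift_out :: "nat \<Rightarrow> nat list \<Rightarrow> (lpart \<Rightarrow>\<^sub>0 complex)" where
  "shift_out n ls = (\<Sum>a<length ls. sg (a, n + a, perm_part (ls ! a) id) 1)"

lemma shift_in_LH: "shift_in (length ks) ls \<in> LH C ls (ks @ ls)"
  and shift_out_LH: "shift_out (length ks) ls \<in> LH C (ks @ ls) ls"
  unfolding shift_in_def shift_out_def LH_def
  by (intro pm.subspace_sum subspace_supp_in single_supp_in; auto simp: nth_append intro: id_part_in_C)+

lemma lid_append_LH: "lid ks \<in> LH C ks (ks @ ls)" "lid ks \<in> LH C (ks @ ls) ks"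
  unfolding lid_def LH_def
  by (intro pm.subspace_sum subspace_supp_in single_supp_in; auto simp: nth_append intro: id_part_in_C)+

lemma shift_lab_eq:
  "lid ks = (\<Sum>a<length ks. lab a a (pid (ks ! a)))"
  "shift_in n ls = (\<Sum>a<length ls. lab (n + a) a (pid (ls ! a)))"
  "shift_out n ls = (\<Sum>a<length ls. lab a (n + a) (pid (ls ! a)))"
  by (simp_all add: lid_def shift_in_def shift_out_def pid_def)

lemma shift_out_in: "shift_out n ls \<star> shift_in n ls = lid ls"
proof -
  have "shift_out n ls \<star> shift_in n ls
    = (\<Sum>b<length ls. \<Sum>a<length ls. if a = b then lab a a (pid (ls ! a) \<diamondop> pid (ls ! a)) else 0)"
    unfolding shift_lab_eq twisted_mult_sum_left twisted_mult_sum_right lmult_lab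
    by (intro sum.cong refl) auto
  then show ?thesis by (simp add: shift_lab_eq pid_left[OF pid_hom0])
qed

lemma lid_shift: "lid ks \<star> shift_in (length ks) ls = 0" "shift_out (length ks) ls \<star> lid ks = 0"
  unfolding shift_lab_eq twisted_mult_sum_left twisted_mult_sum_right lmult_lab
  by (auto intro!: sum.neutral)

lemma sum_lessThan_add: "(\<Sum>i<n + m. g i) = (\<Sum>i<n. g i) + (\<Sum>i<m. g (n + i :: nat))"
  for g :: "nat \<Rightarrow> 'a::comm_monoid_add"
  by (induction m) (simp_all add: add.assoc)

lemma shift_lab:
  assumes f: "f \<in> hom0 C (ls ! j) (ls ! i)" and ij: "i < length ls" "j < length ls"
  shows "shift_in n ls \<star> lab i j f \<star> shift_out n ls = lab (n + i) (n + j) f"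
proof -
  have "shift_in n ls \<star> lab i j f = (\<Sum>a<length ls. if a = i then lab (n + i) j (pid (ls ! i) \<diamondop> f) else 0)"
    unfolding shift_lab_eq twisted_mult_sum_left lmult_lab by (intro sum.cong refl) auto
  then have 2: "shift_in n ls \<star> lab i j f = lab (n + i) j f" using ij pid_left[OF f] by simp
  have "lab (n + i) j f \<star> shift_out n ls = (\<Sum>a<length ls. if j = a then lab (n + i) (n + j) (f \<diamondop> pid (ls ! j)) else 0)"
    unfolding shift_lab_eq twisted_mult_sum_right lmult_lab by (intro sum.cong refl) auto
  then show ?thesis using ij pid_right[OF f] 2 by simp
qed

text \<open>Conjugation with the shifts moves the second block to the indices from
  \<open>length ks\<close> on, so the identity of a direct sum is a sum of two elements of one
  algebra that annihilate each other.\<close>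

lemma toL_Rep_sum:
  assumes e: "e \<in> hom_add C ks ks" and f: "f \<in> hom_add C ls ls"
  shows "toL (snd (Rep_sum (ks, e) (ls, f)))
    = toL e + shift_in (length ks) ls \<star> toL f \<star> shift_out (length ks) ls"
proof -
  let ?n = "length ks" and ?m = "length ls"
  have d: "dim_row e = ?n" "dim_col e = ?n" "dim_row f = ?m" "dim_col f = ?m"
    using hom_add_carrier[OF e] hom_add_carrier[OF f] by auto
  have fij: "f $$ (i, j) \<in> hom0 C (ls ! j) (ls ! i)" if "i < ?m" "j < ?m" for i j
    using f that by (simp add: hom_add_def)
  have "toL (snd (Rep_sum (ks, e) (ls, f)))
    = (\<Sum>i<?n. \<Sum>j<?n. lab i j (e $$ (i, j))) + (\<Sum>i<?m. \<Sum>j<?m. lab (?n + i) (?n + j) (f $$ (i, j)))"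
    unfolding Rep_sum_def toL_def by (simp add: d sum_lessThan_add)
  also have "(\<Sum>i<?n. \<Sum>j<?n. lab i j (e $$ (i, j))) = toL e" by (simp add: toL_def d)
  also have "(\<Sum>i<?m. \<Sum>j<?m. lab (?n + i) (?n + j) (f $$ (i, j)))
    = shift_in ?n ls \<star> toL f \<star> shift_out ?n ls"
    unfolding toL_def d twisted_mult_sum_left twisted_mult_sum_right
    by (intro sum.cong refl) (simp add: shift_lab fij)
  finally show ?thesis .
qed

lemma Rep_sum_hom_add:
  assumes "e \<in> hom_add C ks ks" "f \<in> hom_add C ls ls"
  shows "snd (Rep_sum (ks, e) (ls, f)) \<in> hom_add C (ks @ ls) (ks @ ls)"
  using assms unfolding Rep_sum_def hom_add_def
  by (auto simp: nth_append hom0_def subset_iff)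

lemmas lassoc = labelled.mult_assoc[of _ _ _ t]
lemmas passoc = part_alg.mult_assoc[of _ _ _ t]

lemma shift_U: "shift_in (length ks) ls \<in> supp_in fin_lpart" "shift_out (length ks) ls \<in> supp_in fin_lpart"
  "lid ks \<in> supp_in fin_lpart"
  using shift_in_LH shift_out_LH lid_LH LH_U by blast+

lemma Rep_sum_in_obj:
  assumes "(ks, e) \<in> Rep_obj C t" "(ls, f) \<in> Rep_obj C t"
  shows "Rep_sum (ks, e) (ls, f) \<in> Rep_obj C t"
proof -
  let ?i = "shift_in (length ks) ls" and ?p = "shift_out (length ks) ls"
  let ?E = "toL e" and ?F = "toL f"
  have ef: "e \<in> hom_add C ks ks" "f \<in> hom_add C ls ls" "?E \<star> ?E = ?E" "?F \<star> ?F = ?F"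
    using assms by (auto simp: Rep_obj_iff)
  have L: "?E \<in> LH C ks ks" "?F \<in> LH C ls ls" using ef toL_LH by auto
  have U: "?E \<in> supp_in fin_lpart" "?F \<in> supp_in fin_lpart" using L LH_U by auto
  note S = shift_U(1,2)[of ks ls] shift_U(3)[of ks]
  have Ei: "?E \<star> ?i = 0"
  proof -
    have "?E \<star> ?i = ?E \<star> (lid ks \<star> ?i)" using lid_right[OF L(1)] U S by (simp flip: lassoc)
    then show ?thesis by (simp add: lid_shift)
  qed
  have pE: "?p \<star> ?E = 0"
  proof -
    have "?p \<star> ?E = ?p \<star> lid ks \<star> ?E" using lid_left[OF L(1)] U S by (simp add: lassoc)
    then show ?thesis by (simp add: lid_shift)
  qed
  have 1: "?E \<star> (?i \<star> ?F \<star> ?p) = 0" using U S Ei by (simp flip: lassoc)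
  have 2: "?i \<star> ?F \<star> ?p \<star> ?E = 0" using U S pE by (simp add: lassoc)
  have "?i \<star> ?F \<star> ?p \<star> (?i \<star> ?F \<star> ?p) = ?i \<star> (?F \<star> (?p \<star> ?i \<star> ?F)) \<star> ?p"
    using U S by (simp add: lassoc)
  then have 3: "?i \<star> ?F \<star> ?p \<star> (?i \<star> ?F \<star> ?p) = ?i \<star> ?F \<star> ?p"
    using ef(4) lid_left[OF L(2)] by (simp add: shift_out_in)
  show ?thesis
    unfolding Rep_sum_def prod.case Rep_obj_iff
    using Rep_sum_hom_add[OF ef(1,2)] toL_Rep_sum[OF ef(1,2)] ef(3) 1 2 3
    by (simp add: Rep_sum_def labelled.bilin)
qed

text \<open>An idempotent \<open>g\<close> below the identity splits the object into the images of
  \<open>g\<close> and of its complement, and one of the two has to vanish.\<close>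

lemma indecomposable_trivial:
  assumes X: "indecomposable C t (ks, e)"
  shows "toL e \<noteq> 0"
    and "\<lbrakk>g \<in> LH C ks ks; g \<star> g = g; toL e \<star> g = g; g \<star> toL e = g\<rbrakk> \<Longrightarrow> g = 0 \<or> g = toL e"
proof -
  let ?E = "toL e"
  have obj: "(ks, e) \<in> Rep_obj C t" and nz: "((ks, e), Rep_zero) \<notin> Rep_iso C t"
    and dec: "\<And>Y Z. Y \<in> Rep_obj C t \<Longrightarrow> Z \<in> Rep_obj C t \<Longrightarrow> ((ks, e), Rep_sum Y Z) \<in> Rep_iso C t \<Longrightarrow>
      (Y, Rep_zero) \<in> Rep_iso C t \<or> (Z, Rep_zero) \<in> Rep_iso C t"
    using X unfolding indecomposable_def by auto
  show "?E \<noteq> 0" using nz obj by (simp add: Rep_zero_iff)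
  assume g: "g \<in> LH C ks ks" "g \<star> g = g" "?E \<star> g = g" "g \<star> ?E = g"
  let ?n = "length ks"
  have E: "?E \<in> LH C ks ks" "?E \<star> ?E = ?E" using obj by (auto simp: Rep_obj_iff toL_LH)
  define g' where "g' = ?E - g"
  have g': "g' \<in> LH C ks ks" unfolding g'_def by (intro pm.subspace_diff subspace_LH E g)
  have g'g': "g' \<star> g' = g'" "g \<star> g' = 0" "g' \<star> g = 0" "g' \<star> ?E = g'" "?E \<star> g' = g'"
    using g E by (simp_all add: g'_def labelled.bilin)
  define Y where "Y = fromL ?n ?n g"
  define Z where "Z = fromL ?n ?n g'"
  have Y: "Y \<in> hom_add C ks ks" "toL Y = g" "(ks, Y) \<in> Rep_obj C t"
    and Z: "Z \<in> hom_add C ks ks" "toL Z = g'" "(ks, Z) \<in> Rep_obj C t"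
    using g g' g'g' fromL_hom_add toL_fromL by (auto simp: Y_def Z_def Rep_obj_iff)
  let ?i = "shift_in ?n ks" and ?p = "shift_out ?n ks"
  let ?G = "g + ?i \<star> g' \<star> ?p"
  have snd: "toL (snd (Rep_sum (ks, Y) (ks, Z))) = ?G" using toL_Rep_sum[OF Y(1) Z(1)] Y Z by simp
  have fst: "Rep_sum (ks, Y) (ks, Z) = (ks @ ks, snd (Rep_sum (ks, Y) (ks, Z)))" by (simp add: Rep_sum_def)
  have U: "g \<in> supp_in fin_lpart" "g' \<in> supp_in fin_lpart" "?E \<in> supp_in fin_lpart"
    using g g' E LH_U by blast+
  note S = shift_U(1,2)[of ks ks] shift_U(3)[of ks]
  have gi: "g \<star> ?i = 0"
  proof -
    have "g \<star> ?i = g \<star> (lid ks \<star> ?i)" using lid_right[OF g(1)] U S by (simp flip: lassoc)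
    then show ?thesis by (simp add: lid_shift)
  qed
  have pg: "?p \<star> g = 0"
  proof -
    have "?p \<star> g = ?p \<star> lid ks \<star> g" using lid_left[OF g(1)] U S by (simp add: lassoc)
    then show ?thesis by (simp add: lid_shift)
  qed
  \<comment> \<open>The isomorphism onto the direct sum is the column with entries \<open>g\<close>
    and \<open>g'\<close>, and \<open>b\<close> is the row with the same entries.\<close>
  define a where "a = g + ?i \<star> g'"
  define b where "b = g + g' \<star> ?p"
  have gL: "g \<in> LH C ks (ks @ ks)" "g \<in> LH C (ks @ ks) ks"
    using LH_mult[OF g(1) lid_append_LH(1)[of ks ks]] LH_mult[OF lid_append_LH(2)[of ks ks] g(1)]
    by (simp_all add: lid_left[OF g(1)] lid_right[OF g(1)])
  have aL: "a \<in> LH C ks (ks @ ks)" and bL: "b \<in> LH C (ks @ ks) ks"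
    unfolding a_def b_def
    by (intro pm.subspace_add subspace_LH gL LH_mult[OF g' shift_in_LH] LH_mult[OF shift_out_LH g'])+
  have ba: "b \<star> a = ?E"
  proof -
    have "b \<star> a = g \<star> g + g \<star> ?i \<star> g' + g' \<star> (?p \<star> g) + g' \<star> (?p \<star> ?i \<star> g')"
      unfolding a_def b_def using U S by (simp add: labelled.bilin lassoc)
    also have "\<dots> = g + g'" using gi pg g g'g' lid_left[OF g'] by (simp add: shift_out_in)
    finally show ?thesis by (simp add: g'_def)
  qed
  have ab: "a \<star> b = ?G"
  proof -
    have "a \<star> b = g \<star> g + g \<star> g' \<star> ?p + ?i \<star> (g' \<star> g) + ?i \<star> (g' \<star> g') \<star> ?p"
      unfolding a_def b_def using U S by (simp add: labelled.bilin lassoc)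
    then show ?thesis using g g'g' by simp
  qed
  have "((ks, e), Rep_sum (ks, Y) (ks, Z)) \<in> Rep_iso C t"
  proof -
    have R: "Rep_sum (ks, Y) (ks, Z) \<in> Rep_obj C t" by (rule Rep_sum_in_obj[OF Y(3) Z(3)])
    then have R': "?G \<in> LH C (ks @ ks) (ks @ ks)" "?G \<star> ?G = ?G"
      using Rep_objD snd fst by (metis, metis Rep_obj_iff)
    have "lequiv ks ?E (ks @ ks) ?G"
    proof (rule lequivI[OF aL bL E(1) R'(1) E(2) R'(2) ba ab])
      show "a \<star> ?E = a" "?E \<star> b = b"
        unfolding a_def b_def using U S g g'g' by (simp_all add: labelled.bilin lassoc) (simp flip: lassoc)
    qed
    then show ?thesis using obj R by (subst fst, subst Rep_iso_iff) (simp add: snd flip: fst)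
  qed
  from dec[OF Y(3) Z(3) this] show "g = 0 \<or> g = ?E"
    by (auto simp: Rep_zero_iff Y Z g'_def)
qed

subsection \<open>Images of idempotents\<close>

lemma snd_image_obj: "toL (snd (image_obj k e)) = lab 0 0 e"
  by (simp add: image_obj_def toL_def)

lemma image_obj_eq: "image_obj k e = ([k], snd (image_obj k e))"
  by (simp add: image_obj_def)

lemma lab_LH: "f \<in> hom0 C k l \<Longrightarrow> lab 0 0 f \<in> LH C [k] [l]"
  unfolding LH_def supp_in_iff hom0_iff by (auto simp: lookup_lab)

lemma LH_labE:
  assumes "x \<in> LH C [k] [l]"
  obtains f where "f \<in> hom0 C k l" "x = lab 0 0 f"
proof -
  let ?M = "fromL 1 1 x"
  have "?M \<in> hom_add C [k] [l]" "toL ?M = x"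
    using fromL_hom_add[OF assms] toL_fromL[OF assms] by simp_all
  then show thesis
    by (intro that[of "?M $$ (0, 0)"]) (auto simp: hom_add_def toL_def)
qed

lemma lab_mult [simp]: "lab 0 0 f \<star> lab 0 0 g = lab 0 0 (f \<diamondop> g)"
  by (simp add: lmult_lab)

lemma image_obj_in_obj: "image_obj k e \<in> Rep_obj C t \<longleftrightarrow> e \<in> hom0 C k k \<and> e \<diamondop> e = e"
proof -
  have "snd (image_obj k e) \<in> hom_add C [k] [k] \<longleftrightarrow> e \<in> hom0 C k k"
    by (auto simp: image_obj_def hom_add_def)
  then show ?thesis
    by (subst image_obj_eq) (simp add: Rep_obj_iff snd_image_obj lab_inject)
qed

definition pequiv :: "nat \<Rightarrow> mor \<Rightarrow> nat \<Rightarrow> mor \<Rightarrow> bool" where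
  "pequiv k e l f \<longleftrightarrow> (\<exists>a\<in>hom0 C k l. \<exists>b\<in>hom0 C l k.
     a \<diamondop> e = a \<and> f \<diamondop> a = a \<and> b \<diamondop> f = b \<and> e \<diamondop> b = b \<and> b \<diamondop> a = e \<and> a \<diamondop> b = f)"

lemma lequiv_lab: "lequiv [k] (lab 0 0 e) [l] (lab 0 0 f) \<longleftrightarrow> pequiv k e l f"
proof
  assume "lequiv [k] (lab 0 0 e) [l] (lab 0 0 f)"
  then obtain a b where ab: "a \<in> LH C [k] [l]" "b \<in> LH C [l] [k]" "a \<star> lab 0 0 e = a" "lab 0 0 f \<star> a = a"
    "b \<star> lab 0 0 f = b" "lab 0 0 e \<star> b = b" "b \<star> a = lab 0 0 e" "a \<star> b = lab 0 0 f"
    unfolding lequiv_def by blast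
  obtain a' where a': "a' \<in> hom0 C k l" "a = lab 0 0 a'" by (rule LH_labE[OF ab(1)])
  obtain b' where b': "b' \<in> hom0 C l k" "b = lab 0 0 b'" by (rule LH_labE[OF ab(2)])
  show "pequiv k e l f"
    unfolding pequiv_def using ab a' b' by (intro bexI[of _ a'] bexI[of _ b']) (auto simp: lab_inject)
next
  assume "pequiv k e l f"
  then obtain a b where "a \<in> hom0 C k l" "b \<in> hom0 C l k" "a \<diamondop> e = a" "f \<diamondop> a = a" "b \<diamondop> f = b"
    "e \<diamondop> b = b" "b \<diamondop> a = e" "a \<diamondop> b = f" unfolding pequiv_def by blast
  then show "lequiv [k] (lab 0 0 e) [l] (lab 0 0 f)"
    unfolding lequiv_def by (intro bexI[of _ "lab 0 0 a"] bexI[of _ "lab 0 0 b"]) (auto simp: lab_LH)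
qed

lemma image_obj_iso:
  assumes "e \<in> hom0 C k k" "e \<diamondop> e = e" "f \<in> hom0 C l l" "f \<diamondop> f = f"
  shows "(image_obj k e, image_obj l f) \<in> Rep_iso C t \<longleftrightarrow> pequiv k e l f"
proof -
  have "(image_obj k e, image_obj l f) \<in> Rep_iso C t \<longleftrightarrow>
    image_obj k e \<in> Rep_obj C t \<and> image_obj l f \<in> Rep_obj C t \<and> lequiv [k] (lab 0 0 e) [l] (lab 0 0 f)"
    by (subst (1 2) image_obj_eq, subst Rep_iso_iff) (simp add: snd_image_obj flip: image_obj_eq)
  then show ?thesis using assms by (simp add: image_obj_in_obj lequiv_lab)
qed

lemma primitive_iff: "primitive_idempotent C t k e \<longleftrightarrow> part_alg.prim t (hom0 C k k) e"
proof
  assume e: "primitive_idempotent C t k e"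
  show "part_alg.prim t (hom0 C k k) e"
    unfolding part_alg.prim_def
  proof (intro conjI ballI impI)
    fix f assume f: "f \<in> hom0 C k k" "f \<diamondop> f = f" "e \<diamondop> f = f" "f \<diamondop> e = f"
    have eE: "e \<in> hom0 C k k" "e \<diamondop> e = e" using e by (auto simp: primitive_idempotent_def)
    have "e - f \<in> hom0 C k k" by (intro pm.subspace_diff subspace_hom0 eE f)
    moreover have "(e - f) \<diamondop> (e - f) = e - f" "f \<diamondop> (e - f) = 0" "(e - f) \<diamondop> f = 0" "e = f + (e - f)"
      using f eE by (simp_all add: part_alg.bilin)
    ultimately have "f = 0 \<or> e - f = 0" using e f unfolding primitive_idempotent_def by blast
    then show "f = 0 \<or> f = e" by auto
  qed (use e in \<open>auto simp: primitive_idempotent_def\<close>)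
next
  assume e: "part_alg.prim t (hom0 C k k) e"
  show "primitive_idempotent C t k e"
    unfolding primitive_idempotent_def
  proof (intro conjI ballI impI)
    fix f g assume fg: "f \<in> hom0 C k k" "g \<in> hom0 C k k" "f \<diamondop> f = f" "g \<diamondop> g = g" "f \<diamondop> g = 0" "g \<diamondop> f = 0"
      and eq: "e = f + g"
    have "e \<diamondop> f = f" "f \<diamondop> e = f" using fg by (simp_all add: eq part_alg.bilin)
    then have "f = 0 \<or> f = e" using e fg unfolding part_alg.prim_def by blast
    then show "f = 0 \<or> g = 0" using eq by auto
  qed (use e in \<open>auto simp: part_alg.prim_def\<close>)
qed

text \<open>An isomorphism with a direct sum transports the two projections to idempotents below the
  identity whose sum is the identity. Primitivity makes one of them zero, and since the transport
  can be undone, the summand itself is zero.\<close>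

lemma primitive_indecomposable:
  assumes e: "part_alg.prim t (hom0 C k k) e"
  shows "indecomposable C t (image_obj k e)"
  unfolding indecomposable_def
proof (intro conjI ballI impI)
  have eE: "e \<in> hom0 C k k" "e \<diamondop> e = e" "e \<noteq> 0" using e by (auto simp: part_alg.prim_def)
  show X: "image_obj k e \<in> Rep_obj C t" using eE by (simp add: image_obj_in_obj)
  have "lab 0 0 e \<noteq> 0" using eE lab_inject[of 0 0 e 0] by simp
  then show "(image_obj k e, Rep_zero) \<notin> Rep_iso C t"
    by (subst image_obj_eq) (simp add: Rep_zero_iff snd_image_obj)
  let ?E = "lab 0 0 e"
  have triv: "g = 0 \<or> g = ?E" if g: "g \<in> LH C [k] [k]" "g \<star> g = g" "?E \<star> g = g" "g \<star> ?E = g" for g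
  proof -
    obtain g' where g': "g' \<in> hom0 C k k" "g = lab 0 0 g'" by (rule LH_labE[OF g(1)])
    then have "g' \<diamondop> g' = g'" "e \<diamondop> g' = g'" "g' \<diamondop> e = g'" using g by (auto simp: lab_inject)
    then have "g' = 0 \<or> g' = e" using e g' unfolding part_alg.prim_def by blast
    then show ?thesis using g' by auto
  qed
  fix Y Z assume Y: "Y \<in> Rep_obj C t" and Z: "Z \<in> Rep_obj C t"
    and iso: "(image_obj k e, Rep_sum Y Z) \<in> Rep_iso C t"
  obtain ks y where Yd: "Y = (ks, y)" by (cases Y)
  obtain ls z where Zd: "Z = (ls, z)" by (cases Z)
  let ?Y = "toL y" and ?Z = "toL z" and ?i = "shift_in (length ks) ls" and ?p = "shift_out (length ks) ls"
  have yz: "y \<in> hom_add C ks ks" "z \<in> hom_add C ls ls" "?Y \<star> ?Y = ?Y" "?Z \<star> ?Z = ?Z"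
    using Y Z by (auto simp: Yd Zd Rep_obj_iff)
  have L: "?Y \<in> LH C ks ks" "?Z \<in> LH C ls ls" using yz toL_LH by auto
  define G where "G = ?Y + ?i \<star> ?Z \<star> ?p"
  have G: "toL (snd (Rep_sum Y Z)) = G" "Rep_sum Y Z = (ks @ ls, snd (Rep_sum Y Z))"
    using toL_Rep_sum[OF yz(1,2)] by (simp_all add: Yd Zd G_def Rep_sum_def)
  have "(([k], snd (image_obj k e)), (ks @ ls, snd (Rep_sum Y Z))) \<in> Rep_iso C t"
    unfolding image_obj_eq[symmetric] G(2)[symmetric] by (rule iso)
  then have "lequiv [k] ?E (ks @ ls) G"
    unfolding Rep_iso_iff snd_image_obj G(1) by blast
  then obtain a b where ab: "a \<in> LH C [k] (ks @ ls)" "b \<in> LH C (ks @ ls) [k]" "a \<star> ?E = a" "G \<star> a = a"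
    "b \<star> G = b" "?E \<star> b = b" "b \<star> a = ?E" "a \<star> b = G" unfolding lequiv_def by blast
  have U: "?Y \<in> supp_in fin_lpart" "?Z \<in> supp_in fin_lpart" "a \<in> supp_in fin_lpart" "b \<in> supp_in fin_lpart"
    using L ab LH_U by blast+
  note S = shift_U(1,2)[of ks ls] shift_U(3)[of ks]
  have Yi: "?Y \<star> ?i = 0"
  proof -
    have "?Y \<star> ?i = ?Y \<star> (lid ks \<star> ?i)" using lid_right[OF L(1)] U S by (simp flip: lassoc)
    then show ?thesis by (simp add: lid_shift)
  qed
  have pY: "?p \<star> ?Y = 0"
  proof -
    have "?p \<star> ?Y = ?p \<star> lid ks \<star> ?Y" using lid_left[OF L(1)] U S by (simp add: lassoc)
    then show ?thesis by (simp add: lid_shift)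
  qed
  define Z' where "Z' = ?i \<star> ?Z \<star> ?p"
  have Z'L: "Z' \<in> LH C (ks @ ls) (ks @ ls)"
    unfolding Z'_def by (intro LH_mult[OF shift_out_LH] LH_mult[OF L(2)] shift_in_LH)
  have Y'L: "?Y \<in> LH C (ks @ ls) (ks @ ls)"
    using LH_mult[OF LH_mult[OF lid_append_LH(2)[of ks ls] L(1)] lid_append_LH(1)[of ks ls]]
    by (simp add: lid_left[OF L(1)] lid_right[OF L(1)])
  have YZ: "?Y \<star> Z' = 0" "Z' \<star> ?Y = 0"
    unfolding Z'_def using U S Yi pY by (simp_all add: lassoc) (simp flip: lassoc)
  have ZZ: "Z' \<star> Z' = Z'"
  proof -
    have "Z' \<star> Z' = ?i \<star> (?Z \<star> (?p \<star> ?i \<star> ?Z)) \<star> ?p" unfolding Z'_def using U S by (simp add: lassoc)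
    then show ?thesis using yz(4) lid_left[OF L(2)] by (simp add: shift_out_in Z'_def)
  qed
  have GYZ: "G = ?Y + Z'" by (simp add: G_def Z'_def)
  have U': "Z' \<in> supp_in fin_lpart" "G \<in> supp_in fin_lpart" "?E \<in> supp_in fin_lpart"
    using LH_U[OF Z'L] LH_U[OF lab_LH[OF eE(1)]] U unfolding ab(8)[symmetric] by simp_all
  \<comment> \<open>Nothing below \<open>G\<close> is lost by the transport: \<open>y'\<close> is
    recovered from \<open>b \<star> y' \<star> a\<close> by multiplying with \<open>a\<close> and
    \<open>b\<close> again.\<close>
  have key: "g = 0 \<longrightarrow> y' = 0"
    if y': "y' \<in> LH C (ks @ ls) (ks @ ls)" "y' \<star> y' = y'" "y' \<star> G = y'" "G \<star> y' = y'" and g: "g = b \<star> y' \<star> a" for y' g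
  proof
    assume g0: "g = 0"
    have yU: "y' \<in> supp_in fin_lpart" using y' LH_U by blast
    have "y' = y' \<star> G \<star> y' \<star> (G \<star> y')" using y' by simp
    also have "\<dots> = y' \<star> a \<star> (b \<star> y' \<star> a) \<star> b \<star> y'"
      unfolding ab(8)[symmetric] using U yU by (simp add: lassoc)
    finally show "y' = 0" using g0 g by simp
  qed
  have idem: "b \<star> y' \<star> a \<star> (b \<star> y' \<star> a) = b \<star> y' \<star> a \<and> ?E \<star> (b \<star> y' \<star> a) = b \<star> y' \<star> a
      \<and> b \<star> y' \<star> a \<star> ?E = b \<star> y' \<star> a \<and> b \<star> y' \<star> a \<in> LH C [k] [k]"
    if y': "y' \<in> LH C (ks @ ls) (ks @ ls)" "y' \<star> y' = y'" "y' \<star> G = y'" for y'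
  proof (intro conjI)
    have yU: "y' \<in> supp_in fin_lpart" using y' LH_U by blast
    have "b \<star> y' \<star> a \<star> (b \<star> y' \<star> a) = b \<star> (y' \<star> (a \<star> b) \<star> y') \<star> a" using U yU by (simp add: lassoc)
    then show "b \<star> y' \<star> a \<star> (b \<star> y' \<star> a) = b \<star> y' \<star> a" using ab(8) y' by simp
    show "?E \<star> (b \<star> y' \<star> a) = b \<star> y' \<star> a" using ab(6) U U' yU by (simp flip: lassoc)
    show "b \<star> y' \<star> a \<star> ?E = b \<star> y' \<star> a" using ab(3) U U' yU by (simp add: lassoc)
    show "b \<star> y' \<star> a \<in> LH C [k] [k]" using LH_mult[OF ab(1) LH_mult[OF y'(1) ab(2)]] .
  qed
  have Yp: "?Y \<star> G = ?Y" "G \<star> ?Y = ?Y" and Zp: "Z' \<star> G = Z'" "G \<star> Z' = Z'"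
    using yz(3) YZ ZZ by (simp_all add: GYZ labelled.bilin)
  define g where "g = b \<star> ?Y \<star> a"
  define h where "h = b \<star> Z' \<star> a"
  have gh: "g + h = ?E"
  proof -
    have "g + h = b \<star> G \<star> a" by (simp add: g_def h_def GYZ labelled.bilin)
    then show ?thesis using ab by simp
  qed
  have "g = 0 \<or> g = ?E"
    unfolding g_def using idem[OF Y'L yz(3) Yp(1)] by (intro triv) auto
  then have "g = 0 \<or> h = 0" using gh by auto
  then have "?Y = 0 \<or> Z' = 0"
    using key[OF Y'L yz(3) Yp g_def] key[OF Z'L ZZ Zp h_def] by blast
  moreover have "?Z = 0" if "Z' = 0"
  proof -
    have "?p \<star> Z' \<star> ?i = ?p \<star> ?i \<star> ?Z \<star> (?p \<star> ?i)" unfolding Z'_def using U S by (simp add: lassoc)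
    then show ?thesis using that lid_left[OF L(2)] lid_right[OF L(2)] by (simp add: shift_out_in)
  qed
  ultimately show "(Y, Rep_zero) \<in> Rep_iso C t \<or> (Z, Rep_zero) \<in> Rep_iso C t"
    using Y Z by (auto simp: Yd Zd Rep_zero_iff)
qed

section \<open>Projective partitions as idempotents of the algebra\<close>

definition nproj :: "two_part \<Rightarrow> mor" where
  "nproj p = sg p (1 / t ^ ploops p p)"

declare t_nonzero [simp]

lemma nproj_hom0: "p \<in> Proj C k \<Longrightarrow> nproj p \<in> hom0 C k k"
  unfolding nproj_def hom0_supp_in by (intro single_supp_in Proj_C)

lemma single_hom0: "p \<in> C k l \<Longrightarrow> sg p a \<in> hom0 C k l"
  unfolding hom0_supp_in by (rule single_supp_in)

lemma nproj_single_left: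
  assumes "p \<in> Proj C l" "r \<in> C k l" "p \<bullet>\<^sub>p r = r"
  shows "nproj p \<diamondop> sg r a = sg r a"
proof -
  obtain p\<^sub>0 where "projective l p p\<^sub>0" using Proj_projective assms by blast
  then have "ploops p r = ploops p p" using projective.ploops_absorb_left C_parts assms by blast
  then show ?thesis using assms by (simp add: nproj_def comp0_single)
qed

lemma nproj_single_right:
  assumes "p \<in> Proj C k" "r \<in> C k l" "r \<bullet>\<^sub>p p = r"
  shows "sg r a \<diamondop> nproj p = sg r a"
proof -
  obtain p\<^sub>0 where "projective k p p\<^sub>0" using Proj_projective assms by blast
  then have "ploops r p = ploops p p" using projective.ploops_absorb_right C_parts assms by blast
  then show ?thesis using assms by (simp add: nproj_def comp0_single)
qed

lemma Proj_idem: "p \<in> Proj C k \<Longrightarrow> p \<bullet>\<^sub>p p = p" and Proj_involution: "p \<in> Proj C k \<Longrightarrow> involution p = p"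
  using Proj_projective projective.p_idem projective.involution_p by blast+

text \<open>As an element of the algebra, \<open>p\<close> squares to \<open>t ^ ploops p p\<close>
  times itself. The normalisation, possible since t \<noteq> 0, removes this factor.\<close>

lemma nproj_idem: "p \<in> Proj C k \<Longrightarrow> nproj p \<diamondop> nproj p = nproj p"
  using nproj_single_left[of p k p k] Proj_idem Proj_C by (simp add: nproj_def)

lemma keys_comp0E:
  assumes "r \<in> kys (g \<diamondop> f)"
  obtains q p where "q \<in> kys g" "p \<in> kys f" "r = q \<bullet>\<^sub>p p"
proof -
  have "kys (g \<diamondop> f) \<subseteq> (\<lambda>(x, y). x \<bullet>\<^sub>p y) ` (kys g \<times> kys f)"
    unfolding comp0_eq by (rule keys_twisted_mult)
  with assms have "r \<in> (\<lambda>(x, y). x \<bullet>\<^sub>p y) ` (kys g \<times> kys f)" by (rule rev_subsetD)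
  then show thesis by (elim imageE) (use that in auto)
qed

text \<open>Every partition in the support of a product with \<open>p\<close> has the form
  \<open>p \<bullet>\<^sub>p s\<close> and so is absorbed by the idempotent \<open>p\<close>.
  Conversely the normalising factor is the right one for every absorbed partition at once, by
  \<open>ploops_absorb_left\<close>.\<close>

lemma nproj_left_iff:
  assumes p: "p \<in> Proj C l" and f: "f \<in> hom0 C k l"
  shows "nproj p \<diamondop> f = f \<longleftrightarrow> (\<forall>r\<in>kys f. p \<bullet>\<^sub>p r = r)"
proof
  assume eq: "nproj p \<diamondop> f = f"
  show "\<forall>r\<in>kys f. p \<bullet>\<^sub>p r = r"
  proof
    fix r assume "r \<in> kys f"
    then have "r \<in> kys (nproj p \<diamondop> f)" by (simp only: eq)
    then obtain s where "r = p \<bullet>\<^sub>p s" by (rule keys_comp0E) (auto simp: nproj_def split: if_splits)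
    then show "p \<bullet>\<^sub>p r = r" using Proj_idem[OF p] by (simp flip: pcomp_assoc)
  qed
next
  assume *: "\<forall>r\<in>kys f. p \<bullet>\<^sub>p r = r"
  have f': "r \<in> C k l" if "r \<in> kys f" for r using that f by (auto simp: hom0_def)
  have "nproj p \<diamondop> sg r a = sg r a" if "r \<in> kys f" for r a
    using nproj_single_left[OF p f'[OF that]] * that by blast
  then show "nproj p \<diamondop> f = f" unfolding comp0_eq by (rule twisted_mult_id_left)
qed

lemma nproj_right_iff:
  assumes p: "p \<in> Proj C k" and f: "f \<in> hom0 C k l"
  shows "f \<diamondop> nproj p = f \<longleftrightarrow> (\<forall>r\<in>kys f. r \<bullet>\<^sub>p p = r)"
proof
  assume eq: "f \<diamondop> nproj p = f"
  show "\<forall>r\<in>kys f. r \<bullet>\<^sub>p p = r"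
  proof
    fix r assume "r \<in> kys f"
    then have "r \<in> kys (f \<diamondop> nproj p)" by (simp only: eq)
    then obtain s where "r = s \<bullet>\<^sub>p p" by (rule keys_comp0E) (auto simp: nproj_def split: if_splits)
    then show "r \<bullet>\<^sub>p p = r" using Proj_idem[OF p] by (simp add: pcomp_assoc)
  qed
next
  assume *: "\<forall>r\<in>kys f. r \<bullet>\<^sub>p p = r"
  have f': "r \<in> C k l" if "r \<in> kys f" for r using that f by (auto simp: hom0_def)
  have "sg r a \<diamondop> nproj p = sg r a" if "r \<in> kys f" for r a
    using nproj_single_right[OF p f'[OF that]] * that by blast
  then show "f \<diamondop> nproj p = f" unfolding comp0_eq by (rule twisted_mult_id_right)
qed

section \<open>Indecomposable objects as images of idempotents in corners\<close>

definition corner_idem :: "nat \<Rightarrow> two_part \<Rightarrow> mor \<Rightarrow> bool" where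
  "corner_idem k p f \<longleftrightarrow> p \<in> Proj C k \<and> f \<in> hom0 C k k \<and> f \<diamondop> f = f \<and> nproj p \<diamondop> f = f \<and> f \<diamondop> nproj p = f"

lemma through_le:
  assumes "p \<in> C k l" "q \<in> C l m"
  shows "through_blocks (q \<bullet>\<^sub>p p) \<le> through_blocks p" "through_blocks (q \<bullet>\<^sub>p p) \<le> through_blocks q"
  using through_blocks_pcomp_le[of p q] through_blocks_pcomp_le'[of q p]
    is_part_parts[OF C_parts[OF assms(1)]] is_part_parts[OF C_parts[OF assms(2)]]
    finite_parts[OF C_parts[OF assms(1)]] finite_parts[OF C_parts[OF assms(2)]] by blast+

lemma through_involution_comp:
  "r \<in> C k l \<Longrightarrow> through_blocks (involution r \<bullet>\<^sub>p r) = through_blocks r"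
  by (rule through_blocks_involution_pcomp[OF is_part_parts[OF C_parts] finite_parts[OF C_parts]])

lemma comp_involution_comp: "r \<in> C k l \<Longrightarrow> r \<bullet>\<^sub>p (involution r \<bullet>\<^sub>p r) = r"
  by (rule pcomp_involution_pcomp[OF is_part_parts[OF C_parts]])

text \<open>Each basis element of the identity is factored as its partition \<open>r\<close> after
  \<open>involution r \<bullet>\<^sub>p r\<close>, which writes the identity as a sum of
  endomorphisms through single objects. That \<open>r\<close> is taken from the support of
  \<open>toL e\<close> is recorded, because this bounds the rank of \<open>p\<close> and drives the
  later descent.\<close>

lemma summand:
  assumes obj: "(ks, e) \<in> Rep_obj C t" and nz: "toL e \<noteq> 0"
    and triv: "\<And>g. g \<in> LH C ks ks \<Longrightarrow> g \<star> g = g \<Longrightarrow> toL e \<star> g = g \<Longrightarrow> g \<star> toL e = g \<Longrightarrow> g = 0 \<or> g = toL e"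
  obtains i j r k p f where "(i, j, r) \<in> kys (toL e)" "through_blocks p = through_blocks r"
    "corner_idem k p f" "((ks, e), image_obj k f) \<in> Rep_iso C t"
proof -
  let ?E = "toL e"
  have E: "?E \<in> LH C ks ks" "?E \<star> ?E = ?E" using obj by (auto simp: Rep_obj_iff toL_LH)
  have EU: "?E \<in> supp_in fin_lpart" using E LH_U by blast
  \<comment> \<open>\<open>\<alpha>0\<close> carries \<open>r\<close>; \<open>\<beta>0\<close>
    carries its initial projection and the coefficient, divided by the loops that appear when the
    two are composed.\<close>
  define \<alpha>0 where "\<alpha>0 = (\<lambda>(i, j::nat, r). sg (i, 0::nat, r) (1::complex) :: lpart \<Rightarrow>\<^sub>0 complex)"
  define \<beta>0 where "\<beta>0 = (\<lambda>(i, j, r). sg (0::nat, j, involution r \<bullet>\<^sub>p r)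
    (lk ?E (i, j, r) / t ^ ploops r (involution r \<bullet>\<^sub>p r)) :: lpart \<Rightarrow>\<^sub>0 complex)"
  define \<kappa> where "\<kappa> = (\<lambda>(i::nat, j, r::two_part). ks ! j)"
  have key: "i < length ks \<and> j < length ks \<and> r \<in> C (ks ! j) (ks ! i)" if "(i, j, r) \<in> kys ?E" for i j r
    using that E(1) by (auto simp: LH_def supp_in_def)
  have pr: "involution r \<bullet>\<^sub>p r \<in> Proj C (ks ! j)" if "(i, j, r) \<in> kys ?E" for i j r
    using key[OF that] Proj_involution_pcomp by blast
  have \<alpha>0L: "\<alpha>0 z \<in> LH C [\<kappa> z] ks" if "z \<in> kys ?E" for z
    using that key unfolding \<alpha>0_def \<kappa>_def LH_def by (cases z) (auto intro!: single_supp_in)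
  have \<beta>0L: "\<beta>0 z \<in> LH C ks [\<kappa> z]" if "z \<in> kys ?E" for z
    using that key Proj_C[OF pr] unfolding \<beta>0_def \<kappa>_def LH_def by (cases z) (auto intro!: single_supp_in)
  have U: "\<alpha>0 z \<in> supp_in fin_lpart" "\<beta>0 z \<in> supp_in fin_lpart" if "z \<in> kys ?E" for z
    using \<alpha>0L[OF that] \<beta>0L[OF that] LH_U by blast+
  have \<alpha>\<beta>0: "\<alpha>0 z \<star> \<beta>0 z = sg z (lk ?E z)" if "z \<in> kys ?E" for z
  proof -
    obtain i j r where z: "z = (i, j, r)" by (cases z)
    have "r \<in> C (ks ! j) (ks ! i)" using key that z by blast
    from comp_involution_comp[OF this] show ?thesis
      unfolding \<alpha>0_def \<beta>0_def z by (simp add: twisted_mult_single lcomp_def lweight_def)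
  qed
  define \<alpha> where "\<alpha> z = ?E \<star> \<alpha>0 z" for z
  define \<beta> where "\<beta> z = \<beta>0 z \<star> ?E" for z
  have sum: "?E = (\<Sum>z\<in>kys ?E. \<alpha> z \<star> \<beta> z)"
  proof -
    have "(\<Sum>z\<in>kys ?E. \<alpha> z \<star> \<beta> z) = (\<Sum>z\<in>kys ?E. ?E \<star> (\<alpha>0 z \<star> \<beta>0 z) \<star> ?E)"
      unfolding \<alpha>_def \<beta>_def using U EU by (intro sum.cong refl) (simp add: lassoc)
    also have "\<dots> = ?E \<star> (\<Sum>z\<in>kys ?E. sg z (lk ?E z)) \<star> ?E"
      by (simp add: \<alpha>\<beta>0 twisted_mult_sum_left twisted_mult_sum_right)
    also have "\<dots> = ?E" using E by (simp add: sum_singles)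
    finally show ?thesis ..
  qed
  have \<alpha>L: "\<alpha> z \<in> LH C [\<kappa> z] ks" and \<beta>L: "\<beta> z \<in> LH C ks [\<kappa> z]" if "z \<in> kys ?E" for z
    unfolding \<alpha>_def \<beta>_def using LH_mult[OF \<alpha>0L[OF that] E(1)] LH_mult[OF E(1) \<beta>0L[OF that]] by auto
  obtain z f w v where z: "z \<in> kys ?E" "f \<in> LH C [\<kappa> z] [\<kappa> z]" "w \<in> LH C [\<kappa> z] [\<kappa> z]" "v \<in> LH C ks ks"
    "f \<star> f = f" "f = \<beta> z \<star> v \<star> \<alpha> z \<star> w" "f = w \<star> (\<beta> z \<star> v \<star> \<alpha> z)" "v \<star> ?E = v" "?E = \<alpha> z \<star> w \<star> f \<star> \<beta> z \<star> v"
  proof (rule labelled.factor_through_summand[where t = t and H = "LH C ks ks" and e = ?E and F = "kys ?E"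
        and A = "\<lambda>z. LH C [\<kappa> z] [\<kappa> z]" and u = "\<lambda>z. lid [\<kappa> z]" and \<alpha> = \<alpha> and \<beta> = \<beta>])
    show "LH C ks ks \<subseteq> supp_in fin_lpart" using LH_U by blast
    show "\<alpha> z \<in> supp_in fin_lpart" "\<beta> z \<in> supp_in fin_lpart" if "z \<in> kys ?E" for z
      using \<alpha>L[OF that] \<beta>L[OF that] LH_U by blast+
    show "?E \<star> \<alpha> z = \<alpha> z" "\<beta> z \<star> ?E = \<beta> z" if "z \<in> kys ?E" for z
      unfolding \<alpha>_def \<beta>_def using U[OF that] EU E(2) by (simp flip: lassoc, simp add: lassoc)
    show "\<beta> z \<star> v \<star> \<alpha> z \<in> LH C [\<kappa> z] [\<kappa> z]" if "z \<in> kys ?E" "v \<in> LH C ks ks" for z v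
      by (rule LH_mult[OF \<alpha>L[OF that(1)] LH_mult[OF that(2) \<beta>L[OF that(1)]]])
    show "\<alpha> z \<star> a \<star> \<beta> z \<in> LH C ks ks" if "z \<in> kys ?E" "a \<in> LH C [\<kappa> z] [\<kappa> z]" for z a
      by (rule LH_mult[OF \<beta>L[OF that(1)] LH_mult[OF that(2) \<alpha>L[OF that(1)]]])
  qed (use E nz triv sum in \<open>auto simp: subspace_LH fd_alg_LH lid_left[OF \<beta>L] lid_right[OF \<alpha>L] intro: LH_mult\<close>)
  obtain i j r where zeq: "z = (i, j, r)" by (cases z)
  let ?k = "\<kappa> z" and ?p = "involution r \<bullet>\<^sub>p r"
  have k: "?k = ks ! j" by (simp add: \<kappa>_def zeq)
  have rC: "r \<in> C ?k (ks ! i)" and pP: "?p \<in> Proj C ?k" using key pr z(1) k by (auto simp: zeq)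
  have U2: "\<alpha> z \<in> supp_in fin_lpart" "\<beta> z \<in> supp_in fin_lpart" "f \<in> supp_in fin_lpart"
    "w \<in> supp_in fin_lpart" "v \<in> supp_in fin_lpart" "\<alpha>0 z \<in> supp_in fin_lpart" "\<beta>0 z \<in> supp_in fin_lpart"
    using \<alpha>L[OF z(1)] \<beta>L[OF z(1)] z(2-4) LH_U U[OF z(1)] by blast+
  obtain f' where f': "f' \<in> hom0 C ?k ?k" "f = lab 0 0 f'" by (rule LH_labE[OF z(2)])
  \<comment> \<open>The normalised initial projection of \<open>r\<close>. Both factors absorb it,
    which places \<open>f\<close> in the corner of \<open>?p\<close>.\<close>
  let ?P = "lab 0 0 (nproj ?p)"
  have PU: "?P \<in> supp_in fin_lpart" using LH_U[OF lab_LH[OF nproj_hom0[OF pP]]] .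
  have P\<beta>0: "?P \<star> \<beta>0 z = \<beta>0 z"
    using Proj_idem[OF pP] by (simp add: nproj_def \<beta>0_def zeq twisted_mult_single lcomp_def lweight_def)
  have P\<alpha>0: "\<alpha>0 z \<star> ?P = \<alpha>0 z"
  proof -
    obtain p\<^sub>0 where "projective ?k ?p p\<^sub>0" using Proj_projective pP by blast
    then have "ploops r ?p = ploops ?p ?p"
      using projective.ploops_absorb_right C_parts[OF rC] comp_involution_comp[OF rC] by blast
    then show ?thesis
      using comp_involution_comp[OF rC]
      by (simp add: nproj_def \<alpha>0_def zeq twisted_mult_single lcomp_def lweight_def)
  qed
  have P\<beta>: "?P \<star> \<beta> z = \<beta> z" unfolding \<beta>_def using P\<beta>0 PU U2 EU by (simp flip: lassoc)
  have P\<alpha>: "\<alpha> z \<star> ?P = \<alpha> z" unfolding \<alpha>_def using P\<alpha>0 PU U2 EU by (simp add: lassoc)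
  have "?P \<star> f = f"
  proof -
    have "?P \<star> (\<beta> z \<star> v \<star> \<alpha> z \<star> w) = ?P \<star> \<beta> z \<star> v \<star> \<alpha> z \<star> w" using U2 PU by (simp add: lassoc)
    then show ?thesis using z(6) P\<beta> by simp
  qed
  moreover have "f \<star> ?P = f"
  proof -
    have "w \<star> (\<beta> z \<star> v \<star> \<alpha> z) \<star> ?P = w \<star> (\<beta> z \<star> v \<star> (\<alpha> z \<star> ?P))" using U2 PU by (simp add: lassoc)
    then show ?thesis using z(7) P\<alpha> by simp
  qed
  ultimately have corner_idem: "corner_idem ?k ?p f'"
    using f' z(5) pP by (simp add: corner_idem_def lab_inject)
  have "lequiv ks ?E [?k] f"
  proof (rule lequivI)
    let ?a = "f \<star> \<beta> z \<star> v" and ?b = "\<alpha> z \<star> w \<star> f"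
    show "?a \<in> LH C ks [?k]" by (rule LH_mult[OF z(4) LH_mult[OF \<beta>L[OF z(1)] z(2)]])
    show "?b \<in> LH C [?k] ks" by (rule LH_mult[OF z(2) LH_mult[OF z(3) \<alpha>L[OF z(1)]]])
    have "?b \<star> ?a = \<alpha> z \<star> w \<star> (f \<star> f) \<star> \<beta> z \<star> v" using U2 by (simp add: lassoc)
    then show "?b \<star> ?a = ?E" using z(5,9) by simp
    have "?a \<star> ?b = f \<star> (\<beta> z \<star> v \<star> \<alpha> z \<star> w) \<star> f" using U2 by (simp add: lassoc)
    then show "?a \<star> ?b = f" using z(5,6) by simp
    show "?a \<star> ?E = ?a" using U2 EU z(8) by (simp add: lassoc)
    have "?E \<star> \<alpha> z = \<alpha> z" unfolding \<alpha>_def using U2 EU E(2) by (simp flip: lassoc)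
    then show "?E \<star> ?b = ?b" using U2 EU by (simp flip: lassoc)
  qed (use E z in auto)
  then have "((ks, e), image_obj ?k f') \<in> Rep_iso C t"
    using obj corner_idem by (subst image_obj_eq, subst Rep_iso_iff)
      (simp add: snd_image_obj f'(2) corner_idem_def image_obj_in_obj flip: image_obj_eq)
  then show thesis
    using that[of i j r ?p ?k f'] z(1) zeq corner_idem through_involution_comp[OF rC] by blast
qed

lemma indecomposable_iso:
  assumes X: "indecomposable C t X" and XY: "(X, Y) \<in> Rep_iso C t"
  shows "indecomposable C t Y"
  unfolding indecomposable_def
proof (intro conjI ballI impI)
  show "Y \<in> Rep_obj C t" using XY by (simp add: Rep_iso_def)
  show "(Y, Rep_zero) \<notin> Rep_iso C t"
    using X Rep_iso_trans[OF XY] unfolding indecomposable_def by blast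
  fix Z W assume "Z \<in> Rep_obj C t" "W \<in> Rep_obj C t" "(Y, Rep_sum Z W) \<in> Rep_iso C t"
  then show "(Z, Rep_zero) \<in> Rep_iso C t \<or> (W, Rep_zero) \<in> Rep_iso C t"
    using X Rep_iso_trans[OF XY] unfolding indecomposable_def by blast
qed

lemma indecomposable_summand:
  assumes X: "indecomposable C t (ks, e)"
  obtains i j r k p f where "(i, j, r) \<in> kys (toL e)" "through_blocks p = through_blocks r"
    "corner_idem k p f" "((ks, e), image_obj k f) \<in> Rep_iso C t"
proof (rule summand)
  show "(ks, e) \<in> Rep_obj C t" using X by (simp add: indecomposable_def)
qed (use indecomposable_trivial[OF X] that in blast)+

text \<open>\<open>u\<close> is a partial isometry from \<open>p\<close> to
  \<open>u \<bullet>\<^sub>p involution u\<close>, so conjugation by it moves \<open>f\<close> into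
  the corner of the latter without changing the image up to isomorphism.\<close>

lemma corner_idem_transport:
  assumes f: "corner_idem k p f" and u: "u \<in> C k l" "involution u \<bullet>\<^sub>p u = p"
  obtains f' where "corner_idem l (u \<bullet>\<^sub>p involution u) f'" "(image_obj k f, image_obj l f') \<in> Rep_iso C t"
proof -
  let ?q = "u \<bullet>\<^sub>p involution u"
  have q: "?q \<in> Proj C l" using Proj_involution_pcomp[OF C_involution[OF u(1)]] by simp
  have p: "p \<in> Proj C k" and fh: "f \<in> hom0 C k k" and ff: "f \<diamondop> f = f"
    and pf: "nproj p \<diamondop> f = f" "f \<diamondop> nproj p = f" using f by (auto simp: corner_idem_def)
  \<comment> \<open>Chosen so that \<open>sg (involution u) c \<diamondop> sg u 1 = nproj p\<close>:
    the first power cancels the loops of this product, the second is the normalisation of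
    \<open>p\<close>.\<close>
  define c where "c = 1 / (t ^ ploops (involution u) u * t ^ ploops p p)"
  define a where "a = sg u 1 \<diamondop> f"
  define b where "b = f \<diamondop> sg (involution u) c"
  have iu: "involution u \<in> C l k" by (rule C_involution[OF u(1)])
  have U: "f \<in> supp_in fin_part" "sg u 1 \<in> supp_in fin_part" "sg (involution u) c \<in> supp_in fin_part"
    "nproj ?q \<in> supp_in fin_part"
    using hom0_U fh single_hom0[OF u(1)] single_hom0[OF iu] nproj_hom0[OF q] by blast+
  have ah: "a \<in> hom0 C k l" unfolding a_def by (rule hom0_mult[OF fh single_hom0[OF u(1)]])
  have bh: "b \<in> hom0 C l k" unfolding b_def by (rule hom0_mult[OF single_hom0[OF iu] fh])
  have aU: "a \<in> supp_in fin_part" and bU: "b \<in> supp_in fin_part" using ah bh hom0_U by auto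
  have "sg (involution u) c \<diamondop> sg u 1 = nproj p"
    unfolding comp0_single u(2) nproj_def c_def by simp
  then have "f \<diamondop> (sg (involution u) c \<diamondop> sg u 1) \<diamondop> f = f" using pf ff by simp
  then have ba: "b \<diamondop> a = f" unfolding a_def b_def using U by (simp add: passoc)
  have af: "a \<diamondop> f = a" unfolding a_def using U ff by (simp add: passoc)
  have fb: "f \<diamondop> b = b" unfolding b_def using U ff by (simp flip: passoc)
  define f' where "f' = a \<diamondop> b"
  have f'f': "f' \<diamondop> f' = f'"
  proof -
    have "f' \<diamondop> f' = a \<diamondop> (b \<diamondop> a) \<diamondop> b" unfolding f'_def using aU bU by (simp add: passoc)
    then show ?thesis using ba af by (simp add: f'_def)
  qed
  have f'h: "f' \<in> hom0 C l l" unfolding f'_def by (rule hom0_mult[OF bh ah])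
  have "?q \<bullet>\<^sub>p u = u" using comp_involution_comp[OF u(1)] by (simp add: pcomp_assoc)
  then have "nproj ?q \<diamondop> sg u 1 = sg u 1" by (rule nproj_single_left[OF q u(1)])
  then have "nproj ?q \<diamondop> a = a" unfolding a_def using U by (simp flip: passoc)
  then have 1: "nproj ?q \<diamondop> f' = f'" unfolding f'_def using aU bU U by (simp flip: passoc)
  have "involution u \<bullet>\<^sub>p ?q = involution u" using comp_involution_comp[OF iu] by simp
  then have "sg (involution u) c \<diamondop> nproj ?q = sg (involution u) c" by (rule nproj_single_right[OF q iu])
  then have "b \<diamondop> nproj ?q = b" unfolding b_def using U by (simp add: passoc)
  then have 2: "f' \<diamondop> nproj ?q = f'" unfolding f'_def using aU bU U by (simp add: passoc)
  have "pequiv k f l f'"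
    unfolding pequiv_def
  proof (rule bexI[OF _ ah], rule bexI[OF _ bh], intro conjI)
    have "f' \<diamondop> a = a \<diamondop> (b \<diamondop> a)" "b \<diamondop> f' = b \<diamondop> a \<diamondop> b" unfolding f'_def using aU bU by (simp_all add: passoc)
    then show "f' \<diamondop> a = a" "b \<diamondop> f' = b" using ba af fb by simp_all
  qed (simp_all add: af fb ba f'_def)
  then have "(image_obj k f, image_obj l f') \<in> Rep_iso C t"
    using fh ff f'h f'f' by (simp add: image_obj_iso)
  then show thesis using that 1 2 q f'h f'f' by (simp add: corner_idem_def)
qed

text \<open>If every partition in \<open>f\<close> had fewer through-blocks than \<open>p\<close>,
  then \<open>indecomposable_summand\<close> for the image of \<open>f\<close> would produce a
  projective partition of smaller rank. If \<open>p\<close> factored through fewer points,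
  \<open>f\<close> could be transported there. Minimality of the rank and then of the number of
  points excludes both, and a last transport reaches the representative in \<open>R\<close>.\<close>

lemma indecomposable_repr:
  assumes X: "indecomposable C t X"
    and R: "\<And>Y. Y \<in> PP C // PP_equiv C \<Longrightarrow> \<exists>x. x \<in> R \<inter> Y"
  obtains k p f where "(k, p) \<in> R" "corner_idem k p f" "(X, image_obj k f) \<in> Rep_iso C t"
    "\<exists>q\<in>kys f. through_blocks p \<le> through_blocks q"
proof -
  define Q where "Q T k \<longleftrightarrow> (\<exists>p f. corner_idem k p f \<and> through_blocks p = T \<and> (X, image_obj k f) \<in> Rep_iso C t)" for T k
  obtain ks e where Xe: "X = (ks, e)" by (cases X)
  obtain i j r k p f where "through_blocks p = through_blocks r" "corner_idem k p f" "(X, image_obj k f) \<in> Rep_iso C t"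
    using indecomposable_summand[of ks e] X unfolding Xe by metis
  then have ex: "\<exists>T k. Q T k" unfolding Q_def by blast
  define T where "T = (LEAST T. \<exists>k. Q T k)"
  have T: "\<exists>k. Q T k" unfolding T_def by (rule LeastI_ex) (rule ex)
  have Tmin: "T \<le> T'" if "Q T' k" for T' k unfolding T_def by (rule Least_le) (use that in blast)
  define k where "k = (LEAST k. Q T k)"
  have "Q T k" unfolding k_def by (rule LeastI_ex) (rule T)
  have kmin: "k \<le> k'" if "Q T k'" for k' unfolding k_def by (rule Least_le) (use that in blast)
  have not_ideal: "\<exists>q\<in>kys f. through_blocks p \<le> through_blocks q"
    if f: "corner_idem l p f" "through_blocks p = T" "(X, image_obj l f) \<in> Rep_iso C t" for l p f
  proof (rule ccontr)
    assume no: "\<not> ?thesis"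
    have ind: "indecomposable C t ([l], snd (image_obj l f))"
      using indecomposable_iso[OF X f(3)] by (simp flip: image_obj_eq)
    obtain i j r k' p' f' where r: "(i, j, r) \<in> kys (toL (snd (image_obj l f)))"
      "through_blocks p' = through_blocks r" "corner_idem k' p' f'"
      "(([l], snd (image_obj l f)), image_obj k' f') \<in> Rep_iso C t"
      by (rule indecomposable_summand[OF ind])
    have "r \<in> kys f"
      using r(1) unfolding snd_image_obj by (auto simp: in_keys_iff lookup_lab split: if_splits)
    then have "through_blocks p' < T" using no f(2) r(2) by auto
    moreover have "(X, image_obj k' f') \<in> Rep_iso C t"
      by (rule Rep_iso_trans[OF f(3)]) (use r(4) in \<open>simp flip: image_obj_eq\<close>)
    then have "Q (through_blocks p') k'" using r(3) unfolding Q_def by blast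
    ultimately show False using Tmin by (meson leD)
  qed
  obtain p f where f: "corner_idem k p f" "through_blocks p = T" "(X, image_obj k f) \<in> Rep_iso C t"
    using \<open>Q T k\<close> unfolding Q_def by blast
  have pP: "p \<in> Proj C k" using f by (simp add: corner_idem_def)
  have pPP: "(k, p) \<in> PP C"
    unfolding PP_def mem_Collect_eq prod.case
  proof (intro conjI allI impI ballI notI)
    fix l b q assume l: "l < k" and b: "b \<in> C k l" and q: "q \<in> Proj C l"
      and p: "p = involution b \<bullet>\<^sub>p q \<bullet>\<^sub>p b"
    \<comment> \<open>Inserting \<open>q\<close>, which is idempotent and equal to its involution,
      gives a partial isometry with initial projection \<open>p\<close>.\<close>
    let ?u = "q \<bullet>\<^sub>p b"
    have u: "?u \<in> C k l" by (rule C_comp[OF b Proj_C[OF q]])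
    have "involution ?u \<bullet>\<^sub>p ?u = involution b \<bullet>\<^sub>p (q \<bullet>\<^sub>p q) \<bullet>\<^sub>p b"
      by (simp add: involution_pcomp Proj_involution[OF q] pcomp_assoc)
    then have uu: "involution ?u \<bullet>\<^sub>p ?u = p" using p Proj_idem[OF q] by simp
    obtain f' where f': "corner_idem l (?u \<bullet>\<^sub>p involution ?u) f'" "(image_obj k f, image_obj l f') \<in> Rep_iso C t"
      by (rule corner_idem_transport[OF f(1) u uu])
    have "through_blocks (?u \<bullet>\<^sub>p involution ?u) = T"
      using through_involution_comp[OF C_involution[OF u]] through_involution_comp[OF u] uu f(2)
      by (simp add: through_blocks_involution)
    then have "Q T l" using f' Rep_iso_trans[OF f(3) f'(2)] unfolding Q_def by blast
    then show False using kmin l by (meson leD)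
  qed (rule pP)
  have "(k, p) \<in> PP_equiv C `` {(k, p)}"
    using pPP Proj_C[OF pP] Proj_idem[OF pP] Proj_involution[OF pP]
    by (auto simp: PP_equiv_def intro!: bexI[of _ p])
  have "PP_equiv C `` {(k, p)} \<in> PP C // PP_equiv C" using pPP by (rule quotientI)
  then obtain x where "x \<in> R" "x \<in> PP_equiv C `` {(k, p)}" using R by blast
  then obtain p' where p': "(k, p') \<in> R" "((k, p), (k, p')) \<in> PP_equiv C"
    by (cases x) (auto simp: PP_equiv_def)
  then obtain s where s: "s \<in> C k k" "s \<bullet>\<^sub>p involution s = p" "involution s \<bullet>\<^sub>p s = p'"
    by (auto simp: PP_equiv_def)
  \<comment> \<open>The transport runs along the involution of \<open>s\<close>, whose initial
    projection is \<open>p\<close> and whose final one is \<open>p'\<close>.\<close>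
  obtain f' where f'': "corner_idem k (involution s \<bullet>\<^sub>p involution (involution s)) f'"
    "(image_obj k f, image_obj k f') \<in> Rep_iso C t"
    by (rule corner_idem_transport[OF f(1) C_involution[OF s(1)]]) (simp_all add: s(2))
  then have f': "corner_idem k p' f'" "(image_obj k f, image_obj k f') \<in> Rep_iso C t"
    by (simp_all add: s(3))
  have T': "through_blocks p' = T"
    using through_involution_comp[OF s(1)] through_involution_comp[OF C_involution[OF s(1)]] s f(2)
    by (simp add: through_blocks_involution)
  have iso: "(X, image_obj k f') \<in> Rep_iso C t" by (rule Rep_iso_trans[OF f(3) f'(2)])
  show thesis by (rule that[OF p'(1) f'(1) iso not_ideal[OF f'(1) T' iso]])
qed

text \<open>A partition of full rank in \<open>e = b \<diamondop> a\<close> is a product of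
  partitions from the two supports. Rank does not rise under composition, so the factor
  \<open>u\<close> from \<open>a\<close> has full rank, and it inherits the absorption laws of
  \<open>a\<close>.\<close>

lemma pequiv_through:
  assumes e: "corner_idem k p e" and f: "corner_idem l q f" and a: "a \<in> hom0 C k l" and b: "b \<in> hom0 C l k"
    and ab: "a \<diamondop> e = a" "f \<diamondop> a = a" "b \<diamondop> a = e"
    and x: "\<exists>x\<in>kys e. through_blocks p \<le> through_blocks x"
  obtains u where "u \<in> C k l" "q \<bullet>\<^sub>p u = u" "u \<bullet>\<^sub>p p = u" "through_blocks p \<le> through_blocks u"
    "through_blocks u \<le> through_blocks q"
proof -
  have p: "p \<in> Proj C k" "e \<in> hom0 C k k" "e \<diamondop> nproj p = e" and q: "q \<in> Proj C l" "f \<in> hom0 C l l" "nproj q \<diamondop> f = f"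
    using e f by (auto simp: corner_idem_def)
  have U: "nproj p \<in> supp_in fin_part" "nproj q \<in> supp_in fin_part" "e \<in> supp_in fin_part"
    "f \<in> supp_in fin_part" "a \<in> supp_in fin_part"
    using nproj_hom0[OF p(1)] nproj_hom0[OF q(1)] p q a hom0_U by blast+
  have "nproj q \<diamondop> (f \<diamondop> a) = f \<diamondop> a" using U q(3) by (simp flip: passoc)
  then have qa: "\<forall>r\<in>kys a. q \<bullet>\<^sub>p r = r" using ab nproj_left_iff[OF q(1) a] by simp
  have "a \<diamondop> e \<diamondop> nproj p = a \<diamondop> e" using U p(3) by (simp add: passoc)
  then have ap: "\<forall>r\<in>kys a. r \<bullet>\<^sub>p p = r" using ab nproj_right_iff[OF p(1) a] by simp
  obtain x where x: "x \<in> kys e" "through_blocks p \<le> through_blocks x" using x by blast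
  then have "x \<in> kys (b \<diamondop> a)" by (simp only: ab(3))
  then obtain v u where vu: "v \<in> kys b" "u \<in> kys a" "x = v \<bullet>\<^sub>p u" by (rule keys_comp0E)
  have uC: "u \<in> C k l" "v \<in> C l k" using vu a b by (auto simp: hom0_def)
  have "through_blocks p \<le> through_blocks u" using x through_le(1)[OF uC] vu by simp
  moreover have "through_blocks u \<le> through_blocks q"
    using through_le(2)[OF uC(1) Proj_C[OF q(1)]] qa vu(2) by simp
  ultimately show thesis using that uC qa ap vu(2) by blast
qed

text \<open>The ranks of \<open>p\<close> and \<open>q\<close> bound each other, so \<open>u\<close>
  has full rank at both ends and is a partial isometry between the two. If \<open>k\<close> and
  \<open>l\<close> differed, the projection on more points would factor through fewer, against
  membership in \<open>PP\<close>.\<close>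

lemma pequiv_PP_equiv:
  assumes kp: "(k, p) \<in> PP C" and lq: "(l, q) \<in> PP C" and e: "corner_idem k p e" and f: "corner_idem l q f"
    and x: "\<exists>x\<in>kys e. through_blocks p \<le> through_blocks x"
    and y: "\<exists>y\<in>kys f. through_blocks q \<le> through_blocks y"
    and equiv: "pequiv k e l f"
  shows "((k, p), (l, q)) \<in> PP_equiv C"
proof -
  obtain a b where ab: "a \<in> hom0 C k l" "b \<in> hom0 C l k" "a \<diamondop> e = a" "f \<diamondop> a = a" "b \<diamondop> f = b" "e \<diamondop> b = b"
    "b \<diamondop> a = e" "a \<diamondop> b = f" using equiv unfolding pequiv_def by blast
  obtain u where u: "u \<in> C k l" "q \<bullet>\<^sub>p u = u" "u \<bullet>\<^sub>p p = u" "through_blocks p \<le> through_blocks u"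
    "through_blocks u \<le> through_blocks q"
    by (rule pequiv_through[OF e f ab(1,2,3,4,7) x])
  obtain v where v: "through_blocks q \<le> through_blocks v" "through_blocks v \<le> through_blocks p"
    by (rule pequiv_through[OF f e ab(2,1,5,6,8) y])
  have p: "p \<in> Proj C k" and q: "q \<in> Proj C l" using e f by (auto simp: corner_idem_def)
  obtain p\<^sub>0 q\<^sub>0 where P: "projective k p p\<^sub>0" and Q: "projective l q q\<^sub>0" using Proj_projective p q by blast
  have uq: "u \<bullet>\<^sub>p involution u = q"
    by (rule projective.pcomp_involution_eq_p[OF Q C_parts[OF u(1)] u(2)]) (use u v in simp)
  have iu: "involution u \<in> C l k" by (rule C_involution[OF u(1)])
  have piu: "p \<bullet>\<^sub>p involution u = involution u"
    using u(3) involution_pcomp[of u p] Proj_involution[OF p] by simp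
  have up: "involution u \<bullet>\<^sub>p u = p"
    using projective.pcomp_involution_eq_p[OF P C_parts[OF iu] piu] u(4)
    by (simp add: through_blocks_involution)
  have "\<not> l < k"
  proof
    assume "l < k"
    moreover have "p = involution u \<bullet>\<^sub>p q \<bullet>\<^sub>p u" using up u(2) by (simp add: pcomp_assoc)
    ultimately show False using kp u(1) q unfolding PP_def by auto
  qed
  moreover have "\<not> k < l"
  proof
    assume "k < l"
    moreover have "q = involution (involution u) \<bullet>\<^sub>p p \<bullet>\<^sub>p involution u"
      using uq piu by (simp add: pcomp_assoc)
    ultimately show False using lq iu p unfolding PP_def by blast
  qed
  ultimately have "k = l" by simp
  then show ?thesis using kp lq iu uq up by (auto simp: PP_equiv_def intro!: bexI[of _ "involution u"])
qed

lemma PP_equiv_self: "(k, p) \<in> PP C \<Longrightarrow> ((k, p), (k, p)) \<in> PP_equiv C"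
proof -
  assume kp: "(k, p) \<in> PP C"
  then have pP: "p \<in> Proj C k" by (simp add: PP_def)
  show ?thesis
    using kp Proj_C[OF pP] Proj_idem[OF pP] Proj_involution[OF pP]
    by (auto simp: PP_equiv_def intro!: bexI[of _ p])
qed

lemma indecomposable_prim:
  assumes f: "f \<in> hom0 C k k" "f \<diamondop> f = f" and ind: "indecomposable C t (image_obj k f)"
  shows "part_alg.prim t (hom0 C k k) f"
  unfolding part_alg.prim_def
proof (intro conjI ballI impI)
  have ind': "indecomposable C t ([k], snd (image_obj k f))" using ind by (simp flip: image_obj_eq)
  note triv = indecomposable_trivial[OF ind', unfolded snd_image_obj]
  show "f \<noteq> 0" using triv(1) by auto
  fix g assume g: "g \<in> hom0 C k k" "g \<diamondop> g = g" "f \<diamondop> g = g" "g \<diamondop> f = g"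
  have "lab 0 0 g = 0 \<or> lab 0 0 g = lab 0 0 f" by (rule triv(2)) (use g in \<open>simp_all add: lab_LH\<close>)
  then show "g = 0 \<or> g = f" using lab_inject[of 0 0 g 0] by (simp add: lab_inject)
qed (rule f)+

end

section \<open>Representations of finite groups\<close>

subsection \<open>Linear maps between spaces of column vectors\<close>

lemma linear_map_mat:
  fixes T :: "complex vec \<Rightarrow> complex vec"
  assumes T: "\<And>v. v \<in> carrier_vec n \<Longrightarrow> T v \<in> carrier_vec m"
    and add: "\<And>v w. v \<in> carrier_vec n \<Longrightarrow> w \<in> carrier_vec n \<Longrightarrow> T (v + w) = T v + T w"
    and scale: "\<And>c v. v \<in> carrier_vec n \<Longrightarrow> T (c \<cdot>\<^sub>v v) = c \<cdot>\<^sub>v T v"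
    and v: "v \<in> carrier_vec n"
  shows "mat m n (\<lambda>(i, j). T (unit_vec n j) $ i) *\<^sub>v v = T v"
proof (rule eq_vecI)
  \<comment> \<open>Truncation of \<open>v\<close> to its first \<open>k\<close> coordinates; the
    induction below adds one coordinate at a time.\<close>
  define u where "u k = vec n (\<lambda>i. if i < k then v $ i else 0)" for k
  have u: "u k \<in> carrier_vec n" for k by (simp add: u_def)
  have main: "T (u k) $ i = (\<Sum>j<k. v $ j * T (unit_vec n j) $ i)" if "k \<le> n" "i < m" for k i
    using that(1)
  proof (induction k)
    case 0
    have "u 0 = 0 \<cdot>\<^sub>v u 0" by (rule eq_vecI) (auto simp: u_def)
    then have "T (u 0) = 0 \<cdot>\<^sub>v T (u 0)" using scale[OF u[of 0], of 0] by simp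
    moreover have "(0 \<cdot>\<^sub>v T (u 0)) $ i = 0" using T[OF u[of 0]] that(2) by simp
    ultimately show ?case by simp
  next
    case (Suc k)
    have "u (Suc k) = u k + v $ k \<cdot>\<^sub>v unit_vec n k"
      using Suc.prems by (intro eq_vecI) (auto simp: u_def less_Suc_eq)
    then have "T (u (Suc k)) = T (u k) + v $ k \<cdot>\<^sub>v T (unit_vec n k)"
      using add[OF u, of "v $ k \<cdot>\<^sub>v unit_vec n k" k] scale[of "unit_vec n k" "v $ k"] by simp
    then show ?case
      using Suc T[OF u[of k]] T[of "unit_vec n k"] that(2) by simp
  qed
  have un: "u n = v" using v by (intro eq_vecI) (auto simp: u_def)
  fix i assume "i < dim_vec (T v)"
  then have i: "i < m" using T[OF v] by simp
  have "(mat m n (\<lambda>(i, j). T (unit_vec n j) $ i) *\<^sub>v v) $ i = (\<Sum>j<n. T (unit_vec n j) $ i * v $ j)"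
    using i v by (simp add: scalar_prod_def atLeast0LessThan)
  also have "\<dots> = T v $ i" using main[of n i] i un by (simp add: mult.commute)
  finally show "(mat m n (\<lambda>(i, j). T (unit_vec n j) $ i) *\<^sub>v v) $ i = T v $ i" .
qed (use T[OF v] in simp)

lemma mat_eqI_vec:
  fixes A B :: "complex mat"
  assumes A: "A \<in> carrier_mat m n" and B: "B \<in> carrier_mat m n"
    and eq: "\<And>v. v \<in> carrier_vec n \<Longrightarrow> A *\<^sub>v v = B *\<^sub>v v"
  shows "A = B"
proof (rule eq_matI)
  fix i j assume ij: "i < dim_row B" "j < dim_col B"
  have *: "(M *\<^sub>v unit_vec n j) $ i = M $$ (i, j)" if "M \<in> carrier_mat m n" for M :: "complex mat"
    using that ij B by (simp add: scalar_prod_right_unit)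
  show "A $$ (i, j) = B $$ (i, j)" using *[OF A] *[OF B] eq[of "unit_vec n j"] by simp
qed (use A B in auto)

text \<open>The two products have the same trace, and in characteristic zero the trace of an
  identity matrix determines its size.\<close>

lemma inverse_mats_same_dim:
  fixes A B :: "complex mat"
  assumes A: "A \<in> carrier_mat m n" and B: "B \<in> carrier_mat n m" and AB: "A * B = 1\<^sub>m m" and BA: "B * A = 1\<^sub>m n"
  shows "m = n"
proof -
  have tr: "(\<Sum>i<m. (1\<^sub>m m :: complex mat) $$ (i, i)) = of_nat m" for m by simp
  have "(\<Sum>i<m. (A * B) $$ (i, i)) = (\<Sum>i<m. \<Sum>j<n. A $$ (i, j) * B $$ (j, i))"
    using A B by (intro sum.cong refl) (simp add: scalar_prod_def atLeast0LessThan)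
  also have "\<dots> = (\<Sum>j<n. \<Sum>i<m. B $$ (j, i) * A $$ (i, j))"
    by (subst sum.swap) (simp add: mult.commute)
  also have "\<dots> = (\<Sum>j<n. (B * A) $$ (j, j))"
    using A B by (intro sum.cong refl) (simp add: scalar_prod_def atLeast0LessThan)
  finally have "(of_nat m :: complex) = of_nat n" unfolding AB BA tr .
  then show ?thesis by simp
qed

lemma rep_isoI:
  fixes T :: "complex vec \<Rightarrow> complex vec"
  assumes \<rho>: "matrix_rep G (n, \<rho>)" and \<tau>: "matrix_rep G (m, \<tau>)"
    and T: "bij_betw T (carrier_vec n) (carrier_vec m)"
    and add: "\<And>v w. v \<in> carrier_vec n \<Longrightarrow> w \<in> carrier_vec n \<Longrightarrow> T (v + w) = T v + T w"
    and scale: "\<And>c v. v \<in> carrier_vec n \<Longrightarrow> T (c \<cdot>\<^sub>v v) = c \<cdot>\<^sub>v T v"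
    and equi: "\<And>x v. x \<in> carrier G \<Longrightarrow> v \<in> carrier_vec n \<Longrightarrow> T (\<rho> x *\<^sub>v v) = \<tau> x *\<^sub>v T v"
  shows "((n, \<rho>), (m, \<tau>)) \<in> rep_iso G"
proof -
  define S where "S = inv_into (carrier_vec n) T"
  have ST: "S (T v) = v" if "v \<in> carrier_vec n" for v
    unfolding S_def by (rule bij_betw_inv_into_left[OF T that])
  have TS: "T (S v) = v" if "v \<in> carrier_vec m" for v
    unfolding S_def by (rule bij_betw_inv_into_right[OF T that])
  have Tc: "T v \<in> carrier_vec m" if "v \<in> carrier_vec n" for v using T that by (auto dest: bij_betwE)
  have Sc: "S v \<in> carrier_vec n" if "v \<in> carrier_vec m" for v
    using bij_betw_inv_into[OF T] that unfolding S_def by (auto dest: bij_betwE)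
  have Sadd: "S (v + w) = S v + S w" if "v \<in> carrier_vec m" "w \<in> carrier_vec m" for v w
    using ST[of "S v + S w"] add[of "S v" "S w"] Sc TS that by simp
  have Sscale: "S (c \<cdot>\<^sub>v v) = c \<cdot>\<^sub>v S v" if "v \<in> carrier_vec m" for c v
    using ST[of "c \<cdot>\<^sub>v S v"] scale[of "S v" c] Sc TS that by simp
  define A where "A = mat m n (\<lambda>(i, j). T (unit_vec n j) $ i)"
  define B where "B = mat n m (\<lambda>(i, j). S (unit_vec m j) $ i)"
  have Ac: "A \<in> carrier_mat m n" and Bc: "B \<in> carrier_mat n m" by (simp_all add: A_def B_def)
  have Av: "A *\<^sub>v v = T v" if "v \<in> carrier_vec n" for v
    unfolding A_def by (rule linear_map_mat[OF Tc add scale that])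
  have Bv: "B *\<^sub>v v = S v" if "v \<in> carrier_vec m" for v
    unfolding B_def by (rule linear_map_mat[OF Sc Sadd Sscale that])
  have AB: "A * B = 1\<^sub>m m"
    by (rule mat_eqI_vec[of _ m m]) (use Ac Bc in \<open>simp_all add: Av Bv Sc TS assoc_mult_mat_vec[of A m n]\<close>)
  have BA: "B * A = 1\<^sub>m n"
    by (rule mat_eqI_vec[of _ n n]) (use Ac Bc in \<open>simp_all add: Av Bv Tc ST assoc_mult_mat_vec[of B n m]\<close>)
  have mn: "m = n" by (rule inverse_mats_same_dim[OF Ac Bc AB BA])
  have "invertible_mat A"
    using Ac Bc AB BA mn unfolding invertible_mat_def inverts_mat_def by (auto intro!: exI[of _ B])
  moreover have "A * \<rho> x = \<tau> x * A" if x: "x \<in> carrier G" for x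
  proof (rule mat_eqI_vec[of _ m n])
    have c: "\<rho> x \<in> carrier_mat n n" "\<tau> x \<in> carrier_mat m m" using \<rho> \<tau> x by (auto simp: matrix_rep_def)
    then show "A * \<rho> x \<in> carrier_mat m n" "\<tau> x * A \<in> carrier_mat m n" using Ac by auto
    fix v :: "complex vec" assume v: "v \<in> carrier_vec n"
    have "\<rho> x *\<^sub>v v \<in> carrier_vec n" using c v by auto
    then show "A * \<rho> x *\<^sub>v v = \<tau> x * A *\<^sub>v v"
      using equi[OF x v] Av Ac c v by (simp add: assoc_mult_mat_vec[of A m n] assoc_mult_mat_vec[of "\<tau> x" m m])
  qed
  ultimately show ?thesis using \<rho> \<tau> mn Ac unfolding rep_iso_def by auto
qed

text \<open>Both directions are kept as functions, so that isomorphisms are inverted and composed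
  without computing with matrices.\<close>

definition intertwiner where
  "intertwiner G n \<rho> m \<tau> T S \<longleftrightarrow> (\<forall>v\<in>carrier_vec n. T v \<in> carrier_vec m \<and> S (T v) = v) \<and>
     (\<forall>v\<in>carrier_vec m. S v \<in> carrier_vec n \<and> T (S v) = v) \<and>
     (\<forall>v\<in>carrier_vec n. \<forall>w\<in>carrier_vec n. T (v + w) = T v + T w) \<and>
     (\<forall>c. \<forall>v\<in>carrier_vec n. T (c \<cdot>\<^sub>v v) = c \<cdot>\<^sub>v T v) \<and>
     (\<forall>x\<in>carrier G. \<forall>v\<in>carrier_vec n. T (\<rho> x *\<^sub>v v) = \<tau> x *\<^sub>v T v)"

lemma intertwinerD:
  assumes "intertwiner G n \<rho> m \<tau> T S"
  shows "v \<in> carrier_vec n \<Longrightarrow> T v \<in> carrier_vec m" "v \<in> carrier_vec m \<Longrightarrow> S v \<in> carrier_vec n"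
    "v \<in> carrier_vec n \<Longrightarrow> S (T v) = v" "v \<in> carrier_vec m \<Longrightarrow> T (S v) = v"
    "v \<in> carrier_vec n \<Longrightarrow> w \<in> carrier_vec n \<Longrightarrow> T (v + w) = T v + T w"
    "v \<in> carrier_vec n \<Longrightarrow> T (c \<cdot>\<^sub>v v) = c \<cdot>\<^sub>v T v"
    "x \<in> carrier G \<Longrightarrow> v \<in> carrier_vec n \<Longrightarrow> T (\<rho> x *\<^sub>v v) = \<tau> x *\<^sub>v T v"
  using assms unfolding intertwiner_def by blast+

lemma rep_isoE:
  assumes "((n, \<rho>), (m, \<tau>)) \<in> rep_iso G"
  obtains T S where "intertwiner G n \<rho> m \<tau> T S"
proof -
  obtain A where A: "matrix_rep G (n, \<rho>)" "matrix_rep G (m, \<tau>)" "n = m" "A \<in> carrier_mat n n" "invertible_mat A"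
    "\<And>x. x \<in> carrier G \<Longrightarrow> A * \<rho> x = \<tau> x * A"
    using assms unfolding rep_iso_def by auto
  obtain B where "A * B = 1\<^sub>m (dim_row A)" "B * A = 1\<^sub>m (dim_row B)"
    using A(5) unfolding invertible_mat_def inverts_mat_def by auto
  moreover from this have "B \<in> carrier_mat n n"
    using A(4) by (metis carrier_matD carrier_mat_triv index_mult_mat(2,3) index_one_mat(2,3))
  ultimately have B: "B \<in> carrier_mat n n" "A * B = 1\<^sub>m n" "B * A = 1\<^sub>m n" using A(4) by auto
  have "intertwiner G n \<rho> m \<tau> (\<lambda>v. A *\<^sub>v v) (\<lambda>v. B *\<^sub>v v)"
    unfolding intertwiner_def
  proof (intro conjI ballI allI)
    fix v w :: "complex vec" and c :: complex and x
    show "A *\<^sub>v v \<in> carrier_vec m" if "v \<in> carrier_vec n" using A(3,4) that by auto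
    show "B *\<^sub>v v \<in> carrier_vec n" if "v \<in> carrier_vec m" using B(1) A(3) that by auto
    show "B *\<^sub>v (A *\<^sub>v v) = v" if "v \<in> carrier_vec n"
      using assoc_mult_mat_vec[OF B(1) A(4) that] B(3) that by simp
    show "A *\<^sub>v (B *\<^sub>v v) = v" if "v \<in> carrier_vec m"
      using assoc_mult_mat_vec[OF A(4) B(1), of v] B(2) that A(3) by simp
    show "A *\<^sub>v (v + w) = A *\<^sub>v v + A *\<^sub>v w" if "v \<in> carrier_vec n" "w \<in> carrier_vec n"
      using mult_add_distrib_mat_vec[OF A(4) that] .
    show "A *\<^sub>v (c \<cdot>\<^sub>v v) = c \<cdot>\<^sub>v (A *\<^sub>v v)" if "v \<in> carrier_vec n"
      using mult_mat_vec[OF A(4) that] .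
    show "A *\<^sub>v (\<rho> x *\<^sub>v v) = \<tau> x *\<^sub>v (A *\<^sub>v v)" if "x \<in> carrier G" "v \<in> carrier_vec n"
    proof -
      have c: "\<rho> x \<in> carrier_mat n n" "\<tau> x \<in> carrier_mat n n"
        using A(1-3) that(1) by (auto simp: matrix_rep_def)
      show ?thesis
        using assoc_mult_mat_vec[OF A(4) c(1) that(2)] assoc_mult_mat_vec[OF c(2) A(4) that(2)] A(6)[OF that(1)] by simp
    qed
  qed
  then show thesis by (rule that)
qed

subsection \<open>Group algebras\<close>

lemma ga_mult_eq: "ga_mult G = twisted_mult (mult G) (\<lambda>_ _. 1)"
  by (intro ext) (simp add: ga_mult_def twisted_mult_def)

lemma group_algebra_eq: "group_algebra G = supp_in (carrier G)"
  by (simp add: group_algebra_def supp_in_def)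

locale finite_group = group G for G (structure) +
  assumes finite_carrier: "finite (carrier G)"
begin

sublocale ga_sg: twisted_semigroup "mult G" "\<lambda>_ _. 1" "carrier G"
  by unfold_locales (auto simp: m_assoc)

sublocale ga: lin_alg pscale "group_algebra G" "ga_mult G"
  unfolding ga_mult_eq group_algebra_eq by unfold_locales

abbreviation gmult (infixl "\<cdot>\<^sub>G" 70) where "a \<cdot>\<^sub>G b \<equiv> ga_mult G a b"

abbreviation el where "el x \<equiv> sg x (1::complex)"

lemma single_mult: "sg x a \<cdot>\<^sub>G sg y b = sg (x \<otimes> y) (a * b)"
  by (simp add: ga_mult_eq twisted_mult_single)

lemma el_in: "x \<in> carrier G \<Longrightarrow> sg x c \<in> group_algebra G"
  unfolding group_algebra_eq by (rule single_supp_in)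

lemma one_left: "a \<in> group_algebra G \<Longrightarrow> el \<one> \<cdot>\<^sub>G a = a"
  unfolding ga_mult_eq by (rule twisted_mult_id_left) (auto simp: twisted_mult_single group_algebra_def)

lemma one_right: "a \<in> group_algebra G \<Longrightarrow> a \<cdot>\<^sub>G el \<one> = a"
  unfolding ga_mult_eq by (rule twisted_mult_id_right) (auto simp: twisted_mult_single group_algebra_def)

lemma scalar_mult: "a \<in> group_algebra G \<Longrightarrow> sg \<one> c \<cdot>\<^sub>G a = pscale c a"
  using ga.mult_scale_left[of c "el \<one>" a] one_left by simp

lemma left_ideal_iff:
  assumes "e \<in> group_algebra G" "e \<cdot>\<^sub>G e = e"
  shows "x \<in> left_ideal G e \<longleftrightarrow> x \<in> group_algebra G \<and> x \<cdot>\<^sub>G e = x"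
proof
  assume "x \<in> left_ideal G e"
  then obtain a where "a \<in> group_algebra G" "x = a \<cdot>\<^sub>G e" by (auto simp: left_ideal_def)
  then show "x \<in> group_algebra G \<and> x \<cdot>\<^sub>G e = x" using assms by (simp add: ga.mult_assoc)
next
  assume "x \<in> group_algebra G \<and> x \<cdot>\<^sub>G e = x"
  then show "x \<in> left_ideal G e" unfolding left_ideal_def mem_Collect_eq by (intro exI[of _ x]) simp
qed

definition left_submodule :: "('a \<Rightarrow>\<^sub>0 complex) set \<Rightarrow> bool" where
  "left_submodule K \<longleftrightarrow> pm.subspace K \<and> K \<subseteq> group_algebra G \<and>
     (\<forall>x\<in>carrier G. \<forall>k\<in>K. el x \<cdot>\<^sub>G k \<in> K)"

lemma expand: "a = (\<Sum>x\<in>kys a. pscale (lk a x) (el x))"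
  by (simp add: sum_singles)

lemma left_submodule_mult:
  assumes K: "left_submodule K" and a: "a \<in> group_algebra G" and k: "k \<in> K"
  shows "a \<cdot>\<^sub>G k \<in> K"
proof -
  have "(\<Sum>x\<in>kys a. pscale (lk a x) (el x \<cdot>\<^sub>G k)) \<in> K"
    using K a k unfolding left_submodule_def
    by (intro pm.subspace_sum pm.subspace_scale) (auto simp: group_algebra_def)
  moreover have "a \<cdot>\<^sub>G k = (\<Sum>x\<in>kys a. pscale (lk a x) (el x \<cdot>\<^sub>G k))"
    by (subst expand) (simp only: ga.mult_sum_left ga.mult_scale_left)
  ultimately show ?thesis by simp
qed

text \<open>Maschke: averaging a linear projection onto \<open>K\<close> over the group makes it \<open>G\<close>-linear, hence right
  multiplication by the image of \<open>1\<close>.\<close>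

lemma maschke:
  assumes K: "left_submodule K"
  obtains w where "w \<in> K" "\<And>x. x \<in> K \<Longrightarrow> x \<cdot>\<^sub>G w = x"
proof -
  interpret vp: vector_space_pair pscale pscale by unfold_locales
  have subK: "pm.subspace K" and KU: "K \<subseteq> group_algebra G" using K by (auto simp: left_submodule_def)
  have "Vector_Spaces.linear pscale pscale (\<lambda>x. x)"
    by (rule pm.linear_ident)
  then obtain P where P: "range P \<subseteq> K" "Vector_Spaces.linear pscale pscale P" "\<And>v. v \<in> K \<Longrightarrow> P v = v"
    using vp.linear_exists_left_inverse_on[of "\<lambda>x. x" K] subK by auto
  interpret P: Vector_Spaces.linear pscale pscale P by (rule P(2))
  have PK: "P v \<in> K" for v using P(1) by auto
  define c :: complex where "c = 1 / of_nat (card (carrier G))"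
  have card: "(of_nat (card (carrier G)) :: complex) \<noteq> 0" using finite_carrier one_closed by (auto simp: card_eq_0_iff)
  define Q where "Q x = pscale c (\<Sum>g\<in>carrier G. el g \<cdot>\<^sub>G P (el (inv g) \<cdot>\<^sub>G x))" for x
  have Q_add: "Q (x + y) = Q x + Q y" for x y
    by (simp add: Q_def ga.mult_add_right P.add sum.distrib pm.scale_right_distrib)
  have Q_0: "Q 0 = 0" using Q_add[of 0 0] by simp
  have Q_scale: "Q (pscale a x) = pscale a (Q x)" for a x
    by (simp add: Q_def ga.mult_scale_right P.scale mult.commute flip: pm.scale_sum_right)
  have Q_sum: "Q (sum f S) = (\<Sum>s\<in>S. Q (f s))" for f :: "'a \<Rightarrow> _" and S
    by (induction S rule: infinite_finite_induct) (simp_all add: Q_add Q_0)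
  have Q_K: "Q x \<in> K" for x
    unfolding Q_def using K PK left_submodule_mult[OF K el_in]
    by (intro pm.subspace_scale subK pm.subspace_sum) auto
  have Q_id: "Q x = x" if x: "x \<in> K" for x
  proof -
    have "el g \<cdot>\<^sub>G P (el (inv g) \<cdot>\<^sub>G x) = x" if g: "g \<in> carrier G" for g
    proof -
      have xU: "x \<in> group_algebra G" using x KU by auto
      have "P (el (inv g) \<cdot>\<^sub>G x) = el (inv g) \<cdot>\<^sub>G x" by (rule P(3)[OF left_submodule_mult[OF K el_in x]]) (simp add: g)
      then have "el g \<cdot>\<^sub>G P (el (inv g) \<cdot>\<^sub>G x) = el g \<cdot>\<^sub>G el (inv g) \<cdot>\<^sub>G x"
        using g xU by (simp add: ga.mult_assoc el_in)
      then show ?thesis using g xU by (simp add: single_mult one_left)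
    qed
    then have "Q x = pscale c (\<Sum>g\<in>carrier G. x)" by (simp add: Q_def)
    then show ?thesis using card by (simp add: pm.sum_constant_scale c_def)
  qed
  have Q_el: "el h \<cdot>\<^sub>G Q (el \<one>) = Q (el h)" if h: "h \<in> carrier G" for h
  proof -
    have PU: "P v \<in> group_algebra G" for v using PK KU by auto
    have "el h \<cdot>\<^sub>G Q (el \<one>) = pscale c (\<Sum>g\<in>carrier G. el (h \<otimes> g) \<cdot>\<^sub>G P (el (inv g)))"
      using h PU unfolding Q_def
      by (simp add: ga.mult_scale_right ga.mult_sum_right one_right el_in single_mult flip: ga.mult_assoc)
    \<comment> \<open>Replacing g by its product with the inverse of h moves the factor h from the
      left of \<open>P\<close> into its argument.\<close>
    also have "(\<Sum>g\<in>carrier G. el (h \<otimes> g) \<cdot>\<^sub>G P (el (inv g)))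
      = (\<Sum>g\<in>carrier G. el g \<cdot>\<^sub>G P (el (inv g \<otimes> h)))"
      by (rule sum.reindex_bij_witness[of _ "\<lambda>g. inv h \<otimes> g" "\<lambda>g. h \<otimes> g"])
        (use h in \<open>auto simp: inv_mult_group m_assoc simp flip: m_assoc[of h "inv h"] m_assoc[of "inv h" h]\<close>)
    finally show ?thesis by (simp add: Q_def single_mult)
  qed
  show thesis
  proof (rule that[of "Q (el \<one>)"])
    fix x assume x: "x \<in> K"
    have "x \<cdot>\<^sub>G Q (el \<one>) = (\<Sum>h\<in>kys x. pscale (lk x h) (el h \<cdot>\<^sub>G Q (el \<one>)))"
      by (subst (1) expand) (simp only: ga.mult_sum_left ga.mult_scale_left)
    also have "\<dots> = (\<Sum>h\<in>kys x. pscale (lk x h) (Q (el h)))"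
    proof (intro sum.cong refl)
      fix h assume "h \<in> kys x"
      then have "h \<in> carrier G" using x KU by (auto simp: group_algebra_def)
      then show "pscale (lk x h) (el h \<cdot>\<^sub>G Q (el \<one>)) = pscale (lk x h) (Q (el h))" by (simp only: Q_el)
    qed
    also have "\<dots> = Q (\<Sum>h\<in>kys x. pscale (lk x h) (el h))" by (simp only: Q_sum Q_scale)
    also have "\<dots> = x" using Q_id[OF x] by (simp add: sum_singles)
    finally show "x \<cdot>\<^sub>G Q (el \<one>) = x" .
  qed (rule Q_K)
qed

section \<open>Representations afforded by left ideals\<close>

lemma left_submodule_left_ideal:
  assumes "e \<in> group_algebra G" "e \<cdot>\<^sub>G e = e"
  shows "left_submodule (left_ideal G e)"
proof -
  have L: "left_ideal G e = {x \<in> group_algebra G. x \<cdot>\<^sub>G e = x}"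
    by (rule Set.set_eqI) (simp add: left_ideal_iff[OF assms])
  show ?thesis
    unfolding left_submodule_def L
  proof (intro conjI ballI)
    show "pm.subspace {x \<in> group_algebra G. x \<cdot>\<^sub>G e = x}"
      using ga.subspace_U
      by (intro pm.subspaceI) (auto simp: pm.subspace_0 pm.subspace_add pm.subspace_scale ga.bilin)
    fix x k assume "x \<in> carrier G" "k \<in> {x \<in> group_algebra G. x \<cdot>\<^sub>G e = x}"
    then show "el x \<cdot>\<^sub>G k \<in> {x \<in> group_algebra G. x \<cdot>\<^sub>G e = x}"
      using assms el_in ga.mult_assoc[of "el x" k e] by auto
  qed auto
qed

definition module_coords ::
  "('a \<Rightarrow>\<^sub>0 complex) \<Rightarrow> nat \<Rightarrow> ('a \<Rightarrow> complex mat) \<Rightarrow> (('a \<Rightarrow>\<^sub>0 complex) \<Rightarrow> complex vec)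
    \<Rightarrow> (complex vec \<Rightarrow> ('a \<Rightarrow>\<^sub>0 complex)) \<Rightarrow> bool" where
  "module_coords e n \<rho> \<phi> \<psi> \<longleftrightarrow>
     (\<forall>x\<in>left_ideal G e. \<phi> x \<in> carrier_vec n) \<and> (\<forall>v\<in>carrier_vec n. \<psi> v \<in> left_ideal G e) \<and>
     (\<forall>x\<in>left_ideal G e. \<psi> (\<phi> x) = x) \<and> (\<forall>v\<in>carrier_vec n. \<phi> (\<psi> v) = v) \<and>
     (\<forall>x\<in>left_ideal G e. \<forall>y\<in>left_ideal G e. \<phi> (x + y) = \<phi> x + \<phi> y) \<and>
     (\<forall>c. \<forall>x\<in>left_ideal G e. \<phi> (pscale c x) = c \<cdot>\<^sub>v \<phi> x) \<and>
     (\<forall>g\<in>carrier G. \<forall>x\<in>left_ideal G e. \<phi> (el g \<cdot>\<^sub>G x) = \<rho> g *\<^sub>v \<phi> x)"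

lemma module_coordsD:
  assumes "module_coords e n \<rho> \<phi> \<psi>"
  shows "x \<in> left_ideal G e \<Longrightarrow> \<phi> x \<in> carrier_vec n"
    "v \<in> carrier_vec n \<Longrightarrow> \<psi> v \<in> left_ideal G e"
    "x \<in> left_ideal G e \<Longrightarrow> \<psi> (\<phi> x) = x" "v \<in> carrier_vec n \<Longrightarrow> \<phi> (\<psi> v) = v"
    "x \<in> left_ideal G e \<Longrightarrow> y \<in> left_ideal G e \<Longrightarrow> \<phi> (x + y) = \<phi> x + \<phi> y"
    "x \<in> left_ideal G e \<Longrightarrow> \<phi> (pscale c x) = c \<cdot>\<^sub>v \<phi> x"
    "g \<in> carrier G \<Longrightarrow> x \<in> left_ideal G e \<Longrightarrow> \<phi> (el g \<cdot>\<^sub>G x) = \<rho> g *\<^sub>v \<phi> x"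
  using assms unfolding module_coords_def by blast+

lemma affordsE:
  assumes aff: "affords G e (n, \<rho>)" and \<rho>: "matrix_rep G (n, \<rho>)" and e: "e \<in> group_algebra G" "e \<cdot>\<^sub>G e = e"
  obtains \<phi> \<psi> where "module_coords e n \<rho> \<phi> \<psi>"
proof -
  let ?L = "left_ideal G e"
  obtain \<phi> where \<phi>: "bij_betw \<phi> ?L (carrier_vec n)" "\<forall>a\<in>?L. \<forall>b\<in>?L. \<phi> (a + b) = \<phi> a + \<phi> b"
    "\<forall>c. \<forall>x\<in>carrier G. \<forall>a\<in>?L. \<phi> (sg x c \<cdot>\<^sub>G a) = c \<cdot>\<^sub>v (\<rho> x *\<^sub>v \<phi> a)"
    using aff by (auto simp: affords_def)
  have c: "\<phi> x \<in> carrier_vec n" if "x \<in> ?L" for x using \<phi>(1) that by (auto dest: bij_betwE)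
  have "module_coords e n \<rho> \<phi> (inv_into ?L \<phi>)"
    unfolding module_coords_def
  proof (intro conjI ballI allI)
    show "inv_into ?L \<phi> v \<in> ?L" if "v \<in> carrier_vec n" for v
      using bij_betw_inv_into[OF \<phi>(1)] that by (auto dest: bij_betwE)
    show "inv_into ?L \<phi> (\<phi> x) = x" if "x \<in> ?L" for x by (rule bij_betw_inv_into_left[OF \<phi>(1) that])
    show "\<phi> (inv_into ?L \<phi> v) = v" if "v \<in> carrier_vec n" for v by (rule bij_betw_inv_into_right[OF \<phi>(1) that])
    show "\<phi> (pscale c x) = c \<cdot>\<^sub>v \<phi> x" if x: "x \<in> ?L" for c x
    proof -
      have "\<phi> (sg \<one> c \<cdot>\<^sub>G x) = c \<cdot>\<^sub>v (\<rho> \<one> *\<^sub>v \<phi> x)" using \<phi>(3) x by blast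
      moreover have "\<rho> \<one> = 1\<^sub>m n" using \<rho> by (simp add: matrix_rep_def)
      moreover have "sg \<one> c \<cdot>\<^sub>G x = pscale c x" using x by (simp add: scalar_mult left_ideal_iff[OF e])
      ultimately show ?thesis using c[OF x] by simp
    qed
    show "\<phi> (el g \<cdot>\<^sub>G x) = \<rho> g *\<^sub>v \<phi> x" if "g \<in> carrier G" "x \<in> ?L" for g x
      using \<phi>(3) that by simp
  qed (use \<phi>(2) c in auto)
  then show thesis by (rule that)
qed

lemma affordsI:
  assumes "bij_betw \<phi> (left_ideal G e) (carrier_vec n)" and e: "e \<in> group_algebra G" "e \<cdot>\<^sub>G e = e"
    and "\<And>x y. x \<in> left_ideal G e \<Longrightarrow> y \<in> left_ideal G e \<Longrightarrow> \<phi> (x + y) = \<phi> x + \<phi> y"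
    and sc: "\<And>c x. x \<in> left_ideal G e \<Longrightarrow> \<phi> (pscale c x) = c \<cdot>\<^sub>v \<phi> x"
    and eq: "\<And>g x. g \<in> carrier G \<Longrightarrow> x \<in> left_ideal G e \<Longrightarrow> \<phi> (el g \<cdot>\<^sub>G x) = \<rho> g *\<^sub>v \<phi> x"
  shows "affords G e (n, \<rho>)"
  unfolding affords_def prod.case
proof (intro exI[of _ \<phi>] conjI allI ballI)
  fix c x a assume x: "x \<in> carrier G" and a: "a \<in> left_ideal G e"
  have "sg x c \<cdot>\<^sub>G a = pscale c (el x \<cdot>\<^sub>G a)" using ga.mult_scale_left[of c "el x" a] by simp
  moreover have "el x \<cdot>\<^sub>G a \<in> left_ideal G e"
    using left_submodule_left_ideal[OF e] x a by (auto simp: left_submodule_def)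
  ultimately show "\<phi> (sg x c \<cdot>\<^sub>G a) = c \<cdot>\<^sub>v (\<rho> x *\<^sub>v \<phi> a)" using sc eq[OF x a] by simp
qed (use assms in auto)

lemma module_map_mult:
  assumes L: "left_submodule L"
    and add: "\<And>x y. x \<in> L \<Longrightarrow> y \<in> L \<Longrightarrow> F (x + y) = F x + F y"
    and scale: "\<And>c x. x \<in> L \<Longrightarrow> F (pscale c x) = pscale c (F x)"
    and equi: "\<And>g x. g \<in> carrier G \<Longrightarrow> x \<in> L \<Longrightarrow> F (el g \<cdot>\<^sub>G x) = el g \<cdot>\<^sub>G F x"
    and a: "a \<in> group_algebra G" and x: "x \<in> L"
  shows "F (a \<cdot>\<^sub>G x) = a \<cdot>\<^sub>G F x"
proof -
  have sub: "pm.subspace L" and elx: "el g \<cdot>\<^sub>G x \<in> L" if "g \<in> carrier G" for g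
    using L x that by (auto simp: left_submodule_def)
  have sub: "pm.subspace L" using L by (auto simp: left_submodule_def)
  have F0: "F 0 = 0" using scale[OF x, of 0] by simp
  have main: "F (\<Sum>g\<in>S. pscale (lk a g) (el g \<cdot>\<^sub>G x)) = (\<Sum>g\<in>S. pscale (lk a g) (el g \<cdot>\<^sub>G F x))"
    if "finite S" "S \<subseteq> carrier G" for S
    using that
  proof induction
    case (insert g S)
    have "(\<Sum>g\<in>S. pscale (lk a g) (el g \<cdot>\<^sub>G x)) \<in> L"
      using insert.prems by (intro pm.subspace_sum sub pm.subspace_scale elx) auto
    then show ?case
      using insert elx[of g] sub equi[OF _ x, of g] by (simp add: add scale pm.subspace_scale)
  qed (simp add: F0)
  have exp: "a \<cdot>\<^sub>G y = (\<Sum>g\<in>kys a. pscale (lk a g) (el g \<cdot>\<^sub>G y))" for y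
    by (subst expand) (simp only: ga.mult_sum_left ga.mult_scale_left)
  show ?thesis unfolding exp using a by (intro main) (auto simp: group_algebra_def)
qed

lemma self_left_ideal: "e \<in> group_algebra G \<Longrightarrow> e \<cdot>\<^sub>G e = e \<Longrightarrow> e \<in> left_ideal G e"
  by (simp add: left_ideal_iff)

text \<open>A module map \<open>F\<close> on the left ideal of \<open>e\<close> is right
  multiplication by \<open>F e\<close>, because x = x e for every element x of the ideal. So
  \<open>F e\<close> and the value of the inverse map at \<open>f\<close> form the required
  pair.\<close>

lemma rep_iso_equiv_idempotents:
  assumes e: "e \<in> group_algebra G" "e \<cdot>\<^sub>G e = e" and f: "f \<in> group_algebra G" "f \<cdot>\<^sub>G f = f"
    and ae: "affords G e (n, \<rho>)" and af: "affords G f (m, \<tau>)"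
    and iso: "((n, \<rho>), (m, \<tau>)) \<in> rep_iso G"
  obtains a b where "a \<in> group_algebra G" "b \<in> group_algebra G" "e \<cdot>\<^sub>G a = a" "a \<cdot>\<^sub>G f = a" "f \<cdot>\<^sub>G b = b" "b \<cdot>\<^sub>G e = b"
    "a \<cdot>\<^sub>G b = e" "b \<cdot>\<^sub>G a = f"
proof -
  have \<rho>: "matrix_rep G (n, \<rho>)" and \<tau>: "matrix_rep G (m, \<tau>)" using iso by (auto simp: rep_iso_def)
  obtain \<phi>1 \<psi>1 where "module_coords e n \<rho> \<phi>1 \<psi>1" by (rule affordsE[OF ae \<rho> e])
  note 1 = module_coordsD[OF this]
  obtain \<phi>2 \<psi>2 where "module_coords f m \<tau> \<phi>2 \<psi>2" by (rule affordsE[OF af \<tau> f])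
  note 2 = module_coordsD[OF this]
  obtain T S where "intertwiner G n \<rho> m \<tau> T S" by (rule rep_isoE[OF iso])
  note TS = intertwinerD[OF this]
  let ?Le = "left_ideal G e" and ?Lf = "left_ideal G f"
  note Le = left_submodule_left_ideal[OF e] and Lf = left_submodule_left_ideal[OF f]
  define F where "F x = \<psi>2 (T (\<phi>1 x))" for x
  define H where "H y = \<psi>1 (S (\<phi>2 y))" for y
  have FL: "F x \<in> ?Lf" if "x \<in> ?Le" for x unfolding F_def using that by (simp add: 1 2 TS)
  have HL: "H x \<in> ?Le" if "x \<in> ?Lf" for x unfolding H_def using that by (simp add: 1 2 TS)
  have HF: "H (F x) = x" if "x \<in> ?Le" for x unfolding F_def H_def using that by (simp add: 1 2 TS)
  have FH: "F (H x) = x" if "x \<in> ?Lf" for x unfolding F_def H_def using that by (simp add: 1 2 TS)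
  have F\<phi>: "\<phi>2 (F x) = T (\<phi>1 x)" if "x \<in> ?Le" for x unfolding F_def using that by (simp add: 1 2 TS)
  have FI: "F x = y" if "x \<in> ?Le" "y \<in> ?Lf" "\<phi>2 y = T (\<phi>1 x)" for x y
    unfolding F_def that(3)[symmetric] by (rule 2(3)[OF that(2)])
  have Fmult: "F (a \<cdot>\<^sub>G x) = a \<cdot>\<^sub>G F x" if a: "a \<in> group_algebra G" and x: "x \<in> ?Le" for a x
  proof (rule module_map_mult[OF Le _ _ _ a x])
    fix x y c g assume x: "x \<in> ?Le"
    show "F (x + y) = F x + F y" if y: "y \<in> ?Le"
      using x y Le Lf FL by (intro FI) (auto simp: left_submodule_def pm.subspace_add 1 2 TS F\<phi>)
    show "F (pscale c x) = pscale c (F x)"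
      using x Le Lf FL by (intro FI) (auto simp: left_submodule_def pm.subspace_scale 1 2 TS F\<phi>)
    show "F (el g \<cdot>\<^sub>G x) = el g \<cdot>\<^sub>G F x" if "g \<in> carrier G"
      using that x Le Lf FL by (intro FI) (auto simp: left_submodule_def 1 2 TS F\<phi>)
  qed
  have U: "x \<in> group_algebra G" if "x \<in> ?Le \<or> x \<in> ?Lf" for x
    using that left_ideal_iff[OF e] left_ideal_iff[OF f] by blast
  have Hmult: "H (a \<cdot>\<^sub>G y) = a \<cdot>\<^sub>G H y" if a: "a \<in> group_algebra G" and y: "y \<in> ?Lf" for a y
    using Fmult[OF a HL[OF y]] HF[OF left_submodule_mult[OF Le a HL[OF y]]] FH[OF y] by simp
  have ee: "e \<in> ?Le" "f \<in> ?Lf" using self_left_ideal e f by auto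
  have a: "F e \<in> ?Lf" "F e \<in> group_algebra G" and b: "H f \<in> ?Le" "H f \<in> group_algebra G"
    using FL HL ee U by auto
  show thesis
  proof (rule that[OF a(2) b(2)])
    show "e \<cdot>\<^sub>G F e = F e" using Fmult[OF e(1) ee(1)] e by simp
    show "F e \<cdot>\<^sub>G f = F e" using a left_ideal_iff[OF f] by blast
    show "f \<cdot>\<^sub>G H f = H f" using Hmult[OF f(1) ee(2)] f by simp
    show "H f \<cdot>\<^sub>G e = H f" using b left_ideal_iff[OF e] by blast
    show "F e \<cdot>\<^sub>G H f = e" using Hmult[OF a(2) ee(2)] a left_ideal_iff[OF f] HF[OF ee(1)] by metis
    show "H f \<cdot>\<^sub>G F e = f" using Fmult[OF b(2) ee(1)] b left_ideal_iff[OF e] FH[OF ee(2)] by metis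
  qed
qed

text \<open>Right multiplication by \<open>a\<close> carries the left ideal of \<open>e\<close> to
  that of \<open>f\<close>, and right multiplication by \<open>b\<close> inverts it.\<close>

lemma equiv_idempotents_rep_iso:
  assumes e: "e \<in> group_algebra G" "e \<cdot>\<^sub>G e = e" and f: "f \<in> group_algebra G" "f \<cdot>\<^sub>G f = f"
    and ae: "affords G e (n, \<rho>)" and af: "affords G f (m, \<tau>)"
    and \<rho>: "matrix_rep G (n, \<rho>)" and \<tau>: "matrix_rep G (m, \<tau>)"
    and a: "a \<in> group_algebra G" "a \<cdot>\<^sub>G f = a" and b: "b \<in> group_algebra G" "b \<cdot>\<^sub>G e = b"
    and ab: "a \<cdot>\<^sub>G b = e" "b \<cdot>\<^sub>G a = f"
  shows "((n, \<rho>), (m, \<tau>)) \<in> rep_iso G"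
proof -
  obtain \<phi>1 \<psi>1 where "module_coords e n \<rho> \<phi>1 \<psi>1" by (rule affordsE[OF ae \<rho> e])
  note 1 = module_coordsD[OF this]
  obtain \<phi>2 \<psi>2 where "module_coords f m \<tau> \<phi>2 \<psi>2" by (rule affordsE[OF af \<tau> f])
  note 2 = module_coordsD[OF this]
  let ?Le = "left_ideal G e" and ?Lf = "left_ideal G f"
  note Le = left_submodule_left_ideal[OF e] and Lf = left_submodule_left_ideal[OF f]
  have Ra: "x \<cdot>\<^sub>G a \<in> ?Lf \<and> x \<cdot>\<^sub>G a \<cdot>\<^sub>G b = x" if "x \<in> ?Le" for x
    using that a b ab f ga.mult_assoc[of x a f] ga.mult_assoc[of x a b]
    by (simp add: left_ideal_iff[OF e] left_ideal_iff[OF f])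
  have Rb: "x \<cdot>\<^sub>G b \<in> ?Le \<and> x \<cdot>\<^sub>G b \<cdot>\<^sub>G a = x" if "x \<in> ?Lf" for x
    using that a b ab e ga.mult_assoc[of x b e] ga.mult_assoc[of x b a]
    by (simp add: left_ideal_iff[OF e] left_ideal_iff[OF f])
  define T where "T v = \<phi>2 (\<psi>1 v \<cdot>\<^sub>G a)" for v
  have \<psi>1add: "\<psi>1 (v + w) = \<psi>1 v + \<psi>1 w" if "v \<in> carrier_vec n" "w \<in> carrier_vec n" for v w
    using 1(3)[of "\<psi>1 v + \<psi>1 w"] Le that by (simp add: left_submodule_def pm.subspace_add 1)
  have \<psi>1scale: "\<psi>1 (c \<cdot>\<^sub>v v) = pscale c (\<psi>1 v)" if "v \<in> carrier_vec n" for c v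
    using 1(3)[of "pscale c (\<psi>1 v)"] Le that by (simp add: left_submodule_def pm.subspace_scale 1)
  have \<psi>1equi: "\<psi>1 (\<rho> g *\<^sub>v v) = el g \<cdot>\<^sub>G \<psi>1 v" if "g \<in> carrier G" "v \<in> carrier_vec n" for g v
    using 1(3)[of "el g \<cdot>\<^sub>G \<psi>1 v"] Le that by (simp add: left_submodule_def 1)
  show ?thesis
  proof (rule rep_isoI[OF \<rho> \<tau>, of T])
    show "bij_betw T (carrier_vec n) (carrier_vec m)"
      by (rule bij_betw_byWitness[where f' = "\<lambda>w. \<phi>1 (\<psi>2 w \<cdot>\<^sub>G b)"])
        (auto simp: T_def 1 2 Ra Rb)
    fix v w :: "complex vec" and c g assume v: "v \<in> carrier_vec n"
    show "T (v + w) = T v + T w" if "w \<in> carrier_vec n"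
      using v that by (simp add: T_def \<psi>1add ga.mult_add_left 2 1 Ra)
    show "T (c \<cdot>\<^sub>v v) = c \<cdot>\<^sub>v T v"
      using v by (simp add: T_def \<psi>1scale ga.mult_scale_left 2 1 Ra)
    show "T (\<rho> g *\<^sub>v v) = \<tau> g *\<^sub>v T v" if g: "g \<in> carrier G"
    proof -
      have "el g \<cdot>\<^sub>G \<psi>1 v \<cdot>\<^sub>G a = el g \<cdot>\<^sub>G (\<psi>1 v \<cdot>\<^sub>G a)"
        using a 1(2)[OF v] el_in[OF g] by (intro ga.mult_assoc) (simp_all add: left_ideal_iff[OF e])
      then show ?thesis using v g by (simp add: T_def \<psi>1equi 2 1 Ra)
    qed
  qed
qed

text \<open>An idempotent \<open>g\<close> below \<open>e\<close> generates a submodule of the left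
  ideal of \<open>e\<close>. In coordinates this is an invariant subspace, hence zero or
  everything.\<close>

lemma affords_irreducible_prim:
  assumes e: "e \<in> group_algebra G" "e \<cdot>\<^sub>G e = e" and ae: "affords G e (n, \<rho>)" and irr: "irreducible_rep G (n, \<rho>)"
  shows "ga.prim (group_algebra G) e"
  unfolding ga.prim_def
proof (intro conjI ballI impI)
  have \<rho>: "matrix_rep G (n, \<rho>)" and n: "n \<noteq> 0"
    and W: "\<And>W. invariant_subspace G (n, \<rho>) W \<Longrightarrow> W = {0\<^sub>v n} \<or> W = carrier_vec n"
    using irr by (auto simp: irreducible_rep_def)
  let ?L = "left_ideal G e"
  obtain \<phi> \<psi> where "module_coords e n \<rho> \<phi> \<psi>" by (rule affordsE[OF ae \<rho> e])
  note 1 = module_coordsD[OF this]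
  have "0 \<in> ?L" using pm.subspace_0 left_submodule_left_ideal[OF e] by (auto simp: left_submodule_def)
  have \<phi>0: "\<phi> 0 = 0\<^sub>v n"
  proof -
    have "\<phi> 0 = 0 \<cdot>\<^sub>v \<phi> 0" using 1(6)[OF \<open>0 \<in> ?L\<close>, of 0] by simp
    also have "\<dots> = 0\<^sub>v n" using 1(1)[OF \<open>0 \<in> ?L\<close>] by (intro eq_vecI) auto
    finally show ?thesis .
  qed
  show "e \<in> group_algebra G" "e \<cdot>\<^sub>G e = e" by fact+
  show "e \<noteq> 0"
  proof
    assume "e = 0"
    have zero: "x = 0" if "x \<in> ?L" for x
    proof -
      have "x \<cdot>\<^sub>G e = x" using that left_ideal_iff[OF e] by blast
      then show ?thesis using \<open>e = 0\<close> by simp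
    qed
    have "unit_vec n 0 = (0\<^sub>v n :: complex vec)"
      using zero[OF 1(2)[of "unit_vec n 0"]] 1(4)[of "unit_vec n 0"] \<phi>0 by simp
    then have "(unit_vec n 0 :: complex vec) $ 0 = 0\<^sub>v n $ 0" by simp
    then show False using n by simp
  qed
  fix g assume g: "g \<in> group_algebra G" "g \<cdot>\<^sub>G g = g" "e \<cdot>\<^sub>G g = g" "g \<cdot>\<^sub>G e = g"
  let ?K = "left_ideal G g"
  have K: "left_submodule ?K" by (rule left_submodule_left_ideal[OF g(1,2)])
  have KL: "?K \<subseteq> ?L"
  proof
    fix x assume "x \<in> ?K"
    then have "x \<in> group_algebra G" "x \<cdot>\<^sub>G g = x" using left_ideal_iff[OF g(1,2)] by auto
    then show "x \<in> ?L" using ga.mult_assoc[of x g e] g e by (simp add: left_ideal_iff[OF e])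
  qed
  have gK: "g \<in> ?K" using g self_left_ideal by auto
  have "invariant_subspace G (n, \<rho>) (\<phi> ` ?K)"
    unfolding invariant_subspace_def prod.case
  proof (intro conjI ballI allI)
    show "\<phi> ` ?K \<subseteq> carrier_vec n" using KL 1(1) by auto
    show "0\<^sub>v n \<in> \<phi> ` ?K" using K pm.subspace_0 \<phi>0 by (metis image_eqI left_submodule_def)
    fix v assume "v \<in> \<phi> ` ?K"
    then obtain x where x: "x \<in> ?K" "v = \<phi> x" by auto
    then have xL: "x \<in> ?L" using KL by auto
    show "v + w \<in> \<phi> ` ?K" if "w \<in> \<phi> ` ?K" for w
    proof -
      from that obtain y where y: "y \<in> ?K" "w = \<phi> y" by auto
      then have "v + w = \<phi> (x + y)" using x xL KL 1(5) by (metis subsetD)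
      moreover have "x + y \<in> ?K" using K x y pm.subspace_add by (auto simp: left_submodule_def)
      ultimately show ?thesis by blast
    qed
    show "c \<cdot>\<^sub>v v \<in> \<phi> ` ?K" for c
      using x xL K 1(6)[OF xL, of c] pm.subspace_scale[of ?K x c] by (auto simp: left_submodule_def intro: image_eqI[of _ _ "pscale c x"])
    show "\<rho> h *\<^sub>v v \<in> \<phi> ` ?K" if "h \<in> carrier G" for h
      using x xL K 1(7)[OF that xL] that by (auto simp: left_submodule_def intro: image_eqI[of _ _ "el h \<cdot>\<^sub>G x"])
  qed
  from W[OF this] show "g = 0 \<or> g = e"
  proof
    assume "\<phi> ` ?K = {0\<^sub>v n}"
    then have "\<phi> g = \<phi> 0" using gK \<phi>0 by auto
    then have "g = 0" using 1(3)[of g] 1(3)[of 0] gK KL \<open>0 \<in> ?L\<close> by (metis subsetD)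
    then show ?thesis ..
  next
    assume all: "\<phi> ` ?K = carrier_vec n"
    have eL: "e \<in> ?L" using self_left_ideal e by auto
    then have "\<phi> e \<in> \<phi> ` ?K" using 1(1) all by auto
    then obtain x where "x \<in> ?K" "\<phi> e = \<phi> x" by auto
    then have "e \<in> ?K" using 1(3)[OF eL] 1(3)[of x] KL by (metis subsetD)
    then show ?thesis using g by (simp add: left_ideal_iff[OF g(1,2)])
  qed
qed

text \<open>By irreducibility the orbit map of a nonzero vector is onto. Its kernel is the left
  ideal of an idempotent w by Maschke's theorem, and the left ideal of the complement of w is mapped
  isomorphically.\<close>

lemma irreducible_affords_exists:
  assumes irr: "irreducible_rep G (n, \<rho>)"
  obtains e where "e \<in> group_algebra G" "e \<cdot>\<^sub>G e = e" "affords G e (n, \<rho>)"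
proof -
  have \<rho>: "matrix_rep G (n, \<rho>)" and n: "n \<noteq> 0"
    and W: "\<And>W. invariant_subspace G (n, \<rho>) W \<Longrightarrow> W = {0\<^sub>v n} \<or> W = carrier_vec n"
    using irr by (auto simp: irreducible_rep_def)
  have \<rho>c: "\<rho> g \<in> carrier_mat n n" if "g \<in> carrier G" for g using \<rho> that by (auto simp: matrix_rep_def)
  \<comment> \<open>Any nonzero vector serves; \<open>n \<noteq> 0\<close> provides this
    one.\<close>
  define v0 :: "complex vec" where "v0 = unit_vec n 0"
  have v0: "v0 \<in> carrier_vec n" "v0 \<noteq> 0\<^sub>v n" using n by (auto simp: v0_def)
  define \<Theta> where "\<Theta> a = vec n (\<lambda>i. \<Sum>g\<in>carrier G. lk a g * (\<rho> g *\<^sub>v v0) $ i)" for a :: "'a \<Rightarrow>\<^sub>0 complex"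
  have \<Theta>c: "\<Theta> a \<in> carrier_vec n" for a by (simp add: \<Theta>_def)
  have \<Theta>add: "\<Theta> (a + b) = \<Theta> a + \<Theta> b" for a b
    by (rule eq_vecI) (simp_all add: \<Theta>_def lookup_add algebra_simps sum.distrib)
  have \<Theta>scale: "\<Theta> (pscale c a) = c \<cdot>\<^sub>v \<Theta> a" for c a
    by (rule eq_vecI) (simp_all add: \<Theta>_def sum_distrib_left mult.assoc)
  have \<Theta>el: "\<Theta> (el g) = \<rho> g *\<^sub>v v0" if "g \<in> carrier G" for g
  proof (rule eq_vecI)
    fix i assume "i < dim_vec (\<rho> g *\<^sub>v v0)"
    then have i: "i < n" using \<rho>c[OF that] by simp
    have "(\<Sum>h\<in>carrier G. lk (el g) h * (\<rho> h *\<^sub>v v0) $ i) = (\<Sum>h\<in>carrier G. if g = h then (\<rho> h *\<^sub>v v0) $ i else 0)"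
      by (intro sum.cong refl) (auto simp: lookup_single when_def)
    then show "\<Theta> (el g) $ i = (\<rho> g *\<^sub>v v0) $ i"
      using i that finite_carrier by (simp add: \<Theta>_def)
  qed (use \<rho>c[OF that] in \<open>simp add: \<Theta>_def\<close>)
  have \<Theta>0: "\<Theta> 0 = 0\<^sub>v n" by (rule eq_vecI) (simp_all add: \<Theta>_def)
  have equi: "\<Theta> (el g \<cdot>\<^sub>G a) = \<rho> g *\<^sub>v \<Theta> a" if g: "g \<in> carrier G" and a: "a \<in> group_algebra G" for g a
  proof -
    have "\<Theta> (el g \<cdot>\<^sub>G (\<Sum>h\<in>S. pscale (lk a h) (el h))) = \<rho> g *\<^sub>v \<Theta> (\<Sum>h\<in>S. pscale (lk a h) (el h))"
      if "finite S" "S \<subseteq> carrier G" for S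
      using that
    proof induction
      case empty
      have "\<rho> g *\<^sub>v 0\<^sub>v n = 0\<^sub>v n" using \<rho>c[OF g] by (auto intro!: eq_vecI)
      then show ?case by (simp add: \<Theta>0)
    next
      case (insert h S)
      have h: "h \<in> carrier G" using insert.prems by simp
      let ?s = "\<Sum>h\<in>S. pscale (lk a h) (el h)"
      have "\<Theta> (el g \<cdot>\<^sub>G el h) = \<rho> g *\<^sub>v \<Theta> (el h)"
        using g h \<rho> \<rho>c[OF g] \<rho>c[OF h] v0 by (simp add: single_mult \<Theta>el matrix_rep_def assoc_mult_mat_vec[OF \<rho>c[OF g] \<rho>c[OF h] v0(1)])
      moreover have "\<Theta> (el g \<cdot>\<^sub>G ?s) = \<rho> g *\<^sub>v \<Theta> ?s" using insert by simp
      moreover have "\<rho> g *\<^sub>v (lk a h \<cdot>\<^sub>v \<Theta> (el h) + \<Theta> ?s) = lk a h \<cdot>\<^sub>v (\<rho> g *\<^sub>v \<Theta> (el h)) + \<rho> g *\<^sub>v \<Theta> ?s"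
        using mult_add_distrib_mat_vec[OF \<rho>c[OF g], of "lk a h \<cdot>\<^sub>v \<Theta> (el h)" "\<Theta> ?s"]
          mult_mat_vec[OF \<rho>c[OF g], of "\<Theta> (el h)" "lk a h"] \<Theta>c by auto
      ultimately show ?case
        using insert.hyps by (simp add: ga.mult_add_right ga.mult_scale_right \<Theta>add \<Theta>scale del: pscale_single)
    qed
    from this[of "kys a"] a show ?thesis by (auto simp: group_algebra_def sum_singles)
  qed
  have "invariant_subspace G (n, \<rho>) (\<Theta> ` group_algebra G)"
    unfolding invariant_subspace_def prod.case
  proof (intro conjI ballI allI)
    show "\<Theta> ` group_algebra G \<subseteq> carrier_vec n" using \<Theta>c by auto
    show "0\<^sub>v n \<in> \<Theta> ` group_algebra G" using \<Theta>0 pm.subspace_0[OF ga.subspace_U] by (metis image_eqI)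
    fix v assume "v \<in> \<Theta> ` group_algebra G"
    then obtain x where x: "x \<in> group_algebra G" "v = \<Theta> x" by auto
    show "v + w \<in> \<Theta> ` group_algebra G" if "w \<in> \<Theta> ` group_algebra G" for w
      using that x pm.subspace_add[OF ga.subspace_U] by (auto simp flip: \<Theta>add)
    show "c \<cdot>\<^sub>v v \<in> \<Theta> ` group_algebra G" for c
      using x pm.subspace_scale[OF ga.subspace_U] by (auto simp flip: \<Theta>scale)
    show "\<rho> h *\<^sub>v v \<in> \<Theta> ` group_algebra G" if "h \<in> carrier G" for h
      using x that el_in[OF that] by (auto simp flip: equi)
  qed
  moreover have "v0 \<in> \<Theta> ` group_algebra G"
  proof -
    have "\<Theta> (el \<one>) = v0" using \<Theta>el[of \<one>] \<rho> v0 by (simp add: matrix_rep_def)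
    then show ?thesis using el_in[of \<one>] by (metis image_eqI one_closed)
  qed
  ultimately have surj: "\<Theta> ` group_algebra G = carrier_vec n" using W v0(2) by blast
  define K where "K = {a \<in> group_algebra G. \<Theta> a = 0\<^sub>v n}"
  have "left_submodule K"
    unfolding left_submodule_def K_def
  proof (intro conjI ballI)
    show "pm.subspace {a \<in> group_algebra G. \<Theta> a = 0\<^sub>v n}"
      using ga.subspace_U
      by (intro pm.subspaceI) (auto simp: \<Theta>0 \<Theta>add \<Theta>scale pm.subspace_0 pm.subspace_add pm.subspace_scale)
    fix x k assume x: "x \<in> carrier G" and "k \<in> {a \<in> group_algebra G. \<Theta> a = 0\<^sub>v n}"
    then have k: "k \<in> group_algebra G" "\<Theta> k = 0\<^sub>v n" by auto
    have "\<Theta> (el x \<cdot>\<^sub>G k) = 0\<^sub>v n" using equi[OF x k(1)] k(2) \<rho>c[OF x] by (auto intro!: eq_vecI)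
    then show "el x \<cdot>\<^sub>G k \<in> {a \<in> group_algebra G. \<Theta> a = 0\<^sub>v n}" using k el_in[OF x] by auto
  qed auto
  then obtain w where w: "w \<in> K" "\<And>x. x \<in> K \<Longrightarrow> x \<cdot>\<^sub>G w = x" by (rule maschke) blast
  have wU: "w \<in> group_algebra G" using w by (simp add: K_def)
  define e where "e = el \<one> - w"
  have e: "e \<in> group_algebra G" "e \<cdot>\<^sub>G e = e"
    using w wU pm.subspace_diff[OF ga.subspace_U el_in wU]
    by (simp_all add: e_def ga.bilin one_left one_right el_in)
  have Kmult: "a \<cdot>\<^sub>G w \<in> K" if "a \<in> group_algebra G" for a
    using left_submodule_mult[OF \<open>left_submodule K\<close> that w(1)] .
  \<comment> \<open>The part of \<open>a\<close> that multiplication by \<open>e\<close> removes is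
    a multiple of \<open>w\<close> and so lies in the kernel.\<close>
  have \<Theta>e: "\<Theta> (a \<cdot>\<^sub>G e) = \<Theta> a" if a: "a \<in> group_algebra G" for a
  proof -
    have "a = a \<cdot>\<^sub>G e + a \<cdot>\<^sub>G w" using a by (simp add: e_def ga.bilin one_right)
    then have "\<Theta> a = \<Theta> (a \<cdot>\<^sub>G e) + \<Theta> (a \<cdot>\<^sub>G w)" using \<Theta>add by metis
    then show ?thesis using Kmult[OF a] \<Theta>c by (simp add: K_def)
  qed
  have "affords G e (n, \<rho>)"
  proof (rule affordsI[OF _ e])
    show "bij_betw \<Theta> (left_ideal G e) (carrier_vec n)"
      unfolding bij_betw_def
    proof
      show "inj_on \<Theta> (left_ideal G e)"
      proof (rule inj_onI)
        fix x y assume x: "x \<in> left_ideal G e" and y: "y \<in> left_ideal G e" and eq: "\<Theta> x = \<Theta> y"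
        have d: "x - y \<in> left_ideal G e"
          using x y left_submodule_left_ideal[OF e] pm.subspace_diff by (auto simp: left_submodule_def)
        have "\<Theta> x = \<Theta> (x - y) + \<Theta> y" using \<Theta>add[of "x - y" y] by simp
        then have "\<Theta> (x - y) = 0\<^sub>v n"
          using eq \<Theta>c[of "x - y"] \<Theta>c[of y]
          by (intro eq_vecI) (auto simp: vec_eq_iff)
        then have "x - y \<in> K" using d by (simp add: K_def left_ideal_iff[OF e])
        then have "(x - y) \<cdot>\<^sub>G w = x - y" by (rule w(2))
        moreover have "(x - y) \<cdot>\<^sub>G e = x - y" using d by (simp add: left_ideal_iff[OF e])
        moreover have "w \<cdot>\<^sub>G e = 0" using w wU by (simp add: e_def ga.bilin one_right)
        moreover have "(x - y) \<cdot>\<^sub>G w \<cdot>\<^sub>G e = (x - y) \<cdot>\<^sub>G (w \<cdot>\<^sub>G e)"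
          using d wU e by (intro ga.mult_assoc) (simp_all add: left_ideal_iff[OF e])
        ultimately have "x - y = 0" by simp
        then show "x = y" by simp
      qed
      show "\<Theta> ` left_ideal G e = carrier_vec n"
      proof
        show "\<Theta> ` left_ideal G e \<subseteq> carrier_vec n" using \<Theta>c by auto
        show "carrier_vec n \<subseteq> \<Theta> ` left_ideal G e"
        proof
          fix v :: "complex vec" assume "v \<in> carrier_vec n"
          then obtain a where a: "a \<in> group_algebra G" "v = \<Theta> a" using surj by auto
          then have "v = \<Theta> (a \<cdot>\<^sub>G e)" "a \<cdot>\<^sub>G e \<in> left_ideal G e" using \<Theta>e by (auto simp: left_ideal_def)
          then show "v \<in> \<Theta> ` left_ideal G e" by blast
        qed
      qed
    qed
  qed (auto simp: \<Theta>add \<Theta>scale equi left_ideal_iff[OF e])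
  with e show thesis by (rule that)
qed

text \<open>A basis of the left ideal supplies the coordinates. An invariant subspace pulls back to
  a submodule K, for which Maschke's theorem gives w in K acting on K as a right identity. Then
  \<open>e \<cdot>\<^sub>G w\<close> is an idempotent below \<open>e\<close>, so K is zero or
  contains \<open>e\<close>.\<close>

lemma prim_affords_irreducible:
  assumes prim: "ga.prim (group_algebra G) e"
  obtains n \<rho> where "irreducible_rep G (n, \<rho>)" "affords G e (n, \<rho>)"
proof -
  have e: "e \<in> group_algebra G" "e \<cdot>\<^sub>G e = e" "e \<noteq> 0" using prim by (auto simp: ga.prim_def)
  let ?L = "left_ideal G e"
  note Lm = left_submodule_left_ideal[OF e(1,2)]
  have subL: "pm.subspace ?L" and LU: "?L \<subseteq> group_algebra G" and elL: "\<And>g x. g \<in> carrier G \<Longrightarrow> x \<in> ?L \<Longrightarrow> el g \<cdot>\<^sub>G x \<in> ?L"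
    using Lm by (auto simp: left_submodule_def)
  obtain B where B: "B \<subseteq> ?L" "pm.independent B" "?L \<subseteq> pm.span B" using pm.basis_exists[of ?L] by metis
  have "B \<subseteq> pm.span (el ` carrier G)"
    using B(1) LU supp_in_span[of "carrier G"] unfolding group_algebra_eq by blast
  then have finB: "finite B" using pm.independent_span_bound[OF _ B(2)] finite_carrier by blast
  have span: "pm.span B = ?L" using B subL pm.span_minimal by blast
  define n where "n = card B"
  obtain f where f: "bij_betw f {..<n} B"
    using ex_bij_betw_nat_finite[OF finB] unfolding n_def atLeast0LessThan by blast
  have fB: "f i \<in> B" if "i < n" for i using f that by (auto dest: bij_betwE)
  define \<phi> where "\<phi> x = vec n (\<lambda>i. pm.representation B x (f i))" for x
  define \<psi> where "\<psi> v = (\<Sum>i<n. pscale (v $ i) (f i))" for v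
  have \<phi>c: "\<phi> x \<in> carrier_vec n" for x by (simp add: \<phi>_def)
  have \<psi>L: "\<psi> v \<in> ?L" for v
    unfolding \<psi>_def using fB B(1) by (intro pm.subspace_sum subL pm.subspace_scale) auto
  have \<psi>\<phi>: "\<psi> (\<phi> x) = x" if "x \<in> ?L" for x
  proof -
    have "\<psi> (\<phi> x) = (\<Sum>i<n. pscale (pm.representation B x (f i)) (f i))" by (simp add: \<psi>_def \<phi>_def)
    also have "\<dots> = (\<Sum>b\<in>B. pscale (pm.representation B x b) b)"
      by (rule sum.reindex_bij_betw[OF f])
    also have "\<dots> = x" using that span finB by (intro pm.sum_representation_eq B(2)) auto
    finally show ?thesis .
  qed
  have \<phi>\<psi>: "\<phi> (\<psi> v) = v" if v: "v \<in> carrier_vec n" for v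
  proof (rule eq_vecI)
    fix j assume "j < dim_vec v"
    then have j: "j < n" using v by simp
    have fs: "f i \<in> pm.span B" if "i < n" for i using fB[OF that] by (rule pm.span_base)
    have "pm.representation B (\<psi> v) (f j) = (\<Sum>i<n. v $ i * pm.representation B (f i) (f j))"
      unfolding \<psi>_def using fs
      by (subst pm.representation_sum[OF B(2)]) (auto simp: pm.span_scale pm.representation_scale[OF B(2)])
    also have "\<dots> = (\<Sum>i<n. if i = j then v $ i else 0)"
    proof (rule sum.cong[OF refl])
      fix i assume "i \<in> {..<n}"
      then have i: "i < n" by simp
      have "f j = f i \<longleftrightarrow> i = j"
        using bij_betw_imp_inj_on[OF f] i j by (auto dest: inj_onD)
      then show "v $ i * pm.representation B (f i) (f j) = (if i = j then v $ i else 0)"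
        by (auto simp: pm.representation_basis[OF B(2) fB[OF i]])
    qed
    also have "\<dots> = v $ j" using j by simp
    finally show "\<phi> (\<psi> v) $ j = v $ j" using j by (simp add: \<phi>_def)
  qed (use v in \<open>simp add: \<phi>_def\<close>)
  have \<phi>add: "\<phi> (x + y) = \<phi> x + \<phi> y" if "x \<in> ?L" "y \<in> ?L" for x y
    using that by (intro eq_vecI) (simp_all add: \<phi>_def pm.representation_add[OF B(2)] span)
  have \<phi>scale: "\<phi> (pscale c x) = c \<cdot>\<^sub>v \<phi> x" if "x \<in> ?L" for c x
    using that by (intro eq_vecI) (simp_all add: \<phi>_def pm.representation_scale[OF B(2)] span)
  have \<psi>add: "\<psi> (v + w) = \<psi> v + \<psi> w" if "v \<in> carrier_vec n" "w \<in> carrier_vec n" for v w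
    using \<psi>\<phi>[of "\<psi> v + \<psi> w"] that \<psi>L subL by (simp add: pm.subspace_add \<phi>add \<phi>\<psi>)
  have \<psi>scale: "\<psi> (c \<cdot>\<^sub>v v) = pscale c (\<psi> v)" if "v \<in> carrier_vec n" for c v
    using \<psi>\<phi>[of "pscale c (\<psi> v)"] that \<psi>L subL by (simp add: pm.subspace_scale \<phi>scale \<phi>\<psi>)
  define T where "T g v = \<phi> (el g \<cdot>\<^sub>G \<psi> v)" for g v
  define \<rho> where "\<rho> g = mat n n (\<lambda>(i, j). T g (unit_vec n j) $ i)" for g
  have \<rho>c: "\<rho> g \<in> carrier_mat n n" for g by (simp add: \<rho>_def)
  have \<rho>T: "\<rho> g *\<^sub>v v = T g v" if g: "g \<in> carrier G" and v: "v \<in> carrier_vec n" for g v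
    unfolding \<rho>_def
  proof (rule linear_map_mat[OF _ _ _ v])
    show "T g v \<in> carrier_vec n" for v by (simp add: T_def \<phi>c)
    fix v w :: "complex vec" and c assume v: "v \<in> carrier_vec n"
    show "T g (v + w) = T g v + T g w" if "w \<in> carrier_vec n"
      using v that by (simp add: T_def \<psi>add ga.mult_add_right \<phi>add elL[OF g \<psi>L])
    show "T g (c \<cdot>\<^sub>v v) = c \<cdot>\<^sub>v T g v"
      using v by (simp add: T_def \<psi>scale ga.mult_scale_right \<phi>scale elL[OF g \<psi>L])
  qed
  have \<phi>equi: "\<phi> (el g \<cdot>\<^sub>G x) = \<rho> g *\<^sub>v \<phi> x" if "g \<in> carrier G" "x \<in> ?L" for g x
    using that by (simp add: \<rho>T \<phi>c T_def \<psi>\<phi>)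
  have rep: "matrix_rep G (n, \<rho>)"
    unfolding matrix_rep_def prod.case
  proof (intro conjI ballI)
    show "\<rho> \<one> = 1\<^sub>m n"
    proof (rule mat_eqI_vec[OF \<rho>c])
      fix v :: "complex vec" assume v: "v \<in> carrier_vec n"
      have "\<psi> v \<in> group_algebra G" using \<psi>L LU by auto
      then show "\<rho> \<one> *\<^sub>v v = 1\<^sub>m n *\<^sub>v v" using v by (simp add: \<rho>T T_def one_left \<phi>\<psi>)
    qed simp
    fix g h assume g: "g \<in> carrier G" and h: "h \<in> carrier G"
    show "\<rho> (g \<otimes> h) = \<rho> g * \<rho> h"
    proof (rule mat_eqI_vec[OF \<rho>c])
      show "\<rho> g * \<rho> h \<in> carrier_mat n n" by (rule mult_carrier_mat[OF \<rho>c \<rho>c])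
      fix v :: "complex vec" assume v: "v \<in> carrier_vec n"
      have \<psi>U: "\<psi> v \<in> group_algebra G" using \<psi>L LU by auto
      have "\<rho> g * \<rho> h *\<^sub>v v = \<rho> g *\<^sub>v (\<rho> h *\<^sub>v v)" by (rule assoc_mult_mat_vec[OF \<rho>c \<rho>c v])
      also have "\<dots> = \<rho> g *\<^sub>v \<phi> (el h \<cdot>\<^sub>G \<psi> v)" by (simp only: \<rho>T[OF h v] T_def)
      also have "\<dots> = \<phi> (el g \<cdot>\<^sub>G (el h \<cdot>\<^sub>G \<psi> v))" by (simp only: \<phi>equi[OF g elL[OF h \<psi>L]])
      also have "el g \<cdot>\<^sub>G (el h \<cdot>\<^sub>G \<psi> v) = el g \<cdot>\<^sub>G el h \<cdot>\<^sub>G \<psi> v"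
        by (rule ga.mult_assoc[OF el_in[OF g] el_in[OF h] \<psi>U, symmetric])
      also have "el g \<cdot>\<^sub>G el h = el (g \<otimes> h)" by (simp add: single_mult)
      also have "\<phi> (el (g \<otimes> h) \<cdot>\<^sub>G \<psi> v) = \<rho> (g \<otimes> h) *\<^sub>v v" using g h v by (simp add: \<rho>T T_def)
      finally show "\<rho> (g \<otimes> h) *\<^sub>v v = \<rho> g * \<rho> h *\<^sub>v v" ..
    qed
  qed (rule \<rho>c)
  have aff: "affords G e (n, \<rho>)"
  proof (rule affordsI[OF _ e(1,2)])
    show "bij_betw \<phi> ?L (carrier_vec n)"
      by (rule bij_betw_byWitness[where f' = \<psi>]) (auto simp: \<phi>\<psi> \<psi>\<phi> \<phi>c \<psi>L)
  qed (auto simp: \<phi>add \<phi>scale \<phi>equi)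
  have eL: "e \<in> ?L" and L0: "0 \<in> ?L" using self_left_ideal e pm.subspace_0[OF subL] by auto
  have \<phi>0: "\<phi> 0 = 0\<^sub>v n" by (rule eq_vecI) (simp_all add: \<phi>_def pm.representation_zero)
  have n: "n \<noteq> 0"
  proof
    assume "n = 0"
    then have "\<phi> e = \<phi> 0" by (intro eq_vecI) (simp_all add: \<phi>_def)
    then have "e = 0" using \<psi>\<phi>[OF eL] \<psi>\<phi>[OF L0] by simp
    with e show False by simp
  qed
  have "irreducible_rep G (n, \<rho>)"
    unfolding irreducible_rep_def prod.case
  proof (intro conjI allI impI)
    fix W assume "invariant_subspace G (n, \<rho>) W"
    then have W: "W \<subseteq> carrier_vec n" "0\<^sub>v n \<in> W" "\<And>v w. v \<in> W \<Longrightarrow> w \<in> W \<Longrightarrow> v + w \<in> W"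
      "\<And>c v. v \<in> W \<Longrightarrow> c \<cdot>\<^sub>v v \<in> W" "\<And>g v. g \<in> carrier G \<Longrightarrow> v \<in> W \<Longrightarrow> \<rho> g *\<^sub>v v \<in> W"
      unfolding invariant_subspace_def by auto
    define K where "K = {x \<in> ?L. \<phi> x \<in> W}"
    have K: "left_submodule K"
      unfolding left_submodule_def
    proof (intro conjI ballI)
      show "pm.subspace K"
        unfolding K_def using subL W
        by (intro pm.subspaceI) (auto simp: L0 \<phi>0 \<phi>add \<phi>scale pm.subspace_add pm.subspace_scale)
      show "K \<subseteq> group_algebra G" using LU by (auto simp: K_def)
      fix g k assume "g \<in> carrier G" "k \<in> K"
      then show "el g \<cdot>\<^sub>G k \<in> K" using W(5) elL by (simp add: K_def \<phi>equi)
    qed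
    then obtain w where w: "w \<in> K" "\<And>x. x \<in> K \<Longrightarrow> x \<cdot>\<^sub>G w = x" by (rule maschke) blast
    have KL: "x \<in> group_algebra G" "x \<cdot>\<^sub>G e = x" if "x \<in> K" for x
      using that left_ideal_iff[OF e(1,2)] by (auto simp: K_def)
    have wU: "w \<in> group_algebra G" "w \<cdot>\<^sub>G e = w" "w \<cdot>\<^sub>G w = w" using w KL by auto
    let ?g = "e \<cdot>\<^sub>G w"
    have "?g \<in> group_algebra G" using e wU by simp
    moreover have "?g \<cdot>\<^sub>G ?g = ?g"
    proof -
      have "?g \<cdot>\<^sub>G ?g = e \<cdot>\<^sub>G (w \<cdot>\<^sub>G e \<cdot>\<^sub>G w)" using e wU(1) by (simp add: ga.mult_assoc)
      then show ?thesis using wU by simp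
    qed
    moreover have "e \<cdot>\<^sub>G ?g = ?g" using ga.mult_assoc[OF e(1) e(1) wU(1)] e by simp
    moreover have "?g \<cdot>\<^sub>G e = ?g" using ga.mult_assoc[OF e(1) wU(1) e(1)] wU by simp
    ultimately have "?g = 0 \<or> ?g = e" using prim unfolding ga.prim_def by blast
    then show "W = {0\<^sub>v n} \<or> W = carrier_vec n"
    proof
      assume g0: "?g = 0"
      have "x = 0" if "x \<in> K" for x
      proof -
        have "x = x \<cdot>\<^sub>G e \<cdot>\<^sub>G w" using KL[OF that] w(2)[OF that] by simp
        also have "\<dots> = x \<cdot>\<^sub>G ?g" using KL[OF that] e wU by (intro ga.mult_assoc)
        finally show ?thesis using g0 by simp
      qed
      moreover have "\<psi> v \<in> K" if "v \<in> W" for v using that W(1) \<psi>L by (auto simp: K_def \<phi>\<psi>)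
      ultimately have "v = 0\<^sub>v n" if "v \<in> W" for v
        using that W(1) \<phi>\<psi>[of v] \<phi>0 by (metis subsetD)
      then show ?thesis using W(2) by blast
    next
      assume "?g = e"
      then have eK: "e \<in> K" using left_submodule_mult[OF K e(1) w(1)] by simp
      have "v \<in> W" if v: "v \<in> carrier_vec n" for v
      proof -
        have "\<psi> v = \<psi> v \<cdot>\<^sub>G e" using \<psi>L left_ideal_iff[OF e(1,2)] by metis
        then have "\<psi> v \<in> K" using left_submodule_mult[OF K _ eK, of "\<psi> v"] \<psi>L LU by auto
        then show ?thesis using \<phi>\<psi>[OF v] by (simp add: K_def)
      qed
      then show ?thesis using W(1) by blast
    qed
  qed (rule rep n)+
  then show thesis using aff by (rule that)
qed

lemma affords_iso:
  assumes e: "e \<in> group_algebra G" "e \<cdot>\<^sub>G e = e" and ae: "affords G e (n, \<rho>)"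
    and iso: "((n, \<rho>), (m, \<tau>)) \<in> rep_iso G"
  shows "affords G e (m, \<tau>)"
proof -
  have \<rho>: "matrix_rep G (n, \<rho>)" using iso by (auto simp: rep_iso_def)
  obtain \<phi> \<psi> where "module_coords e n \<rho> \<phi> \<psi>" by (rule affordsE[OF ae \<rho> e])
  note 1 = module_coordsD[OF this]
  obtain T S where "intertwiner G n \<rho> m \<tau> T S" by (rule rep_isoE[OF iso])
  note TS = intertwinerD[OF this]
  show ?thesis
  proof (rule affordsI[OF _ e])
    show "bij_betw (\<lambda>x. T (\<phi> x)) (left_ideal G e) (carrier_vec m)"
      by (rule bij_betw_byWitness[where f' = "\<lambda>v. \<psi> (S v)"]) (auto simp: 1 TS)
  qed (simp_all add: 1 TS)
qed

end

lemma intertwiner_rep_iso: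
  assumes \<rho>: "matrix_rep G (n, \<rho>)" and \<tau>: "matrix_rep G (m, \<tau>)" and TS: "intertwiner G n \<rho> m \<tau> T S"
  shows "((n, \<rho>), (m, \<tau>)) \<in> rep_iso G"
proof (rule rep_isoI[OF \<rho> \<tau>])
  show "bij_betw T (carrier_vec n) (carrier_vec m)"
    by (rule bij_betw_byWitness[where f' = S]) (auto simp: intertwinerD[OF TS])
qed (simp_all add: intertwinerD[OF TS])

lemma rep_iso_refl: "matrix_rep G V \<Longrightarrow> (V, V) \<in> rep_iso G"
  by (cases V) (auto intro!: intertwiner_rep_iso[of _ _ _ _ _ "\<lambda>v. v" "\<lambda>v. v"] simp: intertwiner_def matrix_rep_def)

lemma rep_iso_sym:
  assumes "(V, W) \<in> rep_iso G"
  shows "(W, V) \<in> rep_iso G"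
proof -
  obtain n \<rho> m \<tau> where VW: "V = (n, \<rho>)" "W = (m, \<tau>)" by (cases V; cases W) auto
  have reps: "matrix_rep G (n, \<rho>)" "matrix_rep G (m, \<tau>)" using assms VW by (auto simp: rep_iso_def)
  obtain T S where "intertwiner G n \<rho> m \<tau> T S" using assms VW by (auto elim: rep_isoE)
  note TS = intertwinerD[OF this]
  have \<rho>c: "\<rho> x *\<^sub>v v \<in> carrier_vec n" if "x \<in> carrier G" "v \<in> carrier_vec n" for x v
    using reps(1) that by (auto simp: matrix_rep_def)
  have "S (v + w) = S v + S w" if "v \<in> carrier_vec m" "w \<in> carrier_vec m" for v w
    using TS(3)[of "S v + S w"] that by (simp add: TS)
  moreover have "S (c \<cdot>\<^sub>v v) = c \<cdot>\<^sub>v S v" if "v \<in> carrier_vec m" for c v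
    using TS(3)[of "c \<cdot>\<^sub>v S v"] that by (simp add: TS)
  moreover have "S (\<tau> x *\<^sub>v v) = \<rho> x *\<^sub>v S v" if "x \<in> carrier G" "v \<in> carrier_vec m" for x v
    using TS(3)[of "\<rho> x *\<^sub>v S v"] \<rho>c that by (simp add: TS)
  ultimately have "intertwiner G m \<tau> n \<rho> S T" by (simp add: intertwiner_def TS)
  then show ?thesis unfolding VW by (rule intertwiner_rep_iso[OF reps(2,1)])
qed

lemma rep_iso_trans:
  assumes "(V, W) \<in> rep_iso G" "(W, X) \<in> rep_iso G"
  shows "(V, X) \<in> rep_iso G"
proof -
  obtain n \<rho> m \<tau> l \<chi> where VW: "V = (n, \<rho>)" "W = (m, \<tau>)" "X = (l, \<chi>)" by (cases V; cases W; cases X) auto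
  have reps: "matrix_rep G (n, \<rho>)" "matrix_rep G (l, \<chi>)" using assms VW by (auto simp: rep_iso_def)
  obtain T S where "intertwiner G n \<rho> m \<tau> T S" using assms VW by (auto elim: rep_isoE)
  note TS = intertwinerD[OF this]
  obtain T' S' where "intertwiner G m \<tau> l \<chi> T' S'" using assms VW by (auto elim: rep_isoE)
  note TS' = intertwinerD[OF this]
  have "intertwiner G n \<rho> l \<chi> (\<lambda>v. T' (T v)) (\<lambda>v. S (S' v))" by (simp add: intertwiner_def TS TS')
  then show ?thesis unfolding VW by (rule intertwiner_rep_iso[OF reps])
qed

section \<open>The corner algebra of a projective partition\<close>

locale corner_category = rep_category C t + projective k p p\<^sub>0
  for C :: "nat \<Rightarrow> nat \<Rightarrow> two_part set" and t :: complex and k :: nat and p p\<^sub>0 :: two_part +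
  assumes p_Proj: "p \<in> Proj C k"
begin

abbreviation "Sp \<equiv> S_group C k p p\<^sub>0"
abbreviation "Cor \<equiv> corner C t k p"
abbreviation "I \<equiv> corner_ideal C t k p"
abbreviation "lp \<equiv> ploops p p"

lemma Sp_carrier: "\<sigma> \<in> carrier Sp \<longleftrightarrow> \<sigma> permutes {1..T} \<and> pp \<sigma> \<in> C k k"
  by (simp add: S_group_def sym_group_carrier)

lemma Sp_mult: "mult Sp = (\<circ>)"
  by (simp add: S_group_def sym_group_mult)

text \<open>The involution of \<open>pp \<sigma>\<close> lies in \<open>C\<close>, has full rank and
  is absorbed by \<open>p\<close>, so it is \<open>pp \<tau>\<close> for some \<tau>. Its product
  with \<open>pp \<sigma>\<close> is \<open>p\<close>, which identifies \<tau> as the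
  inverse.\<close>

lemma Sp_inverse:
  assumes "\<sigma> \<in> carrier Sp"
  shows "inv_into UNIV \<sigma> \<in> carrier Sp"
proof -
  have s: "\<sigma> permutes {1..T}" "pp \<sigma> \<in> C k k" using assms by (simp_all only: Sp_carrier)
  let ?r = "involution (pp \<sigma>)"
  have r: "?r \<in> C k k" by (rule C_involution[OF s(2)])
  have "p \<bullet>\<^sub>p ?r = ?r" "?r \<bullet>\<^sub>p p = ?r"
    using p_absorb_pp[OF s(1)] involution_pcomp[of "pp \<sigma>" p] involution_pcomp[of p "pp \<sigma>"]
    by (simp_all add: involution_p)
  moreover have "T \<le> through_blocks ?r" using pp_through[OF s(1)] by (simp add: through_blocks_involution)
  ultimately obtain \<tau> where \<tau>: "\<tau> permutes {1..T}" "?r = pp \<tau>" by (rule pp_E[OF C_parts[OF r]])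
  have "pp \<sigma> \<bullet>\<^sub>p ?r = p"
    by (rule pcomp_involution_eq_p[OF pp_parts[OF s(1)] p_absorb_pp(1)[OF s(1)]]) (simp add: pp_through[OF s(1)])
  then have "pp (\<sigma> \<circ> \<tau>) = pp id" using \<tau> pp_comp[OF s(1) \<tau>(1)] pp_id by simp
  then have "\<sigma> \<circ> \<tau> = id" by (rule pp_inject[OF permutes_compose[OF \<tau>(1) s(1)] permutes_id])
  then have "\<tau> = inv_into UNIV \<sigma>"
    using permutes_inv_o(2)[OF s(1)] by (metis comp_assoc comp_id fun.map_id0 id_comp)
  then show ?thesis using \<tau> r by (simp only: Sp_carrier)
qed

sublocale finite_group Sp
proof -
  interpret S: group "sym_group T" by (rule sym_group_is_group)
  let ?H = "{\<sigma> \<in> carrier (sym_group T). pp \<sigma> \<in> C k k}"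
  have H: "\<sigma> \<in> ?H \<longleftrightarrow> \<sigma> \<in> carrier Sp" for \<sigma> by (simp add: S_group_def)
  have "subgroup ?H (sym_group T)"
  proof (rule S.subgroupI)
    have "id \<in> ?H" using Proj_C[OF p_Proj] by (simp add: sym_group_carrier permutes_id pp_id)
    then show "?H \<noteq> {}" by blast
    show "inv\<^bsub>sym_group T\<^esub> a \<in> ?H" if "a \<in> ?H" for a
      using Sp_inverse[of a] that unfolding H[symmetric] by simp
    fix a b assume a: "a \<in> ?H" and b: "b \<in> ?H"
    then have ab: "a permutes {1..T}" "b permutes {1..T}" "pp a \<in> C k k" "pp b \<in> C k k"
      unfolding H Sp_carrier by simp_all
    have "pp (a \<circ> b) \<in> C k k" using C_comp[OF ab(4,3)] pp_comp[OF ab(1,2)] by simp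
    then show "a \<otimes>\<^bsub>sym_group T\<^esub> b \<in> ?H"
      using permutes_compose[OF ab(2,1)] by (simp add: sym_group_mult sym_group_carrier)
  qed auto
  then have "group Sp" unfolding S_group_def by (rule S.subgroup_imp_group)
  moreover have "finite (carrier Sp)"
    by (rule finite_subset[OF _ finite_permutations[of "{1..T}"]]) (auto simp: Sp_carrier)
  ultimately show "finite_group Sp" by (simp add: finite_group_def finite_group_axioms_def)
qed

lemma p_idempotent: "nproj p \<in> hom0 C k k" "nproj p \<diamondop> nproj p = nproj p"
  using nproj_hom0[OF p_Proj] nproj_idem[OF p_Proj] by auto

text \<open>\<open>corner\<close> is formed with the unnormalised \<open>p\<close>. It differs from
  the idempotent \<open>nproj p\<close> by an invertible scalar, so both cut out the same
  space.\<close>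

lemma Cor_iff: "f \<in> Cor \<longleftrightarrow> f \<in> hom0 C k k \<and> nproj p \<diamondop> f = f \<and> f \<diamondop> nproj p = f"
proof
  have sgp: "sg p 1 = pscale (t ^ lp) (nproj p)" by (simp add: nproj_def)
  note U = hom0_U[OF p_idempotent(1)]
  {
    assume "f \<in> Cor"
    then obtain g where g: "g \<in> hom0 C k k" "f = sg p 1 \<diamondop> g \<diamondop> sg p 1" by (auto simp: corner_def)
    have f: "f = pscale (t ^ lp * t ^ lp) (nproj p \<diamondop> g \<diamondop> nproj p)"
      unfolding g(2) sgp by (simp add: part_alg.bilin del: pscale_single)
    have "f \<in> hom0 C k k"
      unfolding g(2) using single_hom0[OF Proj_C[OF p_Proj]] g(1) by (intro hom0_mult)
    moreover have "nproj p \<diamondop> (nproj p \<diamondop> g \<diamondop> nproj p) = nproj p \<diamondop> nproj p \<diamondop> g \<diamondop> nproj p"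
      "nproj p \<diamondop> g \<diamondop> nproj p \<diamondop> nproj p = nproj p \<diamondop> g \<diamondop> (nproj p \<diamondop> nproj p)"
      using U hom0_U[OF g(1)] by (simp_all add: passoc)
    ultimately show "f \<in> hom0 C k k \<and> nproj p \<diamondop> f = f \<and> f \<diamondop> nproj p = f"
      by (simp add: f part_alg.bilin p_idempotent(2))
  next
    assume f: "f \<in> hom0 C k k \<and> nproj p \<diamondop> f = f \<and> f \<diamondop> nproj p = f"
    let ?g = "pscale (1 / (t ^ lp * t ^ lp)) f"
    have "?g \<in> hom0 C k k" using f pm.subspace_scale[OF subspace_hom0] by blast
    moreover have "sg p 1 \<diamondop> ?g \<diamondop> sg p 1 = f"
      unfolding sgp using f by (simp add: part_alg.bilin del: pscale_single)
    ultimately show "f \<in> Cor"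
      unfolding corner_def mem_Collect_eq by (intro exI[of _ ?g]) simp
  }
qed

lemma Cor_eq: "Cor = part_alg.corner_alg t (hom0 C k k) (nproj p)"
  by (auto simp: Cor_iff part_alg.corner_alg_def)

lemma fd_alg_Cor: "part_alg.fd_alg t Cor (nproj p)"
  unfolding Cor_eq by (rule part_alg.fd_alg_corner[OF fd_alg_hom0 p_idempotent])

lemma Cor_U: "x \<in> Cor \<Longrightarrow> x \<in> supp_in fin_part"
  by (auto simp: Cor_iff intro: hom0_U)

lemma Cor_mult: "x \<in> Cor \<Longrightarrow> y \<in> Cor \<Longrightarrow> x \<diamondop> y \<in> Cor"
  using part_alg.A_mult[OF fd_alg_Cor] .

lemma subspace_Cor: "pm.subspace Cor"
  using part_alg.A_sub[OF fd_alg_Cor] .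

lemma Cor_keys:
  assumes "x \<in> Cor" "r \<in> kys x"
  shows "r \<in> C k k" "p \<bullet>\<^sub>p r = r" "r \<bullet>\<^sub>p p = r"
  using assms nproj_left_iff[OF p_Proj, of x k] nproj_right_iff[OF p_Proj, of x k]
  unfolding Cor_iff by (auto simp: hom0_def)

lemma Cor_keys_pp:
  assumes x: "x \<in> Cor" "r \<in> kys x" and le: "T \<le> through_blocks r"
  obtains \<sigma> where "\<sigma> \<in> carrier Sp" "r = pp \<sigma>"
proof -
  obtain \<sigma> where "\<sigma> permutes {1..T}" "r = pp \<sigma>"
    by (rule pp_E[OF C_parts[OF Cor_keys(1)[OF x]] Cor_keys(2,3)[OF x] le])
  then show thesis using that Cor_keys(1)[OF x] unfolding Sp_carrier by blast
qed

lemma I_iff: "x \<in> I \<longleftrightarrow> x \<in> Cor \<and> (\<forall>r. T \<le> through_blocks r \<longrightarrow> lk x r = 0)"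
  by (auto simp: corner_ideal_def in_keys_iff not_less[symmetric])

lemma ideal_I: "part_alg.ideal_in t Cor I"
  unfolding part_alg.ideal_in_def
proof (intro conjI ballI)
  show "pm.subspace I"
    using subspace_Cor
    by (intro pm.subspaceI) (auto simp: I_iff lookup_add pm.subspace_0 pm.subspace_add pm.subspace_scale)
  fix a i assume a: "a \<in> Cor" and i: "i \<in> I"
  have iC: "i \<in> Cor" and it: "\<And>r. r \<in> kys i \<Longrightarrow> through_blocks r < T" using i by (auto simp: corner_ideal_def)
  have "through_blocks r < T" if r: "r \<in> kys (a \<diamondop> i)" for r
  proof -
    obtain q s where "q \<in> kys a" "s \<in> kys i" "r = q \<bullet>\<^sub>p s" using r by (rule keys_comp0E)
    then show ?thesis using through_le(1)[OF Cor_keys(1)[OF iC] Cor_keys(1)[OF a], of s q] it[of s] by simp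
  qed
  then show "a \<diamondop> i \<in> I" using Cor_mult[OF a iC] by (simp add: corner_ideal_def)
  have "through_blocks r < T" if r: "r \<in> kys (i \<diamondop> a)" for r
  proof -
    obtain q s where "q \<in> kys i" "s \<in> kys a" "r = q \<bullet>\<^sub>p s" using r by (rule keys_comp0E)
    then show ?thesis using through_le(2)[OF Cor_keys(1)[OF a] Cor_keys(1)[OF iC], of s q] it[of q] by simp
  qed
  then show "i \<diamondop> a \<in> I" using Cor_mult[OF iC a] by (simp add: corner_ideal_def)
qed

lemma subspace_I: "pm.subspace I"
  using ideal_I by (simp add: part_alg.ideal_in_def)

abbreviation im :: "((nat \<Rightarrow> nat) \<Rightarrow>\<^sub>0 complex) \<Rightarrow> mor" where
  "im \<equiv> ga_image t p p\<^sub>0"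

text \<open>The composite \<open>pEp \<rightarrow> pEp / I\<^sub>p \<cong> \<complex>S(p)\<close>, left inverse to \<^term>\<open>im\<close>.\<close>

definition red :: "mor \<Rightarrow> ((nat \<Rightarrow> nat) \<Rightarrow>\<^sub>0 complex)" where
  "red x = (\<Sum>\<sigma>\<in>carrier Sp. sg \<sigma> (t ^ lp * lk x (pp \<sigma>)))"

lemma lookup_red: "lk (red x) \<sigma> = (if \<sigma> \<in> carrier Sp then t ^ lp * lk x (pp \<sigma>) else 0)"
proof -
  have "lk (red x) \<sigma> = (\<Sum>\<tau>\<in>carrier Sp. if \<tau> = \<sigma> then t ^ lp * lk x (pp \<tau>) else 0)"
    unfolding red_def lookup_sum by (intro sum.cong refl) (auto simp: lookup_single when_def)
  then show ?thesis using finite_carrier by simp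
qed

lemma red_in: "red x \<in> group_algebra Sp"
  unfolding group_algebra_eq supp_in_iff by (simp add: lookup_red)

lemma red_add: "red (x + y) = red x + red y" and red_diff: "red (x - y) = red x - red y"
  by (rule poly_mapping_eqI; simp add: lookup_red lookup_add lookup_minus algebra_simps)+

lemma im_eq: "a \<in> group_algebra Sp \<Longrightarrow> im a = (\<Sum>\<sigma>\<in>carrier Sp. sg (pp \<sigma>) (lk a \<sigma> / t ^ lp))"
  unfolding ga_image_def group_algebra_def using finite_carrier
  by (intro sum.mono_neutral_left) (auto simp: in_keys_iff)

lemma pp_inj: "\<sigma> \<in> carrier Sp \<Longrightarrow> \<tau> \<in> carrier Sp \<Longrightarrow> pp \<sigma> = pp \<tau> \<longleftrightarrow> \<sigma> = \<tau>"
  using pp_inject by (auto simp: Sp_carrier)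

lemma lookup_im: "a \<in> group_algebra Sp \<Longrightarrow> \<sigma> \<in> carrier Sp \<Longrightarrow> lk (im a) (pp \<sigma>) = lk a \<sigma> / t ^ lp"
proof -
  assume a: "a \<in> group_algebra Sp" and s: "\<sigma> \<in> carrier Sp"
  have "lk (im a) (pp \<sigma>) = (\<Sum>\<tau>\<in>carrier Sp. if \<tau> = \<sigma> then lk a \<tau> / t ^ lp else 0)"
    unfolding im_eq[OF a] lookup_sum using s
    by (intro sum.cong refl) (auto simp: lookup_single when_def pp_inj)
  then show ?thesis using finite_carrier s by simp
qed

lemma lookup_im_other: "a \<in> group_algebra Sp \<Longrightarrow> r \<notin> pp ` carrier Sp \<Longrightarrow> lk (im a) r = 0"
  unfolding im_eq lookup_sum by (intro sum.neutral) (auto simp: lookup_single when_def)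

lemma im_Cor: "a \<in> group_algebra Sp \<Longrightarrow> im a \<in> Cor"
proof -
  assume a: "a \<in> group_algebra Sp"
  have "sg (pp \<sigma>) c \<in> Cor" if s: "\<sigma> \<in> carrier Sp" for \<sigma> c
  proof -
    have "\<sigma> permutes {1..T}" "pp \<sigma> \<in> C k k" using s by (simp_all only: Sp_carrier)
    then show ?thesis
      unfolding Cor_iff
      using single_hom0 nproj_single_left[OF p_Proj] nproj_single_right[OF p_Proj] p_absorb_pp by blast
  qed
  then show "im a \<in> Cor" unfolding im_eq[OF a] by (intro pm.subspace_sum subspace_Cor)
qed

lemma red_im: "a \<in> group_algebra Sp \<Longrightarrow> red (im a) = a"
  by (rule poly_mapping_eqI) (auto simp: lookup_red lookup_im group_algebra_eq supp_in_iff)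

lemma red_I: "x \<in> I \<Longrightarrow> red x = 0"
proof (rule poly_mapping_eqI)
  fix \<sigma> assume x: "x \<in> I"
  have "lk x (pp \<sigma>) = 0" if "\<sigma> \<in> carrier Sp"
    using that x pp_through unfolding I_iff Sp_carrier by simp
  then show "lk (red x) \<sigma> = lk 0 \<sigma>" by (simp add: lookup_red)
qed

lemma im_red: "x \<in> Cor \<Longrightarrow> x - im (red x) \<in> I"
  unfolding I_iff
proof (intro conjI allI impI)
  assume x: "x \<in> Cor"
  show "x - im (red x) \<in> Cor" by (intro pm.subspace_diff subspace_Cor x im_Cor red_in)
  fix r assume r: "T \<le> through_blocks r"
  show "lk (x - im (red x)) r = 0"
  proof (cases "r \<in> pp ` carrier Sp")
    case True
    then show ?thesis by (auto simp: lookup_minus lookup_im[OF red_in] lookup_red)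
  next
    case False
    then have "r \<notin> kys x" using Cor_keys_pp[OF x _ r] by blast
    with False show ?thesis by (simp add: lookup_minus lookup_im_other[OF red_in] in_keys_iff)
  qed
qed

lemma red_0_iff: "x \<in> Cor \<Longrightarrow> red x = 0 \<longleftrightarrow> x \<in> I"
proof
  assume x: "x \<in> Cor" "red x = 0"
  have "im 0 = 0" by (simp add: ga_image_def)
  then show "x \<in> I" using im_red[OF x(1)] x(2) by simp
qed (rule red_I)

text \<open>Multiplicativity is exact and not only modulo \<open>I\<close>: products of the
  \<open>pp \<sigma>\<close> are again of this form, and by \<open>ploops_pp\<close> their loops
  match the normalisation. Both sides are supported on these partitions, where \<open>red\<close>
  loses nothing.\<close>

lemma im_mult:
  assumes a: "a \<in> group_algebra Sp" and b: "b \<in> group_algebra Sp"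
  shows "im a \<diamondop> im b = im (ga_mult Sp a b)"
proof -
  have "red (im a \<diamondop> im b) = ga_mult Sp a b"
  proof -
    have add: "red (sum f S) = (\<Sum>s\<in>S. red (f s))" for f :: "(nat \<Rightarrow> nat) \<Rightarrow> mor" and S
    proof (induction S rule: infinite_finite_induct)
      case (insert x F)
      then show ?case by (simp add: red_add)
    qed (simp_all add: red_I pm.subspace_0[OF subspace_I])
    have sgl: "red (sg (pp \<sigma>) c) = sg \<sigma> (t ^ lp * c)" if s: "\<sigma> \<in> carrier Sp" for \<sigma> c
      using s by (intro poly_mapping_eqI) (auto simp: lookup_red lookup_single when_def pp_inj)
    have red_single: "red (sg (pp \<sigma>) (c / t ^ lp) \<diamondop> sg (pp \<tau>) (d / t ^ lp)) = sg (\<sigma> \<circ> \<tau>) (c * d)"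
      if s: "\<sigma> \<in> carrier Sp" "\<tau> \<in> carrier Sp" for \<sigma> \<tau> c d
    proof -
      have perm: "\<sigma> permutes {1..T}" "\<tau> permutes {1..T}" using s by (simp_all only: Sp_carrier)
      have "\<sigma> \<circ> \<tau> \<in> carrier Sp" using m_closed[OF s] by (simp add: Sp_mult)
      then show ?thesis by (simp add: comp0_single pp_comp[OF perm] ploops_pp[OF perm] sgl)
    qed
    have "red (im a \<diamondop> im b) = (\<Sum>\<tau>\<in>carrier Sp. \<Sum>\<sigma>\<in>carrier Sp. sg (\<sigma> \<circ> \<tau>) (lk a \<sigma> * lk b \<tau>))"
      unfolding im_eq[OF a] im_eq[OF b]
      by (simp add: part_alg.mult_sum_left part_alg.mult_sum_right add red_single)
    also have "\<dots> = ga_mult Sp a b"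
      unfolding ga_mult_eq using a b finite_carrier
      by (subst twisted_mult_superset[of "carrier Sp" "carrier Sp"])
        (auto simp: group_algebra_def Sp_mult intro: sum.swap)
    finally show ?thesis .
  qed
  moreover have "im x = im y" if "red (im x) = red (im y)" "x \<in> group_algebra Sp" "y \<in> group_algebra Sp" for x y
    using that by (simp add: red_im)
  moreover have "x = im (red x)" if x: "\<And>r. r \<in> kys x \<Longrightarrow> r \<in> pp ` carrier Sp" for x
  proof (rule poly_mapping_eqI)
    fix r show "lk x r = lk (im (red x)) r"
    proof (cases "r \<in> pp ` carrier Sp")
      case True
      then show ?thesis by (auto simp: lookup_im[OF red_in] lookup_red)
    next
      case False
      then show ?thesis using x by (auto simp: lookup_im_other[OF red_in] in_keys_iff)
    qed
  qed
  moreover have "r \<in> pp ` carrier Sp" if r: "r \<in> kys (im a \<diamondop> im b)" for r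
  proof -
    obtain q s where "q \<in> kys (im a)" "s \<in> kys (im b)" and rq: "r = q \<bullet>\<^sub>p s" using r by (rule keys_comp0E)
    then obtain \<sigma> \<tau> where s: "\<sigma> \<in> carrier Sp" "\<tau> \<in> carrier Sp" "q = pp \<sigma>" "s = pp \<tau>"
      using lookup_im_other[OF a, of q] lookup_im_other[OF b, of s] by (auto simp: in_keys_iff)
    then have perm: "\<sigma> permutes {1..T}" "\<tau> permutes {1..T}" by (simp_all only: Sp_carrier)
    show ?thesis using rq s pp_comp[OF perm] m_closed[OF s(1,2)] by (auto simp: Sp_mult)
  qed
  ultimately show ?thesis by metis
qed

text \<open>Each factor is its image under \<open>red\<close> and \<open>im\<close> plus an element
  of \<open>I\<close>. The terms containing such an element lie in \<open>I\<close>, which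
  \<open>red\<close> kills.\<close>

lemma red_mult:
  assumes x: "x \<in> Cor" and y: "y \<in> Cor"
  shows "red (x \<diamondop> y) = ga_mult Sp (red x) (red y)"
proof -
  define x' where "x' = x - im (red x)"
  define y' where "y' = y - im (red y)"
  have x': "x' \<in> I" and y': "y' \<in> I" using im_red x y by (auto simp: x'_def y'_def)
  have "x \<diamondop> y = im (red x) \<diamondop> im (red y) + (x' \<diamondop> y + im (red x) \<diamondop> y')"
    by (simp add: x'_def y'_def part_alg.bilin)
  moreover have "x' \<diamondop> y + im (red x) \<diamondop> y' \<in> I"
    using ideal_I x' y' y im_Cor[OF red_in] unfolding part_alg.ideal_in_def by (intro pm.subspace_add) auto
  ultimately have "red (x \<diamondop> y) = red (im (red x) \<diamondop> im (red y))"
    by (simp only:) (subst red_add, simp add: red_I)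
  also have "\<dots> = ga_mult Sp (red x) (red y)"
    unfolding im_mult[OF red_in red_in] by (rule red_im) (simp add: red_in)
  finally show ?thesis .
qed

section \<open>Primitive idempotents of the corner and of the group algebra\<close>

lemma prim_Cor_iff: "part_alg.prim t Cor e \<longleftrightarrow> e \<in> Cor \<and> part_alg.prim t (hom0 C k k) e"
proof -
  \<comment> \<open>Whatever lies below an element of the corner lies in the corner, so primitivity
    may be tested in either algebra.\<close>
  have below: "f \<in> Cor" if e: "e \<in> Cor" and f: "f \<in> hom0 C k k" "e \<diamondop> f = f" "f \<diamondop> e = f" for f
  proof -
    note U = Cor_U[OF e] hom0_U[OF f(1)] hom0_U[OF p_idempotent(1)]
    have "nproj p \<diamondop> (e \<diamondop> f) = nproj p \<diamondop> e \<diamondop> f" "f \<diamondop> e \<diamondop> nproj p = f \<diamondop> (e \<diamondop> nproj p)" using U by (simp_all add: passoc)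
    then show ?thesis using e f by (simp add: Cor_iff)
  qed
  have "Cor \<subseteq> hom0 C k k" by (auto simp: Cor_iff)
  with below show ?thesis unfolding part_alg.prim_def by blast
qed

lemma Cor_corner:
  assumes e: "e \<in> Cor" "e \<diamondop> e = e"
  shows "part_alg.ideal_in t (part_alg.corner_alg t Cor e) I" "part_alg.fd_alg t (part_alg.corner_alg t Cor e) e"
  using ideal_I part_alg.fd_alg_corner[OF fd_alg_Cor e]
  by (auto simp: part_alg.ideal_in_def part_alg.corner_alg_def)

text \<open>An idempotent \<open>g\<close> below \<open>red e\<close> is represented by
  \<open>e \<diamondop> im g \<diamondop> e\<close>, which is idempotent modulo \<open>I\<close>.
  Fitting's lemma in the corner of \<open>e\<close> improves it to a true idempotent below
  \<open>e\<close>, which is 0 or \<open>e\<close>.\<close>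

lemma prim_red:
  assumes e: "part_alg.prim t Cor e" and eI: "e \<notin> I"
  shows "ga.prim (group_algebra Sp) (red e)"
  unfolding ga.prim_def
proof (intro conjI ballI impI)
  have eC: "e \<in> Cor" "e \<diamondop> e = e" using e by (auto simp: part_alg.prim_def)
  show "red e \<in> group_algebra Sp" by (rule red_in)
  show "ga_mult Sp (red e) (red e) = red e" using red_mult[OF eC(1) eC(1)] eC by simp
  show "red e \<noteq> 0" using red_0_iff[OF eC(1)] eI by simp
  fix g assume g: "g \<in> group_algebra Sp" "ga_mult Sp g g = g" "ga_mult Sp (red e) g = g" "ga_mult Sp g (red e) = g"
  let ?z = "e \<diamondop> im g \<diamondop> e"
  note eU = Cor_U[OF eC(1)] and gU = Cor_U[OF im_Cor[OF g(1)]]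
  have zC: "?z \<in> Cor" by (intro Cor_mult eC im_Cor g)
  have rz: "red ?z = g"
    using red_mult[OF Cor_mult[OF eC(1) im_Cor[OF g(1)]] eC(1)] red_mult[OF eC(1) im_Cor[OF g(1)]] g red_im[OF g(1)]
    by simp
  have "e \<diamondop> ?z = e \<diamondop> e \<diamondop> im g \<diamondop> e" "?z \<diamondop> e = e \<diamondop> im g \<diamondop> (e \<diamondop> e)" using eU gU by (simp_all add: passoc)
  then have zc: "?z \<in> part_alg.corner_alg t Cor e" using zC eC by (simp add: part_alg.corner_alg_def)
  have "red (?z \<diamondop> ?z - ?z) = 0" using red_mult[OF zC zC] rz g by (simp add: red_diff)
  then have zI: "?z \<diamondop> ?z - ?z \<in> I"
    using red_0_iff pm.subspace_diff[OF subspace_Cor Cor_mult[OF zC zC] zC] by blast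
  obtain f where f: "f \<in> part_alg.corner_alg t Cor e" "f \<diamondop> f = f"
    "\<And>J. part_alg.ideal_in t (part_alg.corner_alg t Cor e) J \<Longrightarrow> ?z \<diamondop> ?z - ?z \<in> J \<Longrightarrow> f - ?z \<in> J"
    using part_alg.fitting[OF Cor_corner(2)[OF eC] zc] by metis
  have "f - ?z \<in> I" by (rule f(3)[OF Cor_corner(1)[OF eC] zI])
  then have rf: "red f = g" using red_I red_diff rz by (metis eq_iff_diff_eq_0)
  have "f = 0 \<or> f = e" using e f by (auto simp: part_alg.prim_def part_alg.corner_alg_def)
  then show "g = 0 \<or> g = red e" using rf red_I[OF pm.subspace_0[OF subspace_I]] by auto
qed

text \<open>The element \<open>e'\<close> in the definition is forced to be \<open>red e\<close>,
  because \<open>red\<close> kills the ideal and is a left inverse of \<open>im\<close>.\<close>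

lemma is_lift_iff:
  "is_lift C t k p p\<^sub>0 V e \<longleftrightarrow> part_alg.prim t Cor e \<and> ga_mult Sp (red e) (red e) = red e \<and> affords Sp (red e) V"
proof
  assume "is_lift C t k p p\<^sub>0 V e"
  then obtain e' where e: "primitive_idempotent C t k e" "e \<in> Cor" and e': "e' \<in> group_algebra Sp"
    "ga_mult Sp e' e' = e'" "affords Sp e' V" "e - im e' \<in> I" by (auto simp: is_lift_def)
  have "red e = e'" using red_I[OF e'(4)] red_im[OF e'(1)] by (simp add: red_diff)
  then show "part_alg.prim t Cor e \<and> ga_mult Sp (red e) (red e) = red e \<and> affords Sp (red e) V"
    using e e' by (simp add: prim_Cor_iff primitive_iff)
next
  assume e: "part_alg.prim t Cor e \<and> ga_mult Sp (red e) (red e) = red e \<and> affords Sp (red e) V"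
  then have "e \<in> Cor" by (simp add: part_alg.prim_def)
  then show "is_lift C t k p p\<^sub>0 V e"
    unfolding is_lift_def using e im_red red_in by (auto simp: prim_Cor_iff primitive_iff)
qed

text \<open>Fitting's lemma gives an idempotent congruent to \<open>im e'\<close>, and
  \<open>prim_lift\<close> shrinks it to a primitive one with the same reduction. The dichotomy that
  \<open>prim_lift\<close> asks for is the primitivity of \<open>e'\<close>.\<close>

lemma lift_exists:
  assumes irr: "irreducible_rep Sp V"
  obtains e where "is_lift C t k p p\<^sub>0 V e"
proof -
  obtain n \<rho> where V: "V = (n, \<rho>)" by (cases V)
  obtain e' where e': "e' \<in> group_algebra Sp" "ga_mult Sp e' e' = e'" "affords Sp e' (n, \<rho>)"
    by (rule irreducible_affords_exists[OF irr[unfolded V]])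
  have pr: "ga.prim (group_algebra Sp) e'"
    by (rule affords_irreducible_prim[OF e' irr[unfolded V]])
  have zC: "im e' \<in> Cor" by (rule im_Cor[OF e'(1)])
  have "im e' \<diamondop> im e' - im e' \<in> I"
    using im_mult[OF e'(1) e'(1)] e'(2) pm.subspace_0[OF subspace_I] by simp
  then obtain e0 where e0: "e0 \<in> Cor" "e0 \<diamondop> e0 = e0" "e0 - im e' \<in> I"
    using part_alg.fitting[OF fd_alg_Cor zC] ideal_I by metis
  have re0: "red e0 = e'" using red_I[OF e0(3)] red_im[OF e'(1)] by (simp add: red_diff)
  have "e0 \<notin> I" using red_0_iff[OF e0(1)] re0 pr by (auto simp: ga.prim_def)
  then obtain f where f: "part_alg.prim t Cor f" "f - e0 \<in> I"
  proof (rule part_alg.prim_lift[OF fd_alg_Cor ideal_I e0(1,2)])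
    fix g assume g: "g \<in> Cor" "g \<diamondop> g = g" "e0 \<diamondop> g = g" "g \<diamondop> e0 = g"
    have "red g = 0 \<or> red g = e'"
      using pr red_in[of g] red_mult[OF g(1) g(1)] red_mult[OF e0(1) g(1)] red_mult[OF g(1) e0(1)] g re0
      unfolding ga.prim_def by metis
    then show "g \<in> I \<or> e0 - g \<in> I"
      using red_0_iff[OF g(1)] red_0_iff[OF pm.subspace_diff[OF subspace_Cor e0(1) g(1)]] re0
      by (auto simp: red_diff)
  qed blast
  have "red f = e'" using red_I[OF f(2)] re0 by (simp add: red_diff)
  then show thesis using that[of f] f e' unfolding is_lift_iff V by simp
qed

lemma lift_not_I:
  assumes "is_lift C t k p p\<^sub>0 V e" "irreducible_rep Sp V"
  shows "e \<notin> I" "e \<in> Cor" "ga.prim (group_algebra Sp) (red e)"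
proof -
  obtain n \<rho> where V: "V = (n, \<rho>)" by (cases V)
  have e: "part_alg.prim t Cor e" "ga_mult Sp (red e) (red e) = red e" "affords Sp (red e) V"
    using assms(1) by (auto simp: is_lift_iff)
  show eC: "e \<in> Cor" using e by (simp add: part_alg.prim_def)
  show pr: "ga.prim (group_algebra Sp) (red e)"
    using affords_irreducible_prim[OF red_in e(2)] e(3) assms(2) unfolding V by blast
  show "e \<notin> I" using red_I pr by (auto simp: ga.prim_def)
qed

text \<open>Equivalent reductions lift to x and y with \<open>x \<diamondop> y\<close> congruent to
  \<open>e\<close>. Since the corner of \<open>e\<close> is local, y can be corrected to satisfy
  \<open>x \<diamondop> y' = e\<close>; then \<open>y' \<diamondop> x\<close> is a nonzero
  idempotent below \<open>f\<close>, hence equal to \<open>f\<close>.\<close>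

lemma lift_unique:
  assumes e: "is_lift C t k p p\<^sub>0 V e" and f: "is_lift C t k p p\<^sub>0 W f"
    and irr: "irreducible_rep Sp V" "irreducible_rep Sp W" and iso: "(V, W) \<in> rep_iso Sp"
  shows "pequiv k e k f"
proof -
  obtain n \<rho> m \<tau> where V: "V = (n, \<rho>)" and W: "W = (m, \<tau>)" by (cases V; cases W)
  have e': "part_alg.prim t Cor e" "ga_mult Sp (red e) (red e) = red e" "affords Sp (red e) (n, \<rho>)"
    and f': "part_alg.prim t Cor f" "ga_mult Sp (red f) (red f) = red f" "affords Sp (red f) (m, \<tau>)"
    using e f by (auto simp: is_lift_iff V W)
  have eC: "e \<in> Cor" "e \<diamondop> e = e" "e \<noteq> 0" and fC: "f \<in> Cor" "f \<diamondop> f = f"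
    using e' f' by (auto simp: part_alg.prim_def)
  obtain a b where ab: "a \<in> group_algebra Sp" "b \<in> group_algebra Sp" "ga_mult Sp (red e) a = a" "ga_mult Sp a (red f) = a"
    "ga_mult Sp (red f) b = b" "ga_mult Sp b (red e) = b" "ga_mult Sp a b = red e" "ga_mult Sp b a = red f"
    by (rule rep_iso_equiv_idempotents[OF red_in e'(2) red_in f'(2) e'(3) f'(3) iso[unfolded V W]])
  \<comment> \<open>The outer factors enforce exact absorption by \<open>e\<close> and
    \<open>f\<close>, which \<open>im a\<close> satisfies only modulo \<open>I\<close>.\<close>
  define x where "x = e \<diamondop> im a \<diamondop> f"
  define y where "y = f \<diamondop> im b \<diamondop> e"
  have xC: "x \<in> Cor" and yC: "y \<in> Cor" unfolding x_def y_def by (intro Cor_mult eC fC im_Cor ab)+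
  note U = Cor_U[OF eC(1)] Cor_U[OF fC(1)] Cor_U[OF xC] Cor_U[OF yC] Cor_U[OF im_Cor[OF ab(1)]] Cor_U[OF im_Cor[OF ab(2)]]
  have rx: "red x = a" and ry: "red y = b"
    unfolding x_def y_def using ab
    by (simp_all add: red_mult Cor_mult eC fC im_Cor red_im)
  have "e \<diamondop> x = e \<diamondop> e \<diamondop> im a \<diamondop> f" "x \<diamondop> f = e \<diamondop> im a \<diamondop> (f \<diamondop> f)"
    "f \<diamondop> y = f \<diamondop> f \<diamondop> im b \<diamondop> e" "y \<diamondop> e = f \<diamondop> im b \<diamondop> (e \<diamondop> e)"
    unfolding x_def y_def using U by (simp_all add: passoc)
  then have xe: "e \<diamondop> x = x" "x \<diamondop> f = x" "f \<diamondop> y = y" "y \<diamondop> e = y"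
    using eC fC by (simp_all add: x_def y_def)
  have zC: "x \<diamondop> y \<in> Cor" by (rule Cor_mult[OF xC yC])
  have "red (x \<diamondop> y - e) = 0" using rx ry ab by (simp add: red_diff red_mult xC yC)
  then have zI: "x \<diamondop> y - e \<in> I" using red_0_iff pm.subspace_diff[OF subspace_Cor zC eC(1)] by blast
  have ez: "e \<diamondop> (x \<diamondop> y) = x \<diamondop> y" "x \<diamondop> y \<diamondop> e = x \<diamondop> y"
  proof -
    have "e \<diamondop> (x \<diamondop> y) = e \<diamondop> x \<diamondop> y" "x \<diamondop> y \<diamondop> e = x \<diamondop> (y \<diamondop> e)" using U by (simp_all add: passoc)
    then show "e \<diamondop> (x \<diamondop> y) = x \<diamondop> y" "x \<diamondop> y \<diamondop> e = x \<diamondop> y" using xe by simp_all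
  qed
  obtain w where w: "w \<in> Cor" "e \<diamondop> w = w" "w \<diamondop> e = w" "x \<diamondop> y \<diamondop> w = e"
    by (rule part_alg.prim_invertible[OF fd_alg_Cor e'(1) ideal_I lift_not_I(1)[OF e irr(1)] zC ez zI])
  define y' where "y' = y \<diamondop> w"
  have y'C: "y' \<in> Cor" unfolding y'_def by (rule Cor_mult[OF yC w(1)])
  note U = U Cor_U[OF w(1)] Cor_U[OF y'C]
  have xy': "x \<diamondop> y' = e" unfolding y'_def using U w by (simp flip: passoc)
  have y'e: "y' \<diamondop> e = y'" unfolding y'_def using U w by (simp add: passoc)
  have fy': "f \<diamondop> y' = y'" unfolding y'_def using U xe by (simp flip: passoc)
  let ?g = "y' \<diamondop> x"
  have "?g \<diamondop> ?g = y' \<diamondop> (x \<diamondop> y') \<diamondop> x" using U by (simp add: passoc)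
  then have gg: "?g \<diamondop> ?g = ?g" using xy' y'e by simp
  have fg: "f \<diamondop> ?g = ?g" "?g \<diamondop> f = ?g"
  proof -
    have "f \<diamondop> ?g = f \<diamondop> y' \<diamondop> x" "?g \<diamondop> f = y' \<diamondop> (x \<diamondop> f)" using U by (simp_all add: passoc)
    then show "f \<diamondop> ?g = ?g" "?g \<diamondop> f = ?g" using fy' xe by simp_all
  qed
  have "?g \<noteq> 0"
  proof
    assume g0: "?g = 0"
    have "e = x \<diamondop> y' \<diamondop> (x \<diamondop> y')" using xy' eC by simp
    also have "\<dots> = x \<diamondop> ?g \<diamondop> y'" using U by (simp add: passoc)
    finally show False using g0 eC by simp
  qed
  then have gf: "?g = f" using f'(1) Cor_mult[OF y'C xC] gg fg unfolding part_alg.prim_def by blast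
  show ?thesis
    unfolding pequiv_def
  proof (rule bexI[of _ y'], rule bexI[of _ x], intro conjI)
    show "y' \<in> hom0 C k k" "x \<in> hom0 C k k" using y'C xC by (simp_all add: Cor_iff)
  qed (fact y'e fy' xe xy' gf)+
qed

text \<open>An equivalence found among all endomorphisms of \<open>[k]\<close> already lies in the
  corner, since \<open>a\<close> and \<open>b\<close> absorb \<open>e\<close> and \<open>f\<close>.
  So \<open>red\<close> applies to it and preserves its equations.\<close>

lemma pequiv_lifts_rep_iso:
  assumes e: "is_lift C t k p p\<^sub>0 V e" and f: "is_lift C t k p p\<^sub>0 W f"
    and irr: "irreducible_rep Sp V" "irreducible_rep Sp W" and equiv: "pequiv k e k f"
  shows "(V, W) \<in> rep_iso Sp"
proof -
  obtain n \<rho> m \<tau> where V: "V = (n, \<rho>)" and W: "W = (m, \<tau>)" by (cases V; cases W)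
  have e': "part_alg.prim t Cor e" "ga_mult Sp (red e) (red e) = red e" "affords Sp (red e) (n, \<rho>)"
    and f': "part_alg.prim t Cor f" "ga_mult Sp (red f) (red f) = red f" "affords Sp (red f) (m, \<tau>)"
    using e f by (auto simp: is_lift_iff V W)
  have eC: "e \<in> Cor" "e \<diamondop> e = e" and fC: "f \<in> Cor" "f \<diamondop> f = f"
    using e' f' by (auto simp: part_alg.prim_def)
  obtain a b where ab: "a \<in> hom0 C k k" "b \<in> hom0 C k k" "a \<diamondop> e = a" "f \<diamondop> a = a" "b \<diamondop> f = b" "e \<diamondop> b = b"
    "b \<diamondop> a = e" "a \<diamondop> b = f" using equiv unfolding pequiv_def by blast
  note U = Cor_U[OF eC(1)] Cor_U[OF fC(1)] hom0_U[OF ab(1)] hom0_U[OF ab(2)] hom0_U[OF p_idempotent(1)]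
  have "nproj p \<diamondop> (f \<diamondop> a) = nproj p \<diamondop> f \<diamondop> a" "a \<diamondop> e \<diamondop> nproj p = a \<diamondop> (e \<diamondop> nproj p)"
    "nproj p \<diamondop> (e \<diamondop> b) = nproj p \<diamondop> e \<diamondop> b" "b \<diamondop> f \<diamondop> nproj p = b \<diamondop> (f \<diamondop> nproj p)"
    using U by (simp_all add: passoc)
  then have abC: "a \<in> Cor" "b \<in> Cor" using ab eC fC by (simp_all add: Cor_iff)
  have \<rho>: "matrix_rep Sp (n, \<rho>)" "matrix_rep Sp (m, \<tau>)" using irr by (auto simp: irreducible_rep_def V W)
  show ?thesis
    unfolding V W
  proof (rule equiv_idempotents_rep_iso[OF red_in e'(2) red_in f'(2) e'(3) f'(3) \<rho>, of "red b" "red a"])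
    show "ga_mult Sp (red b) (red f) = red b" using red_mult[OF abC(2) fC(1)] ab by simp
    show "ga_mult Sp (red a) (red e) = red a" using red_mult[OF abC(1) eC(1)] ab by simp
    show "ga_mult Sp (red b) (red a) = red e" using red_mult[OF abC(2,1)] ab by simp
    show "ga_mult Sp (red a) (red b) = red f" using red_mult[OF abC] ab by simp
  qed (rule red_in)+
qed

lemma lift_corner_idem:
  assumes "is_lift C t k p p\<^sub>0 V e" "irreducible_rep Sp V"
  shows "corner_idem k p e" "\<exists>q\<in>kys e. T \<le> through_blocks q" "part_alg.prim t (hom0 C k k) e"
proof -
  have eC: "e \<in> Cor" and eI: "e \<notin> I" using lift_not_I[OF assms] by auto
  show pr: "part_alg.prim t (hom0 C k k) e" using assms(1) by (simp add: is_lift_iff prim_Cor_iff)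
  then show "corner_idem k p e" using eC p_Proj by (simp add: corner_idem_def Cor_iff part_alg.prim_def)
  show "\<exists>q\<in>kys e. T \<le> through_blocks q" using eC eI by (auto simp: corner_ideal_def not_less)
qed

text \<open>All admissible choices lead to the same class: a lift for an isomorphic matrix form is
  also a lift for \<open>v\<close>, and any two lifts for \<open>v\<close> are equivalent.\<close>

lemma L_obj_eq:
  assumes v: "irreducible_rep Sp v" and e: "is_lift C t k p p\<^sub>0 v e"
  shows "L_obj C t k p p\<^sub>0 (rep_iso Sp `` {v}) = Rep_iso C t `` {image_obj k e}"
proof
  have mv: "matrix_rep Sp v" using v by (auto simp: irreducible_rep_def)
  then have vv: "(v, v) \<in> rep_iso Sp" by (rule rep_iso_refl)
  then show "Rep_iso C t `` {image_obj k e} \<subseteq> L_obj C t k p p\<^sub>0 (rep_iso Sp `` {v})"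
    using e by (intro subsetI) (auto simp: L_obj_def)
  show "L_obj C t k p p\<^sub>0 (rep_iso Sp `` {v}) \<subseteq> Rep_iso C t `` {image_obj k e}"
  proof
    fix x assume "x \<in> L_obj C t k p p\<^sub>0 (rep_iso Sp `` {v})"
    then obtain \<rho> f where \<rho>: "(v, \<rho>) \<in> rep_iso Sp" and f: "is_lift C t k p p\<^sub>0 \<rho> f"
      and x: "(image_obj k f, x) \<in> Rep_iso C t" by (auto simp: L_obj_def)
    obtain n \<tau> m \<upsilon> where eqs: "\<rho> = (n, \<tau>)" "v = (m, \<upsilon>)" by (cases \<rho>; cases v) simp
    have "affords Sp (red f) v"
      unfolding eqs
    proof (rule affords_iso[OF red_in])
      show "ga_mult Sp (red f) (red f) = red f" "affords Sp (red f) (n, \<tau>)"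
        using f by (simp_all add: is_lift_iff eqs)
      show "((n, \<tau>), (m, \<upsilon>)) \<in> rep_iso Sp" using rep_iso_sym[OF \<rho>] by (simp add: eqs)
    qed
    then have f': "is_lift C t k p p\<^sub>0 v f" using f by (simp add: is_lift_iff)
    have "pequiv k e k f" by (rule lift_unique[OF e f' v v vv])
    then have "(image_obj k e, image_obj k f) \<in> Rep_iso C t"
      using lift_corner_idem(1)[OF e v] lift_corner_idem(1)[OF f' v] by (subst image_obj_iso) (auto simp: corner_idem_def)
    then show "x \<in> Rep_iso C t `` {image_obj k e}" using Rep_iso_trans x by blast
  qed
qed

end

text \<open>The system \<open>R\<close> of representatives and the choice \<open>h\<close> of the
  factors \<open>p\<^sub>0\<close> are arbitrary; the values of the map are isomorphism classes, as
  sets of objects.\<close>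

theorem theorem1p2:
  fixes C :: "nat \<Rightarrow> nat \<Rightarrow> two_part set"
    and t :: complex
    and R :: "(nat \<times> two_part) set"
    and h :: "nat \<times> two_part \<Rightarrow> two_part"
  assumes "partition_category C"
    and "t \<noteq> 0"
    and "R \<subseteq> PP C"
    and "\<And>X. X \<in> PP C // PP_equiv C \<Longrightarrow> \<exists>!x. x \<in> R \<inter> X"
    and "\<And>k p. (k, p) \<in> R \<Longrightarrow> proj_by k p (h (k, p))"
  shows "bij_betw (\<lambda>((k, p), V). L_obj C t k p (h (k, p)) V)
    (SIGMA (k, p):R. Irr (S_group C k p (h (k, p))))
    (Indec C t)"
proof -
  interpret rep_category C t
    using assms(1,2) by (simp add: rep_category_def rep_category_axioms_def)
  let ?S = "\<lambda>k p. S_group C k p (h (k, p))"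
  have corner: "corner_category C t k p (h (k, p))" if "(k, p) \<in> R" for k p
    using assms(3) assms(5)[OF that] that rep_category_axioms
    by (auto simp: corner_category_def corner_category_axioms_def projective_def PP_def)
  \<comment> \<open>One matrix form and one lift per class, together with the properties of the lift
    on which injectivity and surjectivity rely.\<close>
  have Irr: "\<exists>v e. irreducible_rep (?S k p) v \<and> V = rep_iso (?S k p) `` {v} \<and> is_lift C t k p (h (k, p)) v e \<and>
      L_obj C t k p (h (k, p)) V = Rep_iso C t `` {image_obj k e} \<and> corner_idem k p e \<and>
      (\<exists>q\<in>kys e. through_blocks p \<le> through_blocks q) \<and> part_alg.prim t (hom0 C k k) e"
    if kp: "(k, p) \<in> R" and V: "V \<in> Irr (?S k p)" for k p V
  proof -
    interpret corner_category C t k p "h (k, p)" by (rule corner[OF kp])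
    obtain v where v: "irreducible_rep Sp v" "V = rep_iso Sp `` {v}" using V by (auto simp: Irr_def elim: quotientE)
    obtain e where e: "is_lift C t k p (h (k, p)) v e" by (rule lift_exists[OF v(1)])
    show ?thesis using v e L_obj_eq[OF v(1) e] lift_corner_idem[OF e v(1)] by blast
  qed
  have image_iso: "(image_obj k e, image_obj l f) \<in> Rep_iso C t \<longleftrightarrow> pequiv k e l f" if "corner_idem k p e" "corner_idem l q f" for k p e l q f
    using that by (subst image_obj_iso) (auto simp: corner_idem_def)
  have image_refl: "(image_obj k e, image_obj k e) \<in> Rep_iso C t" if "corner_idem k p e" for k p e
    using that by (intro Rep_iso_refl) (simp add: image_obj_in_obj corner_idem_def)
  show ?thesis
    unfolding bij_betw_def
  proof
    show "inj_on (\<lambda>((k, p), V). L_obj C t k p (h (k, p)) V) (SIGMA (k, p):R. Irr (?S k p))"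
    proof (rule inj_onI, clarsimp)
      fix k p V l q W
      assume kp: "(k, p) \<in> R" and V: "V \<in> Irr (?S k p)" and lq: "(l, q) \<in> R" and W: "W \<in> Irr (?S l q)"
        and eq: "L_obj C t k p (h (k, p)) V = L_obj C t l q (h (l, q)) W"
      obtain v e where v: "irreducible_rep (?S k p) v" "V = rep_iso (?S k p) `` {v}" "is_lift C t k p (h (k, p)) v e"
        "L_obj C t k p (h (k, p)) V = Rep_iso C t `` {image_obj k e}" "corner_idem k p e"
        "\<exists>q\<in>kys e. through_blocks p \<le> through_blocks q" using Irr[OF kp V] by blast
      obtain w f where w: "irreducible_rep (?S l q) w" "W = rep_iso (?S l q) `` {w}" "is_lift C t l q (h (l, q)) w f"
        "L_obj C t l q (h (l, q)) W = Rep_iso C t `` {image_obj l f}" "corner_idem l q f"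
        "\<exists>r\<in>kys f. through_blocks q \<le> through_blocks r" using Irr[OF lq W] by blast
      have "image_obj l f \<in> Rep_iso C t `` {image_obj k e}"
        using image_refl[OF w(5)] eq v(4) w(4) by blast
      then have pe: "pequiv k e l f" using image_iso[OF v(5) w(5)] by simp
      have PP: "(k, p) \<in> PP C" "(l, q) \<in> PP C" using assms(3) kp lq by auto
      \<comment> \<open>Isomorphic images make the two projective partitions equivalent. As
        \<open>R\<close> meets each class once, the indices coincide, and both lifts then live in
        one corner.\<close>
      have "((k, p), (l, q)) \<in> PP_equiv C" by (rule pequiv_PP_equiv[OF PP v(5) w(5) v(6) w(6) pe])
      moreover have "PP_equiv C `` {(k, p)} \<in> PP C // PP_equiv C" using PP(1) by (rule quotientI)
      ultimately have "(k, p) = (l, q)"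
        using assms(4)[of "PP_equiv C `` {(k, p)}"] kp lq PP_equiv_self[OF PP(1)] by blast
      then have l: "l = k" and q: "q = p" by auto
      interpret corner_category C t k p "h (k, p)" by (rule corner[OF kp])
      have vw: "(v, w) \<in> rep_iso Sp"
        using pequiv_lifts_rep_iso[of v e w f] v w pe unfolding l q by blast
      have "V = W"
        unfolding v(2) w(2) l q using rep_iso_trans vw rep_iso_sym[OF vw] by blast
      then show "k = l \<and> p = q \<and> V = W" using l q by simp
    qed
    show "(\<lambda>((k, p), V). L_obj C t k p (h (k, p)) V) ` (SIGMA (k, p):R. Irr (?S k p)) = Indec C t"
    proof
      show "(\<lambda>((k, p), V). L_obj C t k p (h (k, p)) V) ` (SIGMA (k, p):R. Irr (?S k p)) \<subseteq> Indec C t"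
      proof clarsimp
        fix k p V assume kp: "(k, p) \<in> R" and V: "V \<in> Irr (?S k p)"
        obtain e where e: "L_obj C t k p (h (k, p)) V = Rep_iso C t `` {image_obj k e}"
          "part_alg.prim t (hom0 C k k) e" using Irr[OF kp V] by blast
        show "L_obj C t k p (h (k, p)) V \<in> Indec C t"
          unfolding e(1) Indec_def using primitive_indecomposable[OF e(2)] by (intro quotientI) simp
      qed
      show "Indec C t \<subseteq> (\<lambda>((k, p), V). L_obj C t k p (h (k, p)) V) ` (SIGMA (k, p):R. Irr (?S k p))"
      proof
        fix Y assume "Y \<in> Indec C t"
        then obtain X where X: "indecomposable C t X" "Y = Rep_iso C t `` {X}"
          by (auto simp: Indec_def elim: quotientE)
        obtain k p f where f: "(k, p) \<in> R" "corner_idem k p f" "(X, image_obj k f) \<in> Rep_iso C t"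
          "\<exists>q\<in>kys f. through_blocks p \<le> through_blocks q"
          by (rule indecomposable_repr[OF X(1), of R]) (use assms(4) in blast)+
        interpret corner_category C t k p "h (k, p)" by (rule corner[OF f(1)])
        have fh: "f \<in> hom0 C k k" "f \<diamondop> f = f" and fC: "f \<in> Cor" using f(2) by (auto simp: corner_idem_def Cor_iff)
        have "part_alg.prim t (hom0 C k k) f"
          by (rule indecomposable_prim[OF fh indecomposable_iso[OF X(1) f(3)]])
        then have pr: "part_alg.prim t Cor f" using fC by (simp add: prim_Cor_iff)
        \<comment> \<open>The partition of full rank secured by the minimal choice keeps
          \<open>f\<close> outside the ideal, so its reduction is primitive and affords an
          irreducible representation.\<close>
        have "f \<notin> I" using f(4) by (auto simp: corner_ideal_def not_less)
        then have "ga.prim (group_algebra Sp) (red f)" by (rule prim_red[OF pr])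
        then obtain n \<rho> where \<rho>: "irreducible_rep Sp (n, \<rho>)" "affords Sp (red f) (n, \<rho>)"
          by (rule prim_affords_irreducible)
        have lift: "is_lift C t k p (h (k, p)) (n, \<rho>) f"
          unfolding is_lift_iff using pr \<rho>(2) red_mult[OF fC fC] fh by simp
        let ?V = "rep_iso Sp `` {(n, \<rho>)}"
        have "L_obj C t k p (h (k, p)) ?V = Rep_iso C t `` {image_obj k f}" by (rule L_obj_eq[OF \<rho>(1) lift])
        also have "\<dots> = Y" unfolding X(2) using Rep_iso_trans f(3) Rep_iso_sym[OF f(3)] by blast
        finally have "Y = (\<lambda>((k, p), V). L_obj C t k p (h (k, p)) V) ((k, p), ?V)" by simp
        moreover have "?V \<in> Irr Sp" unfolding Irr_def using \<rho>(1) by (intro quotientI) simp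
        then have "((k, p), ?V) \<in> (SIGMA (k, p):R. Irr (?S k p))" using f(1) by simp
        ultimately show "Y \<in> (\<lambda>((k, p), V). L_obj C t k p (h (k, p)) V) ` (SIGMA (k, p):R. Irr (?S k p))"
          by (rule image_eqI)
      qed
    qed
  qed
qed

end
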